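(* For every domain-independent query $q$, $q\in\mathsf{DynFO}(+,\times)$ if and only if $q\in\mathsf{DynFO}$.
   Context: Dynamic complexity setting. An input is a relational structure (database) over a finite domain fixed for the whole computation, with all input relations initially empty; a change inserts or deletes a single tuple of an input relation. A dynamic program maintains auxiliary relations over the domain; for every auxiliary relation $R$ and change type $\delta$ it has a first-order update formula $\varphi^R_\delta(\vec x;\vec y)$, and after the change $\delta(\vec a)$ the new $R$ is the set of $\vec b$ with $\text{current state}\models\varphi^R_\delta(\vec a;\vec b)$. The program maintains $q$ if a designated auxiliary relation equals $q$ of the current input after every change sequence. $\mathsf{DynFO}$: all auxiliary relations initially empty. $\mathsf{DynFO}(+,\times)$: additionally three auxiliary relations are initialized as a linear order on the domain and the corresponding addition and multiplication relations; other auxiliary relations are initially empty. A query $q$ is domain independent if $q(D_1)=q(D_2)$ for all databases $D_1,D_2$ that coincide in all relations and constants (but may have different underlying domains). *)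

theory Defs
  imports Main
begin

section \<open>Relational schemas and databases\<close>

text \<open>Relations are sets of tuples, and tuples are lists. All domains are finite nonempty subsets of
  one universe type, so that databases with different domains can have the same relations.\<close>

type_synonym 'a relation = "'a list set"

definition tuples :: "nat \<Rightarrow> 'a set \<Rightarrow> 'a relation" where
  "tuples k A = {xs. length xs = k \<and> set xs \<subseteq> A}"

record ('r, 'c) schema =
  rel_syms :: "'r set"
  arity :: "'r \<Rightarrow> nat"
  con_syms :: "'c set"

definition finite_schema :: "('r, 'c) schema \<Rightarrow> bool" where
  "finite_schema \<tau> \<longleftrightarrow> finite (rel_syms \<tau>) \<and> finite (con_syms \<tau>)"

record ('a, 'r, 'c) database =
  univ :: "'a set"
  rel :: "'r \<Rightarrow> 'a relation"
  con :: "'c \<Rightarrow> 'a option"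

text \<open>Symbols outside the schema are interpreted by the fixed values \<open>{}\<close> and \<open>None\<close>, so that
  equality of the fields \<open>rel\<close> and \<open>con\<close> is agreement on the symbols of the schema.\<close>

definition is_database :: "('r, 'c) schema \<Rightarrow> ('a, 'r, 'c) database \<Rightarrow> bool" where
  "is_database \<tau> D \<longleftrightarrow>
     finite (univ D) \<and> univ D \<noteq> {} \<and>
     (\<forall>R \<in> rel_syms \<tau>. rel D R \<subseteq> tuples (arity \<tau> R) (univ D)) \<and>
     (\<forall>R. R \<notin> rel_syms \<tau> \<longrightarrow> rel D R = {}) \<and>
     dom (con D) = con_syms \<tau> \<and> ran (con D) \<subseteq> univ D"

section \<open>Queries\<close>

type_synonym ('a, 'r, 'c) query = "('a, 'r, 'c) database \<Rightarrow> 'a relation"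

definition is_query :: "('r, 'c) schema \<Rightarrow> nat \<Rightarrow> ('a, 'r, 'c) query \<Rightarrow> bool" where
  "is_query \<tau> k q \<longleftrightarrow> (\<forall>D. is_database \<tau> D \<longrightarrow> q D \<subseteq> tuples k (univ D))"

definition domain_independent :: "('r, 'c) schema \<Rightarrow> ('a, 'r, 'c) query \<Rightarrow> bool" where
  "domain_independent \<tau> q \<longleftrightarrow>
     (\<forall>D1 D2. is_database \<tau> D1 \<and> is_database \<tau> D2 \<and> rel D1 = rel D2 \<and> con D1 = con D2
        \<longrightarrow> q D1 = q D2)"

section \<open>First-order logic\<close>

datatype 'c fo_term = Var nat | Const 'c

datatype ('r, 'c) formula =
    Rel 'r "'c fo_term list"
  | Eq "'c fo_term" "'c fo_term"
  | Neg "('r, 'c) formula"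
  | Conj "('r, 'c) formula" "('r, 'c) formula"
  | Exists nat "('r, 'c) formula"

fun term_vars :: "'c fo_term \<Rightarrow> nat set" where
  "term_vars (Var i) = {i}"
| "term_vars (Const c) = {}"

fun free_vars :: "('r, 'c) formula \<Rightarrow> nat set" where
  "free_vars (Rel R ts) = (\<Union>t \<in> set ts. term_vars t)"
| "free_vars (Eq s t) = term_vars s \<union> term_vars t"
| "free_vars (Neg \<phi>) = free_vars \<phi>"
| "free_vars (Conj \<phi> \<psi>) = free_vars \<phi> \<union> free_vars \<psi>"
| "free_vars (Exists i \<phi>) = free_vars \<phi> - {i}"

fun wf_term :: "('r, 'c) schema \<Rightarrow> 'c fo_term \<Rightarrow> bool" where
  "wf_term \<tau> (Var i) \<longleftrightarrow> True"
| "wf_term \<tau> (Const c) \<longleftrightarrow> c \<in> con_syms \<tau>"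

fun wf_formula :: "('r, 'c) schema \<Rightarrow> ('r, 'c) formula \<Rightarrow> bool" where
  "wf_formula \<tau> (Rel R ts) \<longleftrightarrow>
     R \<in> rel_syms \<tau> \<and> length ts = arity \<tau> R \<and> (\<forall>t \<in> set ts. wf_term \<tau> t)"
| "wf_formula \<tau> (Eq s t) \<longleftrightarrow> wf_term \<tau> s \<and> wf_term \<tau> t"
| "wf_formula \<tau> (Neg \<phi>) \<longleftrightarrow> wf_formula \<tau> \<phi>"
| "wf_formula \<tau> (Conj \<phi> \<psi>) \<longleftrightarrow> wf_formula \<tau> \<phi> \<and> wf_formula \<tau> \<psi>"
| "wf_formula \<tau> (Exists i \<phi>) \<longleftrightarrow> wf_formula \<tau> \<phi>"

fun eval_term :: "('a, 'r, 'c) database \<Rightarrow> (nat \<Rightarrow> 'a) \<Rightarrow> 'c fo_term \<Rightarrow> 'a" where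
  "eval_term D \<sigma> (Var i) = \<sigma> i"
| "eval_term D \<sigma> (Const c) = the (con D c)"

fun sat :: "('a, 'r, 'c) database \<Rightarrow> (nat \<Rightarrow> 'a) \<Rightarrow> ('r, 'c) formula \<Rightarrow> bool" where
  "sat D \<sigma> (Rel R ts) \<longleftrightarrow> map (eval_term D \<sigma>) ts \<in> rel D R"
| "sat D \<sigma> (Eq s t) \<longleftrightarrow> eval_term D \<sigma> s = eval_term D \<sigma> t"
| "sat D \<sigma> (Neg \<phi>) \<longleftrightarrow> \<not> sat D \<sigma> \<phi>"
| "sat D \<sigma> (Conj \<phi> \<psi>) \<longleftrightarrow> sat D \<sigma> \<phi> \<and> sat D \<sigma> \<psi>"
| "sat D \<sigma> (Exists i \<phi>) \<longleftrightarrow> (\<exists>d \<in> univ D. sat D (\<sigma>(i := d)) \<phi>)"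

section \<open>Changes\<close>

datatype 'r change_type = Ins 'r | Del 'r

fun changed_rel :: "'r change_type \<Rightarrow> 'r" where
  "changed_rel (Ins R) = R"
| "changed_rel (Del R) = R"

type_synonym ('a, 'r) change = "'r change_type \<times> 'a list"

text \<open>Inserting a tuple that is present and deleting one that is absent are legal changes; they
  leave the input database as it is.\<close>

definition is_change :: "('r, 'c) schema \<Rightarrow> 'a set \<Rightarrow> ('a, 'r) change \<Rightarrow> bool" where
  "is_change \<tau> A = (\<lambda>(\<delta>, a).
     changed_rel \<delta> \<in> rel_syms \<tau> \<and> a \<in> tuples (arity \<tau> (changed_rel \<delta>)) A)"

fun apply_change :: "('a, 'r) change \<Rightarrow> ('a, 'r, 'c) database \<Rightarrow> ('a, 'r, 'c) database" where
  "apply_change (Ins R, a) D = D\<lparr>rel := (rel D)(R := rel D R \<union> {a})\<rparr>"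
| "apply_change (Del R, a) D = D\<lparr>rel := (rel D)(R := rel D R - {a})\<rparr>"

definition initial_database :: "('r, 'c) schema \<Rightarrow> ('a, 'r, 'c) database \<Rightarrow> bool" where
  "initial_database \<tau> D \<longleftrightarrow> is_database \<tau> D \<and> (\<forall>R. rel D R = {})"

section \<open>Dynamic programs\<close>

text \<open>Auxiliary relation symbols are natural numbers, which is enough for any finite auxiliary
  schema. Update formulas speak about the input relations (symbols \<open>Inl R\<close>) and the auxiliary
  relations (symbols \<open>Inr S\<close>).

  In the update formula \<open>upd P \<delta> S\<close>, with \<open>m\<close> the arity of the changed relation and \<open>n\<close> the arity
  of \<open>S\<close>, the variables \<open>0, \<dots>, m - 1\<close> stand for the changed tuple and the variables
  \<open>m, \<dots>, m + n - 1\<close> for the candidate tuple of \<open>S\<close>.\<close>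

record ('r, 'c) dyn_program =
  aux_syms :: "nat set"
  aux_arity :: "nat \<Rightarrow> nat"
  upd :: "'r change_type \<Rightarrow> nat \<Rightarrow> ('r + nat, 'c) formula"
  answer :: nat

definition state_schema :: "('r, 'c) schema \<Rightarrow> ('r, 'c) dyn_program \<Rightarrow> ('r + nat, 'c) schema" where
  "state_schema \<tau> P = \<lparr>rel_syms = rel_syms \<tau> <+> aux_syms P,
     arity = case_sum (arity \<tau>) (aux_arity P), con_syms = con_syms \<tau>\<rparr>"

definition is_program :: "('r, 'c) schema \<Rightarrow> nat \<Rightarrow> ('r, 'c) dyn_program \<Rightarrow> bool" where
  "is_program \<tau> k P \<longleftrightarrow>
     finite (aux_syms P) \<and> answer P \<in> aux_syms P \<and> aux_arity P (answer P) = k \<and>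
     (\<forall>\<delta> S. changed_rel \<delta> \<in> rel_syms \<tau> \<and> S \<in> aux_syms P \<longrightarrow>
        wf_formula (state_schema \<tau> P) (upd P \<delta> S) \<and>
        free_vars (upd P \<delta> S) \<subseteq> {..<arity \<tau> (changed_rel \<delta>) + aux_arity P S})"

text \<open>A state consists of the input database and the auxiliary relations.\<close>

type_synonym ('a, 'r, 'c) state = "('a, 'r, 'c) database \<times> (nat \<Rightarrow> 'a relation)"

fun state_structure :: "('a, 'r, 'c) state \<Rightarrow> ('a, 'r + nat, 'c) database" where
  "state_structure (D, A) = \<lparr>univ = univ D, rel = case_sum (rel D) A, con = con D\<rparr>"

text \<open>All update formulas are evaluated in the state before the change.\<close>

fun step :: "('r, 'c) dyn_program \<Rightarrow> ('a, 'r) change \<Rightarrow> ('a, 'r, 'c) state \<Rightarrow> ('a, 'r, 'c) state"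
  where
  "step P (\<delta>, a) (D, A) =
     (apply_change (\<delta>, a) D,
      \<lambda>S. if S \<in> aux_syms P
          then {b \<in> tuples (aux_arity P S) (univ D).
                  sat (state_structure (D, A)) (\<lambda>i. (a @ b) ! i) (upd P \<delta> S)}
          else {})"

definition maintains_from ::
  "('r, 'c) schema \<Rightarrow> ('r, 'c) dyn_program \<Rightarrow> ('a, 'r, 'c) query \<Rightarrow> ('a, 'r, 'c) state \<Rightarrow> bool" where
  "maintains_from \<tau> P q s \<longleftrightarrow>
     (\<forall>cs. (\<forall>c \<in> set cs. is_change \<tau> (univ (fst s)) c) \<longrightarrow>
        (case fold (step P) cs s of (D, A) \<Rightarrow> A (answer P) = q D))"

section \<open>The classes DynFO and DynFO(+,*)\<close>

definition DynFO :: "('r, 'c) schema \<Rightarrow> nat \<Rightarrow> ('a, 'r, 'c) query set" where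
  "DynFO \<tau> k = {q. is_query \<tau> k q \<and>
     (\<exists>P. is_program \<tau> k P \<and>
        (\<forall>D. initial_database \<tau> D \<longrightarrow> maintains_from \<tau> P q (D, \<lambda>S. {})))}"

text \<open>With respect to a linear order \<open>r\<close>, the element of rank \<open>i\<close> represents the number \<open>i\<close>; the
  least element represents 0.\<close>

definition rank :: "'a set \<Rightarrow> ('a \<times> 'a) set \<Rightarrow> 'a \<Rightarrow> nat" where
  "rank A r x = card {y \<in> A. (y, x) \<in> r \<and> y \<noteq> x}"

definition order_rel :: "'a set \<Rightarrow> ('a \<times> 'a) set \<Rightarrow> 'a relation" where
  "order_rel A r = {[x, y] |x y. x \<in> A \<and> y \<in> A \<and> (x, y) \<in> r}"

definition plus_rel :: "'a set \<Rightarrow> ('a \<times> 'a) set \<Rightarrow> 'a relation" where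
  "plus_rel A r = {[x, y, z] |x y z. x \<in> A \<and> y \<in> A \<and> z \<in> A \<and> rank A r x + rank A r y = rank A r z}"

definition times_rel :: "'a set \<Rightarrow> ('a \<times> 'a) set \<Rightarrow> 'a relation" where
  "times_rel A r = {[x, y, z] |x y z. x \<in> A \<and> y \<in> A \<and> z \<in> A \<and> rank A r x * rank A r y = rank A r z}"

text \<open>The program has to work for every linear order on the domain.\<close>

definition DynFO_arith :: "('r, 'c) schema \<Rightarrow> nat \<Rightarrow> ('a, 'r, 'c) query set" where
  "DynFO_arith \<tau> k = {q. is_query \<tau> k q \<and>
     (\<exists>P L Pl Ti. is_program \<tau> k P \<and>
        {L, Pl, Ti} \<subseteq> aux_syms P \<and> distinct [L, Pl, Ti] \<and>
        aux_arity P L = 2 \<and> aux_arity P Pl = 3 \<and> aux_arity P Ti = 3 \<and>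
        (\<forall>D r. initial_database \<tau> D \<and> linear_order_on (univ D) r \<longrightarrow>
           maintains_from \<tau> P q
             (D, (\<lambda>S. {})(L := order_rel (univ D) r, Pl := plus_rel (univ D) r,
                            Ti := times_rel (univ D) r))))}"

end

theory Submission
  imports Defs "HOL-Library.List_Lexorder"
begin

text \<open>
The hard direction simulates an arithmetic program without built-in arithmetic. The elements that
occurred in a change are numbered in the order of their activation, and the numbers are represented
by codes: a few constants and the tuples of fixed length over active elements. With every change a
constant number of new codes is appended, and addition and multiplication are easily extended by one
new maximal number. Every code \<open>w\<close> starts a thread, which simulates the program from scratch on the
domain of the numbers up to \<open>w\<close>, with the arithmetic on these numbers as initial data. With every
change of the input a thread first simulates that change on its own copy of the database and then
inserts, for every relation, the lexicographically least tuple that its copy still lacks. So the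
number of missing tuples drops with every change until the thread has caught up, and as there are
polynomially many codes, there is always a thread that has caught up and whose domain still has room
for all active elements. Domain independence makes its answer correct, although its domain is not the
actual one (it may even be larger, which is why the universe has to be infinite).
\<close>

section \<open>First-order logic\<close>

text \<open>Write n for the number of active elements. A thread lacking \<open>j\<close> tuples may
  need \<open>j\<close> more changes to catch up, and each may activate \<open>mx\<close> elements,
  so it is of use only if its domain has at least n + mx * j numbers. Smaller threads are outgrown
  and never repaired. The thread of the largest code may lack all tuples of the input, so the number
  of codes is kept at or above n + mx * total + mx, where the last summand is a reserve for the next
  activation. After the first change, a change raises n by at most \<open>mx\<close> and
  \<open>total\<close> by at most 1, so \<open>2 * mx\<close> new codes suffice. This fixes
  \<open>c\<close>; the \<open>B\<close> constants handle the first change and n <= 1. A thread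
  starts from an empty database because the given program promises nothing about states that no
  legal run reaches. The second obstacle: all update formulas read the state before the change, but
  an update here consists of many dependent phases. Their number is fixed, so first-order
  interpretations compose them into one update.\<close>

lemma sat_cong:
  "(\<And>i. i \<in> free_vars \<phi> \<Longrightarrow> \<sigma> i = \<sigma>' i) \<Longrightarrow> sat D \<sigma> \<phi> = sat D \<sigma>' \<phi>"
proof (induction \<phi> arbitrary: \<sigma> \<sigma>')
  case (Rel R ts)
  have "eval_term D \<sigma> t = eval_term D \<sigma>' t" if "t \<in> set ts" for t
  proof (cases t)
    case (Var i)
    with that have "i \<in> free_vars (Rel R ts)" by force
    with Rel Var show ?thesis by simp
  qed simp
  then have "map (eval_term D \<sigma>) ts = map (eval_term D \<sigma>') ts" by simp
  then show ?case by (metis sat.simps(1))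
next
  case (Eq s t)
  have "eval_term D \<sigma> s = eval_term D \<sigma>' s" using Eq by (cases s) auto
  moreover have "eval_term D \<sigma> t = eval_term D \<sigma>' t" using Eq by (cases t) auto
  ultimately show ?case by simp
next
  case (Neg \<phi>) then show ?case by (metis free_vars.simps(3) sat.simps(3))
next
  case (Conj \<phi> \<psi>) then show ?case by (metis Un_iff free_vars.simps(4) sat.simps(4))
next
  case (Exists j \<phi>)
  have "sat D (\<sigma>(j := d)) \<phi> = sat D (\<sigma>'(j := d)) \<phi>" for d
    by (rule Exists.IH) (use Exists.prems in auto)
  then show ?case by simp
qed

lemma sat_structure_cong:
  assumes "univ D = univ D'" "\<And>R. R \<in> rel_syms \<tau> \<Longrightarrow> rel D R = rel D' R"
    "\<And>c. c \<in> con_syms \<tau> \<Longrightarrow> con D c = con D' c" "wf_formula \<tau> \<phi>"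
  shows "sat D \<sigma> \<phi> = sat D' \<sigma> \<phi>"
  using assms(4)
proof (induction \<phi> arbitrary: \<sigma>)
  case (Rel R ts)
  have "eval_term D \<sigma> t = eval_term D' \<sigma> t" if "t \<in> set ts" for t
  proof -
    have "wf_term \<tau> t" using that Rel by simp
    with assms(3) show ?thesis by (cases t) auto
  qed
  then have "map (eval_term D \<sigma>) ts = map (eval_term D' \<sigma>) ts" by simp
  then show ?case using Rel assms(2) by (metis sat.simps(1) wf_formula.simps(1))
next
  case (Eq s t)
  have "eval_term D \<sigma> s = eval_term D' \<sigma> s" using Eq assms(3) by (cases s) auto
  moreover have "eval_term D \<sigma> t = eval_term D' \<sigma> t" using Eq assms(3) by (cases t) auto
  ultimately show ?case by simp
qed (use assms(1) in auto)

text \<open>The tautology is closed, so it never enlarges the free variables of an update formula,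
  and being of the form \<open>Neg (Conj A (Neg A))\<close> it holds over every universe.\<close>

definition fm_true :: "('r, 'c) formula" where
  "fm_true = Neg (Conj (Exists 0 (Eq (Var 0) (Var 0))) (Neg (Exists 0 (Eq (Var 0) (Var 0)))))"

definition fm_or :: "('r, 'c) formula \<Rightarrow> ('r, 'c) formula \<Rightarrow> ('r, 'c) formula" where
  "fm_or \<phi> \<psi> = Neg (Conj (Neg \<phi>) (Neg \<psi>))"

definition fm_all :: "nat \<Rightarrow> ('r, 'c) formula \<Rightarrow> ('r, 'c) formula" where
  "fm_all i \<phi> = Neg (Exists i (Neg \<phi>))"

definition fm_imp :: "('r, 'c) formula \<Rightarrow> ('r, 'c) formula \<Rightarrow> ('r, 'c) formula" where
  "fm_imp \<phi> \<psi> = Neg (Conj \<phi> (Neg \<psi>))"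

definition fm_conjs :: "('r, 'c) formula list \<Rightarrow> ('r, 'c) formula" where
  "fm_conjs \<phi>s = foldr Conj \<phi>s fm_true"

definition fm_disjs :: "('r, 'c) formula list \<Rightarrow> ('r, 'c) formula" where
  "fm_disjs \<phi>s = foldr fm_or \<phi>s (Neg fm_true)"

fun fm_exs :: "nat \<Rightarrow> nat \<Rightarrow> ('r, 'c) formula \<Rightarrow> ('r, 'c) formula" where
  "fm_exs i 0 \<phi> = \<phi>"
| "fm_exs i (Suc n) \<phi> = Exists i (fm_exs (Suc i) n \<phi>)"

text \<open>The assignment reached when \<open>fm_exs i (length ds)\<close> has chosen
  \<open>ds\<close> for its block of consecutive variables.\<close>

definition upds :: "(nat \<Rightarrow> 'a) \<Rightarrow> nat \<Rightarrow> 'a list \<Rightarrow> nat \<Rightarrow> 'a" where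
  "upds \<sigma> i ds j = (if i \<le> j \<and> j < i + length ds then ds ! (j - i) else \<sigma> j)"

lemma upds_Cons: "upds \<sigma> i (d # ds) = upds (\<sigma>(i := d)) (Suc i) ds"
proof
  fix j
  consider "j < i" | "j = i" | k where "j = Suc (i + k)"
    by (metis less_imp_Suc_add linorder_neqE_nat)
  then show "upds \<sigma> i (d # ds) j = upds (\<sigma>(i := d)) (Suc i) ds j"
    by cases (auto simp: upds_def)
qed

lemma upds_Nil [simp]: "upds \<sigma> i [] = \<sigma>"
  by (rule ext) (auto simp: upds_def)

lemma upds_less [simp]: "j < i \<Longrightarrow> upds \<sigma> i ds j = \<sigma> j"
  by (simp add: upds_def)

lemma upds_add [simp]: "j < length ds \<Longrightarrow> upds \<sigma> i ds (i + j) = ds ! j"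
  by (simp add: upds_def)

lemma map_upds: "n = length ds \<Longrightarrow> map (upds \<sigma> i ds) [i..<i + n] = ds"
  by (rule nth_equalityI) auto

lemma map_upds_less: "\<forall>j \<in> set js. j < i \<Longrightarrow> map (upds \<sigma> i ds) js = map \<sigma> js"
  by simp

lemma sat_fm_true [simp]: "sat D \<sigma> fm_true"
  and sat_fm_or [simp]: "sat D \<sigma> (fm_or \<phi> \<psi>) \<longleftrightarrow> sat D \<sigma> \<phi> \<or> sat D \<sigma> \<psi>"
  and sat_fm_all [simp]: "sat D \<sigma> (fm_all i \<phi>) \<longleftrightarrow> (\<forall>d \<in> univ D. sat D (\<sigma>(i := d)) \<phi>)"
  and sat_fm_imp [simp]: "sat D \<sigma> (fm_imp \<phi> \<psi>) \<longleftrightarrow> (sat D \<sigma> \<phi> \<longrightarrow> sat D \<sigma> \<psi>)"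
  by (auto simp: fm_true_def fm_or_def fm_all_def fm_imp_def)

lemma sat_fm_conjs [simp]: "sat D \<sigma> (fm_conjs \<phi>s) \<longleftrightarrow> (\<forall>\<phi> \<in> set \<phi>s. sat D \<sigma> \<phi>)"
  and sat_fm_disjs [simp]: "sat D \<sigma> (fm_disjs \<phi>s) \<longleftrightarrow> (\<exists>\<phi> \<in> set \<phi>s. sat D \<sigma> \<phi>)"
  by (induction \<phi>s) (auto simp: fm_conjs_def fm_disjs_def)

lemma sat_fm_exs [simp]:
  "sat D \<sigma> (fm_exs i n \<phi>) \<longleftrightarrow> (\<exists>ds \<in> tuples n (univ D). sat D (upds \<sigma> i ds) \<phi>)"
proof (induction n arbitrary: i \<sigma>)
  case 0
  then show ?case by (simp add: tuples_def)
next
  case (Suc n)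
  show ?case
  proof
    assume "sat D \<sigma> (fm_exs i (Suc n) \<phi>)"
    then obtain d ds where "d \<in> univ D" "ds \<in> tuples n (univ D)"
      "sat D (upds (\<sigma>(i := d)) (Suc i) ds) \<phi>"
      unfolding fm_exs.simps sat.simps Suc by blast
    then show "\<exists>ds\<in>tuples (Suc n) (univ D). sat D (upds \<sigma> i ds) \<phi>"
      by (intro bexI[of _ "d # ds"]) (auto simp: tuples_def upds_Cons)
  next
    assume "\<exists>ds\<in>tuples (Suc n) (univ D). sat D (upds \<sigma> i ds) \<phi>"
    then obtain d ds where "d # ds \<in> tuples (Suc n) (univ D)" "sat D (upds \<sigma> i (d # ds)) \<phi>"
      by (auto simp: tuples_def length_Suc_conv)
    then show "sat D \<sigma> (fm_exs i (Suc n) \<phi>)"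
      unfolding fm_exs.simps sat.simps Suc by (auto simp: tuples_def upds_Cons)
  qed
qed

lemma wf_fm_true [simp]: "wf_formula \<tau> fm_true"
  and wf_fm_or [simp]: "wf_formula \<tau> (fm_or \<phi> \<psi>) \<longleftrightarrow> wf_formula \<tau> \<phi> \<and> wf_formula \<tau> \<psi>"
  and wf_fm_all [simp]: "wf_formula \<tau> (fm_all i \<phi>) \<longleftrightarrow> wf_formula \<tau> \<phi>"
  and wf_fm_imp [simp]: "wf_formula \<tau> (fm_imp \<phi> \<psi>) \<longleftrightarrow> wf_formula \<tau> \<phi> \<and> wf_formula \<tau> \<psi>"
  by (auto simp: fm_true_def fm_or_def fm_all_def fm_imp_def)

lemma wf_fm_conjs [simp]: "wf_formula \<tau> (fm_conjs \<phi>s) \<longleftrightarrow> (\<forall>\<phi> \<in> set \<phi>s. wf_formula \<tau> \<phi>)"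
  and wf_fm_disjs [simp]: "wf_formula \<tau> (fm_disjs \<phi>s) \<longleftrightarrow> (\<forall>\<phi> \<in> set \<phi>s. wf_formula \<tau> \<phi>)"
  by (induction \<phi>s) (auto simp: fm_conjs_def fm_disjs_def)

lemma wf_fm_exs [simp]: "wf_formula \<tau> (fm_exs i n \<phi>) \<longleftrightarrow> wf_formula \<tau> \<phi>"
  by (induction n arbitrary: i) auto

lemma fv_fm_true [simp]: "free_vars fm_true = {}"
  and fv_fm_or [simp]: "free_vars (fm_or \<phi> \<psi>) = free_vars \<phi> \<union> free_vars \<psi>"
  and fv_fm_all [simp]: "free_vars (fm_all i \<phi>) = free_vars \<phi> - {i}"
  and fv_fm_imp [simp]: "free_vars (fm_imp \<phi> \<psi>) = free_vars \<phi> \<union> free_vars \<psi>"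
  by (auto simp: fm_true_def fm_or_def fm_all_def fm_imp_def)

lemma fv_fm_conjs [simp]: "free_vars (fm_conjs \<phi>s) = (\<Union>\<phi> \<in> set \<phi>s. free_vars \<phi>)"
  and fv_fm_disjs [simp]: "free_vars (fm_disjs \<phi>s) = (\<Union>\<phi> \<in> set \<phi>s. free_vars \<phi>)"
  by (induction \<phi>s) (auto simp: fm_conjs_def fm_disjs_def)

lemma fv_fm_exs [simp]: "free_vars (fm_exs i n \<phi>) = free_vars \<phi> - {i..<i + n}"
  by (induction n arbitrary: i) auto

section \<open>Runs of a program\<close>

text \<open>This makes transport along a map that is injective only on the universe faithful: no
  stored tuple has an entry outside.\<close>

definition valid_state :: "('r, 'c) schema \<Rightarrow> ('r, 'c) dyn_program \<Rightarrow> ('a, 'r, 'c) state \<Rightarrow> bool" where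
  "valid_state \<tau> P s \<longleftrightarrow> is_database \<tau> (fst s) \<and>
     (\<forall>S. snd s S \<subseteq> tuples (aux_arity P S) (univ (fst s)))"

lemma univ_apply_change [simp]: "univ (apply_change c D) = univ D"
  and con_apply_change [simp]: "con (apply_change c D) = con D"
  by (cases "(c, D)" rule: apply_change.cases; simp)+

lemma rel_apply_change:
  "rel (apply_change (\<delta>, a) D) R = (if R = changed_rel \<delta> then
     (case \<delta> of Ins _ \<Rightarrow> rel D R \<union> {a} | Del _ \<Rightarrow> rel D R - {a}) else rel D R)"
  by (cases \<delta>) auto

lemma is_database_apply_change:
  assumes "is_database \<tau> D" "is_change \<tau> (univ D) c"
  shows "is_database \<tau> (apply_change c D)"
proof -
  obtain \<delta> a where c: "c = (\<delta>, a)" by fastforce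
  have a: "changed_rel \<delta> \<in> rel_syms \<tau>" "a \<in> tuples (arity \<tau> (changed_rel \<delta>)) (univ D)"
    using assms(2) by (auto simp: is_change_def c)
  have "rel (apply_change c D) R \<subseteq> tuples (arity \<tau> R) (univ D)" if "R \<in> rel_syms \<tau>" for R
    using a assms(1) that unfolding c rel_apply_change is_database_def
    by (cases \<delta>) (simp_all split: if_splits, blast+)
  moreover have "rel (apply_change c D) R = {}" if "R \<notin> rel_syms \<tau>" for R
    using a assms(1) that unfolding c is_database_def rel_apply_change by auto
  ultimately show ?thesis using assms(1) unfolding is_database_def by simp
qed

lemma fst_step [simp]: "fst (step P c s) = apply_change c (fst s)"
  by (cases c; cases s) simp

lemma valid_state_step:
  "valid_state \<tau> P s \<Longrightarrow> is_change \<tau> (univ (fst s)) c \<Longrightarrow> valid_state \<tau> P (step P c s)"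
  by (cases c; cases s) (auto simp: valid_state_def is_database_apply_change)

lemma univ_fold_step [simp]: "univ (fst (fold (step P) cs s)) = univ (fst s)"
  by (induction cs arbitrary: s) auto

lemma con_fold_step [simp]: "con (fst (fold (step P) cs s)) = con (fst s)"
  by (induction cs arbitrary: s) auto

lemma valid_state_fold_step:
  "valid_state \<tau> P s \<Longrightarrow> \<forall>c \<in> set cs. is_change \<tau> (univ (fst s)) c \<Longrightarrow>
     valid_state \<tau> P (fold (step P) cs s)"
  by (induction cs arbitrary: s) (auto simp: valid_state_step)

section \<open>Runs of a program on isomorphic domains\<close>

definition image_db :: "('a \<Rightarrow> 'b) \<Rightarrow> ('a, 'r, 'c) database \<Rightarrow> ('b, 'r, 'c) database" where
  "image_db e D = \<lparr>univ = e ` univ D, rel = \<lambda>R. map e ` rel D R, con = \<lambda>c. map_option e (con D c)\<rparr>"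

definition image_state :: "('a \<Rightarrow> 'b) \<Rightarrow> ('a, 'r, 'c) state \<Rightarrow> ('b, 'r, 'c) state" where
  "image_state e s = (image_db e (fst s), \<lambda>S. map e ` snd s S)"

lemma image_db_simps [simp]:
  "univ (image_db e D) = e ` univ D" "rel (image_db e D) R = map e ` rel D R"
  "con (image_db e D) c = map_option e (con D c)"
  by (simp_all add: image_db_def)

lemma map_mem_image_iff:
  assumes "inj_on e A" "set xs \<subseteq> A" "\<And>ys. ys \<in> X \<Longrightarrow> set ys \<subseteq> A"
  shows "map e xs \<in> map e ` X \<longleftrightarrow> xs \<in> X"
proof
  assume "map e xs \<in> map e ` X"
  then obtain ys where ys: "ys \<in> X" "map e xs = map e ys" by auto
  have "inj_on e (set xs \<union> set ys)"
    using assms ys(1) by (meson Un_least inj_on_subset)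
  then show "xs \<in> X" using ys map_inj_on by blast
qed auto

text \<open>First-order logic does not distinguish isomorphic structures. Values are constrained at
  the free variables only, because the assignments \<open>(a @ b) ! i\<close> of update formulas
  mean nothing beyond the length of the list.\<close>

lemma sat_image_db:
  assumes "inj_on e (univ D)" "\<And>R xs. xs \<in> rel D R \<Longrightarrow> set xs \<subseteq> univ D"
    "con_syms \<tau> \<subseteq> dom (con D)" "ran (con D) \<subseteq> univ D"
    and "wf_formula \<tau> \<phi>" "\<And>i. i \<in> free_vars \<phi> \<Longrightarrow> \<sigma> i \<in> univ D"
  shows "sat (image_db e D) (\<lambda>i. e (\<sigma> i)) \<phi> = sat D \<sigma> \<phi>"
  using assms(5,6)
proof (induction \<phi> arbitrary: \<sigma>)
  case (Rel R ts)
  have *: "eval_term (image_db e D) (\<lambda>i. e (\<sigma> i)) t = e (eval_term D \<sigma> t) \<and>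
      eval_term D \<sigma> t \<in> univ D" if "t \<in> set ts" for t
  proof (cases t)
    case (Var i) then show ?thesis using that Rel by force
  next
    case (Const c)
    with that Rel assms(3) obtain d where "con D c = Some d" by fastforce
    with Const assms(4) show ?thesis by (auto simp: ran_def)
  qed
  then have eq: "map (eval_term (image_db e D) (\<lambda>i. e (\<sigma> i))) ts = map e (map (eval_term D \<sigma>) ts)"
    by simp
  have "set (map (eval_term D \<sigma>) ts) \<subseteq> univ D" using * by auto
  then show ?case unfolding sat.simps image_db_simps eq
    by (rule map_mem_image_iff[OF assms(1)]) (rule assms(2))
next
  case (Eq s t)
  have "eval_term (image_db e D) (\<lambda>i. e (\<sigma> i)) u = e (eval_term D \<sigma> u) \<and>
      eval_term D \<sigma> u \<in> univ D" if "u = s \<or> u = t" for u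
  proof (cases u)
    case (Var i) then show ?thesis using that Eq by force
  next
    case (Const c)
    with that Eq assms(3) obtain d where "con D c = Some d" by fastforce
    with Const assms(4) show ?thesis by (auto simp: ran_def)
  qed
  with assms(1) show ?case by (auto simp: inj_on_def)
next
  case (Exists j \<phi>)
  have "sat (image_db e D) ((\<lambda>i. e (\<sigma> i))(j := e d)) \<phi> = sat D (\<sigma>(j := d)) \<phi>"
    if "d \<in> univ D" for d
  proof -
    have "sat (image_db e D) (\<lambda>i. e ((\<sigma>(j := d)) i)) \<phi> = sat D (\<sigma>(j := d)) \<phi>"
      by (rule Exists.IH) (use Exists.prems that in auto)
    moreover have "(\<lambda>i. e ((\<sigma>(j := d)) i)) = (\<lambda>i. e (\<sigma> i))(j := e d)" by auto
    ultimately show ?thesis by simp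
  qed
  then show ?case by simp
qed auto

text \<open>Definable updates commute with isomorphisms. This later turns the run of a thread on
  numbers into a run on elements of the type over which the query is defined.\<close>

lemma step_image:
  assumes P: "is_program \<tau> k P" and v: "valid_state \<tau> P s" and inj: "inj_on e (univ (fst s))"
    and ch: "is_change \<tau> (univ (fst s)) (\<delta>, a)"
  shows "step P (\<delta>, map e a) (image_state e s) = image_state e (step P (\<delta>, a) s)"
proof -
  obtain D A where s: "s = (D, A)" by fastforce
  have a: "a \<in> tuples (arity \<tau> (changed_rel \<delta>)) (univ D)" "changed_rel \<delta> \<in> rel_syms \<tau>"
    using ch by (auto simp: is_change_def s)
  have D: "is_database \<tau> D" and A: "\<And>S. A S \<subseteq> tuples (aux_arity P S) (univ D)"
    using v by (auto simp: valid_state_def s)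
  have inj: "inj_on e (univ D)" using inj s by simp
  have relD: "set xs \<subseteq> univ D" if "xs \<in> rel D R" for R xs
    using D that by (fastforce simp: is_database_def tuples_def)
  have "apply_change (\<delta>, map e a) (image_db e D) = image_db e (apply_change (\<delta>, a) D)"
  proof (rule database.equality)
    \<comment> \<open>Deletion is where injectivity is used: no other tuple may have the same image
      as \<open>a\<close>.\<close>
    have "map e a \<notin> map e ` (rel D R - {a})" for R
      using map_mem_image_iff[OF inj, of a "rel D R - {a}"] relD a by (auto simp: tuples_def)
    then have "map e ` rel D R - {map e a} = map e ` (rel D R - {a})" for R by blast
    then show "rel (apply_change (\<delta>, map e a) (image_db e D)) = rel (image_db e (apply_change (\<delta>, a) D))"
      by (auto simp: fun_eq_iff rel_apply_change split: change_type.split)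
  qed (auto simp: fun_eq_iff)
  moreover have "{b \<in> tuples (aux_arity P S) (e ` univ D).
        sat (state_structure (image_state e s)) (\<lambda>i. (map e a @ b) ! i) (upd P \<delta> S)} =
      map e ` {b \<in> tuples (aux_arity P S) (univ D).
        sat (state_structure s) (\<lambda>i. (a @ b) ! i) (upd P \<delta> S)}" (is "?X = map e ` ?Y")
    if S: "S \<in> aux_syms P" for S
  proof -
    have st: "state_structure (image_state e s) = image_db e (state_structure s)"
      by (auto simp: s image_state_def image_db_def fun_eq_iff split: sum.split)
    have wf: "wf_formula (state_schema \<tau> P) (upd P \<delta> S)"
      and fv: "free_vars (upd P \<delta> S) \<subseteq> {..<arity \<tau> (changed_rel \<delta>) + aux_arity P S}"
      using P S a by (auto simp: is_program_def)
    have *: "sat (state_structure (image_state e s)) (\<lambda>i. (map e a @ map e b) ! i) (upd P \<delta> S) =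
        sat (state_structure s) (\<lambda>i. (a @ b) ! i) (upd P \<delta> S)"
      if b: "b \<in> tuples (aux_arity P S) (univ D)" for b
    proof -
      have len: "i < length (a @ b)" if "i \<in> free_vars (upd P \<delta> S)" for i
        using fv that a b by (auto simp: tuples_def)
      have "sat (image_db e (state_structure s)) (\<lambda>i. e ((a @ b) ! i)) (upd P \<delta> S) =
          sat (state_structure s) (\<lambda>i. (a @ b) ! i) (upd P \<delta> S)"
      proof (rule sat_image_db[where \<tau> = "state_schema \<tau> P", OF _ _ _ _ wf])
        show "(a @ b) ! i \<in> univ (state_structure s)" if "i \<in> free_vars (upd P \<delta> S)" for i
          using nth_mem[OF len[OF that]] a b by (auto simp: s tuples_def)
        show "set xs \<subseteq> univ (state_structure s)" if "xs \<in> rel (state_structure s) R" for R xs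
          using that relD A by (cases R) (fastforce simp: s tuples_def)+
      qed (use inj D in \<open>auto simp: s state_schema_def is_database_def\<close>)
      moreover have "sat (image_db e (state_structure s)) (\<lambda>i. (map e a @ map e b) ! i) (upd P \<delta> S) =
          sat (image_db e (state_structure s)) (\<lambda>i. e ((a @ b) ! i)) (upd P \<delta> S)"
        by (rule sat_cong) (metis len map_append nth_map)
      ultimately show ?thesis by (simp add: st)
    qed
    have tup: "tuples n (e ` univ D) = map e ` tuples n (univ D)" for n
    proof
      show "tuples n (e ` univ D) \<subseteq> map e ` tuples n (univ D)"
      proof
        fix b assume "b \<in> tuples n (e ` univ D)"
        then have "b = map e (map (inv_into (univ D) e) b)"
          "map (inv_into (univ D) e) b \<in> tuples n (univ D)"
          by (auto simp: tuples_def o_def f_inv_into_f subset_iff inv_into_into intro!: nth_equalityI)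
        then show "b \<in> map e ` tuples n (univ D)" by blast
      qed
    qed (auto simp: tuples_def subset_iff)
    show ?thesis unfolding tup using * by blast
  qed
  ultimately show ?thesis by (auto simp: s image_state_def fun_eq_iff)
qed

lemma fold_step_image:
  assumes "is_program \<tau> k P" "valid_state \<tau> P s" "inj_on e (univ (fst s))"
    "\<forall>c \<in> set cs. is_change \<tau> (univ (fst s)) c"
  shows "fold (step P) (map (apsnd (map e)) cs) (image_state e s) = image_state e (fold (step P) cs s)"
  using assms(2-)
proof (induction cs arbitrary: s)
  case (Cons c cs)
  then show ?case
    using step_image[OF assms(1) Cons.prems(1,2), of "fst c" "snd c"] valid_state_step[of \<tau> P s c]
    by (simp add: apsnd_def map_prod_def split_beta)
qed simp

section \<open>Adding arithmetic to a program\<close>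

text \<open>The arithmetic relations are put under fresh symbols. The given update formulas cannot
  mention them, so the run is the same whatever they contain.\<close>

lemma DynFO_imp_DynFO_arith:
  assumes "q \<in> DynFO \<tau> k"
  shows "q \<in> DynFO_arith \<tau> k"
proof -
  obtain P where q: "is_query \<tau> k q" and P: "is_program \<tau> k P"
    and m: "\<And>D. initial_database \<tau> D \<Longrightarrow> maintains_from \<tau> P q (D, \<lambda>S. {})"
    using assms by (auto simp: DynFO_def)
  have fin: "finite (aux_syms P)" using P by (simp add: is_program_def)
  \<comment> \<open>All numbers from \<open>L\<close> on exceed every auxiliary symbol of
    \<open>P\<close>, hence are fresh.\<close>
  define L where "L = Suc (Max (insert 0 (aux_syms P)))"
  have new: "n < L" if "n \<in> aux_syms P" for n
    using that fin by (simp add: L_def less_Suc_eq_le)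
  let ?N = "{L, L + 1, L + 2}"
  define P' where "P' = P\<lparr>aux_syms := aux_syms P \<union> ?N,
    aux_arity := (aux_arity P)(L := 2, L + 1 := 3, L + 2 := 3),
    upd := \<lambda>\<delta> S. if S \<in> ?N then fm_true else upd P \<delta> S\<rparr>"
  have ne: "S \<noteq> L" "S \<noteq> L + 1" "S \<noteq> L + 2" if "S \<in> aux_syms P" for S
    using new[OF that] by auto
  have wf: "wf_formula (state_schema \<tau> P') \<phi>" if "wf_formula (state_schema \<tau> P) \<phi>" for \<phi>
    using that
  proof (induction \<phi>)
    case (Rel R ts)
    have "wf_term (state_schema \<tau> P') t = wf_term (state_schema \<tau> P) t" for t
      by (cases t) (auto simp: state_schema_def)
    with Rel ne show ?case by (cases R) (auto simp: state_schema_def P'_def)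
  next
    case (Eq s t)
    have "wf_term (state_schema \<tau> P') t = wf_term (state_schema \<tau> P) t" for t
      by (cases t) (auto simp: state_schema_def)
    with Eq show ?case by simp
  qed auto
  have P': "is_program \<tau> k P'"
    using P wf ne unfolding is_program_def by (auto simp: P'_def)
  \<comment> \<open>The two runs are compared on the symbols of \<open>P\<close> only; the three new
    relations may start with any contents.\<close>
  have run: "fst (fold (step P') cs (D, A')) = fst (fold (step P) cs (D, A)) \<and>
      (\<forall>S \<in> aux_syms P. snd (fold (step P') cs (D, A')) S = snd (fold (step P) cs (D, A)) S)"
    if "\<forall>S \<in> aux_syms P. A' S = A S" "\<forall>c \<in> set cs. is_change \<tau> (univ D) c" for cs D A A'
    using that
  proof (induction cs arbitrary: D A A')
    case (Cons c cs)
    obtain \<delta> a where c: "c = (\<delta>, a)" by fastforce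
    obtain D1 A1 where s: "step P c (D, A) = (D1, A1)" by fastforce
    obtain D1' A1' where s': "step P' c (D, A') = (D1', A1')" by fastforce
    have D1: "D1 = apply_change c D" "D1' = D1" using s s' by (auto simp: c)
    have "A1' S = A1 S" if S: "S \<in> aux_syms P" for S
    proof -
      have "sat (state_structure (D, A')) \<sigma> (upd P \<delta> S) = sat (state_structure (D, A)) \<sigma> (upd P \<delta> S)"
        for \<sigma>
        by (rule sat_structure_cong[where \<tau> = "state_schema \<tau> P"])
          (use P S Cons.prems in \<open>auto simp: is_program_def state_schema_def c is_change_def\<close>)
      then show ?thesis using s s' S ne[OF S] by (auto simp: c P'_def)
    qed
    then have "\<forall>S \<in> aux_syms P. A1' S = A1 S" by blast
    from Cons.IH[OF this, of D1] Cons.prems show ?case by (simp add: s s' D1)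
  qed simp
  have ans: "answer P' = answer P" "answer P \<in> aux_syms P"
    using P by (auto simp: P'_def is_program_def)
  have "maintains_from \<tau> P' q (D, (\<lambda>S. {})(L := X, L + 1 := Y, L + 2 := Z))"
    if "initial_database \<tau> D" for D X Y Z
    unfolding maintains_from_def
  proof (intro allI impI)
    fix cs assume cs: "\<forall>c\<in>set cs. is_change \<tau> (univ (fst (D, (\<lambda>S. {})(L := X, L + 1 := Y, L + 2 := Z)))) c"
    have "snd (fold (step P) cs (D, \<lambda>S. {})) (answer P) = q (fst (fold (step P) cs (D, \<lambda>S. {})))"
      using m[OF that] cs by (auto simp: maintains_from_def split_beta)
    then show "case fold (step P') cs (D, (\<lambda>S. {})(L := X, L + 1 := Y, L + 2 := Z)) of
        (D, A) \<Rightarrow> A (answer P') = q D"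
      using run[of "(\<lambda>S. {})(L := X, L + 1 := Y, L + 2 := Z)" "\<lambda>S. {}" cs D] ne cs ans
      by (auto simp: split_beta)
  qed
  then show ?thesis
    using q P' unfolding DynFO_arith_def
    by (intro CollectI conjI exI[of _ P'] exI[of _ L] exI[of _ "L + 1"] exI[of _ "L + 2"])
      (simp_all add: P'_def)
qed

section \<open>Interpretations\<close>

text \<open>The syntactic counterpart of an element of an interpreted structure: the tag is known
  when the formula is written, and the list names the variables that hold the components.\<close>

type_synonym block = "nat \<times> nat list"

definition decode :: "(nat \<Rightarrow> 'a) \<Rightarrow> block \<Rightarrow> nat \<times> 'a list" where
  "decode \<sigma> b = (fst b, map \<sigma> (snd b))"

definition tagged_tuples :: "nat \<Rightarrow> (nat \<Rightarrow> nat) \<Rightarrow> 'a set \<Rightarrow> (nat \<times> 'a list) set" where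
  "tagged_tuples G dm A = {(g, xs). g < G \<and> xs \<in> tuples (dm g) A}"

definition is_block :: "nat \<Rightarrow> (nat \<Rightarrow> nat) \<Rightarrow> block \<Rightarrow> bool" where
  "is_block G dm b \<longleftrightarrow> fst b < G \<and> length (snd b) = dm (fst b)"

text \<open>Tags are compared while the formula is built, so blocks with different tags yield the
  constant false.\<close>

definition fm_eq_block :: "block \<Rightarrow> block \<Rightarrow> ('r, 'c) formula" where
  "fm_eq_block b b' = (if fst b = fst b'
     then fm_conjs (map (\<lambda>(i, j). Eq (Var i) (Var j)) (zip (snd b) (snd b'))) else Neg fm_true)"

fun term_block :: "(nat \<Rightarrow> block) \<Rightarrow> ('c \<Rightarrow> block) \<Rightarrow> 'c fo_term \<Rightarrow> block" where
  "term_block \<rho> \<kappa> (Var i) = \<rho> i"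
| "term_block \<rho> \<kappa> (Const c) = \<kappa> c"

text \<open>An element of the interpreted structure is represented by a tag \<open>g < G\<close> and a tuple of length
  \<open>dm g\<close>. Only the variables from \<open>N\<close> on may be bound.\<close>

fun interp :: "nat \<Rightarrow> (nat \<Rightarrow> nat) \<Rightarrow> (nat \<Rightarrow> nat list \<Rightarrow> ('t, 'd) formula) \<Rightarrow>
    ('s \<Rightarrow> nat \<Rightarrow> block list \<Rightarrow> ('t, 'd) formula) \<Rightarrow> ('c \<Rightarrow> block) \<Rightarrow> nat \<Rightarrow> (nat \<Rightarrow> block) \<Rightarrow>
    ('s, 'c) formula \<Rightarrow> ('t, 'd) formula" where
  "interp G dm dmf atm \<kappa> N \<rho> (Rel Z ts) = atm Z N (map (term_block \<rho> \<kappa>) ts)"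
| "interp G dm dmf atm \<kappa> N \<rho> (Eq s t) = fm_eq_block (term_block \<rho> \<kappa> s) (term_block \<rho> \<kappa> t)"
| "interp G dm dmf atm \<kappa> N \<rho> (Neg \<phi>) = Neg (interp G dm dmf atm \<kappa> N \<rho> \<phi>)"
| "interp G dm dmf atm \<kappa> N \<rho> (Conj \<phi> \<psi>) =
     Conj (interp G dm dmf atm \<kappa> N \<rho> \<phi>) (interp G dm dmf atm \<kappa> N \<rho> \<psi>)"
| "interp G dm dmf atm \<kappa> N \<rho> (Exists i \<phi>) =
     fm_disjs (map (\<lambda>g. fm_exs N (dm g) (Conj (dmf g [N..<N + dm g])
       (interp G dm dmf atm \<kappa> (N + dm g) (\<rho>(i := (g, [N..<N + dm g]))) \<phi>))) [0..<G])"

lemma sat_fm_eq_block: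
  assumes "is_block G dm b" "is_block G dm b'"
  shows "sat X \<sigma> (fm_eq_block b b') \<longleftrightarrow> decode \<sigma> b = decode \<sigma> b'"
proof (cases "fst b = fst b'")
  case True
  then have len: "length (snd b) = length (snd b')" using assms by (simp add: is_block_def)
  have "sat X \<sigma> (fm_eq_block b b') \<longleftrightarrow> (\<forall>(i, j) \<in> set (zip (snd b) (snd b')). \<sigma> i = \<sigma> j)"
    using True by (auto simp: fm_eq_block_def)
  also have "\<dots> \<longleftrightarrow> map \<sigma> (snd b) = map \<sigma> (snd b')"
    using len by (simp add: list_eq_iff_nth_eq all_set_conv_all_nth)
  finally show ?thesis using True by (simp add: decode_def)
qed (simp add: fm_eq_block_def decode_def)

lemma is_block_if_decode: "decode \<sigma> b \<in> tagged_tuples G dm A \<Longrightarrow> is_block G dm b"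
  by (simp add: decode_def tagged_tuples_def is_block_def tuples_def)

lemma decode_cong: "(\<And>i. i \<in> set (snd b) \<Longrightarrow> \<sigma> i = \<sigma>' i) \<Longrightarrow> decode \<sigma> b = decode \<sigma>' b"
  by (simp add: decode_def)

locale interpretation_data =
  fixes G :: nat and dm :: "nat \<Rightarrow> nat" and dmf :: "nat \<Rightarrow> nat list \<Rightarrow> ('t, 'd) formula"
    and atm :: "'s \<Rightarrow> nat \<Rightarrow> block list \<Rightarrow> ('t, 'd) formula" and \<kappa> :: "'c \<Rightarrow> block"
    and T :: "('s, 'c) schema" and K :: nat
begin

text \<open>The fundamental property of interpretations. The bijection \<open>h\<close> renames the
  admissible tuples: it is the identity when transformations are composed, and it decodes codes to
  numbers when a thread is simulated. The variables below \<open>K\<close> are parameters with the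
  fixed values \<open>\<sigma>\<^sub>0\<close>; the hypotheses on atoms are demanded for every
  assignment that agrees there, since quantifiers may change all other variables.\<close>

lemma sat_interp:
  fixes X :: "('a, 't, 'd) database" and M :: "('b, 's, 'c) database"
  assumes h: "inj_on h Adm" "univ M = h ` Adm" and Adm: "Adm \<subseteq> tagged_tuples G dm (univ X)"
    and dmf: "\<And>g is \<sigma>. \<lbrakk>g < G; \<forall>i<K. \<sigma> i = \<sigma>\<^sub>0 i; map \<sigma> is \<in> tuples (dm g) (univ X)\<rbrakk> \<Longrightarrow>
      sat X \<sigma> (dmf g is) \<longleftrightarrow> (g, map \<sigma> is) \<in> Adm"
    and atm: "\<And>Z bs N \<sigma>. \<lbrakk>Z \<in> rel_syms T; length bs = arity T Z; K \<le> N; \<forall>i<K. \<sigma> i = \<sigma>\<^sub>0 i;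
      \<forall>b \<in> set bs. decode \<sigma> b \<in> Adm \<and> set (snd b) \<subseteq> {..<N}\<rbrakk> \<Longrightarrow>
      sat X \<sigma> (atm Z N bs) \<longleftrightarrow> map (\<lambda>b. h (decode \<sigma> b)) bs \<in> rel M Z"
    and \<kappa>: "\<And>c. c \<in> con_syms T \<Longrightarrow>
      decode \<sigma>\<^sub>0 (\<kappa> c) \<in> Adm \<and> set (snd (\<kappa> c)) \<subseteq> {..<K} \<and> h (decode \<sigma>\<^sub>0 (\<kappa> c)) = the (con M c)"
    and "wf_formula T \<phi>" "K \<le> N" "\<forall>i<K. \<sigma> i = \<sigma>\<^sub>0 i"
    and "\<And>i. i \<in> free_vars \<phi> \<Longrightarrow> decode \<sigma> (\<rho> i) \<in> Adm \<and> set (snd (\<rho> i)) \<subseteq> {..<N}"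
  shows "sat X \<sigma> (interp G dm dmf atm \<kappa> N \<rho> \<phi>) \<longleftrightarrow> sat M (\<lambda>i. h (decode \<sigma> (\<rho> i))) \<phi>"
  using assms(7-)
proof (induction \<phi> arbitrary: N \<sigma> \<rho>)
  case (Rel Z ts)
  have t: "decode \<sigma> (term_block \<rho> \<kappa> t) \<in> Adm \<and> set (snd (term_block \<rho> \<kappa> t)) \<subseteq> {..<N} \<and>
      h (decode \<sigma> (term_block \<rho> \<kappa> t)) = eval_term M (\<lambda>i. h (decode \<sigma> (\<rho> i))) t"
    if "t \<in> set ts" for t
  proof (cases t)
    case (Var i)
    with that have "i \<in> free_vars (Rel Z ts)" by force
    with Rel Var show ?thesis by simp
  next
    case (Const c)
    with that Rel have c: "c \<in> con_syms T" by force
    have "decode \<sigma> (\<kappa> c) = decode \<sigma>\<^sub>0 (\<kappa> c)"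
      by (rule decode_cong) (use \<kappa>[OF c] Rel in auto)
    with \<kappa>[OF c] Rel Const show ?thesis by auto
  qed
  then have "map (\<lambda>b. h (decode \<sigma> b)) (map (term_block \<rho> \<kappa>) ts) =
      map (eval_term M (\<lambda>i. h (decode \<sigma> (\<rho> i)))) ts" by simp
  moreover have "sat X \<sigma> (atm Z N (map (term_block \<rho> \<kappa>) ts)) \<longleftrightarrow>
      map (\<lambda>b. h (decode \<sigma> b)) (map (term_block \<rho> \<kappa>) ts) \<in> rel M Z"
    by (rule atm) (use Rel t in auto)
  ultimately show ?case by (simp only: interp.simps sat.simps)
next
  case (Eq s s')
  have t: "decode \<sigma> (term_block \<rho> \<kappa> t) \<in> Adm \<and>
      h (decode \<sigma> (term_block \<rho> \<kappa> t)) = eval_term M (\<lambda>i. h (decode \<sigma> (\<rho> i))) t"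
    if "t = s \<or> t = s'" for t
  proof (cases t)
    case (Var i)
    with that have "i \<in> free_vars (Eq s s')" by force
    with Eq Var show ?thesis by simp
  next
    case (Const c)
    with that Eq have c: "c \<in> con_syms T" by force
    have "decode \<sigma> (\<kappa> c) = decode \<sigma>\<^sub>0 (\<kappa> c)"
      by (rule decode_cong) (use \<kappa>[OF c] Eq in auto)
    with \<kappa>[OF c] Eq Const show ?thesis by auto
  qed
  have "is_block G dm (term_block \<rho> \<kappa> t)" if "t = s \<or> t = s'" for t
    using is_block_if_decode[of \<sigma> _ G dm "univ X"] t[OF that] Adm by blast
  then have "sat X \<sigma> (fm_eq_block (term_block \<rho> \<kappa> s) (term_block \<rho> \<kappa> s')) \<longleftrightarrow>
      decode \<sigma> (term_block \<rho> \<kappa> s) = decode \<sigma> (term_block \<rho> \<kappa> s')"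
    by (intro sat_fm_eq_block) blast+
  also have "\<dots> \<longleftrightarrow> h (decode \<sigma> (term_block \<rho> \<kappa> s)) = h (decode \<sigma> (term_block \<rho> \<kappa> s'))"
    using h(1) t by (metis inj_onD)
  finally show ?case using t by simp
next
  case (Exists i \<phi>)
  \<comment> \<open>The variables from \<open>N\<close> on are fresh: all blocks in use lie below
    \<open>N\<close>, so they decode as before, while the new block decodes to
    \<open>(g, xs)\<close>.\<close>
  have IH: "sat X (upds \<sigma> N xs) (interp G dm dmf atm \<kappa> (N + dm g) (\<rho>(i := (g, [N..<N + dm g]))) \<phi>) \<longleftrightarrow>
      sat M ((\<lambda>i. h (decode \<sigma> (\<rho> i)))(i := h (g, xs))) \<phi>"
    if "(g, xs) \<in> Adm" for g xs
  proof -
    have xs: "length xs = dm g" using that Adm by (auto simp: tagged_tuples_def tuples_def)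
    have new: "decode (upds \<sigma> N xs) (g, [N..<N + dm g]) = (g, xs)"
      using map_upds[of "dm g" xs \<sigma> N] xs by (simp add: decode_def)
    have old: "decode (upds \<sigma> N xs) (\<rho> j) = decode \<sigma> (\<rho> j)"
      if "j \<in> free_vars (Exists i \<phi>)" for j
      by (rule decode_cong) (use Exists.prems(4)[OF that] in auto)
    have "sat X (upds \<sigma> N xs) (interp G dm dmf atm \<kappa> (N + dm g) (\<rho>(i := (g, [N..<N + dm g]))) \<phi>) \<longleftrightarrow>
        sat M (\<lambda>j. h (decode (upds \<sigma> N xs) ((\<rho>(i := (g, [N..<N + dm g]))) j))) \<phi>"
    proof (rule Exists.IH)
      show "\<forall>i<K. upds \<sigma> N xs i = \<sigma>\<^sub>0 i" using Exists.prems by auto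
      show "decode (upds \<sigma> N xs) ((\<rho>(i := (g, [N..<N + dm g]))) j) \<in> Adm \<and>
          set (snd ((\<rho>(i := (g, [N..<N + dm g]))) j)) \<subseteq> {..<N + dm g}" if "j \<in> free_vars \<phi>" for j
      proof (cases "j = i")
        case True then show ?thesis using \<open>(g, xs) \<in> Adm\<close> new by auto
      next
        case False
        with that have j: "j \<in> free_vars (Exists i \<phi>)" by simp
        then show ?thesis using Exists.prems(4)[OF j] old[OF j] False by auto
      qed
    qed (use Exists.prems in auto)
    also have "\<dots> \<longleftrightarrow> sat M ((\<lambda>i. h (decode \<sigma> (\<rho> i)))(i := h (g, xs))) \<phi>"
      by (rule sat_cong) (use new old in auto)
    finally show ?thesis .
  qed
  have dmf': "sat X (upds \<sigma> N xs) (dmf g [N..<N + dm g]) \<longleftrightarrow> (g, xs) \<in> Adm"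
    if "g < G" "xs \<in> tuples (dm g) (univ X)" for g xs
  proof -
    have *: "map (upds \<sigma> N xs) [N..<N + dm g] = xs"
      using map_upds[of "dm g" xs \<sigma> N] that by (simp add: tuples_def)
    have "sat X (upds \<sigma> N xs) (dmf g [N..<N + dm g]) \<longleftrightarrow> (g, map (upds \<sigma> N xs) [N..<N + dm g]) \<in> Adm"
      by (rule dmf) (use * that Exists.prems in auto)
    with * show ?thesis by simp
  qed
  have "sat X \<sigma> (interp G dm dmf atm \<kappa> N \<rho> (Exists i \<phi>)) \<longleftrightarrow>
      (\<exists>g<G. \<exists>xs \<in> tuples (dm g) (univ X). (g, xs) \<in> Adm \<and>
        sat M ((\<lambda>i. h (decode \<sigma> (\<rho> i)))(i := h (g, xs))) \<phi>)"
  proof -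
    have "sat X \<sigma> (interp G dm dmf atm \<kappa> N \<rho> (Exists i \<phi>)) \<longleftrightarrow>
        (\<exists>g<G. \<exists>xs \<in> tuples (dm g) (univ X). sat X (upds \<sigma> N xs) (dmf g [N..<N + dm g]) \<and>
          sat X (upds \<sigma> N xs) (interp G dm dmf atm \<kappa> (N + dm g) (\<rho>(i := (g, [N..<N + dm g]))) \<phi>))"
      by (simp add: atLeast0LessThan del: fun_upd_apply) blast
    then show ?thesis using dmf' IH by blast
  qed
  also have "\<dots> \<longleftrightarrow> (\<exists>(g, xs) \<in> Adm. sat M ((\<lambda>i. h (decode \<sigma> (\<rho> i)))(i := h (g, xs))) \<phi>)"
    using Adm by (fastforce simp: tagged_tuples_def)
  also have "\<dots> \<longleftrightarrow> sat M (\<lambda>i. h (decode \<sigma> (\<rho> i))) (Exists i \<phi>)"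
    by (auto simp: h(2))
  finally show ?case .
qed auto

lemma syntax_interp:
  fixes V :: "nat set"
  assumes atm: "\<And>Z bs N. \<lbrakk>Z \<in> rel_syms T; length bs = arity T Z; \<forall>b \<in> set bs. is_block G dm b\<rbrakk> \<Longrightarrow>
      wf_formula T' (atm Z N bs) \<and> free_vars (atm Z N bs) \<subseteq> V \<union> (\<Union>b \<in> set bs. set (snd b))"
    and dmf: "\<And>g is. \<lbrakk>g < G; length is = dm g\<rbrakk> \<Longrightarrow>
      wf_formula T' (dmf g is) \<and> free_vars (dmf g is) \<subseteq> V \<union> set is"
    and \<kappa>: "\<And>c. c \<in> con_syms T \<Longrightarrow> is_block G dm (\<kappa> c) \<and> set (snd (\<kappa> c)) \<subseteq> V"
    and "wf_formula T \<phi>" "\<And>i. i \<in> free_vars \<phi> \<Longrightarrow> is_block G dm (\<rho> i)"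
  shows "wf_formula T' (interp G dm dmf atm \<kappa> N \<rho> \<phi>) \<and>
    free_vars (interp G dm dmf atm \<kappa> N \<rho> \<phi>) \<subseteq> V \<union> (\<Union>i \<in> free_vars \<phi>. set (snd (\<rho> i)))"
  using assms(4-)
proof (induction \<phi> arbitrary: N \<rho>)
  case (Rel Z ts)
  have t: "is_block G dm (term_block \<rho> \<kappa> t) \<and>
      set (snd (term_block \<rho> \<kappa> t)) \<subseteq> V \<union> (\<Union>i \<in> free_vars (Rel Z ts). set (snd (\<rho> i)))"
    if "t \<in> set ts" for t
  proof (cases t)
    case (Var i)
    with that have "i \<in> free_vars (Rel Z ts)" by force
    with Rel Var show ?thesis by auto
  next
    case (Const c)
    with that Rel have c: "c \<in> con_syms T" by force
    with \<kappa>[OF c] Const show ?thesis by auto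
  qed
  have "wf_formula T' (atm Z N (map (term_block \<rho> \<kappa>) ts)) \<and>
      free_vars (atm Z N (map (term_block \<rho> \<kappa>) ts)) \<subseteq>
      V \<union> (\<Union>b \<in> set (map (term_block \<rho> \<kappa>) ts). set (snd b))"
    by (rule atm) (use Rel t in auto)
  moreover have "(\<Union>b \<in> set (map (term_block \<rho> \<kappa>) ts). set (snd b)) \<subseteq>
      V \<union> (\<Union>i \<in> free_vars (Rel Z ts). set (snd (\<rho> i)))"
  proof (rule UN_least)
    fix b assume "b \<in> set (map (term_block \<rho> \<kappa>) ts)"
    then obtain t where "t \<in> set ts" "b = term_block \<rho> \<kappa> t" by auto
    with t show "set (snd b) \<subseteq> V \<union> (\<Union>i \<in> free_vars (Rel Z ts). set (snd (\<rho> i)))" by blast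
  qed
  ultimately show ?case by (simp only: interp.simps) blast
next
  case (Eq s s')
  have t: "is_block G dm (term_block \<rho> \<kappa> t) \<and>
      set (snd (term_block \<rho> \<kappa> t)) \<subseteq> V \<union> (\<Union>i \<in> free_vars (Eq s s'). set (snd (\<rho> i)))"
    if "t = s \<or> t = s'" for t
  proof (cases t)
    case (Var i)
    with that have "i \<in> free_vars (Eq s s')" by force
    with Eq Var show ?thesis by auto
  next
    case (Const c)
    with that Eq have c: "c \<in> con_syms T" by force
    with \<kappa>[OF c] Const show ?thesis by auto
  qed
  have fv: "free_vars (fm_eq_block b b' :: ('t, 'd) formula) \<subseteq> set (snd b) \<union> set (snd b')" for b b'
    by (auto simp: fm_eq_block_def dest: set_zip_leftD set_zip_rightD)
  have wf: "wf_formula T' (fm_eq_block b b')" for b b'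
    by (auto simp: fm_eq_block_def)
  show ?case using t[of s] t[of s'] wf fv[of "term_block \<rho> \<kappa> s" "term_block \<rho> \<kappa> s'"]
    by (simp only: interp.simps) blast
next
  case (Conj \<phi> \<psi>)
  from Conj.IH(1)[of \<rho> N] Conj.IH(2)[of \<rho> N] Conj.prems show ?case by (simp only: interp.simps wf_formula.simps free_vars.simps) blast
next
  case (Exists i \<phi>)
  let ?\<rho> = "\<lambda>g. \<rho>(i := (g, [N..<N + dm g]))"
  have IH: "wf_formula T' (interp G dm dmf atm \<kappa> (N + dm g) (?\<rho> g) \<phi>) \<and>
      free_vars (interp G dm dmf atm \<kappa> (N + dm g) (?\<rho> g) \<phi>) \<subseteq>
        V \<union> (\<Union>j \<in> free_vars \<phi>. set (snd (?\<rho> g j)))" if "g < G" for g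
    by (rule Exists.IH) (use Exists.prems that in \<open>auto simp: is_block_def\<close>)
  have "(\<Union>j \<in> free_vars \<phi>. set (snd (?\<rho> g j))) \<subseteq>
      {N..<N + dm g} \<union> (\<Union>j \<in> free_vars (Exists i \<phi>). set (snd (\<rho> j)))" for g
    by (auto split: if_splits)
  then have fv: "free_vars (interp G dm dmf atm \<kappa> (N + dm g) (?\<rho> g) \<phi>) - {N..<N + dm g} \<subseteq>
      V \<union> (\<Union>j \<in> free_vars (Exists i \<phi>). set (snd (\<rho> j)))" if "g < G" for g
    using IH[OF that] by blast
  have "free_vars (dmf g [N..<N + dm g]) - {N..<N + dm g} \<subseteq> V" if "g < G" for g
    using dmf[OF that, of "[N..<N + dm g]"] by auto
  with fv have "free_vars (interp G dm dmf atm \<kappa> N \<rho> (Exists i \<phi>)) \<subseteq>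
      V \<union> (\<Union>j \<in> free_vars (Exists i \<phi>). set (snd (\<rho> j)))"
    by (simp only: interp.simps fv_fm_disjs set_map set_upt image_image fv_fm_exs free_vars.simps
        UN_subset_iff Un_Diff Un_subset_iff) fastforce
  then show ?case using IH dmf by simp
qed auto

end

section \<open>Definable transformations\<close>

text \<open>All relations are redefined simultaneously from the old structure, as in a single
  update. Cutting off to the universe means that the identity update keeps a relation only if its
  tuples are over the universe.\<close>

definition transform :: "('s \<Rightarrow> nat) \<Rightarrow> ('s \<Rightarrow> ('s, 'c) formula) \<Rightarrow> ('v, 's, 'c) database \<Rightarrow>
    ('v, 's, 'c) database" where
  "transform ar U M = M\<lparr>rel := \<lambda>Z. {vs \<in> tuples (ar Z) (univ M). sat M (\<lambda>i. vs ! i) (U Z)}\<rparr>"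

lemma univ_transform [simp]: "univ (transform ar U M) = univ M"
  and con_transform [simp]: "con (transform ar U M) = con M"
  by (simp_all add: transform_def)

definition wf_transform :: "('s, 'c) schema \<Rightarrow> ('s \<Rightarrow> ('s, 'c) formula) \<Rightarrow> bool" where
  "wf_transform T U \<longleftrightarrow> (\<forall>Z \<in> rel_syms T. wf_formula T (U Z) \<and> free_vars (U Z) \<subseteq> {..<arity T Z})"

text \<open>The atoms of the transformed structure, written as formulas over the structure before:
  the defining formula with its own atoms replaced by \<open>atm\<close>. The block for constants is
  a dummy, because the schemas concerned have none.\<close>

definition pull_back :: "nat \<Rightarrow> (nat \<Rightarrow> nat) \<Rightarrow> ('s \<Rightarrow> ('s, 'c) formula) \<Rightarrow>
    ('s \<Rightarrow> nat \<Rightarrow> block list \<Rightarrow> ('t, 'd) formula) \<Rightarrow> 's \<Rightarrow> nat \<Rightarrow> block list \<Rightarrow> ('t, 'd) formula" where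
  "pull_back G dm U atm Z N bs =
     interp G dm (\<lambda>_ _. fm_true) atm (\<lambda>_. (0, [])) N (\<lambda>i. bs ! i) (U Z)"

definition represents :: "nat \<Rightarrow> (nat \<Rightarrow> nat) \<Rightarrow> ('s, 'c) schema \<Rightarrow> nat \<Rightarrow> (nat \<Rightarrow> 'a) \<Rightarrow>
    ('a, 't, 'd) database \<Rightarrow> ('s \<Rightarrow> nat \<Rightarrow> block list \<Rightarrow> ('t, 'd) formula) \<Rightarrow>
    (nat \<times> 'a list, 's, 'c) database \<Rightarrow> bool" where
  "represents G dm T K \<sigma>\<^sub>0 X atm M \<longleftrightarrow> univ M = tagged_tuples G dm (univ X) \<and>
     (\<forall>Z bs N \<sigma>. Z \<in> rel_syms T \<and> length bs = arity T Z \<and> K \<le> N \<and> (\<forall>i<K. \<sigma> i = \<sigma>\<^sub>0 i) \<and>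
        (\<forall>b \<in> set bs. decode \<sigma> b \<in> univ M \<and> set (snd b) \<subseteq> {..<N}) \<longrightarrow>
        (sat X \<sigma> (atm Z N bs) \<longleftrightarrow> map (decode \<sigma>) bs \<in> rel M Z))"

definition wf_atoms :: "nat \<Rightarrow> (nat \<Rightarrow> nat) \<Rightarrow> ('s, 'c) schema \<Rightarrow> nat \<Rightarrow> ('t, 'd) schema \<Rightarrow>
    ('s \<Rightarrow> nat \<Rightarrow> block list \<Rightarrow> ('t, 'd) formula) \<Rightarrow> bool" where
  "wf_atoms G dm T K T' atm \<longleftrightarrow> (\<forall>Z bs N. Z \<in> rel_syms T \<and> length bs = arity T Z \<and>
     (\<forall>b \<in> set bs. is_block G dm b) \<longrightarrow>
     wf_formula T' (atm Z N bs) \<and> free_vars (atm Z N bs) \<subseteq> {..<K} \<union> (\<Union>b \<in> set bs. set (snd b)))"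

text \<open>An atom after the transformation is a first-order statement before it, so a
  representation survives one more transformation.\<close>

lemma represents_pull_back:
  assumes r: "represents G dm T K \<sigma>\<^sub>0 X atm M" and U: "wf_transform T U" and con: "con_syms T = {}"
  shows "represents G dm T K \<sigma>\<^sub>0 X (pull_back G dm U atm) (transform (arity T) U M)"
  unfolding represents_def
proof (intro conjI allI impI; (elim conjE)?)
  show "univ (transform (arity T) U M) = tagged_tuples G dm (univ X)"
    using r by (simp add: represents_def)
next
  fix Z bs N \<sigma>
  assume Z: "Z \<in> rel_syms T" and len: "length bs = arity T Z" and N: "K \<le> N"
    and \<sigma>: "\<forall>i<K. \<sigma> i = \<sigma>\<^sub>0 i"
    and bs: "\<forall>b \<in> set bs. decode \<sigma> b \<in> univ (transform (arity T) U M) \<and> set (snd b) \<subseteq> {..<N}"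
  have M: "univ M = tagged_tuples G dm (univ X)" using r by (simp add: represents_def)
  have UZ: "wf_formula T (U Z)" "free_vars (U Z) \<subseteq> {..<arity T Z}"
    using U Z by (auto simp: wf_transform_def)
  have b: "decode \<sigma> (bs ! i) \<in> univ M \<and> set (snd (bs ! i)) \<subseteq> {..<N}" if "i \<in> free_vars (U Z)" for i
  proof -
    have "bs ! i \<in> set bs" using UZ that len by auto
    with bs show ?thesis by simp
  qed
  have "sat X \<sigma> (interp G dm (\<lambda>_ _. fm_true) atm (\<lambda>_. (0, [])) N (\<lambda>i. bs ! i) (U Z)) \<longleftrightarrow>
      sat M (\<lambda>i. id (decode \<sigma> (bs ! i))) (U Z)"
  proof (rule interpretation_data.sat_interp[where T = T and K = K and Adm = "univ M" and \<sigma>\<^sub>0 = \<sigma>\<^sub>0])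
    show "sat X \<sigma> fm_true \<longleftrightarrow> (g, map \<sigma> is) \<in> univ M"
      if "g < G" "map \<sigma> is \<in> tuples (dm g) (univ X)" for g "is" \<sigma>
      using that by (simp add: M tagged_tuples_def)
    show "sat X \<sigma> (atm Z N bs) \<longleftrightarrow> map (\<lambda>b. id (decode \<sigma> b)) bs \<in> rel M Z"
      if "Z \<in> rel_syms T" "length bs = arity T Z" "K \<le> N" "\<forall>i<K. \<sigma> i = \<sigma>\<^sub>0 i"
        "\<forall>b \<in> set bs. decode \<sigma> b \<in> univ M \<and> set (snd b) \<subseteq> {..<N}" for Z bs N \<sigma>
      using r that by (simp add: represents_def)
  qed (use con M UZ N \<sigma> b in auto)
  also have "\<dots> \<longleftrightarrow> sat M (\<lambda>i. map (decode \<sigma>) bs ! i) (U Z)"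
    by (rule sat_cong) (use UZ len in auto)
  finally show "sat X \<sigma> (pull_back G dm U atm Z N bs) \<longleftrightarrow>
      map (decode \<sigma>) bs \<in> rel (transform (arity T) U M) Z"
    using len bs by (auto simp: pull_back_def transform_def tuples_def)
qed

lemma wf_atoms_pull_back:
  assumes a: "wf_atoms G dm T K T' atm" and U: "wf_transform T U" and con: "con_syms T = {}"
  shows "wf_atoms G dm T K T' (pull_back G dm U atm)"
  unfolding wf_atoms_def
proof (intro allI impI; elim conjE)
  fix Z bs N
  assume Z: "Z \<in> rel_syms T" and len: "length bs = arity T Z" and bs: "\<forall>b \<in> set bs. is_block G dm b"
  have UZ: "wf_formula T (U Z)" "free_vars (U Z) \<subseteq> {..<arity T Z}"
    using U Z by (auto simp: wf_transform_def)
  have "wf_formula T' (pull_back G dm U atm Z N bs) \<and> free_vars (pull_back G dm U atm Z N bs) \<subseteq>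
      {..<K} \<union> (\<Union>i \<in> free_vars (U Z). set (snd (bs ! i)))"
    unfolding pull_back_def
  proof (rule interpretation_data.syntax_interp[where T = T and V = "{..<K}"])
    show "wf_formula T' (atm Z N bs) \<and> free_vars (atm Z N bs) \<subseteq> {..<K} \<union> (\<Union>b \<in> set bs. set (snd b))"
      if "Z \<in> rel_syms T" "length bs = arity T Z" "\<forall>b \<in> set bs. is_block G dm b" for Z bs N
      using a that unfolding wf_atoms_def by blast
    show "is_block G dm (bs ! i)" if "i \<in> free_vars (U Z)" for i
      using that UZ len bs by auto
  qed (use con UZ in auto)
  moreover have "(\<Union>i \<in> free_vars (U Z). set (snd (bs ! i))) \<subseteq> (\<Union>b \<in> set bs. set (snd b))"
  proof -
    have "bs ! i \<in> set bs" if "i \<in> free_vars (U Z)" for i using UZ that len by auto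
    then show ?thesis by blast
  qed
  ultimately show "wf_formula T' (pull_back G dm U atm Z N bs) \<and>
      free_vars (pull_back G dm U atm Z N bs) \<subseteq> {..<K} \<union> (\<Union>b \<in> set bs. set (snd b))" by blast
qed

text \<open>A program evaluates all its update formulas in the state before the change. By iterated
  substitution an update may nevertheless consist of any fixed number of phases, each of which reads
  the result of the previous one.\<close>

lemma represents_fold:
  assumes "represents G dm T K \<sigma>\<^sub>0 X atm M" "\<forall>U \<in> set Us. wf_transform T U" "con_syms T = {}"
  shows "represents G dm T K \<sigma>\<^sub>0 X (fold (pull_back G dm) Us atm) (fold (transform (arity T)) Us M)"
  using assms(1,2)
  by (induction Us arbitrary: atm M) (auto simp: represents_pull_back assms(3))

lemma wf_atoms_fold:
  assumes "wf_atoms G dm T K T' atm" "\<forall>U \<in> set Us. wf_transform T U" "con_syms T = {}"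
  shows "wf_atoms G dm T K T' (fold (pull_back G dm) Us atm)"
  using assms(1,2)
  by (induction Us arbitrary: atm) (auto simp: wf_atoms_pull_back assms(3))


section \<open>Programs over tagged tuples\<close>

text \<open>The structure that a program over tagged tuples updates: \<open>In\<close>, \<open>Cst\<close> and \<open>Chg\<close> give the input
  relations, the constants and the components of the changed tuple, on the copies \<open>(0, [x])\<close> of the
  domain elements; \<open>Coord j\<close> relates a tuple \<open>(1, xs)\<close> to its \<open>j\<close>-th component; \<open>Bot g\<close> names the
  element \<open>(g + 2, [])\<close>; \<open>Sto z\<close> is an auxiliary relation.\<close>

datatype ('r, 'c, 'z) vsym = In 'r | Cst 'c | Chg nat | Coord nat | Bot nat | Sto 'z

definition emb :: "'a \<Rightarrow> nat \<times> 'a list" where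
  "emb x = (0, [x])"

lemma emb_eq_iff [simp]: "emb x = emb y \<longleftrightarrow> x = y"
  by (simp add: emb_def)

lemma inj_emb: "inj_on emb A"
  by (simp add: inj_on_def)

text \<open>The layout matches the concatenation in which a tuple of tagged tuples is
  stored.\<close>

fun blocks :: "(nat \<Rightarrow> nat) \<Rightarrow> nat \<Rightarrow> nat list \<Rightarrow> block list" where
  "blocks dm i [] = []"
| "blocks dm i (g # gs) = (g, [i..<i + dm g]) # blocks dm (i + dm g) gs"

lemma length_blocks [simp]: "length (blocks dm i gs) = length gs"
  by (induction gs arbitrary: i) auto

lemma map_fst_blocks [simp]: "map fst (blocks dm i gs) = gs"
  by (induction gs arbitrary: i) auto

lemma is_block_blocks: "set gs \<subseteq> {..<G} \<Longrightarrow> b \<in> set (blocks dm i gs) \<Longrightarrow> is_block G dm b"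
  by (induction gs arbitrary: i) (auto simp: is_block_def)

lemma vars_blocks: "b \<in> set (blocks dm i gs) \<Longrightarrow> set (snd b) \<subseteq> {i..<i + sum_list (map dm gs)}"
  by (induction gs arbitrary: i) (fastforce simp: subset_iff)+

lemma decode_blocks:
  assumes "map length xss = map dm gs" "\<forall>j < length (concat xss). \<sigma> (i + j) = concat xss ! j"
  shows "map (decode \<sigma>) (blocks dm i gs) = zip gs xss"
  using assms
proof (induction gs arbitrary: i xss)
  case (Cons g gs)
  then obtain xs xss' where xss: "xss = xs # xss'" "length xs = dm g" "map length xss' = map dm gs"
    by (cases xss) auto
  have "\<sigma> (i + j) = xs ! j" if "j < dm g" for j
    using Cons.prems(2) that xss by (auto simp: nth_append dest!: spec[of _ j])
  then have "map \<sigma> [i..<i + dm g] = xs"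
    using xss by (intro nth_equalityI) auto
  moreover have "map (decode \<sigma>) (blocks dm (i + dm g) gs) = zip gs xss'"
  proof (rule Cons.IH[OF xss(3)], intro allI impI)
    fix j assume "j < length (concat xss')"
    then show "\<sigma> (i + dm g + j) = concat xss' ! j"
      using Cons.prems(2)[rule_format, of "dm g + j"] xss by (simp add: nth_append add.assoc)
  qed
  ultimately show ?case by (simp add: xss decode_def[of _ "(_, _)"])
qed simp

locale tuple_program =
  fixes \<tau> :: "('r, 'c) schema" and c B :: nat and St :: "'z set" and ar :: "'z \<Rightarrow> nat"
    and Us :: "'r change_type \<Rightarrow> (('r, 'c, 'z) vsym \<Rightarrow> (('r, 'c, 'z) vsym, unit) formula) list"
    and ans :: 'z
begin

definition dm :: "nat \<Rightarrow> nat" where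
  "dm g = (if g = 0 then 1 else if g = 1 then c else 0)"

abbreviation vuniv :: "'a set \<Rightarrow> (nat \<times> 'a list) set" where
  "vuniv A \<equiv> tagged_tuples (B + 2) dm A"

fun varity :: "('r, 'c, 'z) vsym \<Rightarrow> nat" where
  "varity (In R) = arity \<tau> R"
| "varity (Coord j) = 2"
| "varity (Sto z) = ar z"
| "varity Z = 1"

definition vschema :: "nat \<Rightarrow> (('r, 'c, 'z) vsym, unit) schema" where
  "vschema m = \<lparr>rel_syms = In ` rel_syms \<tau> \<union> Cst ` con_syms \<tau> \<union> Chg ` {..<m} \<union> Coord ` {..<c} \<union>
     Bot ` {..<B} \<union> Sto ` St, arity = varity, con_syms = {}\<rparr>"

definition vbase :: "('a, 'r, 'c) database \<Rightarrow> 'a list \<Rightarrow> ('z \<Rightarrow> (nat \<times> 'a list) relation) \<Rightarrow>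
    (nat \<times> 'a list, ('r, 'c, 'z) vsym, unit) database" where
  "vbase D a A = \<lparr>univ = vuniv (univ D),
     rel = (\<lambda>Z. case Z of
         In R \<Rightarrow> map emb ` rel D R
       | Cst d \<Rightarrow> {[emb x] |x. con D d = Some x}
       | Chg j \<Rightarrow> {[emb (a ! j)] |_::unit. j < length a}
       | Coord j \<Rightarrow> {[(1, xs), emb (xs ! j)] |xs. j < c \<and> xs \<in> tuples c (univ D)}
       | Bot g \<Rightarrow> {[(g + 2, [])] |_::unit. g < B}
       | Sto z \<Rightarrow> A z),
     con = Map.empty\<rparr>"

fun vstep :: "('a, 'r) change \<Rightarrow> ('a, 'r, 'c) database \<times> ('z \<Rightarrow> (nat \<times> 'a list) relation) \<Rightarrow>
    ('a, 'r, 'c) database \<times> ('z \<Rightarrow> (nat \<times> 'a list) relation)" where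
  "vstep (\<delta>, a) (D, A) = (apply_change (\<delta>, a) D, \<lambda>z. if z \<in> St
     then rel (fold (transform varity) (Us \<delta>) (vbase D a A)) (Sto z) else {})"

text \<open>The entries of a tuple of tagged tuples may have different lengths, so a relation over
  them is not one relation over the domain. It is split into finitely many, one for each vector of
  tags, and this vector becomes part of the symbol.\<close>

definition stored_syms :: "('z \<times> nat list) set" where
  "stored_syms = {(z, gs). z \<in> St \<and> length gs = ar z \<and> set gs \<subseteq> {..<B + 2}}"

text \<open>Auxiliary symbols have to be natural numbers; any injection of the finite set
  \<open>stored_syms\<close> serves.\<close>

definition enc :: "'z \<times> nat list \<Rightarrow> nat" where
  "enc = (SOME f. inj_on f stored_syms)"

fun atom0 :: "('r, 'c, 'z) vsym \<Rightarrow> nat \<Rightarrow> block list \<Rightarrow> ('r + nat, 'c) formula" where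
  "atom0 (In R) N bs = (if \<forall>b \<in> set bs. fst b = 0
     then Rel (Inl R) (map (\<lambda>b. Var (hd (snd b))) bs) else Neg fm_true)"
| "atom0 (Cst d) N bs = (if fst (hd bs) = 0 then Eq (Var (hd (snd (hd bs)))) (Const d) else Neg fm_true)"
| "atom0 (Chg j) N bs = (if fst (hd bs) = 0 then Eq (Var (hd (snd (hd bs)))) (Var j) else Neg fm_true)"
| "atom0 (Coord j) N bs = (if fst (bs ! 0) = 1 \<and> fst (bs ! 1) = 0
     then Eq (Var (snd (bs ! 0) ! j)) (Var (hd (snd (bs ! 1)))) else Neg fm_true)"
| "atom0 (Bot g) N bs = (if fst (hd bs) = g + 2 then fm_true else Neg fm_true)"
| "atom0 (Sto z) N bs = Rel (Inr (enc (z, map fst bs))) (map Var (concat (map snd bs)))"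

definition final_atom :: "'r change_type \<Rightarrow> ('r, 'c, 'z) vsym \<Rightarrow> nat \<Rightarrow> block list \<Rightarrow>
    ('r + nat, 'c) formula" where
  "final_atom \<delta> = fold (pull_back (B + 2) dm) (Us \<delta>) atom0"

text \<open>The variables below \<open>m\<close> belong to the changed tuple, so the blocks of the
  candidate start at \<open>m\<close>, and bound variables come after all of them.\<close>

definition program :: "('r, 'c) dyn_program" where
  "program = \<lparr>aux_syms = enc ` stored_syms,
     aux_arity = (\<lambda>n. sum_list (map dm (snd (inv_into stored_syms enc n)))),
     upd = (\<lambda>\<delta> n. let (z, gs) = inv_into stored_syms enc n; m = arity \<tau> (changed_rel \<delta>) in
       final_atom \<delta> (Sto z) (m + sum_list (map dm gs)) (blocks dm m gs)),
     answer = enc (ans, replicate (ar ans) 0)\<rparr>"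

text \<open>The inverse of the splitting by tag vectors: the relations over tagged tuples are
  reassembled from the auxiliary relations.\<close>

definition stored_state :: "'a set \<Rightarrow> (nat \<Rightarrow> 'a relation) \<Rightarrow> 'z \<Rightarrow> (nat \<times> 'a list) relation" where
  "stored_state V A z = (if z \<in> St then
     {vs \<in> tuples (ar z) (vuniv V). concat (map snd vs) \<in> A (enc (z, map fst vs))} else {})"

end

locale wf_tuple_program = tuple_program \<tau> c B St ar Us ans
  for \<tau> :: "('r, 'c) schema" and c B :: nat and St :: "'z set" and ar :: "'z \<Rightarrow> nat"
    and Us :: "'r change_type \<Rightarrow> (('r, 'c, 'z) vsym \<Rightarrow> (('r, 'c, 'z) vsym, unit) formula) list"
    and ans :: 'z +
  assumes fin: "finite_schema \<tau>" "finite St" and ans: "ans \<in> St"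
    and Us: "\<And>\<delta>. changed_rel \<delta> \<in> rel_syms \<tau> \<Longrightarrow> Us \<delta> \<noteq> [] \<and>
      (\<forall>U \<in> set (Us \<delta>). wf_transform (vschema (arity \<tau> (changed_rel \<delta>))) U)"
begin

lemma finite_stored_syms: "finite stored_syms"
proof -
  have "stored_syms \<subseteq> St \<times> (\<Union>n \<in> ar ` St. {gs. set gs \<subseteq> {..<B + 2} \<and> length gs = n})"
    by (auto simp: stored_syms_def)
  moreover have "finite (St \<times> (\<Union>n \<in> ar ` St. {gs. set gs \<subseteq> {..<B + 2} \<and> length gs = n}))"
    using fin by (intro finite_SigmaI finite_UN_I finite_lists_length_eq) auto
  ultimately show ?thesis by (rule finite_subset)
qed

lemma inj_enc: "inj_on enc stored_syms"
proof -
  obtain f :: "'z \<times> nat list \<Rightarrow> nat" where "inj_on f stored_syms"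
    using finite_imp_inj_to_nat_seg[OF finite_stored_syms] by auto
  then show ?thesis unfolding enc_def by (rule someI[of "\<lambda>f. inj_on f stored_syms"])
qed

lemma inv_enc [simp]: "zg \<in> stored_syms \<Longrightarrow> inv_into stored_syms enc (enc zg) = zg"
  using inj_enc by simp

lemma arity_enc: "(z, gs) \<in> stored_syms \<Longrightarrow> aux_arity program (enc (z, gs)) = sum_list (map dm gs)"
  by (simp add: program_def)

lemma upd_enc: "(z, gs) \<in> stored_syms \<Longrightarrow> upd program \<delta> (enc (z, gs)) =
    final_atom \<delta> (Sto z) (arity \<tau> (changed_rel \<delta>) + sum_list (map dm gs))
      (blocks dm (arity \<tau> (changed_rel \<delta>)) gs)"
  by (simp add: program_def Let_def)

lemma hd_snd_block:
  assumes "is_block (B + 2) dm b" "fst b = 0"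
  obtains i where "b = (0, [i])"
  using assms by (cases b) (auto simp: is_block_def dm_def length_Suc_conv)

lemma wf_atoms_atom0: "wf_atoms (B + 2) dm (vschema m) m (state_schema \<tau> program) atom0"
  unfolding wf_atoms_def
proof (intro allI impI; elim conjE)
  fix Z and bs :: "block list" and N
  assume Z: "Z \<in> rel_syms (vschema m)" and len: "length bs = arity (vschema m) Z"
    and bs: "\<forall>b \<in> set bs. is_block (B + 2) dm b"
  have fv: "hd (snd b) \<in> set (snd b)" if "b \<in> set bs" "fst b = 0" for b
  proof -
    have "is_block (B + 2) dm b" using bs that by blast
    then show ?thesis using that(2) by (rule hd_snd_block) simp
  qed
  have hd: "hd bs \<in> set bs" if "length bs = 1" using that by (cases bs) auto
  show "wf_formula (state_schema \<tau> program) (atom0 Z N bs) \<and>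
      free_vars (atom0 Z N bs) \<subseteq> {..<m} \<union> (\<Union>b \<in> set bs. set (snd b))"
  proof (cases Z)
    case (In R)
    show ?thesis
    proof (cases "\<forall>b \<in> set bs. fst b = 0")
      case True
      then have "(\<Union>b \<in> set bs. {hd (snd b)}) \<subseteq> (\<Union>b \<in> set bs. set (snd b))"
        using fv by blast
      moreover have "R \<in> rel_syms \<tau>" "length bs = arity \<tau> R"
        using In Z len by (auto simp: vschema_def)
      ultimately show ?thesis using In True by (simp add: state_schema_def le_supI2 InlI)
    qed (use In in auto)
  next
    case (Cst d)
    then have "length bs = 1" "d \<in> con_syms \<tau>" using Z len by (auto simp: vschema_def)
    then show ?thesis using Cst fv[OF hd] hd by (auto simp: state_schema_def)
  next
    case (Chg j)
    then have "length bs = 1" "j < m" using Z len by (auto simp: vschema_def)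
    then show ?thesis using Chg fv[OF hd] hd by auto
  next
    case (Coord j)
    then have *: "bs ! 0 \<in> set bs" "bs ! 1 \<in> set bs" "j < c" using Z len by (auto simp: vschema_def)
    have "snd (bs ! 0) ! j \<in> set (snd (bs ! 0))" if "fst (bs ! 0) = 1"
      using bs * that by (auto simp: is_block_def dm_def)
    then show ?thesis using Coord * fv[OF *(2)] by auto
  next
    case (Bot g)
    then show ?thesis by simp
  next
    case (Sto z)
    have "(z, map fst bs) \<in> stored_syms"
      using Z Sto len bs by (auto simp: vschema_def stored_syms_def is_block_def)
    moreover have "length (concat (map snd bs)) = sum_list (map dm (map fst bs))"
      using bs by (auto simp: length_concat is_block_def o_def intro!: arg_cong[of _ _ sum_list])
    ultimately show ?thesis
      using Sto arity_enc by (auto simp: state_schema_def program_def)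
  qed
qed

text \<open>The base of the composition: before any phase, the tagged structure is definable in the
  state of the program, with the changed tuple in the parameters below \<open>m\<close>.\<close>

lemma represents_atom0:
  assumes D: "is_database \<tau> D" and a: "a \<in> tuples m (univ D)"
    and \<sigma>\<^sub>0: "\<forall>i<m. \<sigma>\<^sub>0 i = a ! i"
  shows "represents (B + 2) dm (vschema m) m \<sigma>\<^sub>0 (state_structure (D, A)) atom0
    (vbase D a (stored_state (univ D) A))"
  unfolding represents_def
proof (intro conjI allI impI; (elim conjE)?)
  let ?M = "vbase D a (stored_state (univ D) A)"
  show "univ ?M = vuniv (univ (state_structure (D, A)))" by (simp add: vbase_def)
  fix Z and bs :: "block list" and N \<sigma>
  assume Z: "Z \<in> rel_syms (vschema m)" and len: "length bs = arity (vschema m) Z"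
    and \<sigma>: "\<forall>i<m. \<sigma> i = \<sigma>\<^sub>0 i" and bs: "\<forall>b \<in> set bs. decode \<sigma> b \<in> univ ?M \<and> set (snd b) \<subseteq> {..<N}"
  have blk: "is_block (B + 2) dm b" if "b \<in> set bs" for b
  proof (rule is_block_if_decode)
    show "decode \<sigma> b \<in> vuniv (univ D)" using bs that by (simp add: vbase_def)
  qed
  have dec0: "decode \<sigma> b = emb (\<sigma> (hd (snd b)))" if "b \<in> set bs" "fst b = 0" for b
    by (rule hd_snd_block[OF blk[OF that(1)] that(2)]) (simp add: decode_def emb_def)
  have fst0: "fst b = 0" if "decode \<sigma> b = emb x" for b x using that by (simp add: decode_def emb_def)
  show "sat (state_structure (D, A)) \<sigma> (atom0 Z N bs) \<longleftrightarrow> map (decode \<sigma>) bs \<in> rel ?M Z"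
  proof (cases Z)
    case (In R)
    show ?thesis
    proof (cases "\<forall>b \<in> set bs. fst b = 0")
      case True
      have e: "map (decode \<sigma>) bs = map emb (map (\<lambda>b. \<sigma> (hd (snd b))) bs)"
        using dec0 True by simp
      have "map emb xs \<in> map emb ` X \<longleftrightarrow> xs \<in> X" for xs :: "'e list" and X
        by (rule map_mem_image_iff[of emb UNIV]) (simp_all add: inj_emb)
      then have "map (decode \<sigma>) bs \<in> map emb ` rel D R \<longleftrightarrow> map (\<lambda>b. \<sigma> (hd (snd b))) bs \<in> rel D R"
        unfolding e by blast
      then show ?thesis using True In by (simp add: vbase_def o_def)
    next
      case False
      then obtain b where b: "b \<in> set bs" "fst b \<noteq> 0" by blast
      have "map (decode \<sigma>) bs \<notin> map emb ` X" for X
      proof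
        assume "map (decode \<sigma>) bs \<in> map emb ` X"
        then obtain xs where xs: "map (decode \<sigma>) bs = map emb xs" by blast
        have "decode \<sigma> b \<in> set (map (decode \<sigma>) bs)" using b by simp
        then have "decode \<sigma> b \<in> emb ` set xs" unfolding xs by simp
        then obtain x where "decode \<sigma> b = emb x" by blast
        then show False using b(2) fst0 by simp
      qed
      then show ?thesis using False In by (auto simp: vbase_def)
    qed
  next
    case (Cst d)
    then obtain b where b: "bs = [b]" using len by (auto simp: vschema_def length_Suc_conv)
    have "d \<in> con_syms \<tau>" using Z Cst by (auto simp: vschema_def)
    with D have "d \<in> dom (con D)" unfolding is_database_def by simp
    then obtain x where x: "con D d = Some x" by auto
    show ?thesis using Cst b x dec0[of b] fst0[of b] by (cases "fst b = 0") (auto simp: vbase_def)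
  next
    case (Chg j)
    then obtain b where b: "bs = [b]" using len by (auto simp: vschema_def length_Suc_conv)
    have j: "j < m" using Z Chg by (auto simp: vschema_def)
    then have "\<sigma> j = a ! j" "length a = m" using \<sigma> \<sigma>\<^sub>0 a by (auto simp: tuples_def)
    with j show ?thesis
      using Chg b dec0[of b] fst0[of b] by (cases "fst b = 0") (auto simp: vbase_def)
  next
    case (Coord j)
    then obtain b b' where b: "bs = [b, b']"
      using len by (auto simp: vschema_def length_Suc_conv numeral_2_eq_2)
    have j: "j < c" using Z Coord by (auto simp: vschema_def)
    show ?thesis
    proof (cases "fst b = 1 \<and> fst b' = 0")
      case True
      then obtain js where js: "b = (1, js)" "length js = c" using blk[of b] b
        by (cases b) (auto simp: is_block_def dm_def)
      have "map \<sigma> js \<in> tuples c (univ D)"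
        using bs b js by (auto simp: vbase_def tagged_tuples_def decode_def dm_def)
      moreover have "decode \<sigma> b' = emb (\<sigma> (hd (snd b')))" using dec0 b True by simp
      ultimately show ?thesis using True Coord b js j by (auto simp: vbase_def decode_def)
    next
      case False
      then show ?thesis using Coord b fst0[of b'] by (auto simp: vbase_def decode_def emb_def)
    qed
  next
    case (Bot g)
    then obtain b where b: "bs = [b]" using len by (auto simp: vschema_def length_Suc_conv)
    have "snd b = []" if "fst b = g + 2" using blk[of b] b that by (simp add: is_block_def dm_def)
    then show ?thesis using Bot b Z by (auto simp: vbase_def decode_def vschema_def)
  next
    case (Sto z)
    have "map (decode \<sigma>) bs \<in> tuples (ar z) (vuniv (univ D))"
      using Sto len bs by (auto simp: tuples_def vschema_def vbase_def)
    moreover have "map fst (map (decode \<sigma>) bs) = map fst bs"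
      "concat (map snd (map (decode \<sigma>) bs)) = map \<sigma> (concat (map snd bs))"
      by (simp_all add: decode_def o_def map_concat)
    moreover have "z \<in> St" using Z Sto by (auto simp: vschema_def)
    ultimately show ?thesis
      by (simp add: Sto vbase_def stored_state_def o_def decode_def map_concat)
  qed
qed

lemma con_syms_vschema [simp]: "con_syms (vschema m) = {}"
  and arity_vschema [simp]: "arity (vschema m) = varity"
  by (simp_all add: vschema_def)

lemma is_program_program: "is_program \<tau> (ar ans) program"
  unfolding is_program_def
proof (intro conjI allI impI; (elim conjE)?)
  have a: "(ans, replicate (ar ans) 0) \<in> stored_syms" using ans by (auto simp: stored_syms_def)
  then show "answer program \<in> aux_syms program" by (simp add: program_def)
  show "aux_arity program (answer program) = ar ans"
    using a by (simp add: program_def dm_def sum_list_replicate)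
  show "finite (aux_syms program)" by (simp add: program_def finite_stored_syms)
  fix \<delta> n assume \<delta>: "changed_rel \<delta> \<in> rel_syms \<tau>" and "n \<in> aux_syms program"
  then obtain z gs where n: "n = enc (z, gs)" "(z, gs) \<in> stored_syms" by (auto simp: program_def)
  let ?m = "arity \<tau> (changed_rel \<delta>)"
  have z: "Sto z \<in> rel_syms (vschema ?m)" "length gs = ar z" "set gs \<subseteq> {..<B + 2}"
    using n by (auto simp: stored_syms_def vschema_def)
  have "wf_atoms (B + 2) dm (vschema ?m) ?m (state_schema \<tau> program) (final_atom \<delta>)"
    unfolding final_atom_def using Us[OF \<delta>] by (intro wf_atoms_fold wf_atoms_atom0) auto
  then have *: "wf_formula (state_schema \<tau> program) (upd program \<delta> n)"
    "free_vars (upd program \<delta> n) \<subseteq> {..<?m} \<union> (\<Union>b \<in> set (blocks dm ?m gs). set (snd b))"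
    using z is_block_blocks[OF z(3)] unfolding n(1) upd_enc[OF n(2)] wf_atoms_def by auto
  show "wf_formula (state_schema \<tau> program) (upd program \<delta> n)" by fact
  have "(\<Union>b \<in> set (blocks dm ?m gs). set (snd b)) \<subseteq> {?m..<?m + sum_list (map dm gs)}"
    using vars_blocks by (intro UN_least)
  then show "free_vars (upd program \<delta> n) \<subseteq> {..<?m + aux_arity program n}"
    using *(2) unfolding n(1) arity_enc[OF n(2)] by fastforce
qed

lemma rel_fold_transform:
  "rel M Z \<subseteq> tuples (varity Z) V \<Longrightarrow> univ M = V \<Longrightarrow>
     rel (fold (transform varity) Vs M) Z \<subseteq> tuples (varity Z) V"
proof (induction Vs arbitrary: M)
  case (Cons U Vs)
  show ?case unfolding fold.simps o_def
    by (rule Cons.IH) (use Cons.prems in \<open>auto simp: transform_def\<close>)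
qed simp

text \<open>\<open>final_atom\<close> represents the structure after the last phase; evaluated on
  the flattened candidate it decides membership in the stored relation.\<close>

lemma stored_state_step:
  assumes D: "is_database \<tau> D" and ch: "is_change \<tau> (univ D) (\<delta>, a)"
  shows "stored_state (univ D) (snd (step program (\<delta>, a) (D, A))) =
    snd (vstep (\<delta>, a) (D, stored_state (univ D) A))"
proof
  fix z
  let ?m = "arity \<tau> (changed_rel \<delta>)"
  let ?Mb = "vbase D a (stored_state (univ D) A)"
  let ?M = "fold (transform varity) (Us \<delta>) ?Mb"
  have \<delta>: "changed_rel \<delta> \<in> rel_syms \<tau>" and a: "a \<in> tuples ?m (univ D)"
    using ch by (auto simp: is_change_def)
  show "stored_state (univ D) (snd (step program (\<delta>, a) (D, A))) z =
      snd (vstep (\<delta>, a) (D, stored_state (univ D) A)) z"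
  proof (cases "z \<in> St")
    case z: True
    have "rel ?M (Sto z) \<subseteq> tuples (varity (Sto z)) (univ ?Mb)"
      using z by (intro rel_fold_transform) (auto simp: vbase_def stored_state_def)
    then have sub: "rel ?M (Sto z) \<subseteq> tuples (ar z) (vuniv (univ D))" by (simp add: vbase_def)
    let ?A = "snd (step program (\<delta>, a) (D, A))"
    have *: "concat (map snd vs) \<in> snd (step program (\<delta>, a) (D, A)) (enc (z, map fst vs)) \<longleftrightarrow>
        vs \<in> rel ?M (Sto z)" if vs: "vs \<in> tuples (ar z) (vuniv (univ D))" for vs
    proof -
      let ?gs = "map fst vs" and ?b = "concat (map snd vs)"
      let ?\<sigma> = "\<lambda>i. (a @ ?b) ! i"
      have mem: "(z, ?gs) \<in> stored_syms"
        using vs z by (auto simp: stored_syms_def tuples_def tagged_tuples_def)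
      have lens: "map length (map snd vs) = map dm ?gs"
        using vs by (auto simp: tuples_def tagged_tuples_def)
      then have lb: "length ?b = sum_list (map dm ?gs)" by (simp only: length_concat)
      have "set ?b \<subseteq> univ D"
        using vs by (fastforce simp: tuples_def tagged_tuples_def)
      with lb have b: "?b \<in> tuples (aux_arity program (enc (z, ?gs))) (univ D)"
        unfolding arity_enc[OF mem] by (simp add: tuples_def)
      have la: "length a = ?m" using a by (simp add: tuples_def)
      \<comment> \<open>The flattened candidate is cut into blocks again by its tag vector, which
        gives back \<open>vs\<close>.\<close>
      have dec: "map (decode ?\<sigma>) (blocks dm ?m ?gs) = vs"
        using decode_blocks[OF lens, of ?\<sigma> ?m] la by (simp add: nth_append zip_map_fst_snd)
      have rep: "represents (B + 2) dm (vschema ?m) ?m ?\<sigma> (state_structure (D, A)) (final_atom \<delta>) ?M"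
        unfolding final_atom_def using Us[OF \<delta>] la
        by (intro represents_fold[where T = "vschema ?m", simplified] represents_atom0[OF D a])
          (auto simp: nth_append)
      have "sat (state_structure (D, A)) ?\<sigma> (final_atom \<delta> (Sto z) (?m + sum_list (map dm ?gs))
          (blocks dm ?m ?gs)) \<longleftrightarrow> map (decode ?\<sigma>) (blocks dm ?m ?gs) \<in> rel ?M (Sto z)"
      proof (rule rep[unfolded represents_def, THEN conjunct2, rule_format], intro conjI ballI)
        show "Sto z \<in> rel_syms (vschema ?m)" using z by (simp add: vschema_def)
        show "length (blocks dm ?m ?gs) = arity (vschema ?m) (Sto z)"
          using vs by (simp add: tuples_def)
        fix b assume b: "b \<in> set (blocks dm ?m ?gs)"
        then have "decode ?\<sigma> b \<in> set (map (decode ?\<sigma>) (blocks dm ?m ?gs))" by simp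
        then have "decode ?\<sigma> b \<in> vuniv (univ D)" using vs unfolding dec by (auto simp: tuples_def)
        moreover have "univ ?M = vuniv (univ D)" using rep by (simp add: represents_def)
        ultimately show "decode ?\<sigma> b \<in> univ ?M" by simp
        show "set (snd b) \<subseteq> {..<?m + sum_list (map dm ?gs)}" using vars_blocks[OF b] by auto
      qed auto
      then show ?thesis
        using b mem unfolding dec by (simp add: upd_enc program_def[THEN arg_cong[of _ _ aux_syms]])
    qed
    have "stored_state (univ D) ?A z =
        {vs \<in> tuples (ar z) (vuniv (univ D)). concat (map snd vs) \<in> ?A (enc (z, map fst vs))}"
      by (simp only: stored_state_def z if_True)
    also have "\<dots> = rel ?M (Sto z)" using * sub by blast
    also have "\<dots> = snd (vstep (\<delta>, a) (D, stored_state (univ D) A)) z" using z by simp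
    finally show ?thesis .
  qed (simp add: stored_state_def)
qed

text \<open>Only the part of the answer relation on the copies \<open>(0, [x])\<close> counts, and
  this part is itself an auxiliary relation: the one whose tag vector consists of zeros.\<close>

lemma DynFO_tuple_program:
  fixes q :: "('a, 'r, 'c) query"
  assumes q: "is_query \<tau> (ar ans) q"
    and main: "\<And>D cs. initial_database \<tau> D \<Longrightarrow> \<forall>ch \<in> set cs. is_change \<tau> (univ D) ch \<Longrightarrow>
      (case fold vstep cs (D, \<lambda>z. {}) of (D', A') \<Rightarrow>
        {b \<in> tuples (ar ans) (univ D). map emb b \<in> A' ans} = q D')"
  shows "q \<in> DynFO \<tau> (ar ans)"
proof -
  have run: "fold vstep cs (D, stored_state (univ D) A) =
      (fst (fold (step program) cs (D, A)), stored_state (univ D) (snd (fold (step program) cs (D, A))))"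
    if "is_database \<tau> D" "\<forall>ch \<in> set cs. is_change \<tau> (univ D) ch"
    for D :: "('a, 'r, 'c) database" and A cs
    using that
  proof (induction cs arbitrary: D A)
    case (Cons ch cs)
    obtain \<delta> a where ch: "ch = (\<delta>, a)" by fastforce
    obtain D1 A1 where s: "step program ch (D, A) = (D1, A1)" by fastforce
    have D1: "D1 = apply_change ch D" using s by (simp add: ch)
    have "stored_state (univ D) A1 = snd (vstep ch (D, stored_state (univ D) A))"
      using stored_state_step[of D \<delta> a A] Cons.prems s by (simp add: ch del: vstep.simps step.simps)
    then have "vstep ch (D, stored_state (univ D) A) = (D1, stored_state (univ D1) A1)"
      by (simp add: D1 ch)
    moreover have "is_database \<tau> D1" using Cons.prems by (simp add: D1 is_database_apply_change)
    ultimately show ?case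
      using Cons.IH[of D1 A1] Cons.prems by (simp add: s D1)
  qed simp
  have "maintains_from \<tau> program q (D, \<lambda>S. {})" if D: "initial_database \<tau> D" for D
    unfolding maintains_from_def
  proof (intro allI impI)
    fix cs assume cs: "\<forall>ch \<in> set cs. is_change \<tau> (univ (fst (D, \<lambda>S::nat. {} :: 'a relation))) ch"
    let ?s = "fold (step program) cs (D, \<lambda>S. {})"
    have Ddb: "is_database \<tau> D" using D by (simp add: initial_database_def)
    have "stored_state (univ D) (\<lambda>S. {}) = (\<lambda>z. {})" by (simp add: stored_state_def fun_eq_iff)
    then have "fold vstep cs (D, \<lambda>z. {}) = (fst ?s, stored_state (univ D) (snd ?s))"
      using run[OF Ddb, of cs "\<lambda>S. {}"] cs by simp
    then have q: "{b \<in> tuples (ar ans) (univ D). map emb b \<in> stored_state (univ D) (snd ?s) ans} = q (fst ?s)"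
      using main[OF D, of cs] cs by simp
    have "valid_state \<tau> program ?s"
      by (rule valid_state_fold_step) (use Ddb cs in \<open>auto simp: valid_state_def\<close>)
    then have "snd ?s (answer program) \<subseteq> tuples (ar ans) (univ D)"
      using is_program_program unfolding valid_state_def is_program_def
      by (metis fst_conv univ_fold_step)
    moreover have "map emb b \<in> stored_state (univ D) X ans \<longleftrightarrow> b \<in> X (answer program)"
      if "b \<in> tuples (ar ans) (univ D)" for b and X :: "nat \<Rightarrow> 'a relation"
    proof -
      have "concat (map snd (map emb b)) = b" by (induction b) (auto simp: emb_def)
      moreover have "map fst (map emb b) = replicate (ar ans) 0"
        using that by (auto simp: emb_def tuples_def o_def map_replicate_const)
      moreover have "map emb b \<in> tuples (ar ans) (vuniv (univ D))"
        using that by (auto simp: tuples_def tagged_tuples_def emb_def dm_def)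
      ultimately show ?thesis using ans by (simp add: stored_state_def program_def)
    qed
    ultimately show "case ?s of (D, A) \<Rightarrow> A (answer program) = q D"
      using q by (auto simp: split_beta)
  qed
  then show ?thesis using q is_program_program by (auto simp: DynFO_def)
qed

end

section \<open>The stored relations\<close>

text \<open>\<open>Ord\<close>, \<open>Pls\<close> and \<open>Tms\<close> hold the arithmetic on
  codes, \<open>Num\<close> relates each active element to the code of its number, and
  \<open>Born\<close> marks the codes whose thread has been started. \<open>TIn R\<close> and
  \<open>TAux S\<close> hold the relations of all threads together, with the code of the thread as
  an additional first component.\<close>

datatype 'r sym = Ord | Pls | Tms | Num | Born | TIn 'r | TAux nat | Ans

definition at :: "'s \<Rightarrow> nat list \<Rightarrow> ('s, 'c) formula" where
  "at Z is = Rel Z (map Var is)"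

lemma sat_at [simp]: "sat M \<sigma> (at Z is) \<longleftrightarrow> map \<sigma> is \<in> rel M Z"
  by (simp add: at_def o_def)

lemma fv_at [simp]: "free_vars (at Z is) = set is"
  by (auto simp: at_def)

lemma wf_at [simp]: "wf_formula T (at Z is) \<longleftrightarrow> Z \<in> rel_syms T \<and> length is = arity T Z"
  by (auto simp: at_def)

definition ident :: "('s \<Rightarrow> nat) \<Rightarrow> 's \<Rightarrow> ('s, 'c) formula" where
  "ident ar Z = at Z [0..<ar Z]"

definition wf_rels :: "('s \<Rightarrow> nat) \<Rightarrow> ('v, 's, 'c) database \<Rightarrow> bool" where
  "wf_rels ar M \<longleftrightarrow> (\<forall>Z. rel M Z \<subseteq> tuples (ar Z) (univ M))"

lemma wf_rels_transform [simp]: "wf_rels ar (transform ar U M)"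
  by (auto simp: wf_rels_def transform_def)

lemma rel_transform_ident:
  assumes "wf_rels ar M" "U Z = ident ar Z"
  shows "rel (transform ar U M) Z = rel M Z"
proof -
  have "map (\<lambda>i. vs ! i) [0..<ar Z] = vs" if "vs \<in> tuples (ar Z) (univ M)" for vs
    using that map_nth[of vs] by (simp add: tuples_def)
  then have "vs \<in> rel (transform ar U M) Z \<longleftrightarrow> vs \<in> rel M Z" if "vs \<in> tuples (ar Z) (univ M)" for vs
    using that by (simp add: transform_def assms(2) ident_def)
  moreover have "rel (transform ar U M) Z \<subseteq> tuples (ar Z) (univ M)" "rel M Z \<subseteq> tuples (ar Z) (univ M)"
    using assms(1) by (auto simp: transform_def wf_rels_def)
  ultimately show ?thesis by blast
qed

lemma mem_transform:
  "vs \<in> rel (transform ar U M) Z \<longleftrightarrow> vs \<in> tuples (ar Z) (univ M) \<and> sat M (\<lambda>i. vs ! i) (U Z)"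
  by (simp add: transform_def)

lemma tuples_Nil [simp]: "[] \<in> tuples n A \<longleftrightarrow> n = 0"
  and tuples_Cons [simp]: "x # xs \<in> tuples n A \<longleftrightarrow> x \<in> A \<and> (\<exists>m. n = Suc m \<and> xs \<in> tuples m A)"
  by (auto simp: tuples_def)

section \<open>A growing copy of arithmetic\<close>

text \<open>The entries of \<open>us\<close> play the numbers below \<open>length us\<close>.\<close>

definition codes :: "('v, ('r, 'c, 'r sym) vsym, unit) database \<Rightarrow> 'v list \<Rightarrow> bool" where
  "codes M us \<longleftrightarrow> distinct us \<and> set us \<subseteq> univ M \<and>
     (\<forall>x y. [x, y] \<in> rel M (Sto Ord) \<longleftrightarrow> (\<exists>i j. i \<le> j \<and> j < length us \<and> x = us ! i \<and> y = us ! j)) \<and>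
     (\<forall>x y z. [x, y, z] \<in> rel M (Sto Pls) \<longleftrightarrow>
        (\<exists>i j. i + j < length us \<and> x = us ! i \<and> y = us ! j \<and> z = us ! (i + j))) \<and>
     (\<forall>x y z. [x, y, z] \<in> rel M (Sto Tms) \<longleftrightarrow>
        (\<exists>i j. i < length us \<and> j < length us \<and> i * j < length us \<and>
           x = us ! i \<and> y = us ! j \<and> z = us ! (i * j)))"

lemma codes_nth:
  assumes "codes M us" "i < length us" "j < length us"
  shows "[us ! i, us ! j] \<in> rel M (Sto Ord) \<longleftrightarrow> i \<le> j"
    and "l < length us \<Longrightarrow> [us ! i, us ! j, us ! l] \<in> rel M (Sto Pls) \<longleftrightarrow> i + j = l"
    and "l < length us \<Longrightarrow> [us ! i, us ! j, us ! l] \<in> rel M (Sto Tms) \<longleftrightarrow> i * j = l"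
    and "[us ! i, us ! j, z] \<in> rel M (Sto Pls) \<longleftrightarrow> i + j < length us \<and> z = us ! (i + j)"
    and "[us ! i, us ! j, z] \<in> rel M (Sto Tms) \<longleftrightarrow> i * j < length us \<and> z = us ! (i * j)"
proof -
  have eq: "us ! i' = us ! j' \<longleftrightarrow> i' = j'" if "i' < length us" "j' < length us" for i' j'
    using assms that by (simp add: codes_def nth_eq_iff_index_eq)
  show "[us ! i, us ! j] \<in> rel M (Sto Ord) \<longleftrightarrow> i \<le> j"
    using assms eq unfolding codes_def by (metis le_less_trans)
  show P: "[us ! i, us ! j, z] \<in> rel M (Sto Pls) \<longleftrightarrow> i + j < length us \<and> z = us ! (i + j)" for z
    using assms eq unfolding codes_def by (metis add_lessD1 add.commute)
  show T: "[us ! i, us ! j, z] \<in> rel M (Sto Tms) \<longleftrightarrow> i * j < length us \<and> z = us ! (i * j)" for z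
    using assms eq unfolding codes_def by metis
  show "l < length us \<Longrightarrow> [us ! i, us ! j, us ! l] \<in> rel M (Sto Pls) \<longleftrightarrow> i + j = l"
    unfolding P using eq by auto
  show "l < length us \<Longrightarrow> [us ! i, us ! j, us ! l] \<in> rel M (Sto Tms) \<longleftrightarrow> i * j = l"
    unfolding T using eq by auto
qed

lemma codes_Ord: "codes M us \<Longrightarrow> [x, us ! j] \<in> rel M (Sto Ord) \<Longrightarrow> j < length us \<Longrightarrow> \<exists>i \<le> j. x = us ! i"
  unfolding codes_def by (metis nth_eq_iff_index_eq)

lemma codes_Ord_refl: "codes M us \<Longrightarrow> [x, x] \<in> rel M (Sto Ord) \<longleftrightarrow> x \<in> set us"
  unfolding codes_def by (metis in_set_conv_nth nth_eq_iff_index_eq order_refl)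

lemma codes_Ord_mem:
  "codes M us \<Longrightarrow> [x, y] \<in> rel M (Sto Ord) \<Longrightarrow> x \<in> set us \<and> y \<in> set us"
  unfolding codes_def by fastforce

lemma codes_Pls: "codes M us \<Longrightarrow> [x, y, z] \<in> rel M (Sto Pls) \<longleftrightarrow>
    (\<exists>i j. i + j < length us \<and> x = us ! i \<and> y = us ! j \<and> z = us ! (i + j))"
  by (simp add: codes_def)

lemma codes_Tms: "codes M us \<Longrightarrow> [x, y, z] \<in> rel M (Sto Tms) \<longleftrightarrow>
    (\<exists>i j. i < length us \<and> j < length us \<and> i * j < length us \<and>
       x = us ! i \<and> y = us ! j \<and> z = us ! (i * j))"
  by (simp add: codes_def)

lemma codes_cong:
  assumes "codes M us" "univ M' = univ M" "rel M' (Sto Ord) = rel M (Sto Ord)"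
    "rel M' (Sto Pls) = rel M (Sto Pls)" "rel M' (Sto Tms) = rel M (Sto Tms)"
  shows "codes M' us"
  using assms by (simp add: codes_def)

definition leq :: "nat \<Rightarrow> nat \<Rightarrow> (('r, 'c, 'r sym) vsym, unit) formula" where
  "leq i j = at (Sto Ord) [i, j]"

definition pls :: "nat \<Rightarrow> nat \<Rightarrow> nat \<Rightarrow> (('r, 'c, 'r sym) vsym, unit) formula" where
  "pls i j l = at (Sto Pls) [i, j, l]"

definition tms :: "nat \<Rightarrow> nat \<Rightarrow> nat \<Rightarrow> (('r, 'c, 'r sym) vsym, unit) formula" where
  "tms i j l = at (Sto Tms) [i, j, l]"

definition eq :: "nat \<Rightarrow> nat \<Rightarrow> ('s, unit) formula" where
  "eq i j = Eq (Var i) (Var j)"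

lemma sat_atoms [simp]:
  "sat M \<sigma> (leq i j) \<longleftrightarrow> [\<sigma> i, \<sigma> j] \<in> rel M (Sto Ord)"
  "sat M \<sigma> (pls i j l) \<longleftrightarrow> [\<sigma> i, \<sigma> j, \<sigma> l] \<in> rel M (Sto Pls)"
  "sat M \<sigma> (tms i j l) \<longleftrightarrow> [\<sigma> i, \<sigma> j, \<sigma> l] \<in> rel M (Sto Tms)"
  "sat M \<sigma> (eq i j) \<longleftrightarrow> \<sigma> i = \<sigma> j"
  by (simp_all add: leq_def pls_def tms_def eq_def)

lemma fv_atoms [simp]:
  "free_vars (leq i j) = {i, j}" "free_vars (pls i j l) = {i, j, l}" "free_vars (tms i j l) = {i, j, l}"
  "free_vars (eq i j) = {i, j}"
  by (auto simp: leq_def pls_def tms_def eq_def)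

text \<open>\<open>sum_is_top x y\<close> says that \<open>x + y\<close> is the first number without a code.\<close>

definition sum_is_top :: "nat \<Rightarrow> nat \<Rightarrow> (('r, 'c, 'r sym) vsym, unit) formula" where
  "sum_is_top x y = fm_conjs [leq x x, leq y y, Neg (Exists 4 (pls x y 4)),
     fm_all 4 (fm_imp (Conj (leq 4 y) (Neg (eq 4 y))) (Exists 5 (pls x 4 5)))]"

text \<open>The idempotents of multiplication are 0 and 1, and 0 is the idempotent of
  addition.\<close>

definition one :: "nat \<Rightarrow> (('r, 'c, 'r sym) vsym, unit) formula" where
  "one x = Conj (tms x x x) (Neg (pls x x x))"

definition new_leq :: "(nat \<Rightarrow> (('r, 'c, 'r sym) vsym, unit) formula) \<Rightarrow>
    (('r, 'c, 'r sym) vsym, unit) formula" where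
  "new_leq sel = fm_or (leq 0 1) (Conj (sel 1) (fm_or (leq 0 0) (eq 0 1)))"

text \<open>Let z be the selected element. As the new number exceeds all old ones, it is a sum only
  as z + 0, as 0 + z, or of two old numbers. The conjunct that denies any code treats the very first
  one, which is 0 and satisfies 0 + 0 = 0.\<close>

definition new_pls :: "(nat \<Rightarrow> (('r, 'c, 'r sym) vsym, unit) formula) \<Rightarrow>
    (('r, 'c, 'r sym) vsym, unit) formula" where
  "new_pls sel = fm_or (pls 0 1 2) (Conj (sel 2) (fm_disjs
     [Conj (eq 0 2) (pls 1 1 1), Conj (eq 1 2) (pls 0 0 0),
      fm_conjs [eq 0 2, eq 1 2, Neg (Exists 4 (leq 4 4))], sum_is_top 0 1]))"

text \<open>A product of the new number with 0 has an old value; products with 1 and products of two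
  old numbers may have the new value. The universally quantified conjunct says that 0 is the only
  old number, if there is any; then the new number is 0 or 1 and equals its own square.\<close>

definition new_tms :: "(nat \<Rightarrow> (('r, 'c, 'r sym) vsym, unit) formula) \<Rightarrow>
    (('r, 'c, 'r sym) vsym, unit) formula" where
  "new_tms sel = fm_disjs
     [tms 0 1 2, fm_conjs [sel 0, pls 1 1 1, eq 1 2], fm_conjs [sel 1, pls 0 0 0, eq 0 2],
      Conj (sel 2) (fm_disjs
        [Conj (eq 0 2) (one 1), Conj (eq 1 2) (one 0),
         fm_conjs [eq 0 2, eq 1 2, fm_all 4 (fm_imp (leq 4 4) (pls 4 4 4))],
         Exists 6 (Exists 7 (Exists 8 (fm_conjs [one 7, pls 6 7 0, tms 6 1 8, sum_is_top 8 1])))])]"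

definition add_code :: "(('r, 'c, 'r sym) vsym \<Rightarrow> nat) \<Rightarrow> (nat \<Rightarrow> (('r, 'c, 'r sym) vsym, unit) formula) \<Rightarrow>
    ('r, 'c, 'r sym) vsym \<Rightarrow> (('r, 'c, 'r sym) vsym, unit) formula" where
  "add_code va sel = (ident va)(Sto Ord := new_leq sel, Sto Pls := new_pls sel, Sto Tms := new_tms sel)"

text \<open>A selector \<open>sel i\<close> defines at most one element in its only free variable \<open>i\<close>. The update formulas
  below apply selectors to the variables of the candidate tuple, of which there are at most three,
  and selectors bind other variables.\<close>

definition selects :: "('v, 's, unit) database \<Rightarrow> (nat \<Rightarrow> ('s, unit) formula) \<Rightarrow> 'v option \<Rightarrow> bool" where
  "selects M sel z \<longleftrightarrow> (\<forall>\<sigma> i. i < 4 \<longrightarrow> \<sigma> i \<in> univ M \<longrightarrow> (sat M \<sigma> (sel i) \<longleftrightarrow> z = Some (\<sigma> i)))"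

text \<open>If \<open>x + y\<close> has no code but \<open>x + y'\<close> has one for all
  \<open>y' < y\<close>, then \<open>x + y\<close> is exactly the number of codes. The case
  \<open>y = 0\<close> cannot occur, because \<open>x\<close> itself has a code.\<close>

lemma sat_sum_is_top:
  assumes c: "codes M us" and xy: "x \<notin> {4, 5}" "y \<notin> {4, 5}"
  shows "sat M \<sigma> (sum_is_top x y) \<longleftrightarrow>
    (\<exists>i j. i < length us \<and> j < length us \<and> i + j = length us \<and> \<sigma> x = us ! i \<and> \<sigma> y = us ! j)"
proof -
  have in_univ: "us ! i \<in> univ M" if "i < length us" for i
    using c that nth_mem unfolding codes_def by blast
  have ex: "(\<exists>d \<in> univ M. [us ! i, us ! j, d] \<in> rel M (Sto Pls)) \<longleftrightarrow> i + j < length us"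
    if "i < length us" "j < length us" for i j
    using codes_nth(4)[OF c that] in_univ by auto
  have all: "(\<forall>d \<in> univ M. [d, us ! j] \<in> rel M (Sto Ord) \<and> d \<noteq> us ! j \<longrightarrow>
      (\<exists>e \<in> univ M. [us ! i, d, e] \<in> rel M (Sto Pls))) \<longleftrightarrow> (\<forall>j' < j. i + j' < length us)"
    if ij: "i < length us" "j < length us" for i j
  proof
    assume *: "\<forall>d \<in> univ M. [d, us ! j] \<in> rel M (Sto Ord) \<and> d \<noteq> us ! j \<longrightarrow>
      (\<exists>e \<in> univ M. [us ! i, d, e] \<in> rel M (Sto Pls))"
    show "\<forall>j' < j. i + j' < length us"
    proof (intro allI impI)
      fix j' assume j': "j' < j"
      then have "us ! j' \<noteq> us ! j" "[us ! j', us ! j] \<in> rel M (Sto Ord)"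
        using c ij codes_nth(1)[OF c, of j' j] by (auto simp: codes_def nth_eq_iff_index_eq)
      with * in_univ[of j'] j' ij ex[of i j'] show "i + j' < length us" by auto
    qed
  next
    assume *: "\<forall>j' < j. i + j' < length us"
    show "\<forall>d \<in> univ M. [d, us ! j] \<in> rel M (Sto Ord) \<and> d \<noteq> us ! j \<longrightarrow>
      (\<exists>e \<in> univ M. [us ! i, d, e] \<in> rel M (Sto Pls))"
    proof (intro ballI impI, elim conjE)
      fix d assume "[d, us ! j] \<in> rel M (Sto Ord)" "d \<noteq> us ! j"
      then obtain j' where "j' < j" "d = us ! j'" using codes_Ord[OF c _ ij(2)] by (metis le_neq_implies_less)
      with * ij ex[of i j'] show "\<exists>e \<in> univ M. [us ! i, d, e] \<in> rel M (Sto Pls)" by auto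
    qed
  qed
  have "sat M \<sigma> (sum_is_top x y) \<longleftrightarrow> \<sigma> x \<in> set us \<and> \<sigma> y \<in> set us \<and>
      \<not> (\<exists>d \<in> univ M. [\<sigma> x, \<sigma> y, d] \<in> rel M (Sto Pls)) \<and>
      (\<forall>d \<in> univ M. [d, \<sigma> y] \<in> rel M (Sto Ord) \<and> d \<noteq> \<sigma> y \<longrightarrow>
        (\<exists>e \<in> univ M. [\<sigma> x, d, e] \<in> rel M (Sto Pls)))"
    using xy codes_Ord_refl[OF c] by (simp add: sum_is_top_def)
  also have "\<dots> \<longleftrightarrow> (\<exists>i j. i < length us \<and> j < length us \<and> \<sigma> x = us ! i \<and> \<sigma> y = us ! j \<and>
      \<not> i + j < length us \<and> (\<forall>j' < j. i + j' < length us))" (is "?A \<longleftrightarrow> ?B")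
  proof
    assume ?A
    then obtain i j where "i < length us" "j < length us" "\<sigma> x = us ! i" "\<sigma> y = us ! j"
      by (metis in_set_conv_nth)
    with \<open>?A\<close> ex[of i j] all[of i j] show ?B by metis
  next
    assume ?B
    then obtain i j where "i < length us" "j < length us" "\<sigma> x = us ! i" "\<sigma> y = us ! j"
      "\<not> i + j < length us" "\<forall>j' < j. i + j' < length us" by blast
    with ex[of i j] all[of i j] show ?A by simp
  qed
  also have "\<dots> \<longleftrightarrow> (\<exists>i j. i < length us \<and> j < length us \<and> i + j = length us \<and> \<sigma> x = us ! i \<and> \<sigma> y = us ! j)"
  proof -
    have "\<not> i + j < n \<and> (\<forall>j' < j. i + j' < n) \<longleftrightarrow> i + j = n" if "i < n" for i j n :: nat
    proof
      assume *: "\<not> i + j < n \<and> (\<forall>j' < j. i + j' < n)"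
      with that have "0 < j" by (cases j) auto
      with *[THEN conjunct2, rule_format, of "j - 1"] have "i + (j - 1) < n" by simp
      with * \<open>0 < j\<close> show "i + j = n" by linarith
    qed auto
    then show ?thesis by metis
  qed
  finally show ?thesis .
qed

lemma codes_zero: "codes M us \<Longrightarrow> [x, x, x] \<in> rel M (Sto Pls) \<longleftrightarrow> 0 < length us \<and> x = us ! 0"
proof
  assume c: "codes M us" and x: "[x, x, x] \<in> rel M (Sto Pls)"
  then obtain i j where *: "i + j < length us" "x = us ! i" "x = us ! j" "x = us ! (i + j)"
    unfolding codes_def by blast
  moreover have "distinct us" using c by (simp add: codes_def)
  ultimately have "i = i + j" "j = i + j" by (metis add_lessD1 add.commute nth_eq_iff_index_eq)+
  with * show "0 < length us \<and> x = us ! 0" by auto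
qed (use codes_nth(4)[of M us 0 0 "us ! 0"] in auto)

lemma codes_one: "codes M us \<Longrightarrow>
  [x, x, x] \<in> rel M (Sto Tms) \<and> [x, x, x] \<notin> rel M (Sto Pls) \<longleftrightarrow> 1 < length us \<and> x = us ! 1"
proof
  assume c: "codes M us" and x: "[x, x, x] \<in> rel M (Sto Tms) \<and> [x, x, x] \<notin> rel M (Sto Pls)"
  then obtain i where i: "i < length us" "x = us ! i"
    unfolding codes_def by blast
  with x codes_nth(3)[OF c i(1) i(1) i(1)] codes_zero[OF c, of x] have "i * i = i" "i \<noteq> 0" by auto
  with i show "1 < length us \<and> x = us ! 1" by auto
next
  assume c: "codes M us" and x: "1 < length us \<and> x = us ! 1"
  with codes_nth(3)[OF c, of 1 1 1] codes_nth(2)[OF c, of 1 1 1]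
  show "[x, x, x] \<in> rel M (Sto Tms) \<and> [x, x, x] \<notin> rel M (Sto Pls)" by auto
qed

lemma univ_nth: "codes M us \<Longrightarrow> i < length us \<Longrightarrow> us ! i \<in> univ M"
  using nth_mem unfolding codes_def by blast

text \<open>The defining equation \<open>x y = (x - 1) y + y\<close> expresses the products equal to the new number
  through old products and the sum formula.\<close>

lemma codes_add_code:
  assumes c: "codes M us" and sel: "selects M sel (Some z)" and z: "z \<in> univ M" "z \<notin> set us"
    and va: "va (Sto Ord) = 2" "va (Sto Pls) = 3" "va (Sto Tms) = 3"
  shows "codes (transform va (add_code va sel) M) (us @ [z])"
proof -
  let ?M = "transform va (add_code va sel) M" and ?us = "us @ [z]" and ?n = "length us"
  have d: "distinct us" "distinct ?us" using c z by (auto simp: codes_def)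
  have sub: "set ?us \<subseteq> univ M" using c z by (auto simp: codes_def)
  have nth: "?us ! i = us ! i" if "i < ?n" for i using that by (simp add: nth_append)
  have nz: "us ! i \<noteq> z" if "i < ?n" for i using z that by auto
  have mem3: "[x, y, w] \<in> tuples 3 A \<longleftrightarrow> x \<in> A \<and> y \<in> A \<and> w \<in> A" for x y w A
    by (auto simp: tuples_def)
  have ordM: "[x, y] \<in> rel M (Sto Ord) \<longleftrightarrow> (\<exists>i j. i \<le> j \<and> j < ?n \<and> x = us ! i \<and> y = us ! j)" for x y
    using c by (simp add: codes_def)
  have plsM: "[x, y, w] \<in> rel M (Sto Pls) \<longleftrightarrow>
      (\<exists>i j. i + j < ?n \<and> x = us ! i \<and> y = us ! j \<and> w = us ! (i + j))" for x y w
    using c by (simp add: codes_def)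
  have tmsM: "[x, y, w] \<in> rel M (Sto Tms) \<longleftrightarrow>
      (\<exists>i j. i < ?n \<and> j < ?n \<and> i * j < ?n \<and> x = us ! i \<and> y = us ! j \<and> w = us ! (i * j))" for x y w
    using c by (simp add: codes_def)
  have U: "add_code va sel (Sto Ord) = new_leq sel" "add_code va sel (Sto Pls) = new_pls sel"
    "add_code va sel (Sto Tms) = new_tms sel"
    by (simp_all add: add_code_def)
  have in_univ: "?us ! i \<in> univ M" if "i \<le> ?n" for i
    using sub that nth_mem[of i ?us] by (auto simp del: nth_mem)

  have "[x, y] \<in> rel ?M (Sto Ord) \<longleftrightarrow> (\<exists>i j. i \<le> j \<and> j < length ?us \<and> x = ?us ! i \<and> y = ?us ! j)" for x y
  proof -
    have "[x, y] \<in> rel ?M (Sto Ord) \<longleftrightarrow> x \<in> univ M \<and> y \<in> univ M \<and>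
        ([x, y] \<in> rel M (Sto Ord) \<or> y = z \<and> (x \<in> set us \<or> x = z))"
      using sel codes_Ord_refl[OF c]
      by (auto simp: mem_transform va U new_leq_def selects_def numeral_2_eq_2)
    also have "\<dots> \<longleftrightarrow> (\<exists>i j. i \<le> j \<and> j < ?n \<and> x = us ! i \<and> y = us ! j) \<or>
        (\<exists>i \<le> ?n. x = ?us ! i \<and> y = z)"
    proof -
      have "x \<in> set us \<or> x = z \<longleftrightarrow> (\<exists>i \<le> ?n. x = ?us ! i)"
        using in_set_conv_nth[of x ?us] by (auto simp: less_Suc_eq_le)
      moreover have "x \<in> univ M \<and> y \<in> univ M" if "[x, y] \<in> rel M (Sto Ord)"
        using codes_Ord_mem[OF c that] sub by auto
      ultimately show ?thesis unfolding ordM[symmetric] using sub by auto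
    qed
    also have "\<dots> \<longleftrightarrow> (\<exists>i j. i \<le> j \<and> j < length ?us \<and> x = ?us ! i \<and> y = ?us ! j)" (is "?A \<longleftrightarrow> ?B")
    proof
      assume ?A then show ?B
      proof (elim disjE exE conjE)
        fix i j assume "i \<le> j" "j < ?n" "x = us ! i" "y = us ! j"
        then show ?B by (intro exI[of _ i] exI[of _ j]) (simp add: nth)
      next
        fix i assume "i \<le> ?n" "x = ?us ! i" "y = z"
        then show ?B by (intro exI[of _ i] exI[of _ ?n]) simp
      qed
    next
      assume ?B
      then obtain i j where *: "i \<le> j" "j < length ?us" "x = ?us ! i" "y = ?us ! j" by blast
      show ?A
      proof (cases "j = ?n")
        case True with * show ?A by auto
      next
        case False
        with * have "j < ?n" by simp
        with * nth[of i] nth[of j] show ?A by (intro disjI1 exI[of _ i] exI[of _ j]) simp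
      qed
    qed
    finally show ?thesis .
  qed
  moreover have "[x, y, w] \<in> rel ?M (Sto Pls) \<longleftrightarrow>
      (\<exists>i j. i + j < length ?us \<and> x = ?us ! i \<and> y = ?us ! j \<and> w = ?us ! (i + j))" for x y w
  proof -
    have sit: "sat M (\<lambda>i. [x, y, w] ! i) (sum_is_top 0 1) \<longleftrightarrow>
        (\<exists>i j. i < ?n \<and> j < ?n \<and> i + j = ?n \<and> x = us ! i \<and> y = us ! j)"
      using sat_sum_is_top[OF c, of 0 1] by simp
    have "[x, y, w] \<in> rel ?M (Sto Pls) \<longleftrightarrow> x \<in> univ M \<and> y \<in> univ M \<and> w \<in> univ M \<and>
        ([x, y, w] \<in> rel M (Sto Pls) \<or> w = z \<and> (x = z \<and> [y, y, y] \<in> rel M (Sto Pls) \<or>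
          y = z \<and> [x, x, x] \<in> rel M (Sto Pls) \<or> x = z \<and> y = z \<and> us = [] \<or>
          sat M (\<lambda>i. [x, y, w] ! i) (sum_is_top 0 1)))"
    proof -
      have e: "\<not> (\<exists>d \<in> univ M. [d, d] \<in> rel M (Sto Ord)) \<longleftrightarrow> us = []"
        using codes_Ord_refl[OF c] sub by (cases us) auto
      have "w \<in> univ M \<Longrightarrow> sat M (\<lambda>i. [x, y, w] ! i) (sel 2) \<longleftrightarrow> w = z"
        using sel by (auto simp: selects_def)
      then show ?thesis
        using e by (auto simp: mem_transform va U new_pls_def mem3)
    qed
    also have "\<dots> \<longleftrightarrow> (\<exists>i j. i + j < ?n \<and> x = us ! i \<and> y = us ! j \<and> w = us ! (i + j)) \<or>
        (\<exists>i j. i + j = ?n \<and> x = ?us ! i \<and> y = ?us ! j \<and> w = z)" (is "?A \<longleftrightarrow> ?B")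
    proof
      assume ?A
      then consider (old) "[x, y, w] \<in> rel M (Sto Pls)" | (x) "w = z" "x = z" "0 < ?n" "y = us ! 0"
        | (y) "w = z" "y = z" "0 < ?n" "x = us ! 0" | (e) "w = z" "x = z" "y = z" "us = []"
        | (top) i j where "w = z" "i < ?n" "j < ?n" "i + j = ?n" "x = us ! i" "y = us ! j"
        unfolding codes_zero[OF c] sit by blast
      then show ?B
      proof cases
        case old then show ?B unfolding plsM by blast
      next
        case x then show ?B by (intro disjI2 exI[of _ ?n] exI[of _ 0]) (simp add: nth)
      next
        case y then show ?B by (intro disjI2 exI[of _ 0] exI[of _ ?n]) (simp add: nth)
      next
        case e then show ?B by (intro disjI2 exI[of _ 0] exI[of _ 0]) simp
      next
        case top then show ?B by (intro disjI2 exI[of _ i] exI[of _ j]) (simp add: nth)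
      qed
    next
      assume ?B
      then show ?A
      proof (elim disjE exE conjE)
        fix i j assume *: "i + j < ?n" "x = us ! i" "y = us ! j" "w = us ! (i + j)"
        then have "[x, y, w] \<in> rel M (Sto Pls)" unfolding plsM by blast
        moreover have "x \<in> univ M" "y \<in> univ M" "w \<in> univ M"
          using * univ_nth[OF c] by auto
        ultimately show ?A by blast
      next
        fix i j assume *: "i + j = ?n" "x = ?us ! i" "y = ?us ! j" "w = z"
        have u: "x \<in> univ M" "y \<in> univ M" "w \<in> univ M" using * in_univ[of i] in_univ[of j] z by auto
        \<comment> \<open>Unless one summand is \<open>?n\<close> and the other 0, both are old
          numbers.\<close>
        consider "us = []" | "?n > 0" "i = ?n" "j = 0" | "?n > 0" "i = 0" "j = ?n"
          | "i < ?n" "j < ?n" using *(1) by (cases "i = 0"; cases "j = 0"; auto)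
        then show ?A
        proof cases
          case 1 with * u show ?A by auto
        next
          case 2 with * u codes_zero[OF c, of y] show ?A by (auto simp: nth_append)
        next
          case 3 with * u codes_zero[OF c, of x] show ?A by (auto simp: nth_append)
        next
          case 4 with * u sit nth[of i] nth[of j] show ?A by metis
        qed
      qed
    qed
    also have "\<dots> \<longleftrightarrow> (\<exists>i j. i + j < length ?us \<and> x = ?us ! i \<and> y = ?us ! j \<and> w = ?us ! (i + j))"
      (is "?A \<longleftrightarrow> ?B")
    proof
      assume ?A then show ?B
      proof (elim disjE exE conjE)
        fix i j assume "i + j < ?n" "x = us ! i" "y = us ! j" "w = us ! (i + j)"
        then show ?B by (intro exI[of _ i] exI[of _ j]) (simp add: nth)
      next
        fix i j assume "i + j = ?n" "x = ?us ! i" "y = ?us ! j" "w = z"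
        then show ?B by (intro exI[of _ i] exI[of _ j]) simp
      qed
    next
      assume ?B
      then obtain i j where *: "i + j < length ?us" "x = ?us ! i" "y = ?us ! j" "w = ?us ! (i + j)" by blast
      show ?A
      proof (cases "i + j = ?n")
        case True with * show ?A by (intro disjI2 exI[of _ i] exI[of _ j]) simp
      next
        case False with * show ?A by (intro disjI1 exI[of _ i] exI[of _ j]) (simp add: nth)
      qed
    qed
    finally show ?thesis .
  qed
  moreover have "[x, y, w] \<in> rel ?M (Sto Tms) \<longleftrightarrow>
      (\<exists>i j. i < length ?us \<and> j < length ?us \<and> i * j < length ?us \<and>
        x = ?us ! i \<and> y = ?us ! j \<and> w = ?us ! (i * j))" for x y w
  proof -
    have prod: "sat M (\<lambda>i. [x, y, w] ! i) (Exists 6 (Exists 7 (Exists 8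
          (fm_conjs [one 7, pls 6 7 0, tms 6 1 8, sum_is_top 8 1])))) \<longleftrightarrow>
        (\<exists>i j. i < ?n \<and> j < ?n \<and> i * j = ?n \<and> x = us ! i \<and> y = us ! j)" (is "?A \<longleftrightarrow> ?B")
    proof -
      have eqA: "?A \<longleftrightarrow> (\<exists>x' \<in> univ M. \<exists>e \<in> univ M. \<exists>p \<in> univ M.
          ([e, e, e] \<in> rel M (Sto Tms) \<and> [e, e, e] \<notin> rel M (Sto Pls)) \<and>
          [x', e, x] \<in> rel M (Sto Pls) \<and> [x', y, p] \<in> rel M (Sto Tms) \<and>
          (\<exists>i j. i < ?n \<and> j < ?n \<and> i + j = ?n \<and> p = us ! i \<and> y = us ! j))"
        by (simp add: one_def sat_sum_is_top[OF c])
      show ?thesis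
      proof
      assume ?A
      then obtain x' e p where *: "[e, e, e] \<in> rel M (Sto Tms) \<and> [e, e, e] \<notin> rel M (Sto Pls)"
        "[x', e, x] \<in> rel M (Sto Pls)" "[x', y, p] \<in> rel M (Sto Tms)"
        "\<exists>i j. i < ?n \<and> j < ?n \<and> i + j = ?n \<and> p = us ! i \<and> y = us ! j"
        unfolding eqA by blast
      then have e: "1 < ?n" "e = us ! 1" unfolding codes_one[OF c] by auto
      from *(3) obtain i j where ij: "i < ?n" "j < ?n" "i * j < ?n" "x' = us ! i" "y = us ! j" "p = us ! (i * j)"
        unfolding tmsM by blast
      from *(2) ij e have x: "i + 1 < ?n" "x = us ! (i + 1)"
        using codes_nth(4)[OF c, of i 1 x] by auto
      from *(4) ij d have "i * j + j = ?n" by (metis nth_eq_iff_index_eq)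
      then have "(i + 1) * j = ?n" by simp
      with x ij show ?B by blast
    next
      assume ?B
      then obtain i j where ij: "i < ?n" "j < ?n" "i * j = ?n" "x = us ! i" "y = us ! j" by blast
      \<comment> \<open>Otherwise \<open>?n = i * j \<le> j < ?n\<close>.\<close>
      have i: "1 < i" using ij by (cases i; cases "i = 1") auto
      have j: "0 < j" using ij by (cases j) auto
      have pj: "(i - 1) * j + j = ?n" using ij i by (simp add: diff_mult_distrib)
      then have p: "(i - 1) * j < ?n" using j by linarith
      have "[us ! (i - 1), us ! 1, x] \<in> rel M (Sto Pls)"
        using codes_nth(4)[OF c, of "i - 1" 1 x] ij i by auto
      moreover have "[us ! (i - 1), y, us ! ((i - 1) * j)] \<in> rel M (Sto Tms)"
        using codes_nth(5)[OF c, of "i - 1" j] ij i p by auto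
      moreover have "[us ! 1, us ! 1, us ! 1] \<in> rel M (Sto Tms) \<and> [us ! 1, us ! 1, us ! 1] \<notin> rel M (Sto Pls)"
        using codes_one[OF c, of "us ! 1"] ij i by auto
      moreover have "\<exists>i' j'. i' < ?n \<and> j' < ?n \<and> i' + j' = ?n \<and> us ! ((i - 1) * j) = us ! i' \<and> y = us ! j'"
        using pj p ij by blast
      moreover have "us ! (i - 1) \<in> univ M" "us ! 1 \<in> univ M" "us ! ((i - 1) * j) \<in> univ M"
        using univ_nth[OF c] p i ij by auto
      ultimately show ?A unfolding eqA by blast
      qed
    qed
    have small: "(\<forall>d \<in> univ M. [d, d] \<in> rel M (Sto Ord) \<longrightarrow> [d, d, d] \<in> rel M (Sto Pls)) \<longleftrightarrow> ?n \<le> 1"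
    proof
      assume *: "\<forall>d \<in> univ M. [d, d] \<in> rel M (Sto Ord) \<longrightarrow> [d, d, d] \<in> rel M (Sto Pls)"
      show "?n \<le> 1"
      proof (rule ccontr)
        assume "\<not> ?n \<le> 1"
        then have "1 < ?n" by simp
        with * univ_nth[OF c this] codes_nth(1)[OF c this this] codes_nth(2)[OF c this this this]
        show False by simp
      qed
    next
      assume n: "?n \<le> 1"
      show "\<forall>d \<in> univ M. [d, d] \<in> rel M (Sto Ord) \<longrightarrow> [d, d, d] \<in> rel M (Sto Pls)"
        using n unfolding codes_Ord_refl[OF c] codes_zero[OF c] by (cases us) auto
    qed
    have s: "sat M (\<lambda>i. [x, y, w] ! i) (sel 0) \<longleftrightarrow> x = z" if "x \<in> univ M"
      using sel that by (auto simp: selects_def)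
    have s1: "sat M (\<lambda>i. [x, y, w] ! i) (sel 1) \<longleftrightarrow> y = z" if "y \<in> univ M"
      using sel that by (auto simp: selects_def)
    have s2: "sat M (\<lambda>i. [x, y, w] ! i) (sel 2) \<longleftrightarrow> w = z" if "w \<in> univ M"
      using sel that by (auto simp: selects_def)
    have "[x, y, w] \<in> rel ?M (Sto Tms) \<longleftrightarrow> x \<in> univ M \<and> y \<in> univ M \<and> w \<in> univ M \<and>
        ([x, y, w] \<in> rel M (Sto Tms) \<or> x = z \<and> [y, y, y] \<in> rel M (Sto Pls) \<and> y = w \<or>
          y = z \<and> [x, x, x] \<in> rel M (Sto Pls) \<and> x = w \<or>
          w = z \<and> (x = z \<and> [y, y, y] \<in> rel M (Sto Tms) \<and> [y, y, y] \<notin> rel M (Sto Pls) \<or>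
            y = z \<and> [x, x, x] \<in> rel M (Sto Tms) \<and> [x, x, x] \<notin> rel M (Sto Pls) \<or>
            x = z \<and> y = z \<and> ?n \<le> 1 \<or>
            (\<exists>i j. i < ?n \<and> j < ?n \<and> i * j = ?n \<and> x = us ! i \<and> y = us ! j)))"
    proof (cases "x \<in> univ M \<and> y \<in> univ M \<and> w \<in> univ M")
      case True
      have "sat M (\<lambda>i. [x, y, w] ! i) (fm_all 4 (fm_imp (leq 4 4) (pls 4 4 4))) \<longleftrightarrow> ?n \<le> 1"
        unfolding small[symmetric] by simp
      then have "sat M (\<lambda>i. [x, y, w] ! i) (new_tms sel) \<longleftrightarrow>
          ([x, y, w] \<in> rel M (Sto Tms) \<or> x = z \<and> [y, y, y] \<in> rel M (Sto Pls) \<and> y = w \<or>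
          y = z \<and> [x, x, x] \<in> rel M (Sto Pls) \<and> x = w \<or>
          w = z \<and> (x = w \<and> [y, y, y] \<in> rel M (Sto Tms) \<and> [y, y, y] \<notin> rel M (Sto Pls) \<or>
            y = w \<and> [x, x, x] \<in> rel M (Sto Tms) \<and> [x, x, x] \<notin> rel M (Sto Pls) \<or>
            x = w \<and> y = w \<and> ?n \<le> 1 \<or>
            (\<exists>i j. i < ?n \<and> j < ?n \<and> i * j = ?n \<and> x = us ! i \<and> y = us ! j)))"
        using s s1 s2 True unfolding new_tms_def prod[symmetric]
        by (simp add: one_def del: sat.simps(5) sat_fm_all)
      then show ?thesis using True by (auto simp: mem_transform va U mem3)
    qed (auto simp: mem_transform va mem3)
    also have "\<dots> \<longleftrightarrow> (\<exists>i j. i \<le> ?n \<and> j \<le> ?n \<and> i * j \<le> ?n \<and>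
        x = ?us ! i \<and> y = ?us ! j \<and> w = ?us ! (i * j))" (is "?A \<longleftrightarrow> ?B")
    proof
      assume ?A
      then show ?B unfolding codes_one[OF c] unfolding codes_zero[OF c]
      proof (elim conjE disjE exE)
        assume "[x, y, w] \<in> rel M (Sto Tms)"
        then obtain i j where "i < ?n" "j < ?n" "i * j < ?n" "x = us ! i" "y = us ! j" "w = us ! (i * j)"
          unfolding tmsM by blast
        then show ?B by (intro exI[of _ i] exI[of _ j]) (simp add: nth)
      next
        assume "x = z" "0 < ?n" "y = us ! 0" "y = w"
        then show ?B by (intro exI[of _ ?n] exI[of _ 0]) (simp add: nth)
      next
        assume "y = z" "0 < ?n" "x = us ! 0" "x = w"
        then show ?B by (intro exI[of _ 0] exI[of _ ?n]) (simp add: nth)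
      next
        assume "w = z" "x = z" "1 < ?n" "y = us ! 1"
        then show ?B by (intro exI[of _ ?n] exI[of _ 1]) (simp add: nth)
      next
        assume "w = z" "y = z" "1 < ?n" "x = us ! 1"
        then show ?B by (intro exI[of _ 1] exI[of _ ?n]) (simp add: nth)
      next
        assume "w = z" "x = z" "y = z" "?n \<le> 1"
        \<comment> \<open>Here \<open>?n\<close> is 0 or 1, the two numbers that equal their
          square.\<close>
        moreover from \<open>?n \<le> 1\<close> have e: "?n * ?n = ?n" by (cases "?n") auto
        moreover have "?us ! (?n * ?n) = z" by (subst e) simp
        ultimately show ?B by (intro exI[of _ ?n] exI[of _ ?n] conjI) simp_all
      next
        fix i j assume "w = z" "i < ?n" "j < ?n" "i * j = ?n" "x = us ! i" "y = us ! j"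
        then show ?B by (intro exI[of _ i] exI[of _ j]) (simp add: nth)
      qed
    next
      assume ?B
      then obtain i j where *: "i \<le> ?n" "j \<le> ?n" "i * j \<le> ?n" "x = ?us ! i" "y = ?us ! j" "w = ?us ! (i * j)"
        by blast
      have u: "x \<in> univ M" "y \<in> univ M" "w \<in> univ M" using * in_univ by auto
      consider (old) "i < ?n" "j < ?n" "i * j < ?n" | (top) "i < ?n" "j < ?n" "i * j = ?n"
        | (i) "i = ?n" "j < ?n" | (j) "j = ?n" "i < ?n" | (b) "i = ?n" "j = ?n"
        using * by linarith
      then show ?A
      proof cases
        case old
        with * have "[x, y, w] \<in> rel M (Sto Tms)" unfolding tmsM by (metis nth)
        with u show ?A by blast
      next
        case top
        with * have "\<exists>i j. i < ?n \<and> j < ?n \<and> i * j = ?n \<and> x = us ! i \<and> y = us ! j" "w = z"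
          by (metis nth, simp)
        with u show ?A by blast
      next
        case i
        \<comment> \<open>If one factor is \<open>?n > 0\<close>, a product of at most
          \<open>?n\<close> leaves only 0 and 1 for the other.\<close>
        then have "j = 0 \<or> j = 1" using * by (cases j; cases "j - 1") auto
        with i * u codes_zero[OF c, of y] codes_one[OF c, of y] show ?A by (auto simp: nth_append)
      next
        case j
        then have "i = 0 \<or> i = 1" using * by (cases i; cases "i - 1") auto
        with j * u codes_zero[OF c, of x] codes_one[OF c, of x] show ?A by (auto simp: nth_append)
      next
        case b
        then have "?n \<le> 1" using * by (cases "?n"; cases "?n - 1") auto
        then have e: "?n * ?n = ?n" by (cases "?n") auto
        have "?us ! (?n * ?n) = z" by (subst e) simp
        with b * have "x = z" "y = z" "w = z" by simp_all
        with \<open>?n \<le> 1\<close> u show ?A by blast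
      qed
    qed
    finally show ?thesis by (simp add: less_Suc_eq_le)
  qed
  ultimately show ?thesis using d sub unfolding codes_def by simp
qed

text \<open>The list of phases is the same for every change, so a phase has to be harmless when no
  new code is left to select.\<close>

lemma transform_add_code_None:
  assumes sel: "selects M sel None" and w: "wf_rels va M"
    and va: "va (Sto Ord) = 2" "va (Sto Pls) = 3" "va (Sto Tms) = 3"
  shows "rel (transform va (add_code va sel) M) Z = rel M Z"
proof -
  have s: "\<not> sat M (\<lambda>i. vs ! i) (sel j)" if "vs \<in> tuples n (univ M)" "j < n" "j < 4" for vs j n
  proof -
    have "vs ! j \<in> univ M" using that nth_mem[of j vs] unfolding tuples_def by blast
    with sel that(3) show ?thesis by (simp add: selects_def)
  qed
  have sub: "rel M Z \<subseteq> tuples (va Z) (univ M)" using w by (simp add: wf_rels_def)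
  consider "Z = Sto Ord" | "Z = Sto Pls" | "Z = Sto Tms" | "Z \<notin> {Sto Ord, Sto Pls, Sto Tms}" by blast
  then show ?thesis
  proof cases
    case 1
    have "sat M (\<lambda>i. vs ! i) (new_leq sel) \<longleftrightarrow> vs \<in> rel M (Sto Ord)" if "vs \<in> tuples 2 (univ M)" for vs
      using that s[OF that, of 1] by (auto simp: new_leq_def tuples_def numeral_2_eq_2 length_Suc_conv)
    with 1 sub va show ?thesis by (auto simp: add_code_def transform_def)
  next
    case 2
    have "sat M (\<lambda>i. vs ! i) (new_pls sel) \<longleftrightarrow> vs \<in> rel M (Sto Pls)" if "vs \<in> tuples 3 (univ M)" for vs
      using that s[OF that, of 2] by (auto simp: new_pls_def tuples_def numeral_3_eq_3 numeral_2_eq_2 length_Suc_conv)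
    with 2 sub va show ?thesis by (auto simp: add_code_def transform_def)
  next
    case 3
    have "sat M (\<lambda>i. vs ! i) (new_tms sel) \<longleftrightarrow> vs \<in> rel M (Sto Tms)" if "vs \<in> tuples 3 (univ M)" for vs
      using that s[OF that, of 0] s[OF that, of 1] s[OF that, of 2]
      by (auto simp: new_tms_def tuples_def numeral_3_eq_3 numeral_2_eq_2 length_Suc_conv)
    with 3 sub va show ?thesis by (auto simp: add_code_def transform_def)
  next
    case 4
    then show ?thesis using rel_transform_ident[OF w, of "add_code va sel" Z] by (auto simp: add_code_def)
  qed
qed

lemma rel_add_code_other:
  "wf_rels va M \<Longrightarrow> Z \<notin> {Sto Ord, Sto Pls, Sto Tms} \<Longrightarrow>
     rel (transform va (add_code va sel) M) Z = rel M Z"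
  by (rule rel_transform_ident) (auto simp: add_code_def)

text \<open>Otherwise the simplifier splits quantifiers over tagged tuples.\<close>

declare split_paired_All [simp del] split_paired_Ex [simp del]

section \<open>Numbering the activated elements\<close>

definition num :: "nat \<Rightarrow> nat \<Rightarrow> (('r, 'c, 'r sym) vsym, unit) formula" where
  "num i j = at (Sto Num) [i, j]"

lemma sat_num [simp]: "sat M \<sigma> (num i j) \<longleftrightarrow> [\<sigma> i, \<sigma> j] \<in> rel M (Sto Num)"
  and fv_num [simp]: "free_vars (num i j) = {i, j}"
  by (auto simp: num_def)

definition nums :: "(nat \<times> 'a list, ('r, 'c, 'r sym) vsym, unit) database \<Rightarrow> (nat \<times> 'a list) list \<Rightarrow>
    'a list \<Rightarrow> bool" where
  "nums M us xs \<longleftrightarrow> distinct xs \<and> length xs \<le> length us \<and> emb ` set xs \<subseteq> univ M \<and>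
     (\<forall>x v. [x, v] \<in> rel M (Sto Num) \<longleftrightarrow> (\<exists>i < length xs. x = emb (xs ! i) \<and> v = us ! i))"

lemma nums_mem: "nums M us xs \<Longrightarrow> [x, v] \<in> rel M (Sto Num) \<longleftrightarrow>
    (\<exists>i < length xs. x = emb (xs ! i) \<and> v = us ! i)"
  by (simp add: nums_def)

lemma nums_cong:
  assumes "nums M us xs" "univ M' = univ M" "rel M' (Sto Num) = rel M (Sto Num)"
  shows "nums M' us xs"
  using assms by (simp add: nums_def)

lemma nums_append: "nums M us xs \<Longrightarrow> nums M (us @ vs) xs"
  unfolding nums_def by (auto simp: nth_append)

definition free_code :: "nat \<Rightarrow> (('r, 'c, 'r sym) vsym, unit) formula" where
  "free_code v = fm_conjs [leq v v, Neg (Exists 4 (num 4 v)),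
     fm_all 5 (fm_imp (Conj (leq 5 5) (Neg (Exists 4 (num 4 5)))) (leq v 5))]"

text \<open>The conjunct that denies a number for variable 0 makes activation idempotent: an active
  element keeps its number.\<close>

definition activate :: "(('r, 'c, 'r sym) vsym \<Rightarrow> nat) \<Rightarrow> (nat \<Rightarrow> (('r, 'c, 'r sym) vsym, unit) formula) \<Rightarrow>
    ('r, 'c, 'r sym) vsym \<Rightarrow> (('r, 'c, 'r sym) vsym, unit) formula" where
  "activate va sel = (ident va)(Sto Num :=
     fm_or (num 0 1) (fm_conjs [sel 0, Neg (Exists 4 (num 0 4)), free_code 1]))"

definition snoc_new :: "'a \<Rightarrow> 'a list \<Rightarrow> 'a list" where
  "snoc_new x xs = (if x \<in> set xs then xs else xs @ [x])"

lemma set_snoc_new [simp]: "set (snoc_new x xs) = insert x (set xs)"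
  by (auto simp: snoc_new_def)

lemma nums_nth:
  assumes c: "codes M us" and n: "nums M us xs" and i: "i < length xs"
  shows "[emb (xs ! i), v] \<in> rel M (Sto Num) \<longleftrightarrow> v = us ! i"
  using n i unfolding nums_def by (metis emb_eq_iff nth_eq_iff_index_eq)

lemma nums_code:
  assumes c: "codes M us" and n: "nums M us xs" and j: "j < length us"
  shows "(\<exists>d \<in> univ M. [d, us ! j] \<in> rel M (Sto Num)) \<longleftrightarrow> j < length xs"
proof
  assume "\<exists>d \<in> univ M. [d, us ! j] \<in> rel M (Sto Num)"
  then obtain i where "i < length xs" "us ! j = us ! i" using n unfolding nums_def by blast
  moreover have "distinct us" "length xs \<le> length us" using c n by (auto simp: codes_def nums_def)
  ultimately show "j < length xs" using j by (metis less_le_trans nth_eq_iff_index_eq)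
next
  assume "j < length xs"
  then have "[emb (xs ! j), us ! j] \<in> rel M (Sto Num)" "emb (xs ! j) \<in> univ M"
    using n unfolding nums_def by auto
  then show "\<exists>d \<in> univ M. [d, us ! j] \<in> rel M (Sto Num)" by blast
qed

lemma nums_elem:
  assumes "codes M us" "nums M us xs"
  shows "(\<exists>v \<in> univ M. [emb x, v] \<in> rel M (Sto Num)) \<longleftrightarrow> x \<in> set xs"
proof
  assume "\<exists>v \<in> univ M. [emb x, v] \<in> rel M (Sto Num)"
  then show "x \<in> set xs" using assms(2) unfolding nums_def by (metis emb_eq_iff nth_mem)
next
  assume "x \<in> set xs"
  then obtain i where i: "i < length xs" "x = xs ! i" by (metis in_set_conv_nth)
  with assms have "us ! i \<in> univ M" using univ_nth[OF assms(1), of i] by (simp add: nums_def)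
  with i nums_nth[OF assms i(1)] show "\<exists>v \<in> univ M. [emb x, v] \<in> rel M (Sto Num)" by blast
qed

lemma sat_free_code:
  assumes c: "codes M us" and n: "nums M us xs" and len: "length xs < length us" and v: "v \<notin> {4, 5}"
  shows "sat M \<sigma> (free_code v) \<longleftrightarrow> \<sigma> v = us ! length xs"
proof -
  have "sat M \<sigma> (free_code v) \<longleftrightarrow> \<sigma> v \<in> set us \<and> \<not> (\<exists>d \<in> univ M. [d, \<sigma> v] \<in> rel M (Sto Num)) \<and>
      (\<forall>u \<in> univ M. u \<in> set us \<and> \<not> (\<exists>d \<in> univ M. [d, u] \<in> rel M (Sto Num)) \<longrightarrow>
        [\<sigma> v, u] \<in> rel M (Sto Ord))"
    using v codes_Ord_refl[OF c] by (simp add: free_code_def)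
  also have "\<dots> \<longleftrightarrow> \<sigma> v = us ! length xs" (is "?A \<longleftrightarrow> ?B")
  proof
    assume ?A
    then obtain j where j: "j < length us" "\<sigma> v = us ! j" by (metis in_set_conv_nth)
    with \<open>?A\<close> nums_code[OF c n j(1)] have "\<not> j < length xs" by simp
    moreover have "[\<sigma> v, us ! length xs] \<in> rel M (Sto Ord)"
      using \<open>?A\<close> nums_code[OF c n len] univ_nth[OF c len] nth_mem[OF len] by blast
    then have "j \<le> length xs" using codes_nth(1)[OF c j(1) len] j by simp
    ultimately show ?B using j by simp
  next
    assume ?B
    have 1: "[us ! length xs, u] \<in> rel M (Sto Ord)"
      if u: "u \<in> set us" "\<not> (\<exists>d \<in> univ M. [d, u] \<in> rel M (Sto Num))" for u
    proof -
      obtain j where j: "j < length us" "u = us ! j" using u(1) by (metis in_set_conv_nth)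
      with u(2) nums_code[OF c n j(1)] have "length xs \<le> j" by simp
      then show ?thesis using codes_nth(1)[OF c len j(1)] j by simp
    qed
    have 2: "us ! length xs \<in> set us" "\<not> (\<exists>d \<in> univ M. [d, us ! length xs] \<in> rel M (Sto Num))"
      using nums_code[OF c n len] nth_mem[OF len] by simp_all
    show ?A unfolding \<open>?B\<close> using 1 2 by blast
  qed
  finally show ?thesis .
qed

lemma nums_activate:
  assumes c: "codes M us" and n: "nums M us xs" and len: "length xs < length us"
    and sel: "selects M sel (Some (emb x))" and x: "emb x \<in> univ M" and va: "va (Sto Num) = 2"
  shows "nums (transform va (activate va sel) M) us (snoc_new x xs)"
proof -
  let ?M = "transform va (activate va sel) M"
  have new: "[y, v] \<in> rel ?M (Sto Num) \<longleftrightarrow> [y, v] \<in> rel M (Sto Num) \<or>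
      (y = emb x \<and> x \<notin> set xs \<and> v = us ! length xs)" for y v
  proof -
    have in_univ: "y \<in> univ M \<and> v \<in> univ M" if yv: "[y, v] \<in> rel M (Sto Num)"
    proof -
      obtain i where i: "i < length xs" "y = emb (xs ! i)" "v = us ! i"
        using yv nums_mem[OF n, of y v] by blast
      have "i < length us" "emb (xs ! i) \<in> univ M" using i(1) n nth_mem[OF i(1)] by (auto simp: nums_def)
      then show ?thesis using i univ_nth[OF c, of i] by simp
    qed
    have sel: "sat M (\<lambda>i. [y, v] ! i) (sel 0) \<longleftrightarrow> y = emb x" if "y \<in> univ M"
      using sel that by (auto simp: selects_def)
    have "[y, v] \<in> rel ?M (Sto Num) \<longleftrightarrow> y \<in> univ M \<and> v \<in> univ M \<and> ([y, v] \<in> rel M (Sto Num) \<or>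
        (sat M (\<lambda>i. [y, v] ! i) (sel 0) \<and> \<not> (\<exists>d \<in> univ M. [y, d] \<in> rel M (Sto Num)) \<and>
          v = us ! length xs))"
    proof -
      have fc: "sat M (\<lambda>i. [y, v] ! i) (free_code 1) \<longleftrightarrow> v = us ! length xs"
        using sat_free_code[OF c n len, of 1 "\<lambda>i. [y, v] ! i"] by simp
      show ?thesis by (simp add: mem_transform va activate_def numeral_2_eq_2 fc[unfolded One_nat_def])
    qed
    also have "\<dots> \<longleftrightarrow> [y, v] \<in> rel M (Sto Num) \<or> (y = emb x \<and> x \<notin> set xs \<and> v = us ! length xs)"
      using in_univ sel x nums_elem[OF c n, of x] univ_nth[OF c len] by blast
    finally show ?thesis .
  qed
  show ?thesis
  proof (cases "x \<in> set xs")
    case True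
    then show ?thesis using n new by (simp add: nums_def snoc_new_def)
  next
    case False
    have "[y, v] \<in> rel ?M (Sto Num) \<longleftrightarrow>
        (\<exists>i < length (xs @ [x]). y = emb ((xs @ [x]) ! i) \<and> v = us ! i)" for y v
    proof -
      have "(\<exists>i < length (xs @ [x]). y = emb ((xs @ [x]) ! i) \<and> v = us ! i) \<longleftrightarrow>
          (\<exists>i < length xs. y = emb (xs ! i) \<and> v = us ! i) \<or> (y = emb x \<and> v = us ! length xs)"
      proof -
        have "(\<exists>i < Suc n. R i) \<longleftrightarrow> (\<exists>i < n. R i) \<or> R n" for n and R :: "nat \<Rightarrow> bool"
          by (auto simp: less_Suc_eq)
        then show ?thesis by (simp add: nth_append cong: conj_cong)
      qed
      then show ?thesis using False unfolding new nums_mem[OF n] by blast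
    qed
    moreover have "distinct (xs @ [x])" "length (xs @ [x]) \<le> length us" "emb ` set (xs @ [x]) \<subseteq> univ ?M"
      using False n len x by (simp_all add: nums_def)
    ultimately show ?thesis using False unfolding nums_def snoc_new_def by simp
  qed
qed

lemma rel_activate_other:
  "wf_rels va M \<Longrightarrow> Z \<noteq> Sto Num \<Longrightarrow> rel (transform va (activate va sel) M) Z = rel M Z"
  by (rule rel_transform_ident) (auto simp: activate_def)

section \<open>Lexicographically least tuples of codes\<close>

text \<open>\<open>defines_tuples M us K \<sigma>\<^sub>0 m Q X\<close>: the formula \<open>Q b f\<close> defines, in the variables \<open>b, \<dots>, b + m - 1\<close>, the set
  of tuples of codes whose tuples of numbers form \<open>X\<close>; it may use the parameters \<open>0, \<dots>, K - 1\<close>, and it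
  binds only variables from \<open>f\<close> on.\<close>

definition defines_tuples :: "('v, 's, unit) database \<Rightarrow> 'v list \<Rightarrow> nat \<Rightarrow> (nat \<Rightarrow> 'v) \<Rightarrow> nat \<Rightarrow>
    (nat \<Rightarrow> nat \<Rightarrow> ('s, unit) formula) \<Rightarrow> nat list set \<Rightarrow> bool" where
  "defines_tuples M us K \<sigma>\<^sub>0 m Q X \<longleftrightarrow> (\<forall>\<sigma> b f. (\<forall>i<K. \<sigma> i = \<sigma>\<^sub>0 i) \<and> K \<le> b \<and> b + m \<le> f \<and>
     (\<forall>i \<in> {b..<b + m}. \<sigma> i \<in> univ M) \<longrightarrow>
     (sat M \<sigma> (Q b f) \<longleftrightarrow> (\<exists>is \<in> X. map \<sigma> [b..<b + m] = map (\<lambda>i. us ! i) is)))"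

fun lex_less :: "nat \<Rightarrow> nat \<Rightarrow> nat \<Rightarrow> (('r, 'c, 'r sym) vsym, unit) formula" where
  "lex_less 0 y z = Neg fm_true"
| "lex_less (Suc m) y z = fm_or (Conj (leq y z) (Neg (eq y z))) (Conj (eq y z) (lex_less m (Suc y) (Suc z)))"

lemma sat_lex_less:
  assumes c: "codes M us"
    and "is \<in> tuples m {..<length us}" "js \<in> tuples m {..<length us}"
    and "map \<sigma> [y..<y + m] = map (\<lambda>i. us ! i) is" "map \<sigma> [z..<z + m] = map (\<lambda>i. us ! i) js"
  shows "sat M \<sigma> (lex_less m y z) \<longleftrightarrow> is < js"
  using assms(2-)
proof (induction m arbitrary: "is" js y z)
  case 0
  then show ?case by (simp add: tuples_def)
next
  case (Suc m)
  obtain i is' where i: "is = i # is'" using Suc.prems(1) by (cases "is") auto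
  obtain j js' where j: "js = j # js'" using Suc.prems(2) by (cases js) auto
  have up: "[x..<x + Suc m] = x # [Suc x..<Suc x + m]" for x
    using upt_conv_Cons[of x "x + Suc m"] by simp
  have y: "\<sigma> y = us ! i" "map \<sigma> [Suc y..<Suc y + m] = map (\<lambda>i. us ! i) is'"
    using Suc.prems(3) unfolding up i by (simp_all del: upt_Suc)
  have z: "\<sigma> z = us ! j" "map \<sigma> [Suc z..<Suc z + m] = map (\<lambda>i. us ! i) js'"
    using Suc.prems(4) unfolding up j by (simp_all del: upt_Suc)
  have ij: "\<sigma> y = us ! i" "\<sigma> z = us ! j" "i < length us" "j < length us"
    using Suc.prems(1,2) y z by (auto simp: i j)
  have "us ! i = us ! j \<longleftrightarrow> i = j" using c ij by (simp add: codes_def nth_eq_iff_index_eq)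
  moreover have "sat M \<sigma> (lex_less m (Suc y) (Suc z)) \<longleftrightarrow> is' < js'"
    by (rule Suc.IH) (use Suc.prems(1,2) y z in \<open>simp_all add: i j del: upt_Suc\<close>)
  ultimately show ?case
    using codes_nth(1)[OF c ij(3,4)] by (auto simp: i j ij)
qed

text \<open>A definable choice. To insert a single tuple, a formula has to single one out, and the
  order on the codes makes this possible.\<close>

definition lex_min :: "nat \<Rightarrow> (nat \<Rightarrow> nat \<Rightarrow> (('r, 'c, 'r sym) vsym, unit) formula) \<Rightarrow> nat \<Rightarrow> nat \<Rightarrow>
    (('r, 'c, 'r sym) vsym, unit) formula" where
  "lex_min m Q b f = Conj (Q b f) (Neg (fm_exs f m (Conj (Q f (f + m)) (lex_less m f b))))"

lemma map_nth_eq_iff: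
  assumes "distinct us" "is \<in> tuples m {..<length us}" "js \<in> tuples m {..<length us}"
  shows "map (\<lambda>i. us ! i) is = map (\<lambda>i. us ! i) js \<longleftrightarrow> is = js"
proof
  have "inj_on (\<lambda>i. us ! i) (set is \<union> set js)"
    using assms by (auto simp: inj_on_def tuples_def nth_eq_iff_index_eq subset_iff)
  then show "map (\<lambda>i. us ! i) is = map (\<lambda>i. us ! i) js \<Longrightarrow> is = js" using map_inj_on by blast
qed simp

text \<open>Tuples of codes compare like the tuples of their numbers, and in a finite nonempty set
  only \<open>Min\<close> has nothing below it. The competitor is quantified in the variables from
  \<open>f\<close> on, clear of the candidate at \<open>b\<close>.\<close>

lemma defines_tuples_lex_min:
  assumes c: "codes M us" and Q: "defines_tuples M us K \<sigma>\<^sub>0 m Q X" and X: "X \<subseteq> tuples m {..<length us}"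
  shows "defines_tuples M us K \<sigma>\<^sub>0 m (lex_min m Q) (if X = {} then {} else {Min X})"
  unfolding defines_tuples_def
proof (intro allI impI; elim conjE)
  fix \<sigma> b f
  assume \<sigma>: "\<forall>i<K. \<sigma> i = \<sigma>\<^sub>0 i" "K \<le> b" "b + m \<le> f" and b: "\<forall>i \<in> {b..<b + m}. \<sigma> i \<in> univ M"
  have fin: "finite X"
    using X finite_lists_length_eq[of "{..<length us}" m]
    by (auto simp: tuples_def conj_commute elim: finite_subset)
  have d: "distinct us" using c by (simp add: codes_def)
  have Qb: "sat M \<sigma> (Q b f) \<longleftrightarrow> (\<exists>is \<in> X. map \<sigma> [b..<b + m] = map (\<lambda>i. us ! i) is)"
    using Q \<sigma> b unfolding defines_tuples_def by blast
  have ex: "sat M \<sigma> (fm_exs f m (Conj (Q f (f + m)) (lex_less m f b))) \<longleftrightarrow> (\<exists>js \<in> X. js < is)"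
    if "is": "is \<in> X" "map \<sigma> [b..<b + m] = map (\<lambda>i. us ! i) is" for "is"
  proof -
    have *: "sat M (upds \<sigma> f ds) (Q f (f + m)) \<longleftrightarrow> (\<exists>js \<in> X. ds = map (\<lambda>i. us ! i) js)"
      if ds: "ds \<in> tuples m (univ M)" for ds
    proof -
      have "upds \<sigma> f ds i \<in> univ M" if "i \<in> {f..<f + m}" for i
      proof -
        have "i - f < length ds" "set ds \<subseteq> univ M" using that ds by (auto simp: tuples_def)
        then show ?thesis using that by (auto simp: upds_def)
      qed
      then have "sat M (upds \<sigma> f ds) (Q f (f + m)) \<longleftrightarrow>
          (\<exists>is \<in> X. map (upds \<sigma> f ds) [f..<f + m] = map (\<lambda>i. us ! i) is)"
        using Q[unfolded defines_tuples_def, rule_format, of "upds \<sigma> f ds" f "f + m"] \<sigma> by simp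
      then show ?thesis using map_upds[of m ds \<sigma> f] ds by (simp add: tuples_def)
    qed
    have lex: "sat M (upds \<sigma> f (map (\<lambda>i. us ! i) js)) (lex_less m f b) \<longleftrightarrow> js < is" if js: "js \<in> X" for js
    proof (rule sat_lex_less[OF c])
      have "length js = m" using X js by (auto simp: tuples_def)
      then show "map (upds \<sigma> f (map (\<lambda>i. us ! i) js)) [f..<f + m] = map (\<lambda>i. us ! i) js"
        using map_upds[of m "map (\<lambda>i. us ! i) js" \<sigma> f] by simp
      show "map (upds \<sigma> f (map (\<lambda>i. us ! i) js)) [b..<b + m] = map (\<lambda>i. us ! i) is"
        using "is"(2) \<sigma>(3) by (subst map_upds_less) auto
    qed (use X js "is" in auto)
    have "map (\<lambda>i. us ! i) js \<in> tuples m (univ M)" if "js \<in> X" for js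
      using X that univ_nth[OF c] by (fastforce simp: tuples_def)
    then show ?thesis using * lex by auto
  qed
  show "sat M \<sigma> (lex_min m Q b f) \<longleftrightarrow>
      (\<exists>is \<in> if X = {} then {} else {Min X}. map \<sigma> [b..<b + m] = map (\<lambda>i. us ! i) is)"
  proof (cases "X = {}")
    case True then show ?thesis using Qb by (simp add: lex_min_def)
  next
    case False
    have "sat M \<sigma> (lex_min m Q b f) \<longleftrightarrow>
        (\<exists>is \<in> X. map \<sigma> [b..<b + m] = map (\<lambda>i. us ! i) is \<and> \<not> (\<exists>js \<in> X. js < is))"
      using Qb ex by (auto simp: lex_min_def)
    also have "\<dots> \<longleftrightarrow> map \<sigma> [b..<b + m] = map (\<lambda>i. us ! i) (Min X)" (is "?A \<longleftrightarrow> ?B")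
    proof
      assume ?A
      then obtain "is" where "is": "is \<in> X" "map \<sigma> [b..<b + m] = map (\<lambda>i. us ! i) is" "\<not> (\<exists>js \<in> X. js < is)"
        by blast
      then have "Min X = is" using fin by (intro Min_eqI) (auto simp: not_less)
      with "is" show ?B by simp
    next
      assume ?B
      moreover have "Min X \<in> X" "\<not> (\<exists>js \<in> X. js < Min X)" using fin False by (auto simp: not_less)
      ultimately show ?A by blast
    qed
    finally show ?thesis using False by simp
  qed
qed

section \<open>Threads\<close>

text \<open>The lists \<open>cl\<close> and \<open>Rl\<close> enumerate the constants and the input
  relations, so that formulas can run through them. The numbers \<open>c\<close> and
  \<open>B\<close> stay open until the counting argument fixes them.\<close>

locale threads =
  fixes \<tau> :: "('r, 'c) schema" and P :: "('r, 'c) dyn_program" and L Pl Ti c B k :: nat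
    and cl :: "'c list" and Rl :: "'r list"
  assumes P: "is_program \<tau> k P" and fin: "finite_schema \<tau>"
    and arith: "{L, Pl, Ti} \<subseteq> aux_syms P" "distinct [L, Pl, Ti]"
      "aux_arity P L = 2" "aux_arity P Pl = 3" "aux_arity P Ti = 3"
    and cl: "set cl = con_syms \<tau>" and Rl: "set Rl = rel_syms \<tau>" and c: "0 < c"
begin

fun sar :: "'r sym \<Rightarrow> nat" where
  "sar Ord = 2" | "sar Pls = 3" | "sar Tms = 3" | "sar Num = 2" | "sar Born = 1" | "sar Ans = k"
| "sar (TIn R) = Suc (arity \<tau> R)" | "sar (TAux S) = Suc (aux_arity P S)"

definition St :: "'r sym set" where
  "St = {Ord, Pls, Tms, Num, Born, Ans} \<union> TIn ` rel_syms \<tau> \<union> TAux ` aux_syms P"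

abbreviation va :: "('r, 'c, 'r sym) vsym \<Rightarrow> nat" where
  "va \<equiv> tuple_program.varity \<tau> sar"

declare tuple_program.varity.simps [simp]

text \<open>Arithmetic truncated at \<open>w\<close>, as \<open>order_rel\<close>,
  \<open>plus_rel\<close> and \<open>times_rel\<close> give it for an order with
  \<open>w + 1\<close> elements. The separate bounds on the factors matter for products with
  0.\<close>

definition arith_aux :: "nat \<Rightarrow> nat \<Rightarrow> nat relation" where
  "arith_aux w S = (if S = L then {[i, j] |i j. i \<le> j \<and> j \<le> w}
     else if S = Pl then {[i, j, i + j] |i j. i + j \<le> w}
     else if S = Ti then {[i, j, i * j] |i j. i \<le> w \<and> j \<le> w \<and> i * j \<le> w} else {})"

definition init_state :: "nat \<Rightarrow> ('c \<Rightarrow> nat option) \<Rightarrow> (nat, 'r, 'c) state" where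
  "init_state w \<kappa> = (\<lparr>univ = {..w}, rel = \<lambda>_. {}, con = \<kappa>\<rparr>, arith_aux w)"

text \<open>Thread \<open>w\<close> simulates the program on the domain \<open>{..w}\<close>; its relations are the sections of the
  stored ones at the code of \<open>w\<close>.\<close>

definition thread :: "('v, ('r, 'c, 'r sym) vsym, unit) database \<Rightarrow> 'v list \<Rightarrow> nat \<Rightarrow>
    (nat, 'r, 'c) state \<Rightarrow> bool" where
  "thread M us w s \<longleftrightarrow>
     (\<forall>R \<in> rel_syms \<tau>. {vs. us ! w # vs \<in> rel M (Sto (TIn R))} = map (\<lambda>i. us ! i) ` rel (fst s) R) \<and>
     (\<forall>S \<in> aux_syms P. {vs. us ! w # vs \<in> rel M (Sto (TAux S))} = map (\<lambda>i. us ! i) ` snd s S)"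

lemma thread_TIn: "thread M us w s \<Longrightarrow> R \<in> rel_syms \<tau> \<Longrightarrow>
    us ! w # vs \<in> rel M (Sto (TIn R)) \<longleftrightarrow> vs \<in> map (\<lambda>i. us ! i) ` rel (fst s) R"
  unfolding thread_def by blast

lemma thread_TAux: "thread M us w s \<Longrightarrow> S \<in> aux_syms P \<Longrightarrow>
    us ! w # vs \<in> rel M (Sto (TAux S)) \<longleftrightarrow> vs \<in> map (\<lambda>i. us ! i) ` snd s S"
  unfolding thread_def by blast

lemma thread_cong:
  assumes "thread M us w s" "\<And>R. R \<in> rel_syms \<tau> \<Longrightarrow> rel M' (Sto (TIn R)) = rel M (Sto (TIn R))"
    "\<And>S. S \<in> aux_syms P \<Longrightarrow> rel M' (Sto (TAux S)) = rel M (Sto (TAux S))"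
  shows "thread M' us w s"
  using assms by (simp add: thread_def)

lemma valid_init_state:
  assumes "dom \<kappa> = con_syms \<tau>" "ran \<kappa> \<subseteq> {..w}"
  shows "valid_state \<tau> P (init_state w \<kappa>)"
  using assms arith by (auto simp: valid_state_def init_state_def is_database_def arith_aux_def)

subsection \<open>Starting threads\<close>

definition start_aux :: "nat \<Rightarrow> (('r, 'c, 'r sym) vsym, unit) formula" where
  "start_aux S = (if S = L then Conj (leq 1 2) (leq 2 0)
     else if S = Pl then fm_conjs [pls 1 2 3, leq 3 0]
     else if S = Ti then fm_conjs [tms 1 2 3, leq 1 0, leq 2 0, leq 3 0] else Neg fm_true)"

text \<open>The formulas read the old \<open>Born\<close>, so in the phase that marks all codes as
  born, exactly the codes that were not born yet receive an initial state.\<close>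

definition start :: "('r, 'c, 'r sym) vsym \<Rightarrow> (('r, 'c, 'r sym) vsym, unit) formula" where
  "start Z = (case Z of
       Sto Born \<Rightarrow> leq 0 0
     | Sto (TIn R) \<Rightarrow> Conj (at (Sto Born) [0]) (ident va Z)
     | Sto (TAux S) \<Rightarrow> fm_or (Conj (at (Sto Born) [0]) (ident va Z))
         (Conj (Neg (at (Sto Born) [0])) (start_aux S))
     | _ \<Rightarrow> ident va Z)"

lemma sat_ident: "vs \<in> tuples (ar Z) A \<Longrightarrow> sat M (\<lambda>i. vs ! i) (ident ar Z) \<longleftrightarrow> vs \<in> rel M Z"
  using map_nth[of vs] by (simp add: ident_def tuples_def)

lemma rel_start_other:
  "wf_rels va M \<Longrightarrow> (\<And>R. Z \<noteq> Sto (TIn R)) \<Longrightarrow> (\<And>S. Z \<noteq> Sto (TAux S)) \<Longrightarrow> Z \<noteq> Sto Born \<Longrightarrow>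
     rel (transform va start M) Z = rel M Z"
  by (rule rel_transform_ident) (auto simp: start_def split: vsym.split sym.split)

lemma rel_start_Born:
  assumes "codes M us"
  shows "rel (transform va start M) (Sto Born) = {[u] |u. u \<in> set us}"
proof -
  have "set us \<subseteq> univ M" using assms by (simp add: codes_def)
  then show ?thesis
    using codes_Ord_refl[OF assms]
    by (auto simp: transform_def start_def tuples_def length_Suc_conv)
qed

lemma thread_start_old:
  assumes w: "wf_rels va M" and b: "[us ! w] \<in> rel M (Sto Born)" and t: "thread M us w s"
  shows "thread (transform va start M) us w s"
proof -
  have "us ! w # vs \<in> rel (transform va start M) Z \<longleftrightarrow> us ! w # vs \<in> rel M Z"
    if "Z = Sto (TIn R) \<or> Z = Sto (TAux S)" for Z vs R S
  proof -
    have "sat M (\<lambda>i. (us ! w # vs) ! i) (start Z) \<longleftrightarrow> us ! w # vs \<in> rel M Z"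
      if "us ! w # vs \<in> tuples (va Z) (univ M)"
      using \<open>Z = _ \<or> _\<close> b sat_ident[of "us ! w # vs" va Z "univ M" M] that by (auto simp: start_def)
    moreover have "rel M Z \<subseteq> tuples (va Z) (univ M)" using w by (simp add: wf_rels_def)
    ultimately show ?thesis unfolding mem_transform by blast
  qed
  then show ?thesis using t unfolding thread_def by simp
qed

text \<open>A thread stores no interpretation of its constants: \<open>sim\<close> recovers it from
  \<open>Num\<close> and the actual constants. So at this point \<open>\<kappa>\<close> can still be
  chosen freely.\<close>

lemma thread_start_new:
  assumes c: "codes M us" and b: "[us ! w] \<notin> rel M (Sto Born)" and w: "w < length us"
  shows "thread (transform va start M) us w (init_state w \<kappa>)"
proof -
  have "us ! w # vs \<notin> rel (transform va start M) (Sto (TIn R))" for vs R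
    using b by (simp add: mem_transform start_def)
  moreover have "us ! w # vs \<in> rel (transform va start M) (Sto (TAux S)) \<longleftrightarrow>
      vs \<in> map (\<lambda>i. us ! i) ` arith_aux w S" if S: "S \<in> aux_syms P" for vs S
  proof -
    have u: "us ! i \<in> univ M" if "i \<le> w" for i using univ_nth[OF c, of i] that w by simp
    have Ord: "[x, us ! w] \<in> rel M (Sto Ord) \<longleftrightarrow> (\<exists>i \<le> w. x = us ! i)" for x
      using codes_Ord[OF c _ w, of x] codes_nth(1)[OF c _ w] w by (auto intro: le_less_trans)
    have eq: "us ! w # vs \<in> rel (transform va start M) (Sto (TAux S)) \<longleftrightarrow>
        us ! w # vs \<in> tuples (Suc (aux_arity P S)) (univ M) \<and>
        sat M (\<lambda>i. (us ! w # vs) ! i) (start_aux S)"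
      using b by (simp add: mem_transform start_def)
    consider "S = L" | "S = Pl" | "S = Ti" | "S \<notin> {L, Pl, Ti}" by blast
    then show ?thesis
    proof cases
      case 1
      have "us ! w # vs \<in> rel (transform va start M) (Sto (TAux S)) \<longleftrightarrow>
          (\<exists>x y. vs = [x, y] \<and> x \<in> univ M \<and> y \<in> univ M \<and> [x, y] \<in> rel M (Sto Ord) \<and>
            [y, us ! w] \<in> rel M (Sto Ord))"
        unfolding eq using 1 arith u[of w]
        by (auto simp: start_aux_def tuples_def numeral_2_eq_2 length_Suc_conv)
      also have "\<dots> \<longleftrightarrow> (\<exists>i j. i \<le> j \<and> j \<le> w \<and> vs = [us ! i, us ! j])" (is "?A \<longleftrightarrow> ?B")
      proof
        assume ?A
        then obtain x y where xy: "vs = [x, y]" "[x, y] \<in> rel M (Sto Ord)" "[y, us ! w] \<in> rel M (Sto Ord)"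
          by blast
        obtain j where "j \<le> w" "y = us ! j" using xy(3)[unfolded Ord] by blast
        with xy have j: "vs = [x, us ! j]" "j \<le> w" "[x, us ! j] \<in> rel M (Sto Ord)" by simp_all
        with w codes_Ord[OF c j(3)] show ?B by auto
      next
        assume ?B
        then obtain i j where "i \<le> j" "j \<le> w" "vs = [us ! i, us ! j]" by blast
        with u[of i] u[of j] codes_nth(1)[OF c, of i j] w Ord show ?A by auto
      qed
      also have "\<dots> \<longleftrightarrow> vs \<in> map (\<lambda>i. us ! i) ` arith_aux w S"
        using 1 by (force simp: arith_aux_def)
      finally show ?thesis .
    next
      case 2
      have "us ! w # vs \<in> rel (transform va start M) (Sto (TAux S)) \<longleftrightarrow>
          (\<exists>x y z. vs = [x, y, z] \<and> x \<in> univ M \<and> y \<in> univ M \<and> z \<in> univ M \<and>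
            [x, y, z] \<in> rel M (Sto Pls) \<and> [z, us ! w] \<in> rel M (Sto Ord))"
        unfolding eq using 2 arith u[of w]
        by (auto simp: start_aux_def tuples_def numeral_3_eq_3 numeral_2_eq_2 length_Suc_conv)
      also have "\<dots> \<longleftrightarrow> (\<exists>i j. i + j \<le> w \<and> vs = [us ! i, us ! j, us ! (i + j)])" (is "?A \<longleftrightarrow> ?B")
      proof
        assume ?A
        then obtain x y z where xyz: "vs = [x, y, z]" "[x, y, z] \<in> rel M (Sto Pls)"
            "[z, us ! w] \<in> rel M (Sto Ord)" by blast
        obtain i j where "i + j < length us" "x = us ! i" "y = us ! j" "z = us ! (i + j)"
          using xyz(2) unfolding codes_Pls[OF c] by blast
        with xyz have ij: "i + j < length us" "vs = [us ! i, us ! j, us ! (i + j)]"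
            "[us ! (i + j), us ! w] \<in> rel M (Sto Ord)" by simp_all
        with codes_nth(1)[OF c ij(1) w] show ?B by blast
      next
        assume ?B
        then obtain i j where ij: "i + j \<le> w" "vs = [us ! i, us ! j, us ! (i + j)]" by blast
        then show ?A
          using u[of i] u[of j] u[of "i + j"] codes_nth(4)[OF c, of i j] w Ord by auto
      qed
      also have "\<dots> \<longleftrightarrow> vs \<in> map (\<lambda>i. us ! i) ` arith_aux w S"
        using 2 arith(2) by (force simp: arith_aux_def)
      finally show ?thesis .
    next
      case 3
      have "us ! w # vs \<in> rel (transform va start M) (Sto (TAux S)) \<longleftrightarrow>
          (\<exists>x y z. vs = [x, y, z] \<and> x \<in> univ M \<and> y \<in> univ M \<and> z \<in> univ M \<and>
            [x, y, z] \<in> rel M (Sto Tms) \<and> [x, us ! w] \<in> rel M (Sto Ord) \<and>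
            [y, us ! w] \<in> rel M (Sto Ord) \<and> [z, us ! w] \<in> rel M (Sto Ord))"
        unfolding eq using 3 arith u[of w]
        by (auto simp: start_aux_def tuples_def numeral_3_eq_3 numeral_2_eq_2 length_Suc_conv)
      also have "\<dots> \<longleftrightarrow> (\<exists>i j. i \<le> w \<and> j \<le> w \<and> i * j \<le> w \<and> vs = [us ! i, us ! j, us ! (i * j)])"
        (is "?A \<longleftrightarrow> ?B")
      proof
        assume ?A
        then obtain x y z where xyz: "vs = [x, y, z]" "[x, y, z] \<in> rel M (Sto Tms)"
            "[x, us ! w] \<in> rel M (Sto Ord)" "[y, us ! w] \<in> rel M (Sto Ord)"
            "[z, us ! w] \<in> rel M (Sto Ord)" by blast
        obtain i j where "i < length us" "j < length us" "i * j < length us" "x = us ! i" "y = us ! j"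
            "z = us ! (i * j)"
          using xyz(2) unfolding codes_Tms[OF c] by blast
        with xyz have ij: "i < length us" "j < length us" "i * j < length us"
            "vs = [us ! i, us ! j, us ! (i * j)]" "[us ! i, us ! w] \<in> rel M (Sto Ord)"
            "[us ! j, us ! w] \<in> rel M (Sto Ord)" "[us ! (i * j), us ! w] \<in> rel M (Sto Ord)" by simp_all
        with codes_nth(1)[OF c ij(1) w] codes_nth(1)[OF c ij(2) w] codes_nth(1)[OF c ij(3) w]
        show ?B by blast
      next
        assume ?B
        then obtain i j where ij: "i \<le> w" "j \<le> w" "i * j \<le> w" "vs = [us ! i, us ! j, us ! (i * j)]"
          by blast
        then show ?A
          using u[of i] u[of j] u[of "i * j"] codes_nth(5)[OF c, of i j] w Ord by auto
      qed
      also have "\<dots> \<longleftrightarrow> vs \<in> map (\<lambda>i. us ! i) ` arith_aux w S"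
        using 3 arith(2) by (force simp: arith_aux_def)
      finally show ?thesis .
    next
      case 4
      then show ?thesis unfolding eq by (simp add: start_aux_def arith_aux_def)
    qed
  qed
  ultimately show ?thesis by (auto simp: thread_def init_state_def)
qed

subsection \<open>Simulating a step of the program in all threads\<close>

definition con_index :: "'c \<Rightarrow> nat" where
  "con_index d = (LEAST i. i < length cl \<and> cl ! i = d)"

lemma con_index:
  assumes "d \<in> con_syms \<tau>"
  shows "con_index d < length cl \<and> cl ! con_index d = d"
proof -
  have "d \<in> set cl" using assms cl by simp
  then obtain i where "i < length cl \<and> cl ! i = d" by (auto simp: in_set_conv_nth)
  then show ?thesis unfolding con_index_def by (rule LeastI)
qed

fun thread_atom :: "'r + nat \<Rightarrow> nat \<Rightarrow> block list \<Rightarrow> (('r, 'c, 'r sym) vsym, unit) formula" where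
  "thread_atom (Inl R) N bs = at (Sto (TIn R)) (0 # map (\<lambda>b. hd (snd b)) bs)"
| "thread_atom (Inr S) N bs = at (Sto (TAux S)) (0 # map (\<lambda>b. hd (snd b)) bs)"

text \<open>The update formula of the simulated program, relativized to the codes up to variable 0,
  which holds the code of the thread. The changed tuple sits in the variables from \<open>b\<close>
  on, the candidate in those from 1 on, the codes of the constants in those from \<open>kb\<close>
  on; variables from \<open>f\<close> on may be bound.\<close>

definition sim :: "'r change_type \<Rightarrow> nat \<Rightarrow> nat \<Rightarrow> nat \<Rightarrow> nat \<Rightarrow> (('r, 'c, 'r sym) vsym, unit) formula" where
  "sim \<delta> S b kb f = interp 1 (\<lambda>_. 1) (\<lambda>_ is. leq (hd is) 0) thread_atom (\<lambda>d. (0, [kb + con_index d])) f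
     (\<lambda>i. (0, [if i < arity \<tau> (changed_rel \<delta>) then b + i else Suc (i - arity \<tau> (changed_rel \<delta>))]))
     (upd P \<delta> S)"

text \<open>The codes that play the constants have no names in the structure, so they are guessed
  and compared with the numbers of the actual constants.\<close>

definition con_codes :: "nat \<Rightarrow> nat \<Rightarrow> (('r, 'c, 'r sym) vsym, unit) formula" where
  "con_codes kb f = fm_conjs (map (\<lambda>i. Exists f (Conj (at (Cst (cl ! i)) [f]) (num f (kb + i))))
     [0..<length cl])"

text \<open>The changed tuple is guessed and checked by \<open>Q\<close>, so that each thread can
  simulate a change of its own; if \<open>Q\<close> selects nothing, the relation stays as it is.
  The conjuncts \<open>leq (Suc j) 0\<close> confine the candidate to the domain of the
  thread.\<close>

definition step_aux :: "'r change_type \<Rightarrow> (nat \<Rightarrow> nat \<Rightarrow> (('r, 'c, 'r sym) vsym, unit) formula) \<Rightarrow>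
    nat \<Rightarrow> (('r, 'c, 'r sym) vsym, unit) formula" where
  "step_aux \<delta> Q S = (let n = aux_arity P S; m = arity \<tau> (changed_rel \<delta>); b = Suc n; kb = b + m;
       f = kb + length cl in
     fm_or (fm_exs b m (fm_conjs (Q b kb # map (\<lambda>j. leq (Suc j) 0) [0..<n] @
         [fm_exs kb (length cl) (Conj (con_codes kb f) (sim \<delta> S b kb f))])))
       (Conj (Neg (fm_exs b m (Q b kb))) (ident va (Sto (TAux S)))))"

definition step_in :: "'r change_type \<Rightarrow> (nat \<Rightarrow> nat \<Rightarrow> (('r, 'c, 'r sym) vsym, unit) formula) \<Rightarrow>
    'r \<Rightarrow> (('r, 'c, 'r sym) vsym, unit) formula" where
  "step_in \<delta> Q R = (if R = changed_rel \<delta> then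
     (case \<delta> of Ins _ \<Rightarrow> fm_or (ident va (Sto (TIn R))) (Q 1 (Suc (arity \<tau> R)))
              | Del _ \<Rightarrow> Conj (ident va (Sto (TIn R))) (Neg (Q 1 (Suc (arity \<tau> R)))))
     else ident va (Sto (TIn R)))"

definition step_threads :: "'r change_type \<Rightarrow> (nat \<Rightarrow> nat \<Rightarrow> (('r, 'c, 'r sym) vsym, unit) formula) \<Rightarrow>
    ('r, 'c, 'r sym) vsym \<Rightarrow> (('r, 'c, 'r sym) vsym, unit) formula" where
  "step_threads \<delta> Q Z = (case Z of Sto (TIn R) \<Rightarrow> step_in \<delta> Q R | Sto (TAux S) \<Rightarrow> step_aux \<delta> Q S
     | _ \<Rightarrow> ident va Z)"

lemma rel_step_threads_other:
  "wf_rels va M \<Longrightarrow> (\<And>R. Z \<noteq> Sto (TIn R)) \<Longrightarrow> (\<And>S. Z \<noteq> Sto (TAux S)) \<Longrightarrow>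
     rel (transform va (step_threads \<delta> Q) M) Z = rel M Z"
  by (rule rel_transform_ident) (auto simp: step_threads_def split: vsym.split sym.split)

lemma sat_fm_conjs_upt: "sat M \<sigma> (fm_conjs (map F [0..<n])) \<longleftrightarrow> (\<forall>i<n. sat M \<sigma> (F i))"
  by auto

lemma upds_add_less [simp]: "j < length ds \<Longrightarrow> upds \<sigma> i ds (j + i) = ds ! j"
  by (simp add: upds_def)

text \<open>The guess is unique, since every constant is active and so has exactly one
  number.\<close>

lemma sat_con_codes:
  assumes c: "codes M us" and n: "nums M us xs"
    and cs: "\<And>d. d \<in> con_syms \<tau> \<Longrightarrow> \<kappa> d < length xs \<and> rel M (Cst d) = {[emb (xs ! \<kappa> d)]}"
    and es: "length es = length cl" and kb: "f = kb + length cl"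
  shows "sat M (upds \<sigma> kb es) (con_codes kb f) \<longleftrightarrow> es = map (\<lambda>d. us ! \<kappa> d) cl"
proof -
  have "sat M (upds \<sigma> kb es) (con_codes kb f) \<longleftrightarrow> (\<forall>i < length cl.
      \<exists>d \<in> univ M. [d] \<in> rel M (Cst (cl ! i)) \<and> [d, es ! i] \<in> rel M (Sto Num))"
  proof -
    have "sat M (upds \<sigma> kb es) (Exists f (Conj (at (Cst (cl ! i)) [f]) (num f (kb + i)))) \<longleftrightarrow>
        (\<exists>d \<in> univ M. [d] \<in> rel M (Cst (cl ! i)) \<and> [d, es ! i] \<in> rel M (Sto Num))"
      if "i < length cl" for i
      using es kb that by simp
    then show ?thesis unfolding con_codes_def sat_fm_conjs_upt by (simp del: sat.simps(5))
  qed
  also have "\<dots> \<longleftrightarrow> (\<forall>i < length cl. es ! i = us ! \<kappa> (cl ! i))"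
  proof (intro all_cong1 imp_cong refl)
    fix i assume "i < length cl"
    then have "cl ! i \<in> con_syms \<tau>" using cl nth_mem by blast
    from cs[OF this] show "(\<exists>d \<in> univ M. [d] \<in> rel M (Cst (cl ! i)) \<and> [d, es ! i] \<in> rel M (Sto Num)) \<longleftrightarrow>
        es ! i = us ! \<kappa> (cl ! i)"
    proof -
      assume k: "\<kappa> (cl ! i) < length xs \<and> rel M (Cst (cl ! i)) = {[emb (xs ! \<kappa> (cl ! i))]}"
      then have "emb (xs ! \<kappa> (cl ! i)) \<in> univ M" using n unfolding nums_def by (meson image_subset_iff nth_mem)
      then show ?thesis using nums_nth[OF c n, of "\<kappa> (cl ! i)" "es ! i"] k by simp
    qed
  qed
  also have "\<dots> \<longleftrightarrow> es = map (\<lambda>d. us ! \<kappa> d) cl"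
    using es by (simp add: list_eq_iff_nth_eq)
  finally show ?thesis .
qed

text \<open>An interpretation of dimension one: the numbers up to \<open>w\<close> are represented
  by their codes, and \<open>h\<close> decodes them.\<close>

lemma sat_sim:
  fixes M :: "('d, ('r, 'c, 'r sym) vsym, unit) database"
  assumes c: "codes M us" and w: "w < length us"
    and t: "thread M us w s" and v: "valid_state \<tau> P s" and us: "univ (fst s) = {..w}"
    and S: "S \<in> aux_syms P" and \<delta>: "changed_rel \<delta> \<in> rel_syms \<tau>"
    and ids: "is \<in> tuples (arity \<tau> (changed_rel \<delta>)) {..w}" and js: "js \<in> tuples (aux_arity P S) {..w}"
    and f: "b + arity \<tau> (changed_rel \<delta>) \<le> f" "aux_arity P S < f" "kb + length cl \<le> f"
    and \<sigma>: "\<sigma> 0 = us ! w" "\<And>i. i < arity \<tau> (changed_rel \<delta>) \<Longrightarrow> \<sigma> (b + i) = us ! (is ! i)"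
      "\<And>i. i < aux_arity P S \<Longrightarrow> \<sigma> (Suc i) = us ! (js ! i)"
      "\<And>d. d \<in> con_syms \<tau> \<Longrightarrow> \<sigma> (kb + con_index d) = us ! the (con (fst s) d)"
  shows "sat M \<sigma> (sim \<delta> S b kb f) \<longleftrightarrow> sat (state_structure s) (\<lambda>i. (is @ js) ! i) (upd P \<delta> S)"
proof -
  let ?m = "arity \<tau> (changed_rel \<delta>)" and ?n = "aux_arity P S"
  let ?T = "state_schema \<tau> P"
  define h :: "nat \<times> 'd list \<Rightarrow> nat" where "h p = (THE i. i < length us \<and> us ! i = hd (snd p))" for p
  define Adm :: "(nat \<times> 'd list) set" where "Adm = {(0, [us ! i]) |i. i \<le> w}"
  let ?\<rho> = "\<lambda>i. (0::nat, [if i < ?m then b + i else Suc (i - ?m)])"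
  have d: "distinct us" and sub: "set us \<subseteq> univ M" using c by (auto simp: codes_def)
  have h: "h (g, us ! i # xs) = i" if "i < length us" for g i xs
    unfolding h_def using d that by (intro the_equality) (auto simp: nth_eq_iff_index_eq)
  have ss: "univ (state_structure s) = {..w}" "con (state_structure s) = con (fst s)"
    "rel (state_structure s) = case_sum (rel (fst s)) (snd s)"
    using us by (cases s; simp)+
  have fv: "free_vars (upd P \<delta> S) \<subseteq> {..<?m + ?n}" and wf: "wf_formula ?T (upd P \<delta> S)"
    using P S \<delta> by (auto simp: is_program_def)
  have con_s: "the (con (fst s) d) \<le> w" if dcon: "d \<in> con_syms \<tau>" for d
  proof -
    have "dom (con (fst s)) = con_syms \<tau>" "ran (con (fst s)) \<subseteq> {..w}"
      using v us by (auto simp: valid_state_def is_database_def)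
    moreover obtain i where "con (fst s) d = Some i" using calculation(1) dcon by blast
    ultimately show ?thesis by (auto simp: ran_def)
  qed
  have lens: "length is = ?m" "length js = ?n" using ids js by (auto simp: tuples_def)
  have le: "(is @ js) ! i \<le> w" if "i < ?m + ?n" for i
    using that ids js nth_mem[of i "is @ js"] by (fastforce simp: tuples_def)
  have dec: "decode \<sigma> (?\<rho> i) = (0, [us ! ((is @ js) ! i)])" if "i < ?m + ?n" for i
    using that \<sigma>(2)[of i] \<sigma>(3)[of "i - ?m"] lens by (auto simp: decode_def nth_append)
  have "sat M \<sigma> (interp 1 (\<lambda>_. 1) (\<lambda>_ is. leq (hd is) 0) thread_atom (\<lambda>d. (0, [kb + con_index d])) f
      ?\<rho> (upd P \<delta> S)) \<longleftrightarrow> sat (state_structure s) (\<lambda>i. h (decode \<sigma> (?\<rho> i))) (upd P \<delta> S)"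
  proof (rule interpretation_data.sat_interp[where T = ?T and K = f and Adm = Adm and \<sigma>\<^sub>0 = \<sigma>])
    have "h (0, [us ! i]) = i" if "i \<le> w" for i using h[of i] that w by simp
    then show "inj_on h Adm" "univ (state_structure s) = h ` Adm"
      using d w by (auto simp: ss inj_on_def Adm_def image_iff) (metis)
    show "Adm \<subseteq> tagged_tuples 1 (\<lambda>_. 1) (univ M)"
      using univ_nth[OF c] w by (auto simp: Adm_def tagged_tuples_def)
    show "sat M \<sigma>' (leq (hd is) 0) \<longleftrightarrow> (g, map \<sigma>' is) \<in> Adm"
      if g: "g < 1" "\<forall>i<f. \<sigma>' i = \<sigma> i" "map \<sigma>' is \<in> tuples 1 (univ M)" for g "is" \<sigma>'
    proof -
      obtain i where i: "is = [i]" using g(3) by (auto simp: tuples_def length_Suc_conv)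
      have "[x, us ! w] \<in> rel M (Sto Ord) \<longleftrightarrow> (\<exists>i \<le> w. x = us ! i)" for x
        using codes_Ord[OF c _ w, of x] codes_nth(1)[OF c _ w] w by (auto intro: le_less_trans)
      then show ?thesis using i g f \<sigma>(1) by (auto simp: Adm_def)
    qed
    show "sat M \<sigma>' (thread_atom Z N bs) \<longleftrightarrow> map (\<lambda>b. h (decode \<sigma>' b)) bs \<in> rel (state_structure s) Z"
      if Z: "Z \<in> rel_syms ?T" and "length bs = arity ?T Z" "f \<le> N" "\<forall>i<f. \<sigma>' i = \<sigma> i"
        and bs: "\<forall>b \<in> set bs. decode \<sigma>' b \<in> Adm \<and> set (snd b) \<subseteq> {..<N}" for Z bs N \<sigma>'
    proof -
      define ks where "ks = map (\<lambda>b. h (decode \<sigma>' b)) bs"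
      have b: "h (decode \<sigma>' b) \<le> w \<and> \<sigma>' (hd (snd b)) = us ! h (decode \<sigma>' b)" if "b \<in> set bs" for b
      proof -
        have "decode \<sigma>' b \<in> Adm" using bs that by blast
        then obtain i where i: "i \<le> w" "decode \<sigma>' b = (0, [us ! i])" by (auto simp: Adm_def)
        then obtain l where "snd b = [l]" "\<sigma>' l = us ! i" by (cases b) (auto simp: decode_def)
        with i h[of i 0 "[]"] w show ?thesis by simp
      qed
      have ks: "set ks \<subseteq> {..w}" "map (\<lambda>b. \<sigma>' (hd (snd b))) bs = map (\<lambda>i. us ! i) ks"
        using b by (auto simp: ks_def)
      have inj: "inj_on (\<lambda>i. us ! i) {..w}" using d w by (auto simp: inj_on_def nth_eq_iff_index_eq)
      have \<sigma>0: "\<sigma>' 0 = us ! w" using that f \<sigma>(1) by auto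
      show ?thesis
      proof (cases Z)
        case (Inl R)
        then have R: "R \<in> rel_syms \<tau>" using Z by (auto simp: state_schema_def)
        have "sat M \<sigma>' (thread_atom Z N bs) \<longleftrightarrow> us ! w # map (\<lambda>i. us ! i) ks \<in> rel M (Sto (TIn R))"
          using Inl \<sigma>0 ks(2) by (simp add: o_def)
        also have "\<dots> \<longleftrightarrow> map (\<lambda>i. us ! i) ks \<in> map (\<lambda>i. us ! i) ` rel (fst s) R"
          by (rule thread_TIn[OF t R])
        also have "\<dots> \<longleftrightarrow> ks \<in> rel (fst s) R"
          using v R us by (intro map_mem_image_iff[OF inj ks(1)])
            (fastforce simp: valid_state_def is_database_def tuples_def)
        finally show ?thesis using Inl by (simp add: ss ks_def)
      next
        case (Inr S')
        then have S': "S' \<in> aux_syms P" using Z by (auto simp: state_schema_def)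
        have "sat M \<sigma>' (thread_atom Z N bs) \<longleftrightarrow> us ! w # map (\<lambda>i. us ! i) ks \<in> rel M (Sto (TAux S'))"
          using Inr \<sigma>0 ks(2) by (simp add: o_def)
        also have "\<dots> \<longleftrightarrow> map (\<lambda>i. us ! i) ks \<in> map (\<lambda>i. us ! i) ` snd s S'"
          by (rule thread_TAux[OF t S'])
        also have "\<dots> \<longleftrightarrow> ks \<in> snd s S'"
          using v S' us by (intro map_mem_image_iff[OF inj ks(1)])
            (fastforce simp: valid_state_def tuples_def)
        finally show ?thesis using Inr by (simp add: ss ks_def)
      qed
    qed
    show "decode \<sigma> (0, [kb + con_index d]) \<in> Adm \<and> set (snd (0, [kb + con_index d])) \<subseteq> {..<f} \<and>
        h (decode \<sigma> (0, [kb + con_index d])) = the (con (state_structure s) d)"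
      if "d \<in> con_syms ?T" for d
    proof -
      have d: "d \<in> con_syms \<tau>" using that by (simp add: state_schema_def)
      from con_s[OF d] \<sigma>(4)[OF d] h[of "the (con (fst s) d)" 0 "[]"] con_index[OF d] f w
      show ?thesis by (auto simp: decode_def Adm_def ss)
    qed
    show "decode \<sigma> (?\<rho> i) \<in> Adm \<and> set (snd (?\<rho> i)) \<subseteq> {..<f}" if "i \<in> free_vars (upd P \<delta> S)" for i
    proof -
      have i: "i < ?m + ?n" using fv that by auto
      show ?thesis using dec[OF i] le[OF i] f i by (auto simp: Adm_def)
    qed
  qed (use wf in auto)
  also have "\<dots> \<longleftrightarrow> sat (state_structure s) (\<lambda>i. (is @ js) ! i) (upd P \<delta> S)"
  proof (rule sat_cong)
    fix i assume "i \<in> free_vars (upd P \<delta> S)"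
    then have i: "i < ?m + ?n" using fv by auto
    then show "h (decode \<sigma> (?\<rho> i)) = (is @ js) ! i"
      unfolding dec[OF i] using h[of "(is @ js) ! i" 0 "[]"] le[OF i] w by simp
  qed
  finally show ?thesis unfolding sim_def .
qed

end

lemma tuples_nth: "is \<in> tuples m A \<Longrightarrow> j < m \<Longrightarrow> is ! j \<in> A"
  unfolding tuples_def using nth_mem by blast

lemma tuples_set_nth:
  assumes "b \<in> tuples n (set xs)"
  obtains "is" where "is \<in> tuples n {..<length xs}" "b = map (\<lambda>i. xs ! i) is"
proof -
  have "\<forall>x \<in> set b. \<exists>i < length xs. xs ! i = x"
    using assms by (auto simp: tuples_def in_set_conv_nth subset_iff)
  then obtain g where g: "\<forall>x \<in> set b. g x < length xs \<and> xs ! g x = x" by metis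
  show thesis
  proof (rule that)
    show "map g b \<in> tuples n {..<length xs}" using g assms by (auto simp: tuples_def)
    show "b = map (\<lambda>i. xs ! i) (map g b)" using g by (simp add: map_idI)
  qed
qed

lemma nums_univ: "nums M us xs \<Longrightarrow> i < length xs \<Longrightarrow> emb (xs ! i) \<in> univ M"
  unfolding nums_def by (meson image_subset_iff nth_mem)

context threads
begin

lemma sat_defines_tuples:
  assumes Q: "defines_tuples M us (Suc 0) (\<lambda>_. us ! w) m Q X" and \<sigma>: "\<sigma> 0 = us ! w"
    and b: "0 < b" "b + m \<le> f" and ds: "ds \<in> tuples m (univ M)"
  shows "sat M (upds \<sigma> b ds) (Q b f) \<longleftrightarrow> (\<exists>is \<in> X. ds = map (\<lambda>i. us ! i) is)"
proof -
  have len: "length ds = m" using ds by (simp add: tuples_def)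
  have "upds \<sigma> b ds i \<in> univ M" if "i \<in> {b..<b + m}" for i
  proof -
    have "i - b < length ds" "set ds \<subseteq> univ M" using that ds by (auto simp: tuples_def)
    then show ?thesis using that by (auto simp: upds_def)
  qed
  then have "sat M (upds \<sigma> b ds) (Q b f) \<longleftrightarrow>
      (\<exists>is \<in> X. map (upds \<sigma> b ds) [b..<b + m] = map (\<lambda>i. us ! i) is)"
    using Q[unfolded defines_tuples_def, rule_format, of "upds \<sigma> b ds" b f] \<sigma> b by simp
  then show ?thesis using map_upds[of m ds \<sigma> b] len by simp
qed

lemma sat_step_in:
  assumes Q: "defines_tuples M us (Suc 0) (\<lambda>_. us ! w) (arity \<tau> R) Q X"
    and vs: "us ! w # vs \<in> tuples (Suc (arity \<tau> R)) (univ M)"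
  shows "sat M (\<lambda>i. (us ! w # vs) ! i) (Q (Suc 0) (Suc (arity \<tau> R))) \<longleftrightarrow>
    (\<exists>is \<in> X. vs = map (\<lambda>i. us ! i) is)"
proof -
  have v: "vs \<in> tuples (arity \<tau> R) (univ M)" using vs by simp
  have "sat M (upds (\<lambda>i. (us ! w # vs) ! i) (Suc 0) vs) (Q (Suc 0) (Suc (arity \<tau> R))) \<longleftrightarrow>
      (\<exists>is \<in> X. vs = map (\<lambda>i. us ! i) is)"
    by (rule sat_defines_tuples[OF Q _ _ _ v]) auto
  \<comment> \<open>The variables from 1 on hold \<open>vs\<close> already, so writing
    \<open>vs\<close> there changes nothing.\<close>
  moreover have "upds (\<lambda>i. (us ! w # vs) ! i) (Suc 0) vs = (\<lambda>i. (us ! w # vs) ! i)"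
    by (auto simp: upds_def fun_eq_iff nth_Cons split: nat.split)
  ultimately show ?thesis by simp
qed

text \<open>The case of a thread that lacks no tuple of the relation under replay.\<close>

lemma thread_step_None:
  assumes wf: "wf_rels va M" and Q: "defines_tuples M us (Suc 0) (\<lambda>_. us ! w) (arity \<tau> (changed_rel \<delta>)) Q {}"
    and t: "thread M us w s"
  shows "thread (transform va (step_threads \<delta> Q) M) us w s"
proof -
  have "us ! w # vs \<in> rel (transform va (step_threads \<delta> Q) M) Z \<longleftrightarrow> us ! w # vs \<in> rel M Z"
    if Z: "(\<exists>R. Z = Sto (TIn R)) \<or> (\<exists>S. Z = Sto (TAux S))" for Z vs
  proof -
    have "sat M (\<lambda>i. (us ! w # vs) ! i) (step_threads \<delta> Q Z) \<longleftrightarrow> us ! w # vs \<in> rel M Z"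
      if vs: "us ! w # vs \<in> tuples (va Z) (univ M)"
    proof -
      note id = sat_ident[where ar = va and Z = Z and M = M, OF vs]
      from Z show ?thesis
      proof (elim disjE exE)
        fix R assume Z: "Z = Sto (TIn R)"
        show ?thesis
        proof (cases "R = changed_rel \<delta>")
          case True
          then have "\<not> sat M (\<lambda>i. (us ! w # vs) ! i) (Q (Suc 0) (Suc (arity \<tau> R)))"
            using sat_step_in[of M us w R Q "{}" vs] Q vs Z by simp
          then show ?thesis using Z id True
            by (cases \<delta>) (simp_all add: step_threads_def step_in_def)
        next
          case False then show ?thesis using Z id by (simp add: step_threads_def step_in_def)
        qed
      next
        fix S assume Z: "Z = Sto (TAux S)"
        have "\<not> sat M (upds (\<lambda>i. (us ! w # vs) ! i) (Suc (aux_arity P S)) ds)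
            (Q (Suc (aux_arity P S)) (Suc (aux_arity P S) + arity \<tau> (changed_rel \<delta>)))"
          if "ds \<in> tuples (arity \<tau> (changed_rel \<delta>)) (univ M)" for ds
          using sat_defines_tuples[OF Q _ _ _ that] by simp
        then show ?thesis using Z id by (simp add: step_threads_def step_aux_def Let_def)
      qed
    qed
    moreover have "rel M Z \<subseteq> tuples (va Z) (univ M)" using wf by (simp add: wf_rels_def)
    ultimately show ?thesis unfolding mem_transform by blast
  qed
  then show ?thesis using t unfolding thread_def by simp
qed

lemma map_nth_mem_tuples:
  "codes M us \<Longrightarrow> w < length us \<Longrightarrow> is \<in> tuples n {..w} \<Longrightarrow> map (\<lambda>i. us ! i) is \<in> tuples n (univ M)"
  using univ_nth[of M us] by (auto simp: tuples_def subset_iff)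

text \<open>Once \<open>Q\<close> pins down the changed tuple and the numbers pin down the
  constants, the formulas of \<open>step_threads\<close> say on codes what the update formulas of
  \<open>P\<close> say on numbers.\<close>

lemma thread_step_Some:
  assumes wf: "wf_rels va M" and c: "codes M us" and n: "nums M us xs" and w: "w < length us"
    and Q: "defines_tuples M us (Suc 0) (\<lambda>_. us ! w) (arity \<tau> (changed_rel \<delta>)) Q {is}"
    and ids: "is \<in> tuples (arity \<tau> (changed_rel \<delta>)) {..w}" and \<delta>: "changed_rel \<delta> \<in> rel_syms \<tau>"
    and t: "thread M us w s" and v: "valid_state \<tau> P s" and us: "univ (fst s) = {..w}"
    and cs: "\<And>d. d \<in> con_syms \<tau> \<Longrightarrow>
      the (con (fst s) d) < length xs \<and> rel M (Cst d) = {[emb (xs ! the (con (fst s) d))]}"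
  shows "thread (transform va (step_threads \<delta> Q) M) us w (step P (\<delta>, is) s)"
proof -
  let ?M = "transform va (step_threads \<delta> Q) M" and ?m = "arity \<tau> (changed_rel \<delta>)"
  let ?u = "\<lambda>i. us ! i"
  have d: "distinct us" using c by (simp add: codes_def)
  have inj: "inj_on ?u {..w}" using d w by (auto simp: inj_on_def nth_eq_iff_index_eq)
  have uw: "us ! w \<in> univ M" by (rule univ_nth[OF c w])
  have "{vs. us ! w # vs \<in> rel ?M (Sto (TIn R))} = map ?u ` rel (fst (step P (\<delta>, is) s)) R"
    if R: "R \<in> rel_syms \<tau>" for R
  proof -
    have relD: "rel (fst s) R \<subseteq> tuples (arity \<tau> R) {..w}"
      using v R us by (auto simp: valid_state_def is_database_def)
    have "us ! w # vs \<in> rel ?M (Sto (TIn R)) \<longleftrightarrow> vs \<in> map ?u ` rel (apply_change (\<delta>, is) (fst s)) R" for vs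
    proof (cases "us ! w # vs \<in> tuples (Suc (arity \<tau> R)) (univ M)")
      case vs: True
      note id = sat_ident[of "us ! w # vs" va "Sto (TIn R)" "univ M" M]
      have Qs: "sat M (\<lambda>i. (us ! w # vs) ! i) (Q (Suc 0) (Suc (arity \<tau> R))) \<longleftrightarrow> vs = map ?u is"
        if "R = changed_rel \<delta>"
        using sat_step_in[of M us w R Q "{is}" vs] Q vs that by simp
      have mem: "map ?u is \<in> map ?u ` X \<longleftrightarrow> is \<in> X" if "X \<subseteq> rel (fst s) R" for X
        using map_mem_image_iff[OF inj, of "is" X] ids relD that by (fastforce simp: tuples_def)
      have *: "us ! w # vs \<in> rel ?M (Sto (TIn R)) \<longleftrightarrow>
          sat M (\<lambda>i. (us ! w # vs) ! i) (step_in \<delta> Q R)"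
        using vs by (simp add: mem_transform step_threads_def)
      have T: "us ! w # vs \<in> rel M (Sto (TIn R)) \<longleftrightarrow> vs \<in> map ?u ` rel (fst s) R"
        by (rule thread_TIn[OF t R])
      show ?thesis
      proof (cases "R = changed_rel \<delta>")
        case False
        then show ?thesis using * id vs T by (simp add: step_in_def rel_apply_change)
      next
        case True
        show ?thesis
        proof (cases \<delta>)
          case (Ins R')
          then show ?thesis using True * id vs T Qs by (auto simp: step_in_def rel_apply_change)
        next
          case (Del R')
          \<comment> \<open>Distinct numbers have distinct codes, so the deletion removes the image
            of \<open>is\<close> only.\<close>
          have "vs \<in> map ?u ` (rel (fst s) R - {is}) \<longleftrightarrow> vs \<in> map ?u ` rel (fst s) R \<and> vs \<noteq> map ?u is"
          proof -
            have "map ?u is \<notin> map ?u ` (rel (fst s) R - {is})" using mem[of "rel (fst s) R - {is}"] by simp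
            then show ?thesis by blast
          qed
          then show ?thesis using Del True * id vs T Qs by (simp add: step_in_def rel_apply_change)
        qed
      qed
    next
      case False
      have "rel (apply_change (\<delta>, is) (fst s)) R \<subseteq> tuples (arity \<tau> R) {..w}"
        using relD ids by (auto simp: rel_apply_change split: change_type.splits if_splits)
      moreover have "map ?u js \<in> tuples (arity \<tau> R) (univ M)" if "js \<in> tuples (arity \<tau> R) {..w}" for js
        by (rule map_nth_mem_tuples[OF c w that])
      ultimately have "vs \<notin> map ?u ` rel (apply_change (\<delta>, is) (fst s)) R" using False uw by auto
      then show ?thesis using False by (auto simp: mem_transform)
    qed
    then show ?thesis by auto
  qed
  moreover have "us ! w # vs \<in> rel ?M (Sto (TAux S)) \<longleftrightarrow> vs \<in> map ?u ` snd (step P (\<delta>, is) s) S"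
    if S: "S \<in> aux_syms P" for S vs
  proof -
    let ?n = "aux_arity P S"
    let ?kb = "Suc ?n + ?m"
    let ?f = "?kb + length cl"
    let ?\<sigma> = "\<lambda>i. (us ! w # vs) ! i"
    define \<kappa> where "\<kappa> d = the (con (fst s) d)" for d
    define es where "es = map (\<lambda>d. us ! \<kappa> d) cl"
    define \<sigma>2 where "\<sigma>2 = upds (upds ?\<sigma> (Suc ?n) (map ?u is)) ?kb es"
    have isU: "map ?u is \<in> tuples ?m (univ M)" by (rule map_nth_mem_tuples[OF c w ids])
    have lis: "length is = ?m" using ids by (simp add: tuples_def)
    have \<kappa>us: "\<kappa> d < length us" if "d \<in> con_syms \<tau>" for d
      using cs[OF that] n by (simp add: \<kappa>_def nums_def)
    have esU: "es \<in> tuples (length cl) (univ M)"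
    proof -
      have "us ! \<kappa> d \<in> univ M" if "d \<in> set cl" for d using \<kappa>us that univ_nth[OF c] unfolding cl by blast
      then show ?thesis by (auto simp: es_def tuples_def)
    qed
    have core: "sat M ?\<sigma> (step_aux \<delta> Q S) \<longleftrightarrow>
        (\<forall>j < ?n. [vs ! j, us ! w] \<in> rel M (Sto Ord)) \<and> sat M \<sigma>2 (sim \<delta> S (Suc ?n) ?kb ?f)"
    proof -
      have Qs: "sat M (upds ?\<sigma> (Suc ?n) ds) (Q (Suc ?n) ?kb) \<longleftrightarrow> ds = map ?u is"
        if "ds \<in> tuples ?m (univ M)" for ds
        using sat_defines_tuples[OF Q _ _ _ that, of ?\<sigma> "Suc ?n" ?kb] by simp
      have leqs: "sat M (upds ?\<sigma> (Suc ?n) ds) (fm_conjs (map (\<lambda>j. leq (Suc j) 0) [0..<?n])) \<longleftrightarrow>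
          (\<forall>j < ?n. [vs ! j, us ! w] \<in> rel M (Sto Ord))" for ds
        unfolding sat_fm_conjs_upt by simp
      have cons: "sat M (upds (upds ?\<sigma> (Suc ?n) ds) ?kb es') (con_codes ?kb ?f) \<longleftrightarrow> es' = es"
        if "es' \<in> tuples (length cl) (univ M)" for es' ds
        unfolding es_def using that
        by (intro sat_con_codes[OF c n]) (auto simp: \<kappa>_def tuples_def cs)
      have "sat M ?\<sigma> (step_aux \<delta> Q S) \<longleftrightarrow>
          (\<exists>ds \<in> tuples ?m (univ M). sat M (upds ?\<sigma> (Suc ?n) ds) (Q (Suc ?n) ?kb) \<and>
            sat M (upds ?\<sigma> (Suc ?n) ds) (fm_conjs (map (\<lambda>j. leq (Suc j) 0) [0..<?n])) \<and>
            (\<exists>es' \<in> tuples (length cl) (univ M).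
              sat M (upds (upds ?\<sigma> (Suc ?n) ds) ?kb es') (con_codes ?kb ?f) \<and>
              sat M (upds (upds ?\<sigma> (Suc ?n) ds) ?kb es') (sim \<delta> S (Suc ?n) ?kb ?f))) \<or>
          (\<not> (\<exists>ds \<in> tuples ?m (univ M). sat M (upds ?\<sigma> (Suc ?n) ds) (Q (Suc ?n) ?kb)) \<and>
            sat M ?\<sigma> (ident va (Sto (TAux S))))"
        by (simp only: step_aux_def Let_def sat_fm_or sat_fm_exs sat_fm_conjs sat.simps list.set
            set_append insert_iff ball_simps ball_Un empty_iff conj_assoc simp_thms)
      \<comment> \<open>Both guesses are unique, so the quantifiers reduce to
        \<open>map ?u is\<close> and \<open>es\<close>, and the alternative without a selected tuple
        is refuted.\<close>
      also have "\<dots> \<longleftrightarrow> (\<exists>es' \<in> tuples (length cl) (univ M). es' = es \<and>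
          sat M (upds (upds ?\<sigma> (Suc ?n) (map ?u is)) ?kb es') (sim \<delta> S (Suc ?n) ?kb ?f)) \<and>
          (\<forall>j < ?n. [vs ! j, us ! w] \<in> rel M (Sto Ord))"
        unfolding leqs using Qs isU cons by blast
      also have "\<dots> \<longleftrightarrow> (\<forall>j < ?n. [vs ! j, us ! w] \<in> rel M (Sto Ord)) \<and>
          sat M \<sigma>2 (sim \<delta> S (Suc ?n) ?kb ?f)"
        unfolding \<sigma>2_def using esU by blast
      finally show ?thesis .
    qed
    have sim: "sat M \<sigma>2 (sim \<delta> S (Suc ?n) ?kb ?f) \<longleftrightarrow> sat (state_structure s) (\<lambda>i. (is @ js) ! i) (upd P \<delta> S)"
      if js: "js \<in> tuples ?n {..w}" and vs: "vs = map ?u js" for js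
    proof (rule sat_sim[OF c w t v us S \<delta> ids js])
      have les: "length es = length cl" by (simp add: es_def)
      have ljs: "length js = ?n" using js by (simp add: tuples_def)
      show "\<sigma>2 0 = us ! w" by (simp add: \<sigma>2_def)
      show "\<sigma>2 (Suc ?n + i) = us ! (is ! i)" if "i < ?m" for i
        using that lis by (simp add: \<sigma>2_def upds_def)
      show "\<sigma>2 (Suc i) = us ! (js ! i)" if "i < ?n" for i
        using that ljs by (simp add: \<sigma>2_def vs)
      show "\<sigma>2 (?kb + con_index d) = us ! the (con (fst s) d)" if "d \<in> con_syms \<tau>" for d
        using con_index[OF that] les by (simp add: \<sigma>2_def es_def \<kappa>_def upds_def)
    qed auto
    have new: "snd (step P (\<delta>, is) s) S = {js \<in> tuples ?n {..w}.
        sat (state_structure s) (\<lambda>i. (is @ js) ! i) (upd P \<delta> S)}"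
      using S us by (cases s) simp
    have Ord: "[x, us ! w] \<in> rel M (Sto Ord) \<longleftrightarrow> (\<exists>i \<le> w. x = us ! i)" for x
      using codes_Ord[OF c _ w, of x] codes_nth(1)[OF c _ w] w by (auto intro: le_less_trans)
    show ?thesis
    proof
      assume "us ! w # vs \<in> rel ?M (Sto (TAux S))"
      then have vs: "vs \<in> tuples ?n (univ M)" and sat: "sat M ?\<sigma> (step_aux \<delta> Q S)"
        by (simp_all add: mem_transform step_threads_def)
      \<comment> \<open>The bounds \<open>leq (Suc j) 0\<close> guarantee that every component of
        \<open>vs\<close> is the code of a number up to \<open>w\<close>.\<close>
      define js where "js = map (\<lambda>x. SOME i. i \<le> w \<and> x = us ! i) vs"
      have "(SOME i. i \<le> w \<and> x = us ! i) \<le> w \<and> us ! (SOME i. i \<le> w \<and> x = us ! i) = x"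
        if "x \<in> set vs" for x
      proof -
        obtain j where j: "j < ?n" "x = vs ! j" using \<open>x \<in> set vs\<close> vs by (auto simp: in_set_conv_nth tuples_def)
        then have "\<exists>i \<le> w. x = us ! i" using sat core Ord by blast
        then show ?thesis by (metis (mono_tags, lifting) someI_ex)
      qed
      then have js: "js \<in> tuples ?n {..w}" "vs = map ?u js"
        using vs by (auto simp: js_def tuples_def map_idI)
      with sat core sim[OF js] have "js \<in> snd (step P (\<delta>, is) s) S" unfolding new by blast
      with js(2) show "vs \<in> map ?u ` snd (step P (\<delta>, is) s) S" by blast
    next
      assume "vs \<in> map ?u ` snd (step P (\<delta>, is) s) S"
      then obtain js where js: "js \<in> tuples ?n {..w}" "vs = map ?u js"
        "sat (state_structure s) (\<lambda>i. (is @ js) ! i) (upd P \<delta> S)"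
        unfolding new by blast
      have "[vs ! j, us ! w] \<in> rel M (Sto Ord)" if "j < ?n" for j
      proof -
        have "js ! j \<le> w" "vs ! j = us ! (js ! j)"
          using tuples_nth[OF js(1) that] js(1,2) that by (auto simp: tuples_def)
        then show ?thesis unfolding Ord by blast
      qed
      then have "sat M ?\<sigma> (step_aux \<delta> Q S)" using core sim[OF js(1,2)] js(3) by blast
      moreover have "us ! w # vs \<in> tuples (Suc ?n) (univ M)"
        using uw map_nth_mem_tuples[OF c w js(1)] js(2) by simp
      ultimately show "us ! w # vs \<in> rel ?M (Sto (TAux S))"
        by (simp add: mem_transform step_threads_def)
    qed
  qed
  ultimately show ?thesis unfolding thread_def by (auto simp del: step.simps)
qed

subsection \<open>Selected tuples\<close>

text \<open>Everything in the tagged structure apart from the stored relations. As a property it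
  survives all phases that change stored relations only, and \<open>update_input\<close> just
  replaces \<open>D\<close>.\<close>

definition inputs :: "(nat \<times> 'a list, ('r, 'c, 'r sym) vsym, unit) database \<Rightarrow> ('a, 'r, 'c) database \<Rightarrow>
    'a list \<Rightarrow> bool" where
  "inputs M D a \<longleftrightarrow> univ M = tagged_tuples (B + 2) (tuple_program.dm c) (univ D) \<and>
     (\<forall>R. rel M (In R) = map emb ` rel D R) \<and>
     (\<forall>d. rel M (Cst d) = {[emb x] |x. con D d = Some x}) \<and>
     (\<forall>j < length a. rel M (Chg j) = {[emb (a ! j)]}) \<and>
     (\<forall>j < c. rel M (Coord j) = {[(1, xs), emb (xs ! j)] |xs. xs \<in> tuples c (univ D)}) \<and>
     (\<forall>g < B. rel M (Bot g) = {[(g + 2, [])]})"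

lemma inputs_cong:
  assumes "inputs M D a" "univ M' = univ M" "\<And>Z. (\<And>z. Z \<noteq> Sto z) \<Longrightarrow> rel M' Z = rel M Z"
  shows "inputs M' D a"
  using assms by (simp add: inputs_def)

lemma emb_univ: "inputs M D a \<Longrightarrow> emb x \<in> univ M \<longleftrightarrow> x \<in> univ D"
  by (auto simp: inputs_def emb_def tagged_tuples_def tuple_program.dm_def)

lemma tuple_univ: "inputs M D a \<Longrightarrow> (1, xs) \<in> univ M \<longleftrightarrow> xs \<in> tuples c (univ D)"
  by (auto simp: inputs_def tagged_tuples_def tuple_program.dm_def)

lemma bot_univ: "inputs M D a \<Longrightarrow> g < B \<Longrightarrow> (g + 2, []) \<in> univ M"
  by (auto simp: inputs_def tagged_tuples_def tuple_program.dm_def)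

definition sel_change :: "nat \<Rightarrow> nat \<Rightarrow> nat \<Rightarrow> (('r, 'c, 'r sym) vsym, unit) formula" where
  "sel_change m b f = fm_conjs (map (\<lambda>j. Exists f (Conj (at (Chg j) [f]) (num f (b + j)))) [0..<m])"

text \<open>The change can be passed to the threads only after activation, when all components of
  the changed tuple have numbers.\<close>

lemma defines_sel_change:
  assumes c: "codes M us" and n: "nums M us xs" and i: "inputs M D (map (\<lambda>i. xs ! i) is)"
    and ids: "is \<in> tuples m {..<length xs}"
  shows "defines_tuples M us K \<sigma>\<^sub>0 m (sel_change m) {is}"
  unfolding defines_tuples_def
proof (intro allI impI; elim conjE)
  fix \<sigma> b f assume b: "b + m \<le> f"
  have len: "length is = m" using ids by (simp add: tuples_def)
  have "sat M \<sigma> (sel_change m b f) \<longleftrightarrow>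
      (\<forall>j < m. \<exists>d \<in> univ M. [d] \<in> rel M (Chg j) \<and> [d, \<sigma> (b + j)] \<in> rel M (Sto Num))"
    unfolding sel_change_def sat_fm_conjs_upt using b by simp
  also have "\<dots> \<longleftrightarrow> (\<forall>j < m. \<sigma> (b + j) = us ! (is ! j))"
  proof (intro all_cong1 imp_cong refl)
    fix j assume j: "j < m"
    then have "is ! j < length xs" using tuples_nth[OF ids j] by simp
    moreover have "emb (xs ! (is ! j)) \<in> univ M"
      using nums_univ[OF n calculation] .
    moreover have "rel M (Chg j) = {[emb (xs ! (is ! j))]}" using i j len by (simp add: inputs_def)
    ultimately show "(\<exists>d \<in> univ M. [d] \<in> rel M (Chg j) \<and> [d, \<sigma> (b + j)] \<in> rel M (Sto Num)) \<longleftrightarrow>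
        \<sigma> (b + j) = us ! (is ! j)"
      using nums_nth[OF c n, of "is ! j" "\<sigma> (b + j)"] by simp
  qed
  also have "\<dots> \<longleftrightarrow> map \<sigma> [b..<b + m] = map (\<lambda>i. us ! i) is"
    using len by (simp add: list_eq_iff_nth_eq)
  finally show "sat M \<sigma> (sel_change m b f) \<longleftrightarrow> (\<exists>is \<in> {is}. map \<sigma> [b..<b + m] = map (\<lambda>i. us ! i) is)"
    by simp
qed

lemma nums_tuple:
  assumes c: "codes M us" and n: "nums M us xs" and ds: "length ds = m" and vs: "length vs = m"
  shows "(\<forall>j < m. [ds ! j, vs ! j] \<in> rel M (Sto Num)) \<longleftrightarrow>
    (\<exists>is \<in> tuples m {..<length xs}. ds = map (\<lambda>i. emb (xs ! i)) is \<and> vs = map (\<lambda>i. us ! i) is)"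
proof
  assume *: "\<forall>j < m. [ds ! j, vs ! j] \<in> rel M (Sto Num)"
  then have "\<forall>j < m. \<exists>i < length xs. ds ! j = emb (xs ! i) \<and> vs ! j = us ! i"
    unfolding nums_mem[OF n] .
  then obtain g where g: "\<forall>j < m. g j < length xs \<and> ds ! j = emb (xs ! g j) \<and> vs ! j = us ! g j"
    by metis
  have "map g [0..<m] \<in> tuples m {..<length xs}" using g by (auto simp: tuples_def)
  moreover have "ds = map (\<lambda>i. emb (xs ! i)) (map g [0..<m])"
    by (rule nth_equalityI) (use g ds in simp_all)
  moreover have "vs = map (\<lambda>i. us ! i) (map g [0..<m])"
    by (rule nth_equalityI) (use g vs in simp_all)
  ultimately show "\<exists>is \<in> tuples m {..<length xs}. ds = map (\<lambda>i. emb (xs ! i)) is \<and> vs = map (\<lambda>i. us ! i) is"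
    by blast
next
  assume "\<exists>is \<in> tuples m {..<length xs}. ds = map (\<lambda>i. emb (xs ! i)) is \<and> vs = map (\<lambda>i. us ! i) is"
  then obtain "is" where "is": "is \<in> tuples m {..<length xs}" "ds = map (\<lambda>i. emb (xs ! i)) is"
    "vs = map (\<lambda>i. us ! i) is" by blast
  show "\<forall>j < m. [ds ! j, vs ! j] \<in> rel M (Sto Num)"
  proof (intro allI impI)
    fix j assume "j < m"
    with "is" tuples_nth[OF "is"(1) this] have "is ! j < length xs" "ds ! j = emb (xs ! (is ! j))"
      "vs ! j = us ! (is ! j)"
      by (auto simp: tuples_def)
    then show "[ds ! j, vs ! j] \<in> rel M (Sto Num)" unfolding nums_mem[OF n] by blast
  qed
qed

text \<open>Variable \<open>v\<close> holds the code of the thread: it is 0 in the update of a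
  thread relation, and \<open>k\<close> in the answer formula, where the variables below
  \<open>k\<close> hold the answer tuple.\<close>

definition missing :: "nat \<Rightarrow> 'r \<Rightarrow> nat \<Rightarrow> nat \<Rightarrow> (('r, 'c, 'r sym) vsym, unit) formula" where
  "missing v R b f = (let m = arity \<tau> R in Conj
     (fm_exs f m (Conj (at (In R) [f..<f + m]) (fm_conjs (map (\<lambda>j. num (f + j) (b + j)) [0..<m]))))
     (Neg (at (Sto (TIn R)) (v # [b..<b + m]))))"

lemma defines_missing:
  assumes c: "codes M us" and n: "nums M us xs" and i: "inputs M D a" and v: "v < K" "\<sigma>\<^sub>0 v = us ! w"
    and X: "\<And>vs. us ! w # vs \<in> rel M (Sto (TIn R)) \<longleftrightarrow> vs \<in> map (\<lambda>i. us ! i) ` X"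
      "X \<subseteq> tuples (arity \<tau> R) {..<length us}"
  shows "defines_tuples M us K \<sigma>\<^sub>0 (arity \<tau> R) (missing v R)
    ({is \<in> tuples (arity \<tau> R) {..<length xs}. map (\<lambda>i. xs ! i) is \<in> rel D R} - X)"
  unfolding defines_tuples_def
proof (intro allI impI; elim conjE)
  let ?m = "arity \<tau> R" and ?u = "\<lambda>i. us ! i"
  fix \<sigma> b f assume \<sigma>: "\<forall>i<K. \<sigma> i = \<sigma>\<^sub>0 i" and b: "K \<le> b" "b + ?m \<le> f"
  have d: "distinct us" and lx: "length xs \<le> length us" using c n by (auto simp: codes_def nums_def)
  let ?vs = "map \<sigma> [b..<b + ?m]"
  have sel: "sat M (upds \<sigma> f ds) (Conj (at (In R) [f..<f + ?m]) (fm_conjs (map (\<lambda>j. num (f + j) (b + j)) [0..<?m])))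
      \<longleftrightarrow> ds \<in> rel M (In R) \<and>
        (\<exists>is \<in> tuples ?m {..<length xs}. ds = map (\<lambda>i. emb (xs ! i)) is \<and> ?vs = map ?u is)"
    if ds: "ds \<in> tuples ?m (univ M)" for ds
  proof -
    have l: "length ds = ?m" using ds by (simp add: tuples_def)
    then have "sat M (upds \<sigma> f ds) (fm_conjs (map (\<lambda>j. num (f + j) (b + j)) [0..<?m])) \<longleftrightarrow>
        (\<forall>j < ?m. [ds ! j, ?vs ! j] \<in> rel M (Sto Num))"
      unfolding sat_fm_conjs_upt using b by simp
    also have "\<dots> \<longleftrightarrow> (\<exists>is \<in> tuples ?m {..<length xs}. ds = map (\<lambda>i. emb (xs ! i)) is \<and> ?vs = map ?u is)"
      using nums_tuple[OF c n l, of ?vs] by simp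
    finally show ?thesis using map_upds[of ?m ds \<sigma> f] l by simp
  qed
  have "sat M \<sigma> (missing v R b f) \<longleftrightarrow> (\<exists>ds \<in> tuples ?m (univ M). ds \<in> rel M (In R) \<and>
        (\<exists>is \<in> tuples ?m {..<length xs}. ds = map (\<lambda>i. emb (xs ! i)) is \<and> ?vs = map ?u is)) \<and>
      us ! w # ?vs \<notin> rel M (Sto (TIn R))"
  proof -
    have "\<sigma> v = us ! w" using \<sigma> v by simp
    then have "sat M \<sigma> (at (Sto (TIn R)) (v # [b..<b + ?m])) \<longleftrightarrow> us ! w # ?vs \<in> rel M (Sto (TIn R))" by simp
    then show ?thesis unfolding missing_def Let_def sat.simps(3,4) sat_fm_exs using sel[unfolded sat.simps(4)] by blast
  qed
  also have "\<dots> \<longleftrightarrow> (\<exists>is \<in> tuples ?m {..<length xs}. map (\<lambda>i. emb (xs ! i)) is \<in> tuples ?m (univ M) \<and>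
        map (\<lambda>i. emb (xs ! i)) is \<in> rel M (In R) \<and> ?vs = map ?u is \<and> is \<notin> X)"
  proof -
    have iff: "map ?u is \<in> map ?u ` X \<longleftrightarrow> is \<in> X" if "is \<in> tuples ?m {..<length xs}" for "is"
    proof (rule map_mem_image_iff[where A = "{..<length us}"])
      show "inj_on ?u {..<length us}" using d by (auto simp: inj_on_def nth_eq_iff_index_eq)
    qed (use that lx X(2) in \<open>auto simp: tuples_def\<close>)
    show ?thesis (is "?A \<longleftrightarrow> ?B")
    proof
      assume ?A
      then obtain "is" where "is": "is \<in> tuples ?m {..<length xs}" "?vs = map ?u is"
        "map (\<lambda>i. emb (xs ! i)) is \<in> tuples ?m (univ M)" "map (\<lambda>i. emb (xs ! i)) is \<in> rel M (In R)"
        "?vs \<notin> map ?u ` X" unfolding X(1) by blast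
      have "is \<notin> X" using "is"(5) unfolding "is"(2) iff[OF "is"(1)] .
      with "is" show ?B by blast
    next
      assume ?B
      then obtain "is" where "is": "is \<in> tuples ?m {..<length xs}" "?vs = map ?u is"
        "map (\<lambda>i. emb (xs ! i)) is \<in> tuples ?m (univ M)" "map (\<lambda>i. emb (xs ! i)) is \<in> rel M (In R)"
        "is \<notin> X" by blast
      have "?vs \<notin> map ?u ` X" using "is"(5) unfolding "is"(2) iff[OF "is"(1)] .
      with "is" show ?A unfolding X(1) by blast
    qed
  qed
  also have "\<dots> \<longleftrightarrow> (\<exists>is \<in> {is \<in> tuples ?m {..<length xs}. map (\<lambda>i. xs ! i) is \<in> rel D R} - X. ?vs = map ?u is)"
  proof -
    have "map (\<lambda>i. emb (xs ! i)) is \<in> tuples ?m (univ M)" if "is \<in> tuples ?m {..<length xs}" for "is"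
    proof -
      have "emb (xs ! i) \<in> univ M" if "i < length xs" for i using nums_univ[OF n that] .
      then show ?thesis using \<open>is \<in> _\<close> by (auto simp: tuples_def)
    qed
    moreover have "map (\<lambda>i. emb (xs ! i)) is \<in> rel M (In R) \<longleftrightarrow> map (\<lambda>i. xs ! i) is \<in> rel D R" for "is"
    proof -
      have "map emb (map (\<lambda>i. xs ! i) is) \<in> map emb ` rel D R \<longleftrightarrow> map (\<lambda>i. xs ! i) is \<in> rel D R"
        by (rule map_mem_image_iff[OF inj_emb, of _ UNIV]) auto
      then show ?thesis using i by (simp add: inputs_def o_def)
    qed
    ultimately show ?thesis by blast
  qed
  finally show "sat M \<sigma> (missing v R b f) \<longleftrightarrow>
      (\<exists>is \<in> {is \<in> tuples ?m {..<length xs}. map (\<lambda>i. xs ! i) is \<in> rel D R} - X. ?vs = map ?u is)" .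
qed

section \<open>Selecting new codes among the tuples over active elements and the constants\<close>

definition tuple_code :: "nat \<Rightarrow> nat \<Rightarrow> nat \<Rightarrow> (('r, 'c, 'r sym) vsym, unit) formula" where
  "tuple_code v b f = fm_conjs (map (\<lambda>j. Exists f (Conj (at (Coord j) [v, f]) (num f (b + j)))) [0..<c])"

definition fresh_tuple :: "nat \<Rightarrow> nat \<Rightarrow> (('r, 'c, 'r sym) vsym, unit) formula" where
  "fresh_tuple b f = Exists f (Conj (tuple_code f b (Suc f)) (Neg (leq f f)))"

text \<open>Tuples are ordered by the numbers of their components, so the least one that is not a
  code yet is definable. Starting at variable 20 keeps the quantified block clear of the small
  variables to which selectors are applied.\<close>

definition sel_tuple :: "nat \<Rightarrow> (('r, 'c, 'r sym) vsym, unit) formula" where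
  "sel_tuple i = fm_exs 20 c (Conj (lex_min c fresh_tuple 20 (20 + c)) (tuple_code i 20 (20 + c)))"

lemma sat_tuple_code:
  assumes cd: "codes M us" and n: "nums M us xs" and i: "inputs M D a"
    and f: "v < f" "b + c \<le> f"
  shows "sat M \<sigma> (tuple_code v b f) \<longleftrightarrow> (\<exists>is \<in> tuples c {..<length xs}.
    \<sigma> v = (1, map (\<lambda>i. xs ! i) is) \<and> map \<sigma> [b..<b + c] = map (\<lambda>i. us ! i) is)"
proof -
  let ?vs = "map \<sigma> [b..<b + c]"
  have xs_in: "xs ! j \<in> univ D" if "j < length xs" for j
    using nums_univ[OF n that] emb_univ[OF i] by simp
  have "sat M \<sigma> (tuple_code v b f) \<longleftrightarrow>
      (\<forall>j < c. \<exists>d \<in> univ M. [\<sigma> v, d] \<in> rel M (Coord j) \<and> [d, ?vs ! j] \<in> rel M (Sto Num))"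
    unfolding tuple_code_def sat_fm_conjs_upt using f by simp
  also have "\<dots> \<longleftrightarrow> (\<exists>ys \<in> tuples c (univ D). \<sigma> v = (1, ys) \<and>
      (\<forall>j < c. [map emb ys ! j, ?vs ! j] \<in> rel M (Sto Num)))" (is "?A \<longleftrightarrow> ?B")
  proof
    assume A: ?A
    \<comment> \<open>As \<open>0 < c\<close>, there is a coordinate 0, and it forces
      \<open>\<sigma> v\<close> to carry tag 1.\<close>
    then obtain d where "[\<sigma> v, d] \<in> rel M (Coord 0)" using c by blast
    then obtain ys where ys: "ys \<in> tuples c (univ D)" "\<sigma> v = (1, ys)"
      using i c by (auto simp: inputs_def)
    have "[map emb ys ! j, ?vs ! j] \<in> rel M (Sto Num)" if j: "j < c" for j
    proof -
      obtain d where d: "[\<sigma> v, d] \<in> rel M (Coord j)" "[d, ?vs ! j] \<in> rel M (Sto Num)" using A j by blast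
      have "d = emb (ys ! j)" using d(1) i j ys(2) by (auto simp: inputs_def)
      with d(2) j ys(1) show ?thesis by (simp add: tuples_def)
    qed
    with ys show ?B by blast
  next
    assume ?B
    then obtain ys where ys: "ys \<in> tuples c (univ D)" "\<sigma> v = (1, ys)"
      "\<forall>j < c. [map emb ys ! j, ?vs ! j] \<in> rel M (Sto Num)" by blast
    show ?A
    proof (intro allI impI)
      fix j assume j: "j < c"
      have "ys ! j \<in> univ D" using ys(1) j nth_mem[of j ys] by (auto simp: tuples_def)
      then have "emb (ys ! j) \<in> univ M" using emb_univ[OF i] by blast
      moreover have "[\<sigma> v, emb (ys ! j)] \<in> rel M (Coord j)" using i j ys by (auto simp: inputs_def)
      moreover have "[emb (ys ! j), ?vs ! j] \<in> rel M (Sto Num)" using ys j by (simp add: tuples_def)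
      ultimately show "\<exists>d \<in> univ M. [\<sigma> v, d] \<in> rel M (Coord j) \<and> [d, ?vs ! j] \<in> rel M (Sto Num)" by blast
    qed
  qed
  also have "\<dots> \<longleftrightarrow> (\<exists>ys \<in> tuples c (univ D). \<sigma> v = (1, ys) \<and>
      (\<exists>is \<in> tuples c {..<length xs}. map emb ys = map (\<lambda>i. emb (xs ! i)) is \<and> ?vs = map (\<lambda>i. us ! i) is))"
  proof (intro bex_cong refl)
    fix ys assume "ys \<in> tuples c (univ D)"
    then have l: "length (map emb ys) = c" "length ?vs = c" by (simp_all add: tuples_def)
    show "(\<sigma> v = (1, ys) \<and> (\<forall>j < c. [map emb ys ! j, ?vs ! j] \<in> rel M (Sto Num))) \<longleftrightarrow> (\<sigma> v = (1, ys) \<and>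
        (\<exists>is \<in> tuples c {..<length xs}. map emb ys = map (\<lambda>i. emb (xs ! i)) is \<and> ?vs = map (\<lambda>i. us ! i) is))"
      unfolding nums_tuple[OF cd n l] ..
  qed
  also have "\<dots> \<longleftrightarrow> (\<exists>is \<in> tuples c {..<length xs}. \<sigma> v = (1, map (\<lambda>i. xs ! i) is) \<and>
      ?vs = map (\<lambda>i. us ! i) is)"
  proof -
    have eq: "map emb ys = map (\<lambda>i. emb (xs ! i)) is \<longleftrightarrow> ys = map (\<lambda>i. xs ! i) is" for ys "is"
    proof -
      have e: "map (\<lambda>i. emb (xs ! i)) is = map emb (map (\<lambda>i. xs ! i) is)" by simp
      show ?thesis unfolding e by (rule inj_map_eq_map[OF inj_emb])
    qed
    have mem: "map (\<lambda>i. xs ! i) is \<in> tuples c (univ D)" if ids: "is \<in> tuples c {..<length xs}" for "is"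
      using ids xs_in by (auto simp: tuples_def)
    show ?thesis unfolding eq
    proof (rule iffI; elim bexE conjE)
      fix ys "is" assume "\<sigma> v = (1, ys)" "is \<in> tuples c {..<length xs}" "ys = map (\<lambda>i. xs ! i) is"
        "?vs = map (\<lambda>i. us ! i) is"
      then show "\<exists>is \<in> tuples c {..<length xs}. \<sigma> v = (1, map (\<lambda>i. xs ! i) is) \<and>
          ?vs = map (\<lambda>i. us ! i) is" by (intro bexI[of _ "is"]) simp_all
    next
      fix "is" assume "is": "\<sigma> v = (1, map (\<lambda>i. xs ! i) is)" "is \<in> tuples c {..<length xs}"
        "?vs = map (\<lambda>i. us ! i) is"
      show "\<exists>ys \<in> tuples c (univ D). \<sigma> v = (1, ys) \<and> (\<exists>is \<in> tuples c {..<length xs}.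
          ys = map (\<lambda>i. xs ! i) is \<and> ?vs = map (\<lambda>i. us ! i) is)"
        by (intro bexI[OF _ mem[OF "is"(2)]] conjI bexI[OF _ "is"(2)] "is" refl)
    qed
  qed
  finally show ?thesis .
qed

lemma selects_sel_tuple:
  assumes cd: "codes M us" and n: "nums M us xs" and i: "inputs M D a"
    and X: "X = {is \<in> tuples c {..<length xs}. (1, map (\<lambda>i. xs ! i) is) \<notin> set us}"
  shows "selects M sel_tuple (if X = {} then None else Some (1, map (\<lambda>i. xs ! i) (Min X)))"
proof -
  let ?u = "\<lambda>i. us ! i" and ?x = "\<lambda>i. xs ! i"
  have lx: "length xs \<le> length us" and d: "distinct us" using cd n by (auto simp: codes_def nums_def)
  have Xt: "X \<subseteq> tuples c {..<length us}" using lx by (auto simp: X tuples_def)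
  have xU: "(1, map ?x is) \<in> univ M" if "is \<in> tuples c {..<length xs}" for "is"
  proof -
    have "xs ! j \<in> univ D" if "j < length xs" for j
      using nums_univ[OF n that] emb_univ[OF i] by simp
    then show ?thesis unfolding tuple_univ[OF i] using that by (auto simp: tuples_def)
  qed
  have fresh: "defines_tuples M us 0 \<sigma>\<^sub>0 c fresh_tuple X" for \<sigma>\<^sub>0
    unfolding defines_tuples_def
  proof (intro allI impI; elim conjE)
    fix \<sigma> b f assume b: "b + c \<le> f"
    have "sat M \<sigma> (fresh_tuple b f) \<longleftrightarrow> (\<exists>z \<in> univ M. (\<exists>is \<in> tuples c {..<length xs}.
        z = (1, map ?x is) \<and> map \<sigma> [b..<b + c] = map ?u is) \<and> z \<notin> set us)"
    proof -
      have "map (\<sigma>(f := z)) [b..<b + c] = map \<sigma> [b..<b + c]" for z using b by simp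
      then have "sat M (\<sigma>(f := z)) (tuple_code f b (Suc f)) \<longleftrightarrow> (\<exists>is \<in> tuples c {..<length xs}.
          z = (1, map ?x is) \<and> map \<sigma> [b..<b + c] = map ?u is)" for z
        using sat_tuple_code[OF cd n i, of f "Suc f" b "\<sigma>(f := z)"] b by simp
      then show ?thesis using codes_Ord_refl[OF cd] by (simp add: fresh_tuple_def)
    qed
    also have "\<dots> \<longleftrightarrow> (\<exists>is \<in> X. map \<sigma> [b..<b + c] = map ?u is)"
      unfolding X using xU by blast
    finally show "sat M \<sigma> (fresh_tuple b f) \<longleftrightarrow> (\<exists>is \<in> X. map \<sigma> [b..<b + c] = map ?u is)" .
  qed
  let ?Y = "if X = {} then {} else {Min X}"
  have fin: "finite X" using Xt finite_lists_length_eq[of "{..<length us}" c]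
    by (auto simp: tuples_def conj_commute elim: finite_subset)
  then have Y: "?Y \<subseteq> tuples c {..<length xs}" using Min_in[of X] by (auto simp: X)
  have "sat M \<sigma> (sel_tuple j) \<longleftrightarrow> (if X = {} then None else Some (1, map ?x (Min X))) = Some (\<sigma> j)"
    if j: "j < 4" for \<sigma> j
  proof -
    have "sat M \<sigma> (sel_tuple j) \<longleftrightarrow> (\<exists>ds \<in> tuples c (univ M). (\<exists>is \<in> ?Y. ds = map ?u is) \<and>
        (\<exists>is \<in> tuples c {..<length xs}. \<sigma> j = (1, map ?x is) \<and> ds = map ?u is))"
    proof -
      have "sat M (upds \<sigma> 20 ds) (lex_min c fresh_tuple 20 (20 + c)) \<longleftrightarrow> (\<exists>is \<in> ?Y. ds = map ?u is)"
        if ds: "ds \<in> tuples c (univ M)" for ds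
      proof -
        have l: "length ds = c" using ds by (simp add: tuples_def)
        have "upds \<sigma> 20 ds i \<in> univ M" if "i \<in> {20..<20 + c}" for i
        proof -
          have "i - 20 < length ds" "set ds \<subseteq> univ M" using that ds by (auto simp: tuples_def)
          then show ?thesis using that by (auto simp: upds_def)
        qed
        then show ?thesis
          using defines_tuples_lex_min[OF cd fresh[of \<sigma>] Xt, unfolded defines_tuples_def, rule_format,
              of "upds \<sigma> 20 ds" 20 "20 + c"] map_upds[of c ds \<sigma> 20] l by simp
      qed
      moreover have "sat M (upds \<sigma> 20 ds) (tuple_code j 20 (20 + c)) \<longleftrightarrow>
          (\<exists>is \<in> tuples c {..<length xs}. \<sigma> j = (1, map ?x is) \<and> ds = map ?u is)"
        if ds: "ds \<in> tuples c (univ M)" for ds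
        using sat_tuple_code[OF cd n i, of j "20 + c" 20 "upds \<sigma> 20 ds"] map_upds[of c ds \<sigma> 20] ds j
        by (simp add: tuples_def)
      ultimately show ?thesis unfolding sel_tuple_def sat_fm_exs sat.simps by blast
    qed
    also have "\<dots> \<longleftrightarrow> (\<exists>is \<in> ?Y. \<sigma> j = (1, map ?x is))"
    proof -
      have "map ?u is \<in> tuples c (univ M)" if "is \<in> tuples c {..<length xs}" for "is"
        using that lx univ_nth[OF cd] by (auto simp: tuples_def subset_iff)
      moreover have "map ?u is = map ?u js \<longleftrightarrow> is = js"
        if "is \<in> tuples c {..<length xs}" "js \<in> tuples c {..<length xs}" for "is" js
        using that lx by (intro map_nth_eq_iff[OF d]) (auto simp: tuples_def)
      ultimately show ?thesis using Y by blast
    qed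
    also have "\<dots> \<longleftrightarrow> (if X = {} then None else Some (1, map ?x (Min X))) = Some (\<sigma> j)" by auto
    finally show ?thesis .
  qed
  then show ?thesis by (simp add: selects_def)
qed

text \<open>A constant is added at most once: from the second change on this selects
  nothing.\<close>

definition sel_bot :: "nat \<Rightarrow> nat \<Rightarrow> (('r, 'c, 'r sym) vsym, unit) formula" where
  "sel_bot g i = Conj (at (Bot g) [i]) (Neg (leq i i))"

lemma selects_sel_bot:
  assumes "codes M us" "inputs M D a" "g < B"
  shows "selects M (sel_bot g) (if (g + 2, []) \<in> set us then None else Some (g + 2, []))"
  using assms codes_Ord_refl[OF assms(1)] by (auto simp: selects_def sel_bot_def inputs_def)

lemma selects_at: "rel M Z = {[x]} \<Longrightarrow> selects M (\<lambda>i. at Z [i]) (Some x)"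
  by (auto simp: selects_def)

subsection \<open>Updating the input relations\<close>

text \<open>The base structure shows the input before the change, but the replay and the answer have
  to compare the threads with the input after it.\<close>

definition update_input :: "'r change_type \<Rightarrow> ('r, 'c, 'r sym) vsym \<Rightarrow>
    (('r, 'c, 'r sym) vsym, unit) formula" where
  "update_input \<delta> = (let R = changed_rel \<delta>;
       \<phi> = fm_conjs (map (\<lambda>j. at (Chg j) [j]) [0..<arity \<tau> R]) in
     (ident va)(In R := (case \<delta> of Ins _ \<Rightarrow> fm_or (ident va (In R)) \<phi>
                               | Del _ \<Rightarrow> Conj (ident va (In R)) (Neg \<phi>))))"

lemma rel_update_input_other:
  "wf_rels va M \<Longrightarrow> Z \<noteq> In (changed_rel \<delta>) \<Longrightarrow> rel (transform va (update_input \<delta>) M) Z = rel M Z"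
  by (rule rel_transform_ident) (auto simp: update_input_def Let_def)

lemma inputs_update_input:
  assumes wf: "wf_rels va M" and i: "inputs M D a" and a: "a \<in> tuples (arity \<tau> (changed_rel \<delta>)) (univ D)"
  shows "inputs (transform va (update_input \<delta>) M) (apply_change (\<delta>, a) D) a"
proof -
  let ?M = "transform va (update_input \<delta>) M" and ?R = "changed_rel \<delta>"
  have "vs \<in> rel ?M (In ?R) \<longleftrightarrow> vs \<in> map emb ` rel (apply_change (\<delta>, a) D) ?R" for vs
  proof -
    have sub: "map emb ` rel D ?R \<subseteq> tuples (arity \<tau> ?R) (univ M)"
      using wf i unfolding wf_rels_def inputs_def by (metis tuple_program.varity.simps(1))
    have aU: "map emb a \<in> tuples (arity \<tau> ?R) (univ M)"
      using a emb_univ[OF i] by (auto simp: tuples_def)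
    have \<phi>: "sat M (\<lambda>i. vs ! i) (fm_conjs (map (\<lambda>j. at (Chg j) [j]) [0..<arity \<tau> ?R])) \<longleftrightarrow> vs = map emb a"
      if "vs \<in> tuples (arity \<tau> ?R) (univ M)"
      unfolding sat_fm_conjs_upt using that a i by (auto simp: tuples_def inputs_def list_eq_iff_nth_eq)
    have id: "sat M (\<lambda>i. vs ! i) (ident va (In ?R)) \<longleftrightarrow> vs \<in> map emb ` rel D ?R"
      if "vs \<in> tuples (arity \<tau> ?R) (univ M)"
      using sat_ident[where ar = va and Z = "In ?R" and M = M and vs = vs and A = "univ M"] that i
      by (simp add: inputs_def)
    show ?thesis
    proof (cases \<delta>)
      case (Ins R)
      then show ?thesis using sub aU \<phi> id
        by (auto simp: mem_transform update_input_def Let_def)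
    next
      case (Del R)
      have "map emb a \<notin> map emb ` (rel D R - {a})"
        using map_mem_image_iff[OF inj_emb, of a UNIV "rel D R - {a}"] by auto
      then have "vs \<in> map emb ` (rel D R - {a}) \<longleftrightarrow> vs \<in> map emb ` rel D R \<and> vs \<noteq> map emb a" by blast
      then show ?thesis using Del sub \<phi> id
        by (auto simp: mem_transform update_input_def Let_def)
    qed
  qed
  then have "rel ?M (In R) = map emb ` rel (apply_change (\<delta>, a) D) R" for R
  proof (cases "R = ?R")
    case False
    then show ?thesis using rel_update_input_other[OF wf, of "In R" \<delta>] i
      by (simp add: inputs_def rel_apply_change)
  qed auto
  then show ?thesis
    using i rel_update_input_other[OF wf, of _ \<delta>] by (auto simp: inputs_def)
qed

end

section \<open>The simulation\<close>

locale arith_program = threads \<tau> P L Pl Ti c B k cl Rl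
  for \<tau> :: "('r, 'c) schema" and P :: "('r, 'c) dyn_program" and L Pl Ti c B k :: nat
    and cl :: "'c list" and Rl :: "'r list" +
  fixes q :: "('a, 'r, 'c) query"
  assumes inf: "infinite (UNIV :: 'a set)" and q: "is_query \<tau> k q" and di: "domain_independent \<tau> q"
    and main: "\<And>D r. initial_database \<tau> D \<Longrightarrow> linear_order_on (univ D) r \<Longrightarrow>
      maintains_from \<tau> P q (D, (\<lambda>S. {})(L := order_rel (univ D) r, Pl := plus_rel (univ D) r,
        Ti := times_rel (univ D) r))"
begin

text \<open>The input in terms of numbers, and so directly comparable with the database of a
  thread.\<close>

definition index_tuples :: "('a, 'r, 'c) database \<Rightarrow> 'a list \<Rightarrow> 'r \<Rightarrow> nat list set" where
  "index_tuples D xs R = {is \<in> tuples (arity \<tau> R) {..<length xs}. map (\<lambda>i. xs ! i) is \<in> rel D R}"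

definition active :: "('a, 'r, 'c) database \<Rightarrow> 'a list \<Rightarrow> bool" where
  "active D xs \<longleftrightarrow> distinct xs \<and> set xs \<subseteq> univ D \<and> ran (con D) \<subseteq> set xs \<and>
     (\<forall>R \<in> rel_syms \<tau>. rel D R \<subseteq> tuples (arity \<tau> R) (set xs))"

text \<open>The given program is correct only along legal runs from its initial state. So the
  existence of a history belongs to the invariant although the history is not stored.\<close>

definition reachable :: "nat \<Rightarrow> (nat, 'r, 'c) state \<Rightarrow> bool" where
  "reachable w s \<longleftrightarrow> (\<exists>\<kappa> cs. dom \<kappa> = con_syms \<tau> \<and> ran \<kappa> \<subseteq> {..w} \<and>
     (\<forall>ch \<in> set cs. is_change \<tau> {..w} ch) \<and> s = fold (step P) cs (init_state w \<kappa>))"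

definition sound :: "('a, 'r, 'c) database \<Rightarrow> 'a list \<Rightarrow> (nat, 'r, 'c) state \<Rightarrow> bool" where
  "sound D xs s \<longleftrightarrow> (\<forall>d \<in> con_syms \<tau>. \<exists>i < length xs. con (fst s) d = Some i \<and> con D d = Some (xs ! i)) \<and>
     (\<forall>R \<in> rel_syms \<tau>. rel (fst s) R \<subseteq> index_tuples D xs R)"

lemma init_state_simps [simp]: "univ (fst (init_state w \<kappa>)) = {..w}" "con (fst (init_state w \<kappa>)) = \<kappa>"
  "rel (fst (init_state w \<kappa>)) R = {}" "snd (init_state w \<kappa>) = arith_aux w"
  by (simp_all add: init_state_def)

lemma reachable_valid: "reachable w s \<Longrightarrow> valid_state \<tau> P s \<and> univ (fst s) = {..w}"
  unfolding reachable_def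
proof (elim exE conjE)
  fix \<kappa> cs assume "dom \<kappa> = con_syms \<tau>" "ran \<kappa> \<subseteq> {..w}" "\<forall>ch \<in> set cs. is_change \<tau> {..w} ch"
    "s = fold (step P) cs (init_state w \<kappa>)"
  then show ?thesis using valid_state_fold_step[OF valid_init_state, of \<kappa> w cs] by simp
qed

lemma reachable_step:
  assumes "reachable w s" "is_change \<tau> {..w} ch"
  shows "reachable w (step P ch s)"
proof -
  obtain \<kappa> cs where *: "dom \<kappa> = con_syms \<tau>" "ran \<kappa> \<subseteq> {..w}" "\<forall>ch \<in> set cs. is_change \<tau> {..w} ch"
    "s = fold (step P) cs (init_state w \<kappa>)"
    using assms(1) unfolding reachable_def by blast
  then have "step P ch s = fold (step P) (cs @ [ch]) (init_state w \<kappa>)" by simp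
  moreover have "\<forall>ch \<in> set (cs @ [ch]). is_change \<tau> {..w} ch" using * assms(2) by auto
  ultimately show ?thesis unfolding reachable_def using * by blast
qed

section \<open>From numbers back to linearly ordered domains\<close>

lemma image_order_iff:
  assumes e: "inj_on e {..w}" and ij: "i \<le> w" "j \<le> w"
  shows "(e i, e j) \<in> {(e i, e j) |i j. i \<le> j \<and> j \<le> (w::nat)} \<longleftrightarrow> i \<le> j"
proof
  assume "(e i, e j) \<in> {(e i, e j) |i j. i \<le> j \<and> j \<le> w}"
  then obtain i' j' where *: "e i = e i'" "e j = e j'" "i' \<le> j'" "j' \<le> w" by blast
  have "i = i'" by (rule inj_onD[OF e *(1)]) (use ij * in auto)
  moreover have "j = j'" by (rule inj_onD[OF e *(2)]) (use ij * in auto)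
  ultimately show "i \<le> j" using * by simp
qed (use ij in blast)

lemma rank_image:
  assumes e: "inj_on e {..w}" and i: "i \<le> w"
  shows "rank (e ` {..w}) {(e i, e j) |i j. i \<le> j \<and> j \<le> w} (e i) = i"
proof -
  have "{y \<in> e ` {..w}. (y, e i) \<in> {(e i, e j) |i j. i \<le> j \<and> j \<le> w} \<and> y \<noteq> e i} = e ` {..<i}"
  proof (intro set_eqI iffI)
    fix y assume y: "y \<in> {y \<in> e ` {..w}. (y, e i) \<in> {(e i, e j) |i j. i \<le> j \<and> j \<le> w} \<and> y \<noteq> e i}"
    then obtain j where j: "j \<le> w" "y = e j" by blast
    with y image_order_iff[OF e j(1) i] have "j \<le> i" "j \<noteq> i" by auto
    with j show "y \<in> e ` {..<i}" by auto
  next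
    fix y assume "y \<in> e ` {..<i}"
    then obtain j where j: "j < i" "y = e j" by blast
    then have "(y, e i) \<in> {(e i, e j) |i j. i \<le> j \<and> j \<le> w}"
      using image_order_iff[OF e _ i, of j] i by simp
    moreover have "e j \<noteq> e i"
    proof
      assume eq: "e j = e i"
      have "j = i" by (rule inj_onD[OF e eq]) (use j i in auto)
      with j show False by simp
    qed
    moreover have "y \<in> e ` {..w}" using j i by simp
    ultimately show "y \<in> {y \<in> e ` {..w}. (y, e i) \<in> {(e i, e j) |i j. i \<le> j \<and> j \<le> w} \<and> y \<noteq> e i}"
      unfolding j(2) by blast
  qed
  moreover have "inj_on e {..<i}" by (rule inj_on_subset[OF e]) (use i in auto)
  ultimately show ?thesis by (simp add: rank_def card_image)
qed

text \<open>With the order transported along \<open>e\<close>, the rank of \<open>e i\<close> is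
  \<open>i\<close>. So a thread starts in an isomorphic copy of an official initial state of
  \<open>DynFO_arith\<close>.\<close>

lemma image_arith_aux:
  assumes e: "inj_on e {..w}"
  defines "r \<equiv> {(e i, e j) |i j. i \<le> j \<and> j \<le> w}"
  shows "(\<lambda>S. map e ` arith_aux w S) = (\<lambda>S. {})(L := order_rel (e ` {..w}) r, Pl := plus_rel (e ` {..w}) r,
    Ti := times_rel (e ` {..w}) r)"
proof -
  have rk: "rank (e ` {..w}) r (e i) = i" if "i \<le> w" for i
    unfolding r_def by (rule rank_image[OF e that])
  have 1: "map e ` {[i, j] |i j. i \<le> j \<and> j \<le> w} = order_rel (e ` {..w}) r"
  proof
    show "order_rel (e ` {..w}) r \<subseteq> map e ` {[i, j] |i j. i \<le> j \<and> j \<le> w}"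
    proof
      fix t assume "t \<in> order_rel (e ` {..w}) r"
      then obtain i j where "t = [e i, e j]" "i \<le> j" "j \<le> w" by (auto simp: order_rel_def r_def)
      then show "t \<in> map e ` {[i, j] |i j. i \<le> j \<and> j \<le> w}"
        by (intro image_eqI[of _ _ "[i, j]"]) auto
    qed
    show "map e ` {[i, j] |i j. i \<le> j \<and> j \<le> w} \<subseteq> order_rel (e ` {..w}) r"
    proof
      fix t assume "t \<in> map e ` {[i, j] |i j. i \<le> j \<and> j \<le> w}"
      then obtain i j where "t = [e i, e j]" "i \<le> j" "j \<le> w" by auto
      moreover then have "(e i, e j) \<in> r" unfolding r_def by blast
      ultimately show "t \<in> order_rel (e ` {..w}) r" by (auto simp: order_rel_def)
    qed
  qed
  have 2: "map e ` {[i, j, i + j] |i j. i + j \<le> w} = plus_rel (e ` {..w}) r"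
  proof
    show "map e ` {[i, j, i + j] |i j. i + j \<le> w} \<subseteq> plus_rel (e ` {..w}) r"
      using rk by (auto simp: plus_rel_def)
    show "plus_rel (e ` {..w}) r \<subseteq> map e ` {[i, j, i + j] |i j. i + j \<le> w}"
    proof
      fix t assume "t \<in> plus_rel (e ` {..w}) r"
      then obtain i j l where "t = [e i, e j, e l]" "i \<le> w" "j \<le> w" "l \<le> w" "i + j = l"
        using rk by (auto simp: plus_rel_def)
      then show "t \<in> map e ` {[i, j, i + j] |i j. i + j \<le> w}"
        by (intro image_eqI[of _ _ "[i, j, i + j]"]) auto
    qed
  qed
  have 3: "map e ` {[i, j, i * j] |i j. i \<le> w \<and> j \<le> w \<and> i * j \<le> w} = times_rel (e ` {..w}) r"
  proof
    show "map e ` {[i, j, i * j] |i j. i \<le> w \<and> j \<le> w \<and> i * j \<le> w} \<subseteq> times_rel (e ` {..w}) r"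
      using rk by (auto simp: times_rel_def)
    show "times_rel (e ` {..w}) r \<subseteq> map e ` {[i, j, i * j] |i j. i \<le> w \<and> j \<le> w \<and> i * j \<le> w}"
    proof
      fix t assume "t \<in> times_rel (e ` {..w}) r"
      then obtain i j l where "t = [e i, e j, e l]" "i \<le> w" "j \<le> w" "l \<le> w" "i * j = l"
        using rk by (auto simp: times_rel_def)
      then show "t \<in> map e ` {[i, j, i * j] |i j. i \<le> w \<and> j \<le> w \<and> i * j \<le> w}"
        by (intro image_eqI[of _ _ "[i, j, i * j]"]) auto
    qed
  qed
  show ?thesis using arith(2) 1 2 3 by (auto simp: arith_aux_def fun_eq_iff)
qed

lemma linear_order_image:
  assumes e: "inj_on e {..w}"
  shows "linear_order_on (e ` {..w}) {(e i, e j) |i j. i \<le> j \<and> j \<le> (w::nat)}"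
proof -
  let ?r = "{(e i, e j) |i j. i \<le> j \<and> j \<le> w}"
  have mem: "(e i, e j) \<in> ?r \<longleftrightarrow> i \<le> j" if "i \<le> w" "j \<le> w" for i j
    by (rule image_order_iff[OF e that])
  have sub: "?r \<subseteq> e ` {..w} \<times> e ` {..w}" by auto
  have "refl_on (e ` {..w}) ?r" by (auto simp: refl_on_def)
  moreover have "trans ?r"
  proof (rule transI)
    fix x y z assume "(x, y) \<in> ?r" "(y, z) \<in> ?r"
    then obtain i j l where "x = e i" "y = e j" "z = e l" "i \<le> w" "j \<le> w" "l \<le> w"
      using sub by blast
    with mem[of i j] mem[of j l] mem[of i l] \<open>(x, y) \<in> ?r\<close> \<open>(y, z) \<in> ?r\<close> show "(x, z) \<in> ?r" by simp
  qed
  moreover have "antisym ?r"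
  proof (rule antisymI)
    fix x y assume "(x, y) \<in> ?r" "(y, x) \<in> ?r"
    then obtain i j where "x = e i" "y = e j" "i \<le> w" "j \<le> w" using sub by blast
    with mem[of i j] mem[of j i] \<open>(x, y) \<in> ?r\<close> \<open>(y, x) \<in> ?r\<close> show "x = y" by simp
  qed
  moreover have "total_on (e ` {..w}) ?r"
  proof (rule total_onI)
    fix x y assume "x \<in> e ` {..w}" "y \<in> e ` {..w}"
    then obtain i j where "x = e i" "y = e j" "i \<le> w" "j \<le> w" by blast
    with mem[of i j] mem[of j i] show "(x, y) \<in> ?r \<or> (y, x) \<in> ?r" by (simp add: nat_le_linear)
  qed
  ultimately show ?thesis
    using sub by (simp add: linear_order_on_def partial_order_on_def preorder_on_def)
qed

text \<open>Domain independence allows the removal of all inactive elements from the domain. The new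
  element \<open>z\<close> keeps the domain nonempty when nothing is active, and it cannot enter the
  answer because it lies outside \<open>univ D\<close>.\<close>

lemma answer_subset:
  assumes D: "is_database \<tau> D" and xs: "active D xs"
  shows "q D \<subseteq> tuples k (set xs)"
proof
  fix b assume b: "b \<in> q D"
  obtain z where z: "z \<notin> univ D"
    using inf D unfolding is_database_def by (meson ex_new_if_finite)
  let ?D = "D\<lparr>univ := insert z (set xs)\<rparr>"
  have sub: "tuples m (set xs) \<subseteq> tuples m (insert z (set xs))" for m by (auto simp: tuples_def)
  have db: "is_database \<tau> ?D"
    unfolding is_database_def
  proof (intro conjI ballI allI impI)
    show "rel ?D R \<subseteq> tuples (arity \<tau> R) (univ ?D)" if "R \<in> rel_syms \<tau>" for R
      using xs that sub[of "arity \<tau> R"] by (simp add: active_def) blast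
    show "rel ?D R = {}" if "R \<notin> rel_syms \<tau>" for R using D that by (simp add: is_database_def)
    show "dom (con ?D) = con_syms \<tau>" using D by (simp add: is_database_def)
    show "ran (con ?D) \<subseteq> univ ?D" using xs by (simp add: active_def) blast
  qed simp_all
  then have "q ?D = q D" using di[unfolded domain_independent_def, rule_format, of ?D D] D by simp
  with b q D db have "b \<in> tuples k (univ D)" "b \<in> tuples k (insert z (set xs))"
    unfolding is_query_def by fastforce+
  with z show "b \<in> tuples k (set xs)" by (auto simp: tuples_def)
qed

lemma extend_enumeration:
  assumes "distinct (xs :: 'a list)" "length xs \<le> Suc w"
  obtains e where "inj_on e {..w}" "\<forall>i < length xs. e i = xs ! i"
proof -
  have "infinite (UNIV - set xs)" using inf by simp
  then obtain F where F: "finite F" "card F = Suc w - length xs" "F \<subseteq> UNIV - set xs"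
    using infinite_arbitrarily_large by blast
  obtain zs where zs: "set zs = F" "distinct zs" using finite_distinct_list[OF F(1)] by blast
  then have len: "length (xs @ zs) = Suc w" using F(2) assms(2) distinct_card[of zs] by simp
  have "distinct (xs @ zs)" using assms zs F(3) by auto
  then have "inj_on (\<lambda>i. (xs @ zs) ! i) {..w}"
    using len by (auto simp: inj_on_def nth_eq_iff_index_eq less_Suc_eq_le[symmetric] simp del: length_append)
  then show thesis by (rule that) (simp add: nth_append)
qed

text \<open>Sending the first numbers to the active elements and the others to arbitrary new ones
  turns the history of the thread into a run of the arithmetic program on real elements. If nothing
  is missing, the database at its end agrees with \<open>D\<close> in all relations and constants,
  so domain independence identifies the answers.\<close>

lemma thread_answer:
  assumes D: "is_database \<tau> D" and xs: "active D xs" and s: "reachable w s" "sound D xs s"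
    and w: "length xs \<le> Suc w" and caught: "\<And>R. R \<in> rel_syms \<tau> \<Longrightarrow> index_tuples D xs R \<subseteq> rel (fst s) R"
    and ids: "is \<in> tuples k {..<length xs}"
  shows "is \<in> snd s (answer P) \<longleftrightarrow> map (\<lambda>i. xs ! i) is \<in> q D"
proof -
  have dx: "distinct xs" using xs by (simp add: active_def)
  obtain e where e: "inj_on e {..w}" "\<forall>i < length xs. e i = xs ! i"
    by (rule extend_enumeration[OF dx w])
  obtain \<kappa> cs where r: "dom \<kappa> = con_syms \<tau>" "ran \<kappa> \<subseteq> {..w}" "\<forall>ch \<in> set cs. is_change \<tau> {..w} ch"
    "s = fold (step P) cs (init_state w \<kappa>)"
    using s(1) unfolding reachable_def by blast
  let ?cs = "map (apsnd (map e)) cs" and ?D0 = "image_db e (fst (init_state w \<kappa>))"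
  have v0: "valid_state \<tau> P (init_state w \<kappa>)" by (rule valid_init_state[OF r(1,2)])
  have vs: "valid_state \<tau> P s" "univ (fst s) = {..w}" using reachable_valid[OF s(1)] by auto
  have conS: "con (fst s) = \<kappa>" by (simp add: r(4))
  have run: "fold (step P) ?cs (image_state e (init_state w \<kappa>)) = image_state e s"
    unfolding r(4) by (rule fold_step_image[OF P v0]) (use e r in auto)
  have init: "initial_database \<tau> ?D0"
    using r by (auto simp: initial_database_def is_database_def ran_def dom_def)
  have "maintains_from \<tau> P q (image_state e (init_state w \<kappa>))"
    using main[OF init, of "{(e i, e j) |i j. i \<le> j \<and> j \<le> w}"] linear_order_image[OF e(1)]
      image_arith_aux[OF e(1)] by (simp add: image_state_def)
  moreover have "\<forall>ch \<in> set ?cs. is_change \<tau> (univ (fst (image_state e (init_state w \<kappa>)))) ch"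
    using r(3) by (fastforce simp: is_change_def image_state_def tuples_def)
  ultimately have ans: "map e ` snd s (answer P) = q (image_db e (fst s))"
    unfolding maintains_from_def using run by (fastforce simp: image_state_def)
  have eq_xs: "map e js = map (\<lambda>i. xs ! i) js" if "js \<in> tuples m {..<length xs}" for js m
    using that e(2) by (auto simp: tuples_def)
  have relR: "map e ` rel (fst s) R = rel D R" for R
  proof (cases "R \<in> rel_syms \<tau>")
    case True
    then have "rel (fst s) R = index_tuples D xs R" using s(2) caught by (auto simp: sound_def)
    then have "map e ` rel (fst s) R = (\<lambda>js. map (\<lambda>i. xs ! i) js) ` index_tuples D xs R"
      using eq_xs by (auto simp: index_tuples_def intro!: image_cong)
    also have "\<dots> = rel D R"
    proof
      show "rel D R \<subseteq> (\<lambda>js. map (\<lambda>i. xs ! i) js) ` index_tuples D xs R"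
      proof
        fix b assume b: "b \<in> rel D R"
        then have bt: "b \<in> tuples (arity \<tau> R) (set xs)" using xs True by (auto simp: active_def)
        obtain js where "js \<in> tuples (arity \<tau> R) {..<length xs}" "b = map (\<lambda>i. xs ! i) js"
          by (rule tuples_set_nth[OF bt])
        then show "b \<in> (\<lambda>js. map (\<lambda>i. xs ! i) js) ` index_tuples D xs R"
          using b by (intro image_eqI[of _ _ js]) (auto simp: index_tuples_def)
      qed
    qed (auto simp: index_tuples_def)
    finally show ?thesis .
  next
    case False
    then show ?thesis using D vs by (simp add: is_database_def valid_state_def)
  qed
  have con_eq: "map_option e (con (fst s) d) = con D d" for d
  proof (cases "d \<in> con_syms \<tau>")
    case True
    then show ?thesis using s(2) e(2) by (fastforce simp: sound_def)
  next
    case False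
    then have "con (fst s) d = None" "con D d = None"
      using D r(1) by (auto simp: is_database_def conS)
    then show ?thesis by simp
  qed
  have De: "is_database \<tau> (image_db e (fst s))"
    unfolding is_database_def
  proof (intro conjI ballI allI impI)
    fix R assume R: "R \<in> rel_syms \<tau>"
    then have "rel (fst s) R \<subseteq> tuples (arity \<tau> R) {..w}" using vs by (auto simp: valid_state_def is_database_def)
    then show "rel (image_db e (fst s)) R \<subseteq> tuples (arity \<tau> R) (univ (image_db e (fst s)))"
      using vs by (fastforce simp: tuples_def)
  qed (use vs r(1,2) conS in \<open>auto simp: valid_state_def is_database_def ran_def dom_def\<close>)
  have "rel (image_db e (fst s)) = rel D" "con (image_db e (fst s)) = con D"
    using relR con_eq by (auto simp: fun_eq_iff)
  with De D have "q (image_db e (fst s)) = q D" using di unfolding domain_independent_def by blast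
  with ans have "map e ` snd s (answer P) = q D" by simp
  moreover have "map e is \<in> map e ` snd s (answer P) \<longleftrightarrow> is \<in> snd s (answer P)"
  proof (rule map_mem_image_iff[OF e(1)])
    show "set is \<subseteq> {..w}" using ids w by (auto simp: tuples_def)
    show "set js \<subseteq> {..w}" if "js \<in> snd s (answer P)" for js
      using vs that by (fastforce simp: valid_state_def tuples_def)
  qed
  ultimately show ?thesis using eq_xs[OF ids] by simp
qed

text \<open>Variable \<open>k\<close> guesses a thread. The second conjunct says that its domain
  contains all numbers in use, the third that it lacks no tuple. All such threads give the same
  correct answer, so the guess need not be unique.\<close>

definition answer_fm :: "(('r, 'c, 'r sym) vsym, unit) formula" where
  "answer_fm = Exists k (fm_conjs (leq k k #
     fm_all (Suc k) (fm_all (Suc (Suc k)) (fm_imp (num (Suc k) (Suc (Suc k))) (leq (Suc (Suc k)) k))) #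
     fm_conjs (map (\<lambda>R. Neg (fm_exs (Suc k) (arity \<tau> R) (missing k R (Suc k) (Suc k + arity \<tau> R)))) Rl) #
     [fm_exs (Suc k) k (Conj (fm_conjs (map (\<lambda>j. num j (Suc k + j)) [0..<k]))
        (at (Sto (TAux (answer P))) (k # [Suc k..<Suc k + k])))]))"

definition answer_update :: "('r, 'c, 'r sym) vsym \<Rightarrow> (('r, 'c, 'r sym) vsym, unit) formula" where
  "answer_update = (ident va)(Sto Ans := answer_fm)"

lemma rel_answer_update_other:
  "wf_rels va M \<Longrightarrow> Z \<noteq> Sto Ans \<Longrightarrow> rel (transform va answer_update M) Z = rel M Z"
  by (rule rel_transform_ident) (auto simp: answer_update_def)

text \<open>This will be claimed only for threads with \<open>length xs \<le> Suc w\<close>. As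
  \<open>xs\<close> only grows, the others are lost for good and nothing is recorded about
  them.\<close>

definition live :: "(nat \<times> 'a list, ('r, 'c, 'r sym) vsym, unit) database \<Rightarrow> (nat \<times> 'a list) list \<Rightarrow>
    'a list \<Rightarrow> ('a, 'r, 'c) database \<Rightarrow> nat \<Rightarrow> (nat, 'r, 'c) state \<Rightarrow> bool" where
  "live M us xs D w s \<longleftrightarrow> thread M us w s \<and> reachable w s \<and> sound D xs s"

text \<open>Every thread accepted by the formula answers correctly, and the thread
  \<open>w\<^sub>0\<close> ensures that at least one is accepted.\<close>

lemma rel_answer_update:
  assumes cd: "codes M us" and n: "nums M us xs" and i: "inputs M D a" and D: "is_database \<tau> D"
    and xs: "active D xs"
    and live: "\<And>w. w < length us \<Longrightarrow> length xs \<le> Suc w \<Longrightarrow> \<exists>s. live M us xs D w s"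
    and ready: "w\<^sub>0 < length us" "length xs \<le> Suc w\<^sub>0" "live M us xs D w\<^sub>0 s\<^sub>0"
      "\<And>R. R \<in> rel_syms \<tau> \<Longrightarrow> index_tuples D xs R \<subseteq> rel (fst s\<^sub>0) R"
    and b: "b \<in> tuples k (univ D)"
  shows "map emb b \<in> rel (transform va answer_update M) (Sto Ans) \<longleftrightarrow> b \<in> q D"
proof -
  let ?\<sigma> = "\<lambda>i. map emb b ! i" and ?u = "\<lambda>i. us ! i"
  have lb: "length b = k" using b by (simp add: tuples_def)
  have bU: "map emb b \<in> tuples k (univ M)" using b emb_univ[OF i] by (auto simp: tuples_def)
  have lx: "length xs \<le> length us" using n by (simp add: nums_def)
  define caught where "caught w s \<longleftrightarrow> (\<forall>R \<in> rel_syms \<tau>. index_tuples D xs R \<subseteq> rel (fst s) R)" for w :: nat and s :: "(nat, 'r, 'c) state"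
  \<comment> \<open>Numbers start at 0, so the largest number in use is
    \<open>length xs - 1\<close>; hence the bound with \<open>Suc w\<close>.\<close>
  have alive: "(\<forall>d \<in> univ M. \<forall>e \<in> univ M. [d, e] \<in> rel M (Sto Num) \<longrightarrow> [e, us ! w] \<in> rel M (Sto Ord)) \<longleftrightarrow>
      length xs \<le> Suc w" if w: "w < length us" for w
  proof
    assume *: "\<forall>d \<in> univ M. \<forall>e \<in> univ M. [d, e] \<in> rel M (Sto Num) \<longrightarrow> [e, us ! w] \<in> rel M (Sto Ord)"
    show "length xs \<le> Suc w"
    proof (rule ccontr)
      assume "\<not> length xs \<le> Suc w"
      then have l: "Suc w < length xs" by simp
      then have "[us ! Suc w, us ! w] \<in> rel M (Sto Ord)"
        using * nums_univ[OF n l] univ_nth[OF cd, of "Suc w"] nums_nth[OF cd n l] lx by simp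
      then show False using codes_nth(1)[OF cd _ w, of "Suc w"] l lx by simp
    qed
  next
    assume l: "length xs \<le> Suc w"
    show "\<forall>d \<in> univ M. \<forall>e \<in> univ M. [d, e] \<in> rel M (Sto Num) \<longrightarrow> [e, us ! w] \<in> rel M (Sto Ord)"
    proof (intro ballI impI)
      fix d e assume "[d, e] \<in> rel M (Sto Num)"
      then obtain i where "i < length xs" "e = us ! i" unfolding nums_mem[OF n] by blast
      then show "[e, us ! w] \<in> rel M (Sto Ord)" using codes_nth(1)[OF cd _ w, of i] l lx by simp
    qed
  qed
  have miss: "(\<exists>ds \<in> tuples (arity \<tau> R) (univ M). sat M (upds (?\<sigma>(k := us ! w)) (Suc k) ds)
      (missing k R (Suc k) (Suc k + arity \<tau> R))) \<longleftrightarrow> \<not> index_tuples D xs R \<subseteq> rel (fst s) R"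
    if w: "w < length us" "length xs \<le> Suc w" and l: "live M us xs D w s" and R: "R \<in> rel_syms \<tau>" for R w s
  proof -
    have v: "valid_state \<tau> P s" "univ (fst s) = {..w}" and t: "thread M us w s"
      using l reachable_valid[of w s] by (simp_all add: live_def)
    have relS: "rel (fst s) R \<subseteq> tuples (arity \<tau> R) {..<length us}"
    proof -
      have "rel (fst s) R \<subseteq> tuples (arity \<tau> R) {..w}" using v R by (auto simp: valid_state_def is_database_def)
      then show ?thesis using w by (fastforce simp: tuples_def)
    qed
    have "defines_tuples M us (Suc k) (?\<sigma>(k := us ! w)) (arity \<tau> R) (missing k R) (index_tuples D xs R - rel (fst s) R)"
      unfolding index_tuples_def by (rule defines_missing[OF cd n i _ _ thread_TIn[OF t R] relS]) auto
    then have *: "sat M (upds (?\<sigma>(k := us ! w)) (Suc k) ds) (missing k R (Suc k) (Suc k + arity \<tau> R)) \<longleftrightarrow>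
        (\<exists>is \<in> index_tuples D xs R - rel (fst s) R. ds = map ?u is)"
      if ds: "ds \<in> tuples (arity \<tau> R) (univ M)" for ds
    proof -
      have "length ds = arity \<tau> R" using ds by (simp add: tuples_def)
      moreover have "upds (?\<sigma>(k := us ! w)) (Suc k) ds i \<in> univ M" if "i \<in> {Suc k..<Suc k + arity \<tau> R}" for i
        using tuples_nth[OF ds, of "i - Suc k"] that calculation by (auto simp: upds_def)
      ultimately show ?thesis
        using \<open>defines_tuples _ _ _ _ _ _ _\<close>[unfolded defines_tuples_def, rule_format,
            of "upds (?\<sigma>(k := us ! w)) (Suc k) ds" "Suc k" "Suc k + arity \<tau> R"]
          map_upds[of "arity \<tau> R" ds "?\<sigma>(k := us ! w)" "Suc k"]
        by (simp del: upt_Suc)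
    qed
    have "map ?u is \<in> tuples (arity \<tau> R) (univ M)" if "is \<in> index_tuples D xs R" for "is"
      using that univ_nth[OF cd] lx by (auto simp: index_tuples_def tuples_def subset_iff)
    then show ?thesis using * by blast
  qed
  have out: "(\<exists>vs \<in> tuples k (univ M). (\<forall>j < k. [emb (b ! j), vs ! j] \<in> rel M (Sto Num)) \<and>
      us ! w # vs \<in> rel M (Sto (TAux (answer P)))) \<longleftrightarrow> b \<in> q D"
    if w: "w < length us" "length xs \<le> Suc w" and l: "live M us xs D w s" and ct: "caught w s" for w s
  proof -
    have t: "thread M us w s" and r: "reachable w s" and sd: "sound D xs s" using l by (auto simp: live_def)
    have v: "valid_state \<tau> P s" "univ (fst s) = {..w}" using reachable_valid[OF r] by auto
    have aP: "answer P \<in> aux_syms P" "aux_arity P (answer P) = k" using P by (auto simp: is_program_def)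
    have An: "js \<in> snd s (answer P) \<Longrightarrow> set js \<subseteq> {..w}" for js
      using v by (fastforce simp: valid_state_def tuples_def)
    have inj: "inj_on ?u {..w}" using cd w by (auto simp: codes_def inj_on_def nth_eq_iff_index_eq)
    have "(\<exists>vs \<in> tuples k (univ M). (\<forall>j < k. [emb (b ! j), vs ! j] \<in> rel M (Sto Num)) \<and>
        us ! w # vs \<in> rel M (Sto (TAux (answer P)))) \<longleftrightarrow>
      (\<exists>is \<in> tuples k {..<length xs}. b = map (\<lambda>i. xs ! i) is \<and> is \<in> snd s (answer P))" (is "?A \<longleftrightarrow> ?B")
    proof
      assume ?A
      then obtain vs where vs: "vs \<in> tuples k (univ M)" "\<forall>j < k. [map emb b ! j, vs ! j] \<in> rel M (Sto Num)"
        "us ! w # vs \<in> rel M (Sto (TAux (answer P)))" using lb by auto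
      have lens: "length (map emb b) = k" "length vs = k" using lb vs(1) by (simp_all add: tuples_def)
      from vs(2) obtain "is" where "is": "is \<in> tuples k {..<length xs}"
        "map emb b = map (\<lambda>i. emb (xs ! i)) is" "vs = map ?u is"
        unfolding nums_tuple[OF cd n lens] by blast
      have e: "map (\<lambda>i. emb (xs ! i)) is = map emb (map (\<lambda>i. xs ! i) is)" by simp
      have "b = map (\<lambda>i. xs ! i) is" using "is"(2) unfolding e by (simp only: inj_map_eq_map[OF inj_emb])
      moreover have "is \<in> snd s (answer P)"
      proof -
        have "set is \<subseteq> {..w}" using "is"(1) w(2) by (auto simp: tuples_def)
        then have "map ?u is \<in> map ?u ` snd s (answer P) \<longleftrightarrow> is \<in> snd s (answer P)"
          using An by (rule map_mem_image_iff[OF inj])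
        then show ?thesis using vs(3)[unfolded thread_TAux[OF t aP(1)] "is"(3)] by simp
      qed
      ultimately show ?B using "is"(1) by blast
    next
      assume ?B
      then obtain "is" where "is": "is \<in> tuples k {..<length xs}" "b = map (\<lambda>i. xs ! i) is" "is \<in> snd s (answer P)"
        by blast
      let ?vs = "map ?u is"
      have lens: "length (map emb b) = k" "length ?vs = k" using lb "is"(1) by (simp_all add: tuples_def)
      have "\<forall>j < k. [map emb b ! j, ?vs ! j] \<in> rel M (Sto Num)"
        unfolding nums_tuple[OF cd n lens] using "is" by (intro bexI[of _ "is"]) auto
      then have "\<forall>j < k. [emb (b ! j), ?vs ! j] \<in> rel M (Sto Num)" using lb by simp
      moreover have "us ! w # ?vs \<in> rel M (Sto (TAux (answer P)))"
        unfolding thread_TAux[OF t aP(1)] using "is"(3) by blast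
      moreover have "?vs \<in> tuples k (univ M)"
        using "is"(1) univ_nth[OF cd] lx by (auto simp: tuples_def subset_iff)
      ultimately show ?A by blast
    qed
    also have "\<dots> \<longleftrightarrow> (\<exists>is \<in> tuples k {..<length xs}. b = map (\<lambda>i. xs ! i) is \<and> b \<in> q D)"
      using thread_answer[OF D xs r sd w(2)] ct unfolding caught_def by blast
    also have "\<dots> \<longleftrightarrow> b \<in> q D"
    proof -
      have "\<exists>is \<in> tuples k {..<length xs}. b = map (\<lambda>i. xs ! i) is" if "b \<in> q D"
      proof -
        have bt: "b \<in> tuples k (set xs)" using answer_subset[OF D xs] that by blast
        show ?thesis by (rule tuples_set_nth[OF bt]) blast
      qed
      then show ?thesis by blast
    qed
    finally show ?thesis .
  qed
  have "map emb b \<in> rel (transform va answer_update M) (Sto Ans) \<longleftrightarrow> sat M ?\<sigma> answer_fm"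
    using bU by (simp add: mem_transform answer_update_def)
  also have "\<dots> \<longleftrightarrow> (\<exists>u \<in> univ M. [u, u] \<in> rel M (Sto Ord) \<and>
      (\<forall>d \<in> univ M. \<forall>e \<in> univ M. [d, e] \<in> rel M (Sto Num) \<longrightarrow> [e, u] \<in> rel M (Sto Ord)) \<and>
      (\<forall>R \<in> rel_syms \<tau>. \<not> (\<exists>ds \<in> tuples (arity \<tau> R) (univ M). sat M (upds (?\<sigma>(k := u)) (Suc k) ds)
        (missing k R (Suc k) (Suc k + arity \<tau> R)))) \<and>
      (\<exists>vs \<in> tuples k (univ M). (\<forall>j < k. [emb (b ! j), vs ! j] \<in> rel M (Sto Num)) \<and>
        u # vs \<in> rel M (Sto (TAux (answer P)))))"
  proof -
    have o: "sat M (upds (?\<sigma>(k := u)) (Suc k) vs) (Conj (fm_conjs (map (\<lambda>j. num j (Suc k + j)) [0..<k]))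
        (at (Sto (TAux (answer P))) (k # [Suc k..<Suc k + k]))) \<longleftrightarrow>
        (\<forall>j < k. [emb (b ! j), vs ! j] \<in> rel M (Sto Num)) \<and> u # vs \<in> rel M (Sto (TAux (answer P)))"
      if "vs \<in> tuples k (univ M)" for u vs
    proof -
      have l: "length vs = k" using that by (simp add: tuples_def)
      have "sat M (upds (?\<sigma>(k := u)) (Suc k) vs) (fm_conjs (map (\<lambda>j. num j (Suc k + j)) [0..<k])) \<longleftrightarrow>
          (\<forall>j < k. [emb (b ! j), vs ! j] \<in> rel M (Sto Num))"
        unfolding sat_fm_conjs_upt using l lb by (simp add: upds_def)
      then show ?thesis using map_upds[of k vs "?\<sigma>(k := u)" "Suc k"] l by (simp del: upt_Suc)
    qed
    show ?thesis unfolding answer_fm_def sat.simps(5) sat_fm_conjs list.set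
      using o by (simp add: Rl del: upt_Suc sat_fm_exs) (simp del: upt_Suc)
  qed
  also have "\<dots> \<longleftrightarrow> (\<exists>w s. w < length us \<and> length xs \<le> Suc w \<and> live M us xs D w s \<and> caught w s \<and>
      (\<exists>vs \<in> tuples k (univ M). (\<forall>j < k. [emb (b ! j), vs ! j] \<in> rel M (Sto Num)) \<and>
        us ! w # vs \<in> rel M (Sto (TAux (answer P)))))" (is "?A \<longleftrightarrow> ?B")
  proof
    assume ?A
    then obtain u where u: "u \<in> set us"
      "\<forall>d \<in> univ M. \<forall>e \<in> univ M. [d, e] \<in> rel M (Sto Num) \<longrightarrow> [e, u] \<in> rel M (Sto Ord)"
      "\<forall>R \<in> rel_syms \<tau>. \<not> (\<exists>ds \<in> tuples (arity \<tau> R) (univ M). sat M (upds (?\<sigma>(k := u)) (Suc k) ds)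
        (missing k R (Suc k) (Suc k + arity \<tau> R)))"
      "\<exists>vs \<in> tuples k (univ M). (\<forall>j < k. [emb (b ! j), vs ! j] \<in> rel M (Sto Num)) \<and>
        u # vs \<in> rel M (Sto (TAux (answer P)))"
      unfolding codes_Ord_refl[OF cd] by blast
    obtain w where w: "w < length us" "u = us ! w" using u(1) by (metis in_set_conv_nth)
    have l: "length xs \<le> Suc w" using u(2) alive[OF w(1)] unfolding w(2) by blast
    obtain s where s: "live M us xs D w s" using live[OF w(1) l] by blast
    have "caught w s" using u(3) miss[OF w(1) l s] unfolding w(2) caught_def by blast
    with w l s u(4) show ?B by blast
  next
    assume ?B
    then obtain w s where w: "w < length us" "length xs \<le> Suc w" "live M us xs D w s" "caught w s"
      "\<exists>vs \<in> tuples k (univ M). (\<forall>j < k. [emb (b ! j), vs ! j] \<in> rel M (Sto Num)) \<and>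
        us ! w # vs \<in> rel M (Sto (TAux (answer P)))" by blast
    have "us ! w \<in> univ M" "[us ! w, us ! w] \<in> rel M (Sto Ord)"
      using univ_nth[OF cd w(1)] codes_Ord_refl[OF cd] nth_mem[OF w(1)] by auto
    then show ?A using alive[OF w(1)] w miss[OF w(1-3)] unfolding caught_def by blast
  qed
  also have "\<dots> \<longleftrightarrow> b \<in> q D"
    using out ready unfolding caught_def by blast
  finally show ?thesis .
qed

end

section \<open>Well-formedness of the update formulas\<close>

context threads
begin

abbreviation vsch :: "nat \<Rightarrow> (('r, 'c, 'r sym) vsym, unit) schema" where
  "vsch m \<equiv> tuple_program.vschema \<tau> c B St sar m"

lemma arity_vsch [simp]: "arity (vsch m) = va" "con_syms (vsch m) = {}"
  by (simp_all add: tuple_program.vschema_def)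

lemma syms_vsch [simp]:
  "In R \<in> rel_syms (vsch m) \<longleftrightarrow> R \<in> rel_syms \<tau>" "Cst d \<in> rel_syms (vsch m) \<longleftrightarrow> d \<in> con_syms \<tau>"
  "Chg j \<in> rel_syms (vsch m) \<longleftrightarrow> j < m" "Coord j \<in> rel_syms (vsch m) \<longleftrightarrow> j < c"
  "Bot g \<in> rel_syms (vsch m) \<longleftrightarrow> g < B" "Sto z \<in> rel_syms (vsch m) \<longleftrightarrow> z \<in> St"
  by (auto simp: tuple_program.vschema_def)

lemma St_simps [simp]: "Ord \<in> St" "Pls \<in> St" "Tms \<in> St" "Num \<in> St" "Born \<in> St" "Ans \<in> St"
  "TIn R \<in> St \<longleftrightarrow> R \<in> rel_syms \<tau>" "TAux S \<in> St \<longleftrightarrow> S \<in> aux_syms P"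
  by (auto simp: St_def)

lemma wf_atoms_vsch [simp]: "wf_formula (vsch m) (leq i j)" "wf_formula (vsch m) (pls i j l)"
  "wf_formula (vsch m) (tms i j l)" "wf_formula (vsch m) (num i j)" "wf_formula (vsch m) (eq i j)"
  by (simp_all add: leq_def pls_def tms_def num_def eq_def)

lemma wf_ident [simp]: "wf_formula (vsch m) (ident va Z) \<longleftrightarrow> Z \<in> rel_syms (vsch m)"
  and fv_ident [simp]: "free_vars (ident va Z) = {..<va Z}"
  by (auto simp: ident_def)

lemma wf_add_code:
  assumes "\<And>i. i < 4 \<Longrightarrow> wf_formula (vsch m) (sel i) \<and> free_vars (sel i) \<subseteq> {i}"
  shows "wf_transform (vsch m) (add_code va sel)"
proof -
  have wf: "wf_formula (vsch m) (sel 0)" "wf_formula (vsch m) (sel 1)" "wf_formula (vsch m) (sel 2)"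
    using assms by auto
  have "free_vars (sel 0) \<subseteq> {0}" "free_vars (sel 1) \<subseteq> {1}" "free_vars (sel 2) \<subseteq> {2}"
    using assms[of 0] assms[of 1] assms[of 2] by auto
  then have fv: "free_vars (sel 0) \<subseteq> {..<3}" "free_vars (sel 1) \<subseteq> {..<3}" "free_vars (sel 2) \<subseteq> {..<3}"
      "free_vars (sel 1) \<subseteq> {..<2}"
    by auto
  have "free_vars (new_leq sel) \<subseteq> {..<2}" using fv by (auto simp: new_leq_def)
  moreover have "free_vars (new_pls sel) \<subseteq> {..<3}" using fv by (auto simp: new_pls_def sum_is_top_def)
  moreover have "free_vars (new_tms sel) \<subseteq> {..<3}"
    using fv by (auto simp: new_tms_def sum_is_top_def one_def)
  moreover have "wf_formula (vsch m) (new_leq sel)" "wf_formula (vsch m) (new_pls sel)"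
    "wf_formula (vsch m) (new_tms sel)"
    using wf by (auto simp: new_leq_def new_pls_def new_tms_def sum_is_top_def one_def)
  ultimately show ?thesis
    by (auto simp: wf_transform_def add_code_def)
qed

lemma wf_activate:
  assumes "wf_formula (vsch m) (sel 0)" "free_vars (sel 0) \<subseteq> {0}"
  shows "wf_transform (vsch m) (activate va sel)"
proof -
  have fv: "free_vars (sel 0) \<subseteq> {..<2}" using assms(2) by auto
  then have "free_vars (fm_or (num 0 1) (fm_conjs [sel 0, Neg (Exists 4 (num 0 4)), free_code 1])) \<subseteq> {..<2}"
    by (auto simp: free_code_def)
  then show ?thesis using assms(1)
    by (auto simp: wf_transform_def activate_def free_code_def)
qed

lemma wf_sel_bot: "g < B \<Longrightarrow> wf_formula (vsch m) (sel_bot g i) \<and> free_vars (sel_bot g i) \<subseteq> {i}"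
  by (simp add: sel_bot_def)

lemma wf_lex_less [simp]: "wf_formula (vsch m) (lex_less n y z)"
  by (induction n arbitrary: y z) auto

lemma fv_lex_less: "free_vars (lex_less n y z) \<subseteq> {y..<y + n} \<union> {z..<z + n}"
proof (induction n arbitrary: y z)
  case (Suc n)
  from Suc[of "Suc y" "Suc z"] show ?case by auto
qed simp

lemma wf_lex_min:
  assumes "\<And>b f. b + n \<le> f \<Longrightarrow> wf_formula (vsch m) (Q b f) \<and> free_vars (Q b f) \<subseteq> V \<union> {b..<b + n}"
    and "b + n \<le> f"
  shows "wf_formula (vsch m) (lex_min n Q b f) \<and> free_vars (lex_min n Q b f) \<subseteq> V \<union> {b..<b + n}"
proof -
  have Q: "wf_formula (vsch m) (Q b f)" "free_vars (Q b f) \<subseteq> V \<union> {b..<b + n}"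
    "wf_formula (vsch m) (Q f (f + n))" "free_vars (Q f (f + n)) \<subseteq> V \<union> {f..<f + n}"
    using assms(1)[OF assms(2)] assms(1)[of f "f + n"] by auto
  then have "free_vars (lex_min n Q b f) \<subseteq> V \<union> {b..<b + n}"
    using fv_lex_less[of n f b] unfolding lex_min_def free_vars.simps fv_fm_exs by blast
  with Q show ?thesis by (simp add: lex_min_def)
qed

lemma wf_tuple_code:
  assumes "v < f" "b + c \<le> f"
  shows "wf_formula (vsch m) (tuple_code v b f) \<and> free_vars (tuple_code v b f) \<subseteq> {v} \<union> {b..<b + c}"
  using assms by (auto simp: tuple_code_def)

lemma wf_sel_tuple:
  assumes "i < 4"
  shows "wf_formula (vsch m) (sel_tuple i) \<and> free_vars (sel_tuple i) \<subseteq> {i}"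
proof -
  have fr: "wf_formula (vsch m) (fresh_tuple b f) \<and> free_vars (fresh_tuple b f) \<subseteq> {} \<union> {b..<b + c}"
    if "b + c \<le> f" for b f
    using wf_tuple_code[of f "Suc f" b m] that by (auto simp: fresh_tuple_def)
  have l: "wf_formula (vsch m) (lex_min c fresh_tuple 20 (20 + c)) \<and>
      free_vars (lex_min c fresh_tuple 20 (20 + c)) \<subseteq> {} \<union> {20..<20 + c}"
    by (rule wf_lex_min[OF fr]) auto
  moreover have "wf_formula (vsch m) (tuple_code i 20 (20 + c)) \<and>
      free_vars (tuple_code i 20 (20 + c)) \<subseteq> {i} \<union> {20..<20 + c}"
    using assms by (intro wf_tuple_code) auto
  ultimately show ?thesis by (simp add: sel_tuple_def) blast
qed

lemma wf_start: "wf_transform (vsch m) start"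
proof -
  have fv: "free_vars (start_aux S) \<subseteq> {..<Suc (aux_arity P S)}" for S
    using arith by (auto simp: start_aux_def)
  have wf: "wf_formula (vsch m) (start_aux S)" for S by (auto simp: start_aux_def)
  show ?thesis
    unfolding wf_transform_def
  proof (intro ballI conjI)
    fix Z assume Z: "Z \<in> rel_syms (vsch m)"
    show "wf_formula (vsch m) (start Z)"
      using Z wf by (auto simp: start_def split: vsym.split sym.split)
    show "free_vars (start Z) \<subseteq> {..<arity (vsch m) Z}"
    proof (cases "\<exists>S. Z = Sto (TAux S)")
      case True
      then obtain S where "Z = Sto (TAux S)" by blast
      then show ?thesis using fv[of S] by (simp add: start_def)
    next
      case False
      then show ?thesis by (auto simp: start_def split: vsym.split sym.split)
    qed
  qed
qed

lemma wf_sim: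
  assumes "changed_rel \<delta> \<in> rel_syms \<tau>" "S \<in> aux_syms P"
    and f: "b + arity \<tau> (changed_rel \<delta>) \<le> kb" "Suc (aux_arity P S) \<le> b" "kb + length cl \<le> f"
  shows "wf_formula (vsch m) (sim \<delta> S b kb f) \<and> free_vars (sim \<delta> S b kb f) \<subseteq>
    {..aux_arity P S} \<union> {b..<b + arity \<tau> (changed_rel \<delta>)} \<union> {kb..<kb + length cl}"
proof -
  let ?m = "arity \<tau> (changed_rel \<delta>)"
  let ?T = "state_schema \<tau> P" and ?V = "{0} \<union> {kb..<kb + length cl}"
  let ?\<rho> = "\<lambda>i. (0::nat, [if i < ?m then b + i else Suc (i - ?m)])"
  have wf: "wf_formula ?T (upd P \<delta> S)" and fv: "free_vars (upd P \<delta> S) \<subseteq> {..<?m + aux_arity P S}"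
    using P assms by (auto simp: is_program_def)
  have "wf_formula (vsch m) (sim \<delta> S b kb f) \<and> free_vars (sim \<delta> S b kb f) \<subseteq>
      ?V \<union> (\<Union>i \<in> free_vars (upd P \<delta> S). set (snd (?\<rho> i)))"
    unfolding sim_def
  proof (rule interpretation_data.syntax_interp[where T = ?T and V = ?V])
    show "wf_formula (vsch m) (thread_atom Z N bs) \<and>
        free_vars (thread_atom Z N bs) \<subseteq> ?V \<union> (\<Union>b \<in> set bs. set (snd b))"
      if Z: "Z \<in> rel_syms ?T" "length bs = arity ?T Z" "\<forall>b \<in> set bs. is_block 1 (\<lambda>_. 1) b" for Z bs N
    proof -
      have "hd (snd b) \<in> set (snd b)" if "b \<in> set bs" for b
        using Z(3) that by (intro hd_in_set) (auto simp: is_block_def)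
      then show ?thesis using Z by (cases Z) (auto simp: state_schema_def)
    qed
    show "is_block 1 (\<lambda>_. 1) (0, [kb + con_index d]) \<and> set (snd (0, [kb + con_index d])) \<subseteq> ?V"
      if "d \<in> con_syms ?T" for d
      using con_index[of d] that by (auto simp: is_block_def state_schema_def)
    show "wf_formula (vsch m) (leq (hd is) 0) \<and> free_vars (leq (hd is) 0) \<subseteq> ?V \<union> set is"
      if "g < 1" "length is = 1" for g and "is" :: "nat list"
      using that by (cases "is") auto
  qed (use wf in \<open>auto simp: is_block_def\<close>)
  moreover have "(\<Union>i \<in> free_vars (upd P \<delta> S). set (snd (?\<rho> i))) \<subseteq> {..aux_arity P S} \<union> {b..<b + ?m}"
  proof (rule UN_least)
    fix i assume "i \<in> free_vars (upd P \<delta> S)"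
    then have "i < ?m + aux_arity P S" using fv by auto
    then show "set (snd (?\<rho> i)) \<subseteq> {..aux_arity P S} \<union> {b..<b + ?m}" by auto
  qed
  moreover have "{0} \<subseteq> {..aux_arity P S}" by simp
  ultimately show ?thesis by blast
qed

lemma wf_step_threads:
  assumes \<delta>: "changed_rel \<delta> \<in> rel_syms \<tau>"
    and Q: "\<And>b f. 0 < b \<Longrightarrow> b + arity \<tau> (changed_rel \<delta>) \<le> f \<Longrightarrow> wf_formula (vsch m) (Q b f) \<and>
      free_vars (Q b f) \<subseteq> {0} \<union> {b..<b + arity \<tau> (changed_rel \<delta>)}"
  shows "wf_transform (vsch m) (step_threads \<delta> Q)"
proof -
  let ?m = "arity \<tau> (changed_rel \<delta>)"
  have aux: "wf_formula (vsch m) (step_aux \<delta> Q S) \<and> free_vars (step_aux \<delta> Q S) \<subseteq> {..<Suc (aux_arity P S)}"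
    if S: "S \<in> aux_syms P" for S
  proof -
    let ?b = "Suc (aux_arity P S)"
    let ?kb = "?b + ?m"
    let ?f = "?kb + length cl"
    have q: "wf_formula (vsch m) (Q ?b ?kb)" "free_vars (Q ?b ?kb) \<subseteq> {0} \<union> {?b..<?b + ?m}"
      using Q[of ?b ?kb] by auto
    have s: "wf_formula (vsch m) (sim \<delta> S ?b ?kb ?f)"
      "free_vars (sim \<delta> S ?b ?kb ?f) \<subseteq> {..aux_arity P S} \<union> {?b..<?b + ?m} \<union> {?kb..<?kb + length cl}"
      using wf_sim[OF \<delta> S, of ?b ?kb ?f m] by auto
    have cc: "wf_formula (vsch m) (con_codes ?kb ?f)" "free_vars (con_codes ?kb ?f) \<subseteq> {?kb..<?kb + length cl}"
      using cl nth_mem[of _ cl] by (auto simp: con_codes_def)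
    have "free_vars (fm_exs ?kb (length cl) (Conj (con_codes ?kb ?f) (sim \<delta> S ?b ?kb ?f))) \<subseteq>
        {..aux_arity P S} \<union> {?b..<?b + ?m}"
      using s(2) cc(2) unfolding fv_fm_exs free_vars.simps by blast
    then have "free_vars (fm_exs ?b ?m (fm_conjs (Q ?b ?kb # map (\<lambda>j. leq (Suc j) 0) [0..<aux_arity P S] @
        [fm_exs ?kb (length cl) (Conj (con_codes ?kb ?f) (sim \<delta> S ?b ?kb ?f))]))) \<subseteq> {..aux_arity P S}"
      using q(2) by (auto simp del: fv_fm_exs simp: fv_fm_exs[of ?b])
    moreover have "free_vars (fm_exs ?b ?m (Q ?b ?kb)) \<subseteq> {..aux_arity P S}" using q(2) by auto
    ultimately show ?thesis using q(1) s(1) cc(1) S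
      by (auto simp: step_aux_def Let_def less_Suc_eq_le simp del: fv_fm_exs)
  qed
  have "in": "wf_formula (vsch m) (step_in \<delta> Q R) \<and> free_vars (step_in \<delta> Q R) \<subseteq> {..<Suc (arity \<tau> R)}"
    if R: "R \<in> rel_syms \<tau>" for R
  proof (cases "R = changed_rel \<delta>")
    case True
    have "wf_formula (vsch m) (Q (Suc 0) (Suc ?m))" "free_vars (Q (Suc 0) (Suc ?m)) \<subseteq> {..<Suc ?m}"
      using Q[of "Suc 0" "Suc ?m"] by auto
    then show ?thesis using True R by (cases \<delta>) (auto simp: step_in_def)
  next
    case False then show ?thesis using R by (simp add: step_in_def)
  qed
  show ?thesis
    unfolding wf_transform_def
  proof (intro ballI)
    fix Z assume Z: "Z \<in> rel_syms (vsch m)"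
    show "wf_formula (vsch m) (step_threads \<delta> Q Z) \<and> free_vars (step_threads \<delta> Q Z) \<subseteq> {..<arity (vsch m) Z}"
    proof (cases "(\<exists>R. Z = Sto (TIn R)) \<or> (\<exists>S. Z = Sto (TAux S))")
      case True
      then show ?thesis
      proof (elim disjE exE)
        fix R assume "Z = Sto (TIn R)"
        then show ?thesis using Z "in"[of R] by (simp add: step_threads_def)
      next
        fix S assume "Z = Sto (TAux S)"
        then show ?thesis using Z aux[of S] by (simp add: step_threads_def)
      qed
    next
      case False
      then have "step_threads \<delta> Q Z = ident va Z" by (auto simp: step_threads_def split: vsym.split sym.split)
      then show ?thesis using Z by simp
    qed
  qed
qed

lemma wf_sel_change:
  assumes "b + m \<le> f"
  shows "wf_formula (vsch m) (sel_change m b f) \<and> free_vars (sel_change m b f) \<subseteq> {0} \<union> {b..<b + m}"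
  using assms by (auto simp: sel_change_def)

lemma wf_missing:
  assumes "R \<in> rel_syms \<tau>" "b + arity \<tau> R \<le> f"
  shows "wf_formula (vsch m) (missing v R b f) \<and> free_vars (missing v R b f) \<subseteq> {v} \<union> {b..<b + arity \<tau> R}"
  using assms by (auto simp: missing_def Let_def)

lemma wf_update_input:
  assumes "changed_rel \<delta> \<in> rel_syms \<tau>"
  shows "wf_transform (vsch (arity \<tau> (changed_rel \<delta>))) (update_input \<delta>)"
  using assms by (auto simp: wf_transform_def update_input_def Let_def split: change_type.split)

end

context arith_program
begin

lemma wf_answer_update: "wf_transform (vsch m) answer_update"
proof -
  have aP: "answer P \<in> aux_syms P" "aux_arity P (answer P) = k" using P by (auto simp: is_program_def)
  have ms: "wf_formula (vsch m) (missing k R (Suc k) (Suc k + arity \<tau> R)) \<and>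
      free_vars (missing k R (Suc k) (Suc k + arity \<tau> R)) \<subseteq> {k} \<union> {Suc k..<Suc k + arity \<tau> R}"
    if "R \<in> set Rl" for R
    using wf_missing[of R "Suc k" "Suc k + arity \<tau> R" m k] that Rl by simp
  have "wf_formula (vsch m) answer_fm" using aP ms by (auto simp: answer_fm_def)
  moreover have "free_vars answer_fm \<subseteq> {..<k}"
  proof -
    have "free_vars (fm_exs (Suc k) (arity \<tau> R) (missing k R (Suc k) (Suc k + arity \<tau> R))) \<subseteq> {k}"
      if "R \<in> set Rl" for R
      using ms[OF that] unfolding fv_fm_exs by blast
    then show ?thesis by (auto simp: answer_fm_def simp del: upt_Suc fv_fm_exs) (auto simp del: upt_Suc)
  qed
  ultimately show ?thesis by (auto simp: wf_transform_def answer_update_def)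
qed

text \<open>The order matters. The constants supply codes for the first activation, tuples over
  newly activated elements may become codes at once, and new threads start before the input is
  updated, so that they simulate the current change like all others. The replay and the answer see
  the new input.\<close>

definition updates :: "nat \<Rightarrow> 'r change_type \<Rightarrow>
    (('r, 'c, 'r sym) vsym \<Rightarrow> (('r, 'c, 'r sym) vsym, unit) formula) list" where
  "updates n \<delta> = map (\<lambda>g. add_code va (sel_bot g)) [0..<B] @
     map (\<lambda>Z. activate va (\<lambda>i. at Z [i])) (map Cst cl @ map Chg [0..<arity \<tau> (changed_rel \<delta>)]) @
     replicate n (add_code va sel_tuple) @
     [start, update_input \<delta>, step_threads \<delta> (sel_change (arity \<tau> (changed_rel \<delta>)))] @
     map (\<lambda>R. step_threads (Ins R) (lex_min (arity \<tau> R) (missing 0 R))) Rl @ [answer_update]"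

lemma wf_updates:
  assumes \<delta>: "changed_rel \<delta> \<in> rel_syms \<tau>"
  shows "\<forall>U \<in> set (updates n \<delta>). wf_transform (vsch (arity \<tau> (changed_rel \<delta>))) U"
proof -
  let ?m = "arity \<tau> (changed_rel \<delta>)"
  have "wf_transform (vsch ?m) (add_code va (sel_bot g))" if "g < B" for g
    by (intro wf_add_code wf_sel_bot that)
  moreover have "wf_transform (vsch ?m) (activate va (\<lambda>i. at Z [i]))"
    if "Z \<in> set (map Cst cl @ map Chg [0..<?m])" for Z
    by (rule wf_activate) (use that cl in auto)
  moreover have "wf_transform (vsch ?m) (add_code va sel_tuple)"
    by (intro wf_add_code wf_sel_tuple)
  moreover have "wf_transform (vsch ?m) (step_threads \<delta> (sel_change ?m))"
    by (intro wf_step_threads[OF \<delta>] wf_sel_change)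
  moreover have "wf_transform (vsch ?m) (step_threads (Ins R) (lex_min (arity \<tau> R) (missing 0 R)))"
    if "R \<in> set Rl" for R
  proof (rule wf_step_threads)
    have R: "R \<in> rel_syms \<tau>" using that Rl by simp
    then show "changed_rel (Ins R) \<in> rel_syms \<tau>" by simp
    show "wf_formula (vsch ?m) (lex_min (arity \<tau> R) (missing 0 R) b f) \<and>
        free_vars (lex_min (arity \<tau> R) (missing 0 R) b f) \<subseteq> {0} \<union> {b..<b + arity \<tau> (changed_rel (Ins R))}"
      if "b + arity \<tau> (changed_rel (Ins R)) \<le> f" for b f
      using wf_lex_min[of "arity \<tau> R" ?m "missing 0 R" "{0}" b f] wf_missing[OF R] that by simp
  qed
  ultimately show ?thesis
    using wf_start wf_update_input[OF \<delta>] wf_answer_update by (auto simp: updates_def)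
qed

end

section \<open>The invariant\<close>

text \<open>In \<open>B\<close>, the part \<open>length cl + 3 * mx\<close> pays for the first
  change: constants and changed tuple are activated, one input tuple may appear, and a reserve of
  \<open>mx\<close> remains. The part \<open>mx * card (rel_syms \<tau>)\<close> covers at most one
  active element, where powers do not grow. In \<open>c\<close>, the summand \<open>mx\<close> is
  the degree of the bound on \<open>total\<close>, and the rest makes the power exceed its
  factor.\<close>

locale simulation = arith_program \<tau> P L Pl Ti c B k cl Rl q
  for \<tau> :: "('r, 'c) schema" and P :: "('r, 'c) dyn_program" and L Pl Ti c B k :: nat
    and cl :: "'c list" and Rl :: "'r list" and q :: "('a, 'r, 'c) query" +
  fixes mx :: nat
  assumes mx: "0 < mx" "\<And>R. R \<in> rel_syms \<tau> \<Longrightarrow> arity \<tau> R \<le> mx"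
    and B: "B = length cl + 3 * mx + mx * card (rel_syms \<tau>)"
    and c_eq: "c = mx + mx * card (rel_syms \<tau>) + 1"
begin

section \<open>Measures of progress, and stability under new codes and new elements\<close>

definition total :: "('a, 'r, 'c) database \<Rightarrow> 'a list \<Rightarrow> nat" where
  "total D xs = (\<Sum>R \<in> rel_syms \<tau>. card (index_tuples D xs R))"

definition deficit :: "('a, 'r, 'c) database \<Rightarrow> 'a list \<Rightarrow> (nat, 'r, 'c) state \<Rightarrow> nat" where
  "deficit D xs s = (\<Sum>R \<in> rel_syms \<tau>. card (index_tuples D xs R - rel (fst s) R))"

definition core :: "(nat \<times> 'a list, ('r, 'c, 'r sym) vsym, unit) database \<Rightarrow> ('a, 'r, 'c) database \<Rightarrow>
    'a list \<Rightarrow> (nat \<times> 'a list) list \<Rightarrow> 'a list \<Rightarrow> bool" where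
  "core M D a us xs \<longleftrightarrow> wf_rels va M \<and> inputs M D a \<and> codes M us \<and> nums M us xs"

definition same_threads :: "(nat \<times> 'a list, ('r, 'c, 'r sym) vsym, unit) database \<Rightarrow>
    (nat \<times> 'a list, ('r, 'c, 'r sym) vsym, unit) database \<Rightarrow> bool" where
  "same_threads M M' \<longleftrightarrow> rel M' (Sto Born) = rel M (Sto Born) \<and>
     (\<forall>R. rel M' (Sto (TIn R)) = rel M (Sto (TIn R))) \<and> (\<forall>S. rel M' (Sto (TAux S)) = rel M (Sto (TAux S)))"

lemma same_threads_refl: "same_threads M M"
  and same_threads_trans: "same_threads M M' \<Longrightarrow> same_threads M' M'' \<Longrightarrow> same_threads M M''"
  by (simp_all add: same_threads_def)

lemma finite_tuples: "finite A \<Longrightarrow> finite (tuples n A)" and card_tuples: "finite A \<Longrightarrow> card (tuples n A) = card A ^ n"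
  using finite_lists_length_eq[of A n] card_lists_length_eq[of A n] by (simp_all add: tuples_def conj_commute)

lemma finite_index_tuples: "finite (index_tuples D xs R)"
  using finite_tuples[of "{..<length xs}" "arity \<tau> R"] by (auto simp: index_tuples_def)

lemma finite_rel_syms: "finite (rel_syms \<tau>)"
  using fin by (simp add: finite_schema_def)

lemma deficit_le_total: "deficit D xs s \<le> total D xs"
  unfolding deficit_def total_def by (intro sum_mono card_mono finite_index_tuples) auto

text \<open>A newly activated element occurs in no input tuple yet, and the old elements keep their
  numbers.\<close>

lemma index_tuples_append:
  assumes "rel D R \<subseteq> tuples (arity \<tau> R) (set xs)" "distinct (xs @ ys)"
  shows "index_tuples D (xs @ ys) R = index_tuples D xs R"
proof -
  have 1: "is \<in> tuples (arity \<tau> R) {..<length xs}"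
    if "is": "is \<in> tuples (arity \<tau> R) {..<length (xs @ ys)}" "map (\<lambda>i. (xs @ ys) ! i) is \<in> rel D R" for "is"
  proof -
    have "i < length xs" if i: "i \<in> set is" for i
    proof (rule ccontr)
      assume "\<not> i < length xs"
      then have "(xs @ ys) ! i \<in> set ys"
        using "is"(1) i by (auto simp: tuples_def nth_append subset_iff)
      moreover have "set (map (\<lambda>i. (xs @ ys) ! i) is) \<subseteq> set xs"
        using assms(1) "is"(2) unfolding tuples_def by blast
      then have "(xs @ ys) ! i \<in> set xs" using i by auto
      ultimately show False using assms(2) by auto
    qed
    then show ?thesis using "is"(1) by (auto simp: tuples_def)
  qed
  have 2: "map (\<lambda>i. (xs @ ys) ! i) is = map (\<lambda>i. xs ! i) is"
    if "is \<in> tuples (arity \<tau> R) {..<length xs}" for "is"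
    using that by (auto simp: tuples_def nth_append)
  have 3: "tuples (arity \<tau> R) {..<length xs} \<subseteq> tuples (arity \<tau> R) {..<length (xs @ ys)}"
    by (auto simp: tuples_def)
  show ?thesis
  proof (intro set_eqI iffI)
    fix "is" assume "is \<in> index_tuples D (xs @ ys) R"
    then have *: "is \<in> tuples (arity \<tau> R) {..<length (xs @ ys)}" "map (\<lambda>i. (xs @ ys) ! i) is \<in> rel D R"
      unfolding index_tuples_def by blast+
    from *(2) show "is \<in> index_tuples D xs R"
      unfolding index_tuples_def 2[OF 1[OF *]] using 1[OF *] by blast
  next
    fix "is" assume "is \<in> index_tuples D xs R"
    then have *: "is \<in> tuples (arity \<tau> R) {..<length xs}" "map (\<lambda>i. xs ! i) is \<in> rel D R"
      unfolding index_tuples_def by blast+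
    then show "is \<in> index_tuples D (xs @ ys) R"
      unfolding index_tuples_def mem_Collect_eq 2[OF *(1)] using 3 by blast
  qed
qed

lemma sound_append:
  assumes "sound D xs s"
  shows "sound D (xs @ ys) s"
  unfolding sound_def
proof (intro conjI ballI)
  fix d assume "d \<in> con_syms \<tau>"
  then obtain i where "i < length xs" "con (fst s) d = Some i" "con D d = Some (xs ! i)"
    using assms by (auto simp: sound_def)
  then show "\<exists>i < length (xs @ ys). con (fst s) d = Some i \<and> con D d = Some ((xs @ ys) ! i)"
    by (intro exI[of _ i]) (simp add: nth_append)
next
  fix R assume R: "R \<in> rel_syms \<tau>"
  have "index_tuples D xs R \<subseteq> index_tuples D (xs @ ys) R"
  proof
    fix "is" assume "is": "is \<in> index_tuples D xs R"
    then have "map (\<lambda>i. (xs @ ys) ! i) is = map (\<lambda>i. xs ! i) is"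
      by (auto simp: index_tuples_def tuples_def nth_append)
    moreover have "is \<in> tuples (arity \<tau> R) {..<length (xs @ ys)}" "map (\<lambda>i. xs ! i) is \<in> rel D R"
      using "is" by (auto simp: index_tuples_def tuples_def)
    ultimately show "is \<in> index_tuples D (xs @ ys) R"
      unfolding index_tuples_def mem_Collect_eq by (simp only: simp_thms)
  qed
  then show "rel (fst s) R \<subseteq> index_tuples D (xs @ ys) R" using assms R by (auto simp: sound_def)
qed

text \<open>A thread uses only the numbers up to \<open>w\<close>, and their codes never
  change.\<close>

lemma thread_append:
  assumes t: "thread M us w s" and r: "reachable w s" and w: "w < length us"
  shows "thread M (us @ vs) w s"
proof -
  have v: "valid_state \<tau> P s" "univ (fst s) = {..w}" using reachable_valid[OF r] by auto
  have eq: "map (\<lambda>i. (us @ vs) ! i) ` X = map (\<lambda>i. us ! i) ` X" if "X \<subseteq> tuples n {..w}" for X n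
  proof (intro image_cong refl)
    fix js assume "js \<in> X"
    then have "set js \<subseteq> {..w}" using that by (auto simp: tuples_def)
    then show "map (\<lambda>i. (us @ vs) ! i) js = map (\<lambda>i. us ! i) js"
      using w by (intro map_cong refl) (auto simp: nth_append)
  qed
  have "map (\<lambda>i. (us @ vs) ! i) ` rel (fst s) R = map (\<lambda>i. us ! i) ` rel (fst s) R" if "R \<in> rel_syms \<tau>" for R
    using v that by (intro eq[of _ "arity \<tau> R"]) (auto simp: valid_state_def is_database_def)
  moreover have "map (\<lambda>i. (us @ vs) ! i) ` snd s S = map (\<lambda>i. us ! i) ` snd s S" for S
    using v by (intro eq[of _ "aux_arity P S"]) (auto simp: valid_state_def)
  ultimately show ?thesis using t w by (simp add: thread_def nth_append)
qed

lemma live_same: "live M us xs D w s \<Longrightarrow> same_threads M M' \<Longrightarrow> live M' us xs D w s"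
  using thread_cong[of M us w s M'] by (simp add: live_def same_threads_def)

lemma live_append: "live M us xs D w s \<Longrightarrow> w < length us \<Longrightarrow> live M (us @ vs) (xs @ ys) D w s"
  by (simp add: live_def thread_append sound_append)

subsection \<open>The phases of an update\<close>

lemma add_code_core:
  assumes core: "core M D a us xs" and sel: "selects M sel z"
    and z: "\<And>u. z = Some u \<Longrightarrow> u \<in> univ M \<and> u \<notin> set us"
  defines "M' \<equiv> transform va (add_code va sel) M"
  shows "core M' D a (us @ (case z of None \<Rightarrow> [] | Some u \<Rightarrow> [u])) xs" "same_threads M M'"
proof -
  have wf: "wf_rels va M" and i: "inputs M D a" and cd: "codes M us" and n: "nums M us xs"
    using core by (auto simp: core_def)
  have other: "rel M' Z = rel M Z" if "Z \<notin> {Sto Ord, Sto Pls, Sto Tms}" for Z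
    unfolding M'_def using rel_add_code_other[OF wf that] .
  have "inputs M' D a" by (rule inputs_cong[OF i]) (auto simp: M'_def other[unfolded M'_def])
  moreover have "codes M' (us @ (case z of None \<Rightarrow> [] | Some u \<Rightarrow> [u]))"
  proof (cases z)
    case None
    then have "rel M' Z = rel M Z" for Z
      unfolding M'_def using sel wf by (intro transform_add_code_None) auto
    then show ?thesis using None codes_cong[OF cd, of M'] by (simp add: M'_def)
  next
    case (Some u)
    then show ?thesis unfolding M'_def using codes_add_code[OF cd, of sel u va] sel z by simp
  qed
  moreover have "nums M' (us @ (case z of None \<Rightarrow> [] | Some u \<Rightarrow> [u])) xs"
    by (rule nums_append, rule nums_cong[OF n]) (simp_all add: M'_def other[unfolded M'_def])
  ultimately show "core M' D a (us @ (case z of None \<Rightarrow> [] | Some u \<Rightarrow> [u])) xs"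
    by (simp add: core_def M'_def)
  show "same_threads M M'" using other by (simp add: same_threads_def)
qed

lemma phase_bots:
  assumes "core M D a us xs" "set gs \<subseteq> {..<B}"
  defines "M' \<equiv> fold (transform va) (map (\<lambda>g. add_code va (sel_bot g)) gs) M"
  shows "\<exists>vs. core M' D a (us @ vs) xs \<and> same_threads M M' \<and> (\<lambda>g. (g + 2, [])) ` set gs \<subseteq> set (us @ vs)"
  using assms(1,2) unfolding M'_def
proof (induction gs arbitrary: M us)
  case Nil
  then show ?case by (intro exI[of _ "[]"]) (simp add: same_threads_refl)
next
  case (Cons g gs)
  let ?N = "transform va (add_code va (sel_bot g)) M"
  let ?z = "if (g + 2, []) \<in> set us then None else Some (g + 2, [])"
  let ?v = "case ?z of None \<Rightarrow> [] | Some u \<Rightarrow> [u]"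
  have "selects M (sel_bot g) ?z"
    by (rule selects_sel_bot) (use Cons.prems in \<open>auto simp: core_def\<close>)
  moreover have "u \<in> univ M \<and> u \<notin> set us" if "?z = Some u" for u
    using that bot_univ[of M D a g] Cons.prems by (auto simp: core_def split: if_splits)
  ultimately have N: "core ?N D a (us @ ?v) xs" "same_threads M ?N"
    using add_code_core[OF Cons.prems(1)] by blast+
  obtain vs where vs: "core (fold (transform va) (map (\<lambda>g. add_code va (sel_bot g)) gs) ?N) D a ((us @ ?v) @ vs) xs"
    "same_threads ?N (fold (transform va) (map (\<lambda>g. add_code va (sel_bot g)) gs) ?N)"
    "(\<lambda>g. (g + 2, [])) ` set gs \<subseteq> set ((us @ ?v) @ vs)"
    using Cons.IH[OF N(1)] Cons.prems(2) by auto
  have "(g + 2, []) \<in> set (us @ ?v)" by simp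
  then show ?case
    using vs same_threads_trans[OF N(2) vs(2)] by (intro exI[of _ "?v @ vs"]) auto
qed

lemma activate_core:
  assumes core: "core M D a us xs" and sel: "selects M sel (Some (emb x))" and x: "x \<in> univ D"
    and len: "x \<notin> set xs \<Longrightarrow> length xs < length us"
  defines "M' \<equiv> transform va (activate va sel) M"
  shows "core M' D a us (snoc_new x xs)" "same_threads M M'"
proof -
  have wf: "wf_rels va M" and i: "inputs M D a" and cd: "codes M us" and n: "nums M us xs"
    using core by (auto simp: core_def)
  have other: "rel M' Z = rel M Z" if "Z \<noteq> Sto Num" for Z
    unfolding M'_def using rel_activate_other[OF wf that] .
  have "inputs M' D a" by (rule inputs_cong[OF i]) (auto simp: M'_def other[unfolded M'_def])
  moreover have "codes M' us" by (rule codes_cong[OF cd]) (simp_all add: M'_def other[unfolded M'_def])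
  moreover have "nums M' us (snoc_new x xs)"
  proof (cases "x \<in> set xs")
    case False
    have xU: "emb x \<in> univ M" using emb_univ[OF i] x by blast
    show ?thesis unfolding M'_def by (rule nums_activate[OF cd n len[OF False] sel xU]) simp
  next
    case True
    have "rel M' (Sto Num) = rel M (Sto Num)"
    proof -
      have "vs \<in> rel M' (Sto Num) \<longleftrightarrow> vs \<in> rel M (Sto Num)" if vs: "vs \<in> tuples 2 (univ M)" for vs
      proof -
        obtain y v where yv: "vs = [y, v]" "y \<in> univ M"
          using vs by (auto simp: tuples_def numeral_2_eq_2 length_Suc_conv)
        have "sat M (\<lambda>i. [y, v] ! i) (sel 0) \<longleftrightarrow> y = emb x" using sel yv(2) by (auto simp: selects_def)
        then show ?thesis using vs yv nums_elem[OF cd n, of x] True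
          by (auto simp: M'_def mem_transform activate_def)
      qed
      moreover have "rel M' (Sto Num) \<subseteq> tuples 2 (univ M)" by (auto simp: M'_def transform_def)
      moreover have "rel M (Sto Num) \<subseteq> tuples (va (Sto Num)) (univ M)" using wf unfolding wf_rels_def by blast
      ultimately show ?thesis by auto
    qed
    then have "nums M' us xs" by (intro nums_cong[OF n]) (simp_all add: M'_def)
    then show ?thesis using True by (simp add: snoc_new_def)
  qed
  ultimately show "core M' D a us (snoc_new x xs)" by (simp add: core_def M'_def)
  show "same_threads M M'" using other by (simp add: same_threads_def)
qed

text \<open>Only elements without a number consume codes, so the room is measured by the set of new
  elements and not by the length of \<open>Zs\<close>.\<close>

lemma phase_activate:
  assumes "core M D a us xs" "length xs + card (f ` set Zs - set xs) \<le> length us"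
    and "\<And>Z N. Z \<in> set Zs \<Longrightarrow> inputs N D a \<Longrightarrow> rel N Z = {[emb (f Z)]}" "f ` set Zs \<subseteq> univ D"
  defines "M' \<equiv> fold (transform va) (map (\<lambda>Z. activate va (\<lambda>i. at Z [i])) Zs) M"
  shows "\<exists>ys. core M' D a us (xs @ ys) \<and> same_threads M M' \<and> set (xs @ ys) = set xs \<union> f ` set Zs"
  using assms(1-4) unfolding M'_def
proof (induction Zs arbitrary: M xs)
  case Nil
  then show ?case by (intro exI[of _ "[]"]) (simp add: same_threads_refl)
next
  case (Cons Z Zs)
  let ?N = "transform va (activate va (\<lambda>i. at Z [i])) M" and ?x = "f Z"
  have i: "inputs M D a" using Cons.prems(1) by (simp add: core_def)
  have sel: "selects M (\<lambda>i. at Z [i]) (Some (emb ?x))"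
    by (rule selects_at) (use Cons.prems(3)[of Z] i in simp)
  have len: "length xs < length us" if "?x \<notin> set xs"
  proof -
    have "?x \<in> f ` set (Z # Zs) - set xs" using that by simp
    then have "0 < card (f ` set (Z # Zs) - set xs)" by (subst card_gt_0_iff) auto
    then show ?thesis using Cons.prems(2) by linarith
  qed
  have N: "core ?N D a us (snoc_new ?x xs)" "same_threads M ?N"
    using activate_core[OF Cons.prems(1) sel _ len] Cons.prems(4) by auto
  obtain ys0 where ys0: "snoc_new ?x xs = xs @ ys0" by (cases "?x \<in> set xs") (auto simp: snoc_new_def)
  have "length (snoc_new ?x xs) + card (f ` set Zs - set (snoc_new ?x xs)) \<le> length us"
  proof (cases "?x \<in> set xs")
    case True
    then have "f ` set Zs - set (snoc_new ?x xs) = f ` set (Z # Zs) - set xs" by auto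
    then show ?thesis using True Cons.prems(2) by (simp add: snoc_new_def)
  next
    case False
    have "f ` set (Z # Zs) - set xs = insert ?x (f ` set Zs - set (snoc_new ?x xs))" using False by auto
    then have "card (f ` set (Z # Zs) - set xs) = Suc (card (f ` set Zs - set (snoc_new ?x xs)))"
      by (simp add: card_insert_if)
    then show ?thesis using False Cons.prems(2) by (simp add: snoc_new_def)
  qed
  then obtain ys where ys: "core (fold (transform va) (map (\<lambda>Z. activate va (\<lambda>i. at Z [i])) Zs) ?N) D a us
      (snoc_new ?x xs @ ys)"
    "same_threads ?N (fold (transform va) (map (\<lambda>Z. activate va (\<lambda>i. at Z [i])) Zs) ?N)"
    "set (snoc_new ?x xs @ ys) = set (snoc_new ?x xs) \<union> f ` set Zs"
    using Cons.IH[OF N(1)] Cons.prems(3,4) by auto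
  have "set (xs @ ys0 @ ys) = set xs \<union> f ` set (Z # Zs)"
  proof -
    have "set (xs @ ys0 @ ys) = set (snoc_new ?x xs @ ys)" by (simp add: ys0)
    then show ?thesis unfolding ys(3) by auto
  qed
  then show ?case using ys(1) same_threads_trans[OF N(2) ys(2)] unfolding ys0
    by (intro exI[of _ "ys0 @ ys"]) simp
qed

text \<open>A round appends no code only if all tuples over the active elements are codes already,
  and this stays true afterwards.\<close>

lemma phase_tuples:
  fixes n :: nat
  assumes "core M D a us xs"
  defines "M' \<equiv> fold (transform va) (replicate n (add_code va sel_tuple)) M"
  shows "\<exists>vs. core M' D a (us @ vs) xs \<and> same_threads M M' \<and>
    (length vs = n \<or> (\<forall>is \<in> tuples c {..<length xs}. (1, map (\<lambda>i. xs ! i) is) \<in> set (us @ vs)))"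
  using assms(1) unfolding M'_def
proof (induction n arbitrary: M us)
  case 0
  then show ?case by (intro exI[of _ "[]"]) (simp add: same_threads_refl)
next
  case (Suc n)
  let ?N = "transform va (add_code va sel_tuple) M"
  let ?X = "{is \<in> tuples c {..<length xs}. (1, map (\<lambda>i. xs ! i) is) \<notin> set us}"
  let ?z = "if ?X = {} then None else Some (1, map (\<lambda>i. xs ! i) (Min ?X))"
  let ?v = "case ?z of None \<Rightarrow> [] | Some u \<Rightarrow> [u]"
  have cd: "codes M us" and nm: "nums M us xs" and i: "inputs M D a" using Suc.prems by (auto simp: core_def)
  have finX: "finite ?X" using finite_tuples[of "{..<length xs}" c] by auto
  have "selects M sel_tuple ?z" by (rule selects_sel_tuple[OF cd nm i refl])
  moreover have "u \<in> univ M \<and> u \<notin> set us" if "?z = Some u" for u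
  proof -
    have ne: "?X \<noteq> {}" and u: "u = (1, map (\<lambda>i. xs ! i) (Min ?X))" using that by (auto split: if_splits)
    have m: "Min ?X \<in> ?X" by (rule Min_in[OF finX ne])
    have "map (\<lambda>i. xs ! i) (Min ?X) \<in> tuples c (univ D)"
    proof -
      have "xs ! j \<in> univ D" if "j < length xs" for j using nums_univ[OF nm that] emb_univ[OF i] by simp
      moreover have "set (Min ?X) \<subseteq> {..<length xs}" "length (Min ?X) = c" using m by (auto simp: tuples_def)
      ultimately show ?thesis by (auto simp: tuples_def)
    qed
    then show ?thesis using m tuple_univ[OF i] unfolding u by blast
  qed
  ultimately have N: "core ?N D a (us @ ?v) xs" "same_threads M ?N"
    using add_code_core[OF Suc.prems] by blast+
  have "?X = {} \<or> length ?v = 1" by simp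
  with N obtain v where v: "core ?N D a (us @ v) xs" "?X = {} \<or> length v = 1" by blast
  obtain vs where vs: "core (fold (transform va) (replicate n (add_code va sel_tuple)) ?N) D a ((us @ v) @ vs) xs"
    "same_threads ?N (fold (transform va) (replicate n (add_code va sel_tuple)) ?N)"
    "length vs = n \<or> (\<forall>is \<in> tuples c {..<length xs}. (1, map (\<lambda>i. xs ! i) is) \<in> set ((us @ v) @ vs))"
    using Suc.IH[OF v(1)] by blast
  have "length (v @ vs) = Suc n \<or> (\<forall>is \<in> tuples c {..<length xs}. (1, map (\<lambda>i. xs ! i) is) \<in> set (us @ v @ vs))"
  proof (cases "?X = {}")
    case True
    then have "(1, map (\<lambda>i. xs ! i) is) \<in> set us" if "is \<in> tuples c {..<length xs}" for "is" using that by blast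
    then show ?thesis by simp
  next
    case False
    then have "length v = 1" using v(2) by blast
    then show ?thesis using vs(3) by auto
  qed
  then show ?case using vs(1) same_threads_trans[OF N(2) vs(2)]
    by (intro exI[of _ "v @ vs"]) (simp only: append.assoc replicate_Suc fold.simps o_apply simp_thms)
qed

text \<open>The first \<open>n\<close> codes are the old ones. A new thread is claimed live only if
  its domain has room for all active elements, in particular for the constants, which its initial
  state interprets.\<close>

lemma phase_start:
  assumes core: "core M D a us xs" and born: "rel M (Sto Born) = {[u] |u. u \<in> set (take n us)}"
    and act: "active D xs" and D: "is_database \<tau> D"
  defines "M' \<equiv> transform va start M"
  shows "core M' D a us xs" "rel M' (Sto Born) = {[u] |u. u \<in> set us}"
    "\<And>w s. w < length us \<Longrightarrow> w < n \<Longrightarrow> live M us xs D w s \<Longrightarrow> live M' us xs D w s"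
    "\<And>w. w < length us \<Longrightarrow> n \<le> w \<Longrightarrow> length xs \<le> Suc w \<Longrightarrow> \<exists>s. live M' us xs D w s"
proof -
  have wf: "wf_rels va M" and i: "inputs M D a" and cd: "codes M us" and nm: "nums M us xs"
    using core by (auto simp: core_def)
  have other: "rel M' Z = rel M Z"
    if "\<And>R. Z \<noteq> Sto (TIn R)" "\<And>S. Z \<noteq> Sto (TAux S)" "Z \<noteq> Sto Born" for Z
    unfolding M'_def using rel_start_other[OF wf that] .
  have "inputs M' D a" by (rule inputs_cong[OF i]) (auto simp: M'_def other[unfolded M'_def])
  moreover have "codes M' us" by (rule codes_cong[OF cd]) (simp_all add: M'_def other[unfolded M'_def])
  moreover have "nums M' us xs" by (rule nums_cong[OF nm]) (simp_all add: M'_def other[unfolded M'_def])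
  ultimately show "core M' D a us xs" by (simp add: core_def M'_def)
  show "rel M' (Sto Born) = {[u] |u. u \<in> set us}" unfolding M'_def by (rule rel_start_Born[OF cd])
  have Born: "[us ! w] \<in> rel M (Sto Born) \<longleftrightarrow> w < n" if "w < length us" for w
  proof -
    have d: "distinct us" using cd by (simp add: codes_def)
    have "us ! w \<in> set (take n us) \<longleftrightarrow> w < n"
    proof
      assume "us ! w \<in> set (take n us)"
      then obtain j where "j < n" "j < length us" "us ! j = us ! w" by (auto simp: in_set_conv_nth)
      then show "w < n" using nth_eq_iff_index_eq[OF d, of j w] that by simp
    next
      assume "w < n"
      then show "us ! w \<in> set (take n us)" using that by (auto simp: in_set_conv_nth intro!: exI[of _ w])
    qed
    then show ?thesis by (simp add: born)
  qed
  show "live M' us xs D w s" if "w < length us" "w < n" "live M us xs D w s" for w s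
    using that thread_start_old[OF wf, of us w s] Born[of w] by (simp add: live_def M'_def)
  show "\<exists>s. live M' us xs D w s" if w: "w < length us" "n \<le> w" "length xs \<le> Suc w" for w
  proof -
    have "\<exists>i < length xs. con D d = Some (xs ! i)" if "d \<in> con_syms \<tau>" for d
    proof -
      have "d \<in> dom (con D)" using D that unfolding is_database_def by simp
      then obtain x where x: "con D d = Some x" by auto
      then have "x \<in> set xs" using act by (auto simp: active_def ran_def)
      with x show ?thesis by (auto simp: in_set_conv_nth)
    qed
    then obtain g where g: "\<And>d. d \<in> con_syms \<tau> \<Longrightarrow> g d < length xs \<and> con D d = Some (xs ! g d)" by metis
    define \<kappa> where "\<kappa> d = (if d \<in> con_syms \<tau> then Some (g d) else None)" for d
    have \<kappa>: "dom \<kappa> = con_syms \<tau>" "ran \<kappa> \<subseteq> {..w}"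
      using g w(3) by (fastforce simp: \<kappa>_def dom_def ran_def split: if_splits)+
    have "thread M' us w (init_state w \<kappa>)"
      unfolding M'_def using Born[OF w(1)] w by (intro thread_start_new[OF cd]) auto
    moreover have "reachable w (init_state w \<kappa>)"
      unfolding reachable_def using \<kappa> by (intro exI[of _ \<kappa>] exI[of _ "[]"]) simp
    moreover have "sound D xs (init_state w \<kappa>)"
      using g by (auto simp: sound_def \<kappa>_def)
    ultimately show ?thesis by (auto simp: live_def)
  qed
qed

lemma live_step:
  assumes core: "core M D a us xs" and w: "w < length us" "length xs \<le> Suc w"
    and l: "thread M us w s" "reachable w s"
    and con: "\<And>d. d \<in> con_syms \<tau> \<Longrightarrow> \<exists>i < length xs. con (fst s) d = Some i \<and> con D d = Some (xs ! i)"
    and \<delta>: "changed_rel \<delta> \<in> rel_syms \<tau>" and ids: "is \<in> tuples (arity \<tau> (changed_rel \<delta>)) {..<length xs}"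
    and Q: "defines_tuples M us (Suc 0) (\<lambda>_. us ! w) (arity \<tau> (changed_rel \<delta>)) Q {is}"
  shows "thread (transform va (step_threads \<delta> Q) M) us w (step P (\<delta>, is) s)" "reachable w (step P (\<delta>, is) s)"
proof -
  have wf: "wf_rels va M" and i: "inputs M D a" and cd: "codes M us" and n: "nums M us xs"
    using core by (auto simp: core_def)
  have v: "valid_state \<tau> P s" "univ (fst s) = {..w}" using reachable_valid[OF l(2)] by auto
  have isw: "is \<in> tuples (arity \<tau> (changed_rel \<delta>)) {..w}" using ids w(2) by (fastforce simp: tuples_def)
  have cs: "the (con (fst s) d) < length xs \<and> rel M (Cst d) = {[emb (xs ! the (con (fst s) d))]}"
    if d: "d \<in> con_syms \<tau>" for d
    using con[OF d] i by (auto simp: inputs_def)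
  show "thread (transform va (step_threads \<delta> Q) M) us w (step P (\<delta>, is) s)"
    by (rule thread_step_Some[OF wf cd n w(1) Q isw \<delta> l(1) v cs])
  show "reachable w (step P (\<delta>, is) s)"
    by (rule reachable_step[OF l(2)]) (use \<delta> isw in \<open>simp add: is_change_def\<close>)
qed

lemma core_step_threads:
  fixes \<delta> :: "'r change_type" and Q :: "nat \<Rightarrow> nat \<Rightarrow> (('r, 'c, 'r sym) vsym, unit) formula"
  assumes core: "core M D a us xs"
  defines "M' \<equiv> transform va (step_threads \<delta> Q) M"
  shows "core M' D a us xs" "rel M' (Sto Born) = rel M (Sto Born)"
proof -
  have wf: "wf_rels va M" and i: "inputs M D a" and cd: "codes M us" and n: "nums M us xs"
    using core by (auto simp: core_def)
  have other: "rel M' Z = rel M Z" if "\<And>R. Z \<noteq> Sto (TIn R)" "\<And>S. Z \<noteq> Sto (TAux S)" for Z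
    unfolding M'_def using rel_step_threads_other[OF wf that] .
  have "inputs M' D a" by (rule inputs_cong[OF i]) (auto simp: M'_def other[unfolded M'_def])
  moreover have "codes M' us" by (rule codes_cong[OF cd]) (simp_all add: M'_def other[unfolded M'_def])
  moreover have "nums M' us xs" by (rule nums_cong[OF n]) (simp_all add: M'_def other[unfolded M'_def])
  ultimately show "core M' D a us xs" by (simp add: core_def M'_def)
  show "rel M' (Sto Born) = rel M (Sto Born)" by (rule other) auto
qed

lemma index_tuples_change:
  assumes "distinct xs" "is \<in> tuples (arity \<tau> (changed_rel \<delta>)) {..<length xs}"
  shows "index_tuples (apply_change (\<delta>, map (\<lambda>i. xs ! i) is) D) xs R = (if R = changed_rel \<delta> then
    (case \<delta> of Ins _ \<Rightarrow> index_tuples D xs R \<union> {is} | Del _ \<Rightarrow> index_tuples D xs R - {is})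
    else index_tuples D xs R)"
proof -
  have "map (\<lambda>i. xs ! i) js = map (\<lambda>i. xs ! i) is \<longleftrightarrow> js = is"
    if "js \<in> tuples (arity \<tau> (changed_rel \<delta>)) {..<length xs}" for js
    by (rule map_nth_eq_iff[OF assms(1) that assms(2)])
  then show ?thesis
    using assms(2) by (cases \<delta>) (auto simp: index_tuples_def rel_apply_change)
qed

lemma rel_step: "rel (fst (step P (\<delta>, is) s)) R = (if R = changed_rel \<delta> then
    (case \<delta> of Ins _ \<Rightarrow> rel (fst s) R \<union> {is} | Del _ \<Rightarrow> rel (fst s) R - {is}) else rel (fst s) R)"
  by (simp add: rel_apply_change)

text \<open>Input and copy undergo the same change: an inserted tuple is missing no longer, and a
  deleted one disappears from both. So the deficit cannot grow.\<close>

lemma phase_change: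
  assumes core: "core M D a us xs" and \<delta>: "changed_rel \<delta> \<in> rel_syms \<tau>"
    and ids: "is \<in> tuples (arity \<tau> (changed_rel \<delta>)) {..<length xs}" and a: "a = map (\<lambda>i. xs ! i) is"
    and aD: "a \<in> tuples (arity \<tau> (changed_rel \<delta>)) (univ D)" and act: "active D xs"
  defines "D' \<equiv> apply_change (\<delta>, a) D"
  defines "M' \<equiv> transform va (step_threads \<delta> (sel_change (arity \<tau> (changed_rel \<delta>))))
    (transform va (update_input \<delta>) M)"
  shows "core M' D' a us xs" "rel M' (Sto Born) = rel M (Sto Born)"
    "\<And>w s. w < length us \<Longrightarrow> length xs \<le> Suc w \<Longrightarrow> live M us xs D w s \<Longrightarrow>
      \<exists>s'. live M' us xs D' w s' \<and> deficit D' xs s' \<le> deficit D xs s"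
proof -
  let ?m = "arity \<tau> (changed_rel \<delta>)"
  let ?N = "transform va (update_input \<delta>) M"
  have wf: "wf_rels va M" and i: "inputs M D a" and cd: "codes M us" and n: "nums M us xs"
    using core by (auto simp: core_def)
  have dx: "distinct xs" using act by (simp add: active_def)
  have other: "rel ?N (Sto z) = rel M (Sto z)" for z by (rule rel_update_input_other[OF wf]) simp
  have iN: "inputs ?N D' a" unfolding D'_def by (rule inputs_update_input[OF wf i aD])
  have coreN: "core ?N D' a us xs"
    using iN codes_cong[OF cd, of ?N] nums_cong[OF n, of ?N] other by (simp add: core_def)
  show "core M' D' a us xs" "rel M' (Sto Born) = rel M (Sto Born)"
    unfolding M'_def using core_step_threads[OF coreN] other by auto
  fix w s assume w: "w < length us" "length xs \<le> Suc w" and l: "live M us xs D w s"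
  have cdN: "codes ?N us" and nN: "nums ?N us xs" using coreN by (auto simp: core_def)
  have Q: "defines_tuples ?N us (Suc 0) (\<lambda>_. us ! w) ?m (sel_change ?m) {is}"
    using defines_sel_change[OF cdN nN iN[unfolded a] ids] .
  have l': "thread ?N us w s" "reachable w s" "sound D xs s"
    using l thread_cong[of M us w s ?N] other by (auto simp: live_def)
  let ?s = "step P (\<delta>, is) s"
  have "\<exists>i < length xs. con (fst s) d = Some i \<and> con D' d = Some (xs ! i)" if "d \<in> con_syms \<tau>" for d
    using l'(3) that by (simp add: sound_def D'_def)
  then have t: "thread M' us w ?s" "reachable w ?s"
    unfolding M'_def using live_step[OF coreN w l'(1,2) _ \<delta> ids Q] by blast+
  have idx: "index_tuples D' xs R = (if R = changed_rel \<delta> then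
      (case \<delta> of Ins _ \<Rightarrow> index_tuples D xs R \<union> {is} | Del _ \<Rightarrow> index_tuples D xs R - {is})
      else index_tuples D xs R)" for R
    unfolding D'_def a by (rule index_tuples_change[OF dx ids])
  have "sound D' xs ?s"
    unfolding sound_def
  proof (intro conjI ballI)
    show "\<exists>i < length xs. con (fst ?s) d = Some i \<and> con D' d = Some (xs ! i)" if "d \<in> con_syms \<tau>" for d
      using l'(3) that by (simp add: sound_def D'_def)
    show "rel (fst ?s) R \<subseteq> index_tuples D' xs R" if "R \<in> rel_syms \<tau>" for R
    proof -
      have "rel (fst s) R \<subseteq> index_tuples D xs R" using l'(3) that by (simp add: sound_def)
      then show ?thesis unfolding idx rel_step by (auto split: change_type.split)
    qed
  qed
  moreover have "deficit D' xs ?s \<le> deficit D xs s"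
    unfolding deficit_def idx rel_step
    by (intro sum_mono card_mono finite_Diff finite_index_tuples) (auto split: change_type.splits if_splits)
  ultimately show "\<exists>s'. live M' us xs D' w s' \<and> deficit D' xs s' \<le> deficit D xs s"
    using t by (auto simp: live_def)
qed

text \<open>The inserted tuple belongs to the actual input, so the thread stays sound, and it was
  missing, so the deficit drops.\<close>

lemma replay_one:
  assumes core: "core M D a us xs" and R: "R \<in> rel_syms \<tau>"
  defines "M' \<equiv> transform va (step_threads (Ins R) (lex_min (arity \<tau> R) (missing 0 R))) M"
  shows "core M' D a us xs" "rel M' (Sto Born) = rel M (Sto Born)"
    "\<And>w s. w < length us \<Longrightarrow> length xs \<le> Suc w \<Longrightarrow> live M us xs D w s \<Longrightarrow>
      \<exists>s'. live M' us xs D w s' \<and> (s' = s \<and> index_tuples D xs R \<subseteq> rel (fst s) R \<or> deficit D xs s' < deficit D xs s)"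
proof -
  have wf: "wf_rels va M" and i: "inputs M D a" and cd: "codes M us" and n: "nums M us xs"
    using core by (auto simp: core_def)
  show "core M' D a us xs" "rel M' (Sto Born) = rel M (Sto Born)"
    unfolding M'_def using core_step_threads[OF core] by auto
  fix w s assume w: "w < length us" "length xs \<le> Suc w" and l: "live M us xs D w s"
  have t: "thread M us w s" "reachable w s" "sound D xs s" using l by (auto simp: live_def)
  have v: "valid_state \<tau> P s" "univ (fst s) = {..w}" using reachable_valid[OF t(2)] by auto
  let ?X = "index_tuples D xs R - rel (fst s) R"
  have relS: "rel (fst s) R \<subseteq> tuples (arity \<tau> R) {..<length us}"
  proof -
    have "rel (fst s) R \<subseteq> tuples (arity \<tau> R) {..w}" using v R by (auto simp: valid_state_def is_database_def)
    then show ?thesis using w by (fastforce simp: tuples_def)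
  qed
  have "defines_tuples M us (Suc 0) (\<lambda>_. us ! w) (arity \<tau> R) (missing 0 R) ?X"
    unfolding index_tuples_def by (rule defines_missing[OF cd n i _ _ thread_TIn[OF t(1) R] relS]) auto
  moreover have "?X \<subseteq> tuples (arity \<tau> R) {..<length us}"
    using n by (fastforce simp: index_tuples_def tuples_def nums_def)
  ultimately have Q: "defines_tuples M us (Suc 0) (\<lambda>_. us ! w) (arity \<tau> R) (lex_min (arity \<tau> R) (missing 0 R))
      (if ?X = {} then {} else {Min ?X})"
    by (rule defines_tuples_lex_min[OF cd])
  show "\<exists>s'. live M' us xs D w s' \<and> (s' = s \<and> index_tuples D xs R \<subseteq> rel (fst s) R \<or> deficit D xs s' < deficit D xs s)"
  proof (cases "?X = {}")
    case True
    then have "thread M' us w s" unfolding M'_def using Q t(1) by (intro thread_step_None[OF wf]) auto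
    then show ?thesis using t(2,3) True by (auto simp: live_def)
  next
    case False
    let ?is = "Min ?X"
    let ?s = "step P (Ins R, ?is) s"
    have isX: "?is \<in> ?X" by (rule Min_in[OF _ False]) (simp add: finite_index_tuples)
    then have ids: "?is \<in> tuples (arity \<tau> (changed_rel (Ins R))) {..<length xs}" by (simp add: index_tuples_def)
    have con: "\<exists>i < length xs. con (fst s) d = Some i \<and> con D d = Some (xs ! i)" if "d \<in> con_syms \<tau>" for d
      using t(3) that by (simp add: sound_def)
    have th: "thread M' us w ?s" "reachable w ?s"
      unfolding M'_def using live_step[OF core w t(1,2) con _ ids] Q False R by auto
    have rs: "rel (fst ?s) R' = (if R' = R then rel (fst s) R \<union> {?is} else rel (fst s) R')" for R'
      unfolding rel_step by simp
    have "sound D xs ?s"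
      unfolding sound_def
    proof (intro conjI ballI)
      show "\<exists>i < length xs. con (fst ?s) d = Some i \<and> con D d = Some (xs ! i)" if "d \<in> con_syms \<tau>" for d
        using con[OF that] by simp
      show "rel (fst ?s) R' \<subseteq> index_tuples D xs R'" if "R' \<in> rel_syms \<tau>" for R'
        unfolding rs using t(3) that isX by (auto simp: sound_def)
    qed
    moreover have "deficit D xs ?s < deficit D xs s"
      unfolding deficit_def rs
    proof (rule sum_strict_mono_ex1[OF finite_rel_syms])
      show "\<forall>R' \<in> rel_syms \<tau>. card (index_tuples D xs R' - (if R' = R then rel (fst s) R \<union> {?is} else rel (fst s) R'))
          \<le> card (index_tuples D xs R' - rel (fst s) R')"
        by (intro ballI card_mono finite_Diff finite_index_tuples) auto
      have "card (index_tuples D xs R - (rel (fst s) R \<union> {?is})) < card ?X"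
        using isX by (intro psubset_card_mono finite_Diff finite_index_tuples) blast
      then show "\<exists>R' \<in> rel_syms \<tau>. card (index_tuples D xs R' - (if R' = R then rel (fst s) R \<union> {?is} else rel (fst s) R'))
          < card (index_tuples D xs R' - rel (fst s) R')"
        using R by (intro bexI[of _ R]) simp_all
    qed
    ultimately show ?thesis using th by (auto simp: live_def)
  qed
qed

text \<open>The alternative \<open>s' = s\<close> ties the findings for the single relations to one
  and the same state: a thread that no relation has helped was complete from the beginning.\<close>

lemma phase_replay:
  assumes "core M D a us xs" "set Rs \<subseteq> rel_syms \<tau>"
  defines "M' \<equiv> fold (transform va) (map (\<lambda>R. step_threads (Ins R) (lex_min (arity \<tau> R) (missing 0 R))) Rs) M"
  shows "core M' D a us xs \<and> rel M' (Sto Born) = rel M (Sto Born) \<and>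
    (\<forall>w s. w < length us \<longrightarrow> length xs \<le> Suc w \<longrightarrow> live M us xs D w s \<longrightarrow>
      (\<exists>s'. live M' us xs D w s' \<and> (s' = s \<and> (\<forall>R \<in> set Rs. index_tuples D xs R \<subseteq> rel (fst s) R) \<or>
        deficit D xs s' < deficit D xs s)))"
  using assms(1,2) unfolding M'_def
proof (induction Rs arbitrary: M)
  case Nil
  then show ?case by auto
next
  case (Cons R Rs)
  let ?N = "transform va (step_threads (Ins R) (lex_min (arity \<tau> R) (missing 0 R))) M"
  let ?F = "fold (transform va) (map (\<lambda>R. step_threads (Ins R) (lex_min (arity \<tau> R) (missing 0 R))) Rs) ?N"
  have R: "R \<in> rel_syms \<tau>" using Cons.prems(2) by simp
  note N = replay_one[OF Cons.prems(1) R]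
  have IH: "core ?F D a us xs" "rel ?F (Sto Born) = rel ?N (Sto Born)"
    "\<And>w s. w < length us \<Longrightarrow> length xs \<le> Suc w \<Longrightarrow> live ?N us xs D w s \<Longrightarrow>
      (\<exists>s'. live ?F us xs D w s' \<and> (s' = s \<and> (\<forall>R \<in> set Rs. index_tuples D xs R \<subseteq> rel (fst s) R) \<or>
        deficit D xs s' < deficit D xs s))"
    using Cons.IH[OF N(1)] Cons.prems(2) by auto
  have "\<exists>s'. live ?F us xs D w s' \<and> (s' = s \<and> (\<forall>R \<in> set (R # Rs). index_tuples D xs R \<subseteq> rel (fst s) R) \<or>
      deficit D xs s' < deficit D xs s)"
    if w: "w < length us" "length xs \<le> Suc w" and l: "live M us xs D w s" for w s
  proof -
    obtain s1 where s1: "live ?N us xs D w s1"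
      "s1 = s \<and> index_tuples D xs R \<subseteq> rel (fst s) R \<or> deficit D xs s1 < deficit D xs s"
      using N(3)[OF w l] by blast
    obtain s2 where s2: "live ?F us xs D w s2"
      "s2 = s1 \<and> (\<forall>R \<in> set Rs. index_tuples D xs R \<subseteq> rel (fst s1) R) \<or> deficit D xs s2 < deficit D xs s1"
      using IH(3)[OF w s1(1)] by blast
    from s1(2) s2(2) have "s2 = s \<and> (\<forall>R \<in> set (R # Rs). index_tuples D xs R \<subseteq> rel (fst s) R) \<or>
        deficit D xs s2 < deficit D xs s" by auto
    with s2(1) show ?thesis by blast
  qed
  then show ?case using IH(1,2) N(2) by auto
qed

end

section \<open>Preservation of the invariant\<close>

context simulation
begin

sublocale tp: wf_tuple_program \<tau> c B St sar "updates (2 * mx)" Ans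
proof
  show "finite_schema \<tau>" by (rule fin)
  have "finite (aux_syms P)" using P by (simp add: is_program_def)
  then show "finite St" using finite_rel_syms by (simp add: St_def)
  show "updates (2 * mx) \<delta> \<noteq> [] \<and>
      (\<forall>U \<in> set (updates (2 * mx) \<delta>). wf_transform (vsch (arity \<tau> (changed_rel \<delta>))) U)"
    if "changed_rel \<delta> \<in> rel_syms \<tau>" for \<delta>
    using wf_updates[OF that] by (simp add: updates_def)
qed simp

lemma vbase_simps [simp]: "univ (tp.vbase D a A) = tp.vuniv (univ D)" "rel (tp.vbase D a A) (Sto z) = A z"
  by (simp_all add: tp.vbase_def)

lemma inputs_vbase: "inputs (tp.vbase D a A) D a"
  by (auto simp: inputs_def tp.vbase_def)

lemma wf_rels_vbase:
  assumes D: "is_database \<tau> D" and a: "set a \<subseteq> univ D" and A: "\<And>z. A z \<subseteq> tuples (sar z) (tp.vuniv (univ D))"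
  shows "wf_rels va (tp.vbase D a A)"
  unfolding wf_rels_def
proof
  fix Z
  have e: "emb x \<in> tp.vuniv (univ D) \<longleftrightarrow> x \<in> univ D" for x
    using emb_univ[OF inputs_vbase, of x D a A] by simp
  show "rel (tp.vbase D a A) Z \<subseteq> tuples (va Z) (univ (tp.vbase D a A))"
  proof (cases Z)
    case (In R)
    have "rel D R \<subseteq> tuples (arity \<tau> R) (univ D)"
      using D by (cases "R \<in> rel_syms \<tau>") (auto simp: is_database_def)
    then have "map emb t \<in> tuples (arity \<tau> R) (tp.vuniv (univ D))" if "t \<in> rel D R" for t
    proof -
      have "length t = arity \<tau> R" "set t \<subseteq> univ D" using \<open>rel D R \<subseteq> _\<close> that by (auto simp: tuples_def)
      moreover have "set (map emb t) \<subseteq> tp.vuniv (univ D)" using calculation(2) e by auto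
      ultimately show ?thesis by (simp add: tuples_def)
    qed
    then show ?thesis using In by (auto simp: tp.vbase_def)
  next
    case (Cst d)
    have "ran (con D) \<subseteq> univ D" using D by (simp add: is_database_def)
    then show ?thesis using Cst e by (auto simp: tp.vbase_def tuples_def ran_def)
  next
    case (Chg j)
    moreover have "a ! j \<in> univ D" if "j < length a" using a nth_mem[OF that] by blast
    ultimately show ?thesis using e by (auto simp: tp.vbase_def tuples_def)
  next
    case (Coord j)
    have "xs ! j \<in> univ D" if "j < c" "xs \<in> tuples c (univ D)" for xs
      using tuples_nth[OF that(2,1)] .
    moreover have "(1, xs) \<in> tp.vuniv (univ D)" if "xs \<in> tuples c (univ D)" for xs
      using that tuple_univ[OF inputs_vbase, of xs D a A] by simp
    ultimately show ?thesis using Coord e by (auto simp: tp.vbase_def tuples_def)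
  next
    case (Bot g)
    then show ?thesis using bot_univ[OF inputs_vbase, of g D a A]
      by (auto simp: tp.vbase_def tuples_def)
  next
    case (Sto z)
    then show ?thesis using A[of z] by simp
  qed
qed

definition ready_for_all :: "(nat \<times> 'a list, ('r, 'c, 'r sym) vsym, unit) database \<Rightarrow>
    (nat \<times> 'a list) list \<Rightarrow> 'a list \<Rightarrow> ('a, 'r, 'c) database \<Rightarrow> bool" where
  "ready_for_all M us xs D \<longleftrightarrow> (\<forall>j \<le> total D xs. \<exists>w s. w < length us \<and> length xs + mx * j \<le> Suc w \<and>
     live M us xs D w s \<and> deficit D xs s \<le> j)"

text \<open>A thread with deficit \<open>j\<close> has caught up with the input after \<open>j\<close> further changes, in which at most
  \<open>mx * j\<close> elements are activated. So the condition \<open>ready_for_all\<close> provides, now and at every later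
  time, a thread that has caught up and whose domain has room for all active elements.\<close>

definition invariant_at :: "('a, 'r, 'c) database \<Rightarrow> ('r sym \<Rightarrow> (nat \<times> 'a list) relation) \<Rightarrow>
    (nat \<times> 'a list) list \<Rightarrow> 'a list \<Rightarrow> bool" where
  "invariant_at D A us xs \<longleftrightarrow> (let M = tp.vbase D [] A in
     codes M us \<and> nums M us xs \<and> A Born = {[u] |u. u \<in> set us} \<and>
     (\<forall>R \<in> rel_syms \<tau>. rel D R \<subseteq> tuples (arity \<tau> R) (set xs)) \<and>
     (\<forall>w < length us. length xs \<le> Suc w \<longrightarrow> (\<exists>s. live M us xs D w s)) \<and>
     (us = [] \<longrightarrow> xs = [] \<and> (\<forall>R. rel D R = {})) \<and>
     (us \<noteq> [] \<longrightarrow> ran (con D) \<subseteq> set xs \<and> length xs + mx * total D xs + mx \<le> length us \<and>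
        ready_for_all M us xs D))"

definition invariant :: "('a, 'r, 'c) database \<Rightarrow> ('r sym \<Rightarrow> (nat \<times> 'a list) relation) \<Rightarrow> bool" where
  "invariant D A \<longleftrightarrow> (\<forall>z. A z \<subseteq> tuples (sar z) (tp.vuniv (univ D))) \<and> (\<exists>us xs. invariant_at D A us xs)"

text \<open>Before the first change there are neither codes nor threads, and not even the constants
  are active. The branch \<open>us = []\<close> of \<open>invariant_at\<close> exists for this state
  alone.\<close>

lemma invariant_initial:
  assumes "initial_database \<tau> D"
  shows "invariant D (\<lambda>z. {})"
  using assms unfolding invariant_def invariant_at_def Let_def
  by (auto simp: codes_def nums_def initial_database_def intro!: exI[of _ "[]"])

section \<open>Counting tuples against codes\<close>

lemma total_change:
  assumes "distinct xs" "is \<in> tuples (arity \<tau> (changed_rel \<delta>)) {..<length xs}" "changed_rel \<delta> \<in> rel_syms \<tau>"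
  shows "total (apply_change (\<delta>, map (\<lambda>i. xs ! i) is) D) xs \<le> Suc (total D xs)"
proof -
  let ?D = "apply_change (\<delta>, map (\<lambda>i. xs ! i) is) D"
  have "card (index_tuples ?D xs R) \<le> card (index_tuples D xs R) + (if R = changed_rel \<delta> then 1 else 0)" for R
  proof -
    have "index_tuples ?D xs R \<subseteq> (if R = changed_rel \<delta> then insert is (index_tuples D xs R) else index_tuples D xs R)"
      unfolding index_tuples_change[OF assms(1,2)] by (auto split: change_type.split)
    from card_mono[OF _ this] show ?thesis
      using finite_index_tuples[of D xs R] by (auto simp: card_insert_if split: if_splits)
  qed
  then have "total ?D xs \<le> (\<Sum>R \<in> rel_syms \<tau>. card (index_tuples D xs R) + (if R = changed_rel \<delta> then 1 else 0))"
    unfolding total_def by (rule sum_mono)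
  also have "\<dots> = Suc (total D xs)"
    using finite_rel_syms assms(3) by (simp add: sum.distrib total_def)
  finally show ?thesis .
qed

text \<open>Even without active elements a 0-ary relation can hold the empty tuple, hence
  \<open>max 1\<close>.\<close>

lemma total_le: "total D xs \<le> card (rel_syms \<tau>) * max 1 (length xs) ^ mx"
proof -
  have "card (index_tuples D xs R) \<le> max 1 (length xs) ^ mx" if R: "R \<in> rel_syms \<tau>" for R
  proof -
    have "card (index_tuples D xs R) \<le> card (tuples (arity \<tau> R) {..<length xs})"
      by (intro card_mono finite_tuples) (auto simp: index_tuples_def)
    also have "\<dots> = length xs ^ arity \<tau> R" by (simp add: card_tuples)
    also have "\<dots> \<le> max 1 (length xs) ^ arity \<tau> R" by (intro power_mono) auto
    also have "\<dots> \<le> max 1 (length xs) ^ mx" by (intro power_increasing mx(2)[OF R]) auto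
    finally show ?thesis .
  qed
  then have "total D xs \<le> of_nat (card (rel_syms \<tau>)) * max 1 (length xs) ^ mx"
    unfolding total_def by (rule sum_bounded_above)
  then show ?thesis by simp
qed

text \<open>Let r be the number of input relations. For \<open>n \<ge> 2\<close>, multiply mx * r +
  2 <= 2 ^ (mx * r + 1) <= n ^ (mx * r + 1) by \<open>n ^ mx\<close>; the surplus of two copies of
  \<open>n ^ mx\<close> absorbs \<open>n\<close>. For \<open>n \<le> 1\<close> the constants counted
  by \<open>B\<close> suffice.\<close>

lemma enough_codes: "n + mx * (card (rel_syms \<tau>) * max 1 n ^ mx) + mx \<le> B + n ^ c"
proof -
  let ?r = "card (rel_syms \<tau>)"
  consider "n = 0" | "n = 1" | "2 \<le> n" by linarith
  then show ?thesis
  proof cases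
    case 3
    have "mx * ?r + 2 \<le> 2 ^ (mx * ?r + 1)"
      using less_exp[of "mx * ?r + 1"] by simp
    also have "(2::nat) ^ (mx * ?r + 1) \<le> n ^ (mx * ?r + 1)" using 3 by (intro power_mono) auto
    finally have "n ^ mx * (mx * ?r + 2) \<le> n ^ mx * n ^ (mx * ?r + 1)" by (rule mult_left_mono) simp
    also have "\<dots> = n ^ c" by (simp add: c_eq power_add)
    finally have "mx * (?r * n ^ mx) + 2 * n ^ mx \<le> n ^ c" by (simp add: algebra_simps)
    moreover have "n \<le> n ^ mx" using mx(1) 3 by (intro self_le_power) auto
    ultimately have "n + mx * (?r * n ^ mx) \<le> n ^ c" by linarith
    then show ?thesis using 3 by (simp add: B max_def)
  qed (simp_all add: B c_eq)
qed

lemma vstep_snd: "z \<in> St \<Longrightarrow> snd (tp.vstep (\<delta>, a) (D, A)) z =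
    rel (fold (transform va) (updates (2 * mx) \<delta>) (tp.vbase D a A)) (Sto z)"
  "z \<notin> St \<Longrightarrow> snd (tp.vstep (\<delta>, a) (D, A)) z = {}"
  by simp_all

lemma invariant_step:
  assumes D: "is_database \<tau> D" and ch: "is_change \<tau> (univ D) (\<delta>, a)" and inv: "invariant D A"
  defines "D' \<equiv> apply_change (\<delta>, a) D" and "A' \<equiv> snd (tp.vstep (\<delta>, a) (D, A))"
  shows "invariant D' A'" "{b \<in> tuples k (univ D). map emb b \<in> A' Ans} = q D'"
proof -
  let ?m = "arity \<tau> (changed_rel \<delta>)"
  have \<delta>: "changed_rel \<delta> \<in> rel_syms \<tau>" and aD: "a \<in> tuples ?m (univ D)" using ch by (auto simp: is_change_def)
  have m: "?m \<le> mx" by (rule mx(2)[OF \<delta>])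
  have la: "length a = ?m" "set a \<subseteq> univ D" using aD by (auto simp: tuples_def)
  have D': "is_database \<tau> D'" unfolding D'_def by (rule is_database_apply_change[OF D ch])
  obtain us xs where "invariant_at D A us xs" and I1: "\<And>z. A z \<subseteq> tuples (sar z) (tp.vuniv (univ D))"
    using inv unfolding invariant_def by blast
  note inv' = this(1)[unfolded invariant_at_def Let_def]
  have I2: "codes (tp.vbase D [] A) us" using inv' by (elim conjE)
  have I3: "nums (tp.vbase D [] A) us xs" using inv' by (elim conjE)
  have I4: "A Born = {[u] |u. u \<in> set us}" using inv' by (elim conjE)
  have "\<forall>R \<in> rel_syms \<tau>. rel D R \<subseteq> tuples (arity \<tau> R) (set xs)" using inv' by (elim conjE)
  then have I5: "rel D R \<subseteq> tuples (arity \<tau> R) (set xs)" if "R \<in> rel_syms \<tau>" for R using that by blast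
  have "\<forall>w < length us. length xs \<le> Suc w \<longrightarrow> (\<exists>s. live (tp.vbase D [] A) us xs D w s)"
    using inv' by (elim conjE)
  then have I6: "\<exists>s. live (tp.vbase D [] A) us xs D w s" if "w < length us" "length xs \<le> Suc w" for w
    using that by blast
  have I7: "us = [] \<longrightarrow> xs = [] \<and> (\<forall>R. rel D R = {})" using inv' by (elim conjE)
  have I8: "us \<noteq> [] \<longrightarrow> ran (con D) \<subseteq> set xs \<and> length xs + mx * total D xs + mx \<le> length us \<and>
    ready_for_all (tp.vbase D [] A) us xs D" using inv' by (elim conjE)

  \<comment> \<open>The invariant speaks about the structure with an empty changed tuple, so as not
    to depend on any change. Codes, numbers and threads do not see the difference.\<close>
  define M0 where "M0 = tp.vbase D a A"
  have same0: "same_threads (tp.vbase D [] A) M0" by (simp add: same_threads_def M0_def)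
  have "wf_rels va M0" unfolding M0_def by (rule wf_rels_vbase[OF D la(2) I1])
  then have core0: "core M0 D a us xs"
    using inputs_vbase codes_cong[OF I2, of M0] nums_cong[OF I3, of M0] by (simp add: core_def M0_def)

  define M1 where "M1 = fold (transform va) (map (\<lambda>g. add_code va (sel_bot g)) [0..<B]) M0"
  obtain vs1 where core1: "core M1 D a (us @ vs1) xs" and same1: "same_threads M0 M1"
    and bots: "(\<lambda>g. (g + 2, [])) ` set [0..<B] \<subseteq> set (us @ vs1)"
  proof -
    have "set [0..<B] \<subseteq> {..<B}" by auto
    from phase_bots[OF core0 this] show thesis using that unfolding M1_def by blast
  qed
  have card_bots: "card ((\<lambda>g. (g + 2, [] :: 'a list)) ` set [0..<B]) = B"
    by (subst card_image) (auto simp: inj_on_def)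
  have lB: "B \<le> length (us @ vs1)"
    using card_mono[OF _ bots] card_bots card_length[of "us @ vs1"] by (metis List.finite_set le_trans)

  define Zs :: "('r, 'c, 'r sym) vsym list" where "Zs = map Cst cl @ map Chg [0..<?m]"
  define f :: "('r, 'c, 'r sym) vsym \<Rightarrow> 'a" where
    "f Z = (case Z of Cst d \<Rightarrow> the (con D d) | Chg j \<Rightarrow> a ! j | _ \<Rightarrow> undefined)" for Z
  have conD: "\<exists>x. con D d = Some x" if "d \<in> set cl" for d
  proof -
    have "d \<in> dom (con D)" using that D unfolding cl is_database_def by simp
    then show ?thesis by auto
  qed
  have ranD: "(\<lambda>d. the (con D d)) ` set cl = ran (con D)"
  proof
    show "(\<lambda>d. the (con D d)) ` set cl \<subseteq> ran (con D)" using conD by (force simp: ran_def)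
    show "ran (con D) \<subseteq> (\<lambda>d. the (con D d)) ` set cl"
    proof
      fix x assume "x \<in> ran (con D)"
      then obtain d where d: "con D d = Some x" by (auto simp: ran_def)
      then have "d \<in> dom (con D)" by blast
      then have "d \<in> set cl" using D unfolding cl is_database_def by simp
      with d show "x \<in> (\<lambda>d. the (con D d)) ` set cl" by force
    qed
  qed
  have setZs: "f ` set Zs = ran (con D) \<union> set a"
  proof -
    have "f ` set Zs = (\<lambda>d. the (con D d)) ` set cl \<union> (\<lambda>j. a ! j) ` {0..<?m}"
      by (simp add: Zs_def image_Un image_image f_def)
    moreover have "(\<lambda>j. a ! j) ` {0..<?m} = set a" using nth_image[of ?m a] la(1) by simp
    ultimately show ?thesis unfolding ranD by simp
  qed
  have selZ: "rel N Z = {[emb (f Z)]}" if "Z \<in> set Zs" "inputs N D a" for Z N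
    using that conD la(1) by (fastforce simp: Zs_def f_def inputs_def)
  have fD: "f ` set Zs \<subseteq> univ D" unfolding setZs using la(2) D by (simp add: is_database_def)
  \<comment> \<open>At the first change the \<open>B\<close> constants have to number all of
    \<open>Zs\<close>. Later the reserve of \<open>mx\<close> codes suffices, because the constants
    are active and only the changed tuple can bring new elements.\<close>
  have room: "length xs + card (f ` set Zs - set xs) \<le> length (us @ vs1)"
  proof (cases "us = []")
    case True
    then have "xs = []" using I7 by simp
    moreover have "card (f ` set Zs) \<le> length Zs" using card_image_le[of "set Zs" f] card_length[of Zs] by simp
    moreover have "length Zs \<le> B" using m by (simp add: Zs_def B)
    ultimately show ?thesis using lB by simp
  next
    case False
    then have r: "ran (con D) \<subseteq> set xs" "length xs + mx * total D xs + mx \<le> length us" using I8 by auto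
    have "card (f ` set Zs - set xs) \<le> card (set a)"
      unfolding setZs using r(1) by (intro card_mono) auto
    also have "\<dots> \<le> mx" using card_length[of a] la(1) m by linarith
    finally show ?thesis using r(2) by simp
  qed
  define M2 where "M2 = fold (transform va) (map (\<lambda>Z. activate va (\<lambda>i. at Z [i])) Zs) M1"
  obtain ys where core2: "core M2 D a (us @ vs1) (xs @ ys)" and same2: "same_threads M1 M2"
    and set2: "set (xs @ ys) = set xs \<union> f ` set Zs"
    unfolding M2_def using phase_activate[OF core1 room selZ fD] by blast
  define xs' where "xs' = xs @ ys"

  define M3 where "M3 = fold (transform va) (replicate (2 * mx) (add_code va sel_tuple)) M2"
  obtain vs2 where core3: "core M3 D a ((us @ vs1) @ vs2) xs'" and same3: "same_threads M2 M3"
    and tup: "length vs2 = 2 * mx \<or>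
      (\<forall>is \<in> tuples c {..<length xs'}. (1, map (\<lambda>i. xs' ! i) is) \<in> set ((us @ vs1) @ vs2))"
    unfolding M3_def xs'_def using phase_tuples[OF core2] by blast
  define us' where "us' = us @ vs1 @ vs2"
  have us': "us' = (us @ vs1) @ vs2" by (simp add: us'_def)
  note core3 = core3[folded us'] and tup = tup[folded us']
  have cd3: "codes M3 us'" and n3: "nums M3 us' xs'" and i3: "inputs M3 D a" using core3 by (auto simp: core_def)
  have dx: "distinct xs'" using n3 by (simp add: nums_def)
  have du: "distinct us'" using cd3 by (simp add: codes_def)
  have same: "same_threads (tp.vbase D [] A) M3"
    using same0 same1 same2 same3 same_threads_trans by blast
  have act: "active D xs'"
  proof -
    have "xs' ! j \<in> univ D" if "j < length xs'" for j using nums_univ[OF n3 that] emb_univ[OF i3] by simp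
    then have "set xs' \<subseteq> univ D" by (auto simp: in_set_conv_nth)
    moreover have "ran (con D) \<subseteq> set xs'" using set2 setZs by (auto simp: xs'_def)
    moreover have "rel D R \<subseteq> tuples (arity \<tau> R) (set xs')" if "R \<in> rel_syms \<tau>" for R
      using I5[OF that] by (auto simp: xs'_def tuples_def)
    ultimately show ?thesis using dx by (simp add: active_def)
  qed
  have aset: "a \<in> tuples ?m (set xs')" using aD set2 setZs by (auto simp: xs'_def tuples_def)
  obtain "is" where ids: "is \<in> tuples ?m {..<length xs'}" and a: "a = map (\<lambda>i. xs' ! i) is"
    by (rule tuples_set_nth[OF aset])
  have act': "active D' xs'"
  proof -
    have "rel D' R \<subseteq> tuples (arity \<tau> R) (set xs')" if "R \<in> rel_syms \<tau>" for R
    proof -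
      have "rel D R \<subseteq> tuples (arity \<tau> R) (set xs')" using act that by (simp add: active_def)
      then show ?thesis unfolding D'_def rel_apply_change using aset by (auto split: change_type.split)
    qed
    then show ?thesis using act by (simp add: active_def D'_def)
  qed
  have idx: "index_tuples D xs' R = index_tuples D xs R" if "R \<in> rel_syms \<tau>" for R
    unfolding xs'_def using index_tuples_append[OF I5[OF that]] dx by (simp add: xs'_def)
  then have tot: "total D xs' = total D xs" and def_eq: "deficit D xs' s = deficit D xs s" for s
    by (simp_all add: total_def deficit_def)
  have tot': "total D' xs' \<le> Suc (total D xs)"
    using total_change[OF dx ids \<delta>, of D] tot by (simp add: D'_def a)
  have lxs': "length xs' \<le> length xs + card (f ` set Zs - set xs)"
  proof -
    have "length xs' = card (set xs')" using distinct_card[OF dx] by simp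
    also have "set xs' = set xs \<union> (f ` set Zs - set xs)" using set2 by (auto simp: xs'_def)
    also have "card \<dots> \<le> card (set xs) + card (f ` set Zs - set xs)" by (rule card_Un_le)
    also have "card (set xs) \<le> length xs" by (rule card_length)
    finally show ?thesis by simp
  qed
  have lxs_old: "length xs' \<le> length xs + mx" if "us \<noteq> []"
  proof -
    have "ran (con D) \<subseteq> set xs" using I8 that by simp
    then have "card (f ` set Zs - set xs) \<le> card (set a)" unfolding setZs by (intro card_mono) auto
    also have "\<dots> \<le> mx" using card_length[of a] la(1) m by linarith
    finally show ?thesis using lxs' by simp
  qed
  have first: "total D xs = 0" "length xs' \<le> length cl + mx" if "us = []"
  proof -
    have "rel D R = {}" for R using I7 that by simp
    then show "total D xs = 0" by (simp add: total_def index_tuples_def)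
    have "xs = []" using I7 that by simp
    moreover have "card (f ` set Zs) \<le> length Zs" using card_image_le[of "set Zs" f] card_length[of Zs] by simp
    ultimately show "length xs' \<le> length cl + mx" using lxs' m by (simp add: Zs_def)
  qed
  \<comment> \<open>Either \<open>2 * mx\<close> codes were appended, which pay \<open>mx\<close>
    for new active elements and \<open>mx\<close> for one more input tuple (the first change is paid
    by \<open>B\<close>), or all tuples over active elements are codes and
    \<open>enough_codes\<close> applies.\<close>
  have big: "length xs' + mx * total D' xs' + mx \<le> length us'"
    using tup
  proof
    assume l: "length vs2 = 2 * mx"
    show ?thesis
    proof (cases "us = []")
      case True
      have "total D' xs' \<le> 1" using tot' first(1)[OF True] by simp
      then have "mx * total D' xs' \<le> mx" using mult_le_mono2[of "total D' xs'" 1 mx] by linarith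
      moreover have "length cl + 3 * mx \<le> length (us @ vs1)" using lB by (simp add: B)
      moreover have "length us' = length (us @ vs1) + length vs2" by (simp add: us'_def)
      ultimately show ?thesis using first(2)[OF True] l by linarith
    next
      case False
      have "mx * total D' xs' \<le> mx * Suc (total D xs)" using tot' by (rule mult_le_mono2)
      moreover have "length xs + mx * total D xs + mx \<le> length us" using I8 False by simp
      ultimately show ?thesis using lxs_old[OF False] l by (simp add: us'_def)
    qed
  next
    assume all: "\<forall>is \<in> tuples c {..<length xs'}. (1, map (\<lambda>i. xs' ! i) is) \<in> set us'"
    let ?T = "(\<lambda>js. (1::nat, map (\<lambda>i. xs' ! i) js)) ` tuples c {..<length xs'}"
    let ?B = "(\<lambda>g. (g + 2, [] :: 'a list)) ` set [0..<B]"
    have fT: "finite (tuples c {..<length xs'})" by (rule finite_tuples) simp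
    have "card ?T = card (tuples c {..<length xs'})"
      using map_nth_eq_iff[OF dx] by (intro card_image) (auto simp: inj_on_def)
    also have "\<dots> = length xs' ^ c" by (simp add: card_tuples)
    finally have cT: "card ?T = length xs' ^ c" .
    have "B + length xs' ^ c = card (?B \<union> ?T)"
    proof -
      have "finite ?B" "finite ?T" "?B \<inter> ?T = {}" using fT by auto
      from card_Un_disjoint[OF this] show ?thesis unfolding cT card_bots by (rule sym)
    qed
    also have "\<dots> \<le> card (set us')"
      using all bots by (intro card_mono) (auto simp: us'_def)
    also have "\<dots> \<le> length us'" by (rule card_length)
    finally have "B + length xs' ^ c \<le> length us'" .
    moreover have "mx * total D' xs' \<le> mx * (card (rel_syms \<tau>) * max 1 (length xs') ^ mx)"
      using total_le by (rule mult_le_mono2)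
    ultimately show ?thesis using enough_codes[of "length xs'"] by linarith
  qed

  define M4 where "M4 = transform va start M3"
  have "rel M3 (Sto Born) = A Born" using same by (simp add: same_threads_def)
  then have born3: "rel M3 (Sto Born) = {[u] |u. u \<in> set (take (length us) us')}" using I4 by (simp add: us'_def)
  note start = phase_start[OF core3 born3 act D, folded M4_def]
  have old4: "live M4 us' xs' D w s" if "live (tp.vbase D [] A) us xs D w s" "w < length us" for w s
  proof -
    have "live M3 us' xs' D w s" unfolding us'_def xs'_def
      by (rule live_append[OF live_same[OF that(1) same] that(2)])
    then show ?thesis using start(3)[of w s] that(2) by (simp add: us'_def)
  qed
  have live4: "\<exists>s. live M4 us' xs' D w s" if w: "w < length us'" "length xs' \<le> Suc w" for w
  proof (cases "w < length us")
    case True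
    then obtain s where "live (tp.vbase D [] A) us xs D w s" using I6[of w] w(2) by (auto simp: xs'_def)
    then show ?thesis using old4 True by blast
  next
    case False
    then show ?thesis using start(4)[of w] w by simp
  qed

  define M5 where "M5 = transform va (step_threads \<delta> (sel_change ?m)) (transform va (update_input \<delta>) M4)"
  note change = phase_change[OF start(1) \<delta> ids a aD act, folded M5_def D'_def]
  define M6 where "M6 = fold (transform va)
    (map (\<lambda>R. step_threads (Ins R) (lex_min (arity \<tau> R) (missing 0 R))) Rl) M5"
  have replay: "core M6 D' a us' xs'" "rel M6 (Sto Born) = rel M5 (Sto Born)"
    "\<And>w s. w < length us' \<Longrightarrow> length xs' \<le> Suc w \<Longrightarrow> live M5 us' xs' D' w s \<Longrightarrow>
      \<exists>s'. live M6 us' xs' D' w s' \<and> (s' = s \<and> (\<forall>R \<in> set Rl. index_tuples D' xs' R \<subseteq> rel (fst s) R) \<or>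
        deficit D' xs' s' < deficit D' xs' s)"
    unfolding M6_def using phase_replay[OF change(1), of Rl] Rl by auto
  \<comment> \<open>The replay lowers a positive deficit, and the truncated subtraction covers
    threads that lack nothing. The second bound is for threads about which nothing is known but that
    they lack at most all tuples.\<close>
  have live6: "\<exists>s'. live M6 us' xs' D' w s' \<and> deficit D' xs' s' \<le> deficit D xs' s - 1 \<and>
      deficit D' xs' s' \<le> total D' xs' - 1"
    if w: "w < length us'" "length xs' \<le> Suc w" and l: "live M4 us' xs' D w s" for w s
  proof -
    obtain s1 where s1: "live M5 us' xs' D' w s1" "deficit D' xs' s1 \<le> deficit D xs' s"
      using change(3)[OF w l] by blast
    obtain s2 where s2: "live M6 us' xs' D' w s2"
      "s2 = s1 \<and> (\<forall>R \<in> set Rl. index_tuples D' xs' R \<subseteq> rel (fst s1) R) \<or>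
        deficit D' xs' s2 < deficit D' xs' s1"
      using replay(3)[OF w s1(1)] by blast
    have "deficit D' xs' s2 \<le> deficit D' xs' s1 - 1"
      using s2(2)
    proof
      assume *: "s2 = s1 \<and> (\<forall>R \<in> set Rl. index_tuples D' xs' R \<subseteq> rel (fst s1) R)"
      then have "index_tuples D' xs' R - rel (fst s1) R = {}" if "R \<in> rel_syms \<tau>" for R
        using that Rl by blast
      then have "deficit D' xs' s1 = 0"
        unfolding deficit_def by (intro sum.neutral ballI) (simp only: card.empty)
      with * show ?thesis by simp
    qed simp
    moreover have "deficit D' xs' s1 \<le> total D' xs'" by (rule deficit_le_total)
    ultimately show ?thesis using s1(2) s2(1) by (intro exI[of _ s2]) auto
  qed
  have all6: "\<exists>s. live M6 us' xs' D' w s" if "w < length us'" "length xs' \<le> Suc w" for w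
    using live4[OF that] live6[OF that] by blast
  have ne: "us' \<noteq> []" using big mx(1) by (cases us') auto
  have ready: "ready_for_all M6 us' xs' D'"
    unfolding ready_for_all_def
  proof (intro allI impI)
    fix j assume j: "j \<le> total D' xs'"
    show "\<exists>w s. w < length us' \<and> length xs' + mx * j \<le> Suc w \<and> live M6 us' xs' D' w s \<and> deficit D' xs' s \<le> j"
    \<comment> \<open>A thread that served for \<open>j + 1\<close> before the change serves for
      \<open>j\<close> now: its deficit has dropped by one, and the at most \<open>mx\<close> new
      elements are paid by one of its \<open>mx * (j + 1)\<close> spare blocks of size
      \<open>mx\<close>. If \<open>j + 1\<close> was out of range, the thread of the largest code
      takes over.\<close>
    proof (cases "us \<noteq> [] \<and> Suc j \<le> total D xs")
      case True
      then have "ready_for_all (tp.vbase D [] A) us xs D" using I8 True by simp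
      then obtain w s where w: "w < length us" "length xs + mx * Suc j \<le> Suc w"
        "live (tp.vbase D [] A) us xs D w s" "deficit D xs s \<le> Suc j"
        using True unfolding ready_for_all_def by blast
      have w': "w < length us'" using w(1) by (simp add: us'_def)
      have l: "length xs' + mx * j \<le> Suc w" using w(2) lxs_old True by simp
      obtain s' where "live M6 us' xs' D' w s'" "deficit D' xs' s' \<le> deficit D xs' s - 1"
        using live6[OF w' _ old4[OF w(3,1)]] l by auto
      then show ?thesis using w' l w(4) def_eq by (intro exI[of _ w] exI[of _ s']) auto
    next
      case False
      let ?w = "length us' - 1"
      have w: "?w < length us'" "Suc ?w = length us'" using ne by (cases us'; simp)+
      have "mx * j \<le> mx * total D' xs'" using j by (rule mult_le_mono2)
      then have l: "length xs' + mx * j \<le> Suc ?w" using big w by linarith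
      then have l0: "length xs' \<le> Suc ?w" by simp
      obtain s where "live M4 us' xs' D ?w s" using live4[OF w(1) l0] by blast
      then obtain s' where s': "live M6 us' xs' D' ?w s'" "deficit D' xs' s' \<le> total D' xs' - 1"
        using live6[OF w(1) l0] by blast
      \<comment> \<open>Either there was no code before, and then the old total is 0, or the old
        total is at most \<open>j\<close>; the change adds at most one tuple.\<close>
      have "total D' xs' - 1 \<le> j" using False tot' first(1) by (cases "us = []") auto
      then show ?thesis using w(1) l s' by (intro exI[of _ ?w] exI[of _ s']) auto
    qed
  qed

  define M7 where "M7 = transform va answer_update M6"
  have final: "fold (transform va) (updates (2 * mx) \<delta>) M0 = M7"
    by (simp add: updates_def M1_def M2_def M3_def M4_def M5_def M6_def M7_def Zs_def)
  have A': "A' z = (if z \<in> St then rel M7 (Sto z) else {})" for z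
    using vstep_snd[of z \<delta> a D A] final by (simp add: A'_def M0_def)
  have cd6: "codes M6 us'" and n6: "nums M6 us' xs'" and i6: "inputs M6 D' a" and wf6: "wf_rels va M6"
    using replay(1) by (auto simp: core_def)
  have M7: "rel M7 (Sto z) = rel M6 (Sto z)" if "z \<noteq> Ans" for z
    unfolding M7_def using that by (intro rel_answer_update_other[OF wf6]) simp
  have u6: "univ M6 = tp.vuniv (univ D')" using i6 by (simp add: inputs_def)
  let ?N = "tp.vbase D' [] A'"
  have relN: "rel ?N (Sto z) = rel M6 (Sto z)" if "z \<in> St" "z \<noteq> Ans" for z
    using that A' M7 by simp
  have liveN: "live ?N us' xs' D' w s" if "live M6 us' xs' D' w s" for w s
    using that thread_cong[of M6 us' w s ?N] relN by (simp add: live_def)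
  show "invariant D' A'"
    unfolding invariant_def invariant_at_def Let_def
  proof (intro conjI allI exI[of _ us'] exI[of _ xs'])
    fix z show "A' z \<subseteq> tuples (sar z) (tp.vuniv (univ D'))"
    proof -
      have "rel M7 (Sto z) \<subseteq> tuples (va (Sto z)) (univ M7)"
        unfolding M7_def using wf_rels_transform[of va answer_update M6] unfolding wf_rels_def by blast
      then show ?thesis using u6 by (simp add: A' M7_def)
    qed
  next
    show "codes ?N us'" by (rule codes_cong[OF cd6]) (use u6 relN in simp_all)
    show "nums ?N us' xs'" by (rule nums_cong[OF n6]) (use u6 relN in simp_all)
    show "A' Born = {[u] |u. u \<in> set us'}"
      using A' M7 replay(2) change(2) start(2) by simp
    show "\<forall>R \<in> rel_syms \<tau>. rel D' R \<subseteq> tuples (arity \<tau> R) (set xs')" using act' by (simp add: active_def)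
    show "w < length us' \<longrightarrow> length xs' \<le> Suc w \<longrightarrow> (\<exists>s. live ?N us' xs' D' w s)" for w
      using all6 liveN by blast
    have "ready_for_all ?N us' xs' D'" using ready liveN unfolding ready_for_all_def by blast
    then show "us' \<noteq> [] \<longrightarrow> ran (con D') \<subseteq> set xs' \<and> length xs' + mx * total D' xs' + mx \<le> length us' \<and>
        ready_for_all ?N us' xs' D'"
      using big act' by (simp add: active_def)
    show "us' = [] \<longrightarrow> xs' = [] \<and> (\<forall>R. rel D' R = {})" using ne by blast
  qed
  \<comment> \<open>The instance \<open>j = 0\<close> of \<open>ready_for_all\<close>: a thread that
    can answer right now.\<close>
  obtain w s where w: "w < length us'" "length xs' \<le> Suc w" "live M6 us' xs' D' w s" "deficit D' xs' s = 0"
    using ready unfolding ready_for_all_def by fastforce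
  have caught: "index_tuples D' xs' R \<subseteq> rel (fst s) R" if "R \<in> rel_syms \<tau>" for R
  proof -
    have "card (index_tuples D' xs' R - rel (fst s) R) = 0"
      using w(4) that finite_rel_syms by (simp add: deficit_def)
    then have "index_tuples D' xs' R - rel (fst s) R = {}"
      using finite_index_tuples[of D' xs' R] by (simp only: card_0_eq finite_Diff)
    then show ?thesis by blast
  qed
  have "map emb b \<in> A' Ans \<longleftrightarrow> b \<in> q D'" if "b \<in> tuples k (univ D)" for b
  proof -
    have "map emb b \<in> rel M7 (Sto Ans) \<longleftrightarrow> b \<in> q D'"
      unfolding M7_def using that
      by (intro rel_answer_update[OF cd6 n6 i6 D' act' all6 w(1-3) caught]) (simp_all add: D'_def)
    then show ?thesis by (simp add: A')
  qed
  moreover have "q D' \<subseteq> tuples k (univ D)"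
    using q[unfolded is_query_def, rule_format, OF D'] by (simp add: D'_def)
  ultimately show "{b \<in> tuples k (univ D). map emb b \<in> A' Ans} = q D'" by blast
qed

text \<open>Before any change \<open>Ans\<close> is empty, so the query has to be empty as well,
  although the arithmetic program may designate one of its nonempty initial relations as the answer.
  Such a relation contains a tuple of zeros. With an element \<open>z\<close> outside the domain in
  the role of 0, this tuple would belong to the answer over the actual domain, which is
  impossible.\<close>

lemma q_initial:
  assumes init: "initial_database \<tau> D"
  shows "q D = {}"
proof -
  have D: "is_database \<tau> D" and rD: "\<And>R. rel D R = {}" using init by (auto simp: initial_database_def)
  then have finD: "finite (univ D)" by (simp add: is_database_def)
  obtain z where z: "z \<notin> univ D" using inf finD by (meson ex_new_if_finite)
  obtain zs where zs: "set zs = univ D" "distinct zs" using finite_distinct_list[OF finD] by blast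
  let ?e = "\<lambda>i. (z # zs) ! i" and ?w = "length zs"
  have e: "inj_on ?e {..?w}"
    using zs z by (auto simp: inj_on_def nth_eq_iff_index_eq[of "z # zs"] less_Suc_eq_le[symmetric])
  have img: "?e ` {..?w} = insert z (univ D)"
  proof -
    have "{..?w} = {0..<length (z # zs)}" by auto
    then have "?e ` {..?w} = set (z # zs)" using nth_image[of "length (z # zs)" "z # zs"] by simp
    then show ?thesis using zs by simp
  qed
  let ?D = "D\<lparr>univ := insert z (univ D)\<rparr>"
  have "is_database \<tau> ?D" using D by (auto simp: is_database_def rD)
  then have init': "initial_database \<tau> ?D" and qD: "q ?D = q D"
    using rD D di[unfolded domain_independent_def, rule_format, of ?D D]
    by (simp_all add: initial_database_def)
  have "maintains_from \<tau> P q (?D, \<lambda>S. map ?e ` arith_aux ?w S)"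
    unfolding image_arith_aux[OF e] img
    using main[OF init', of "{(?e i, ?e j) |i j. i \<le> j \<and> j \<le> ?w}"] linear_order_image[OF e, unfolded img]
    by simp
  from this[unfolded maintains_from_def, rule_format, of "[]"]
  have ans: "map ?e ` arith_aux ?w (answer P) = q D" using qD by simp
  show ?thesis
  proof (cases "answer P \<in> {L, Pl, Ti}")
    case True
    then have "[0, 0] \<in> arith_aux ?w (answer P) \<or> [0, 0, 0] \<in> arith_aux ?w (answer P)"
      using arith(2) by (auto simp: arith_aux_def)
    then have "map ?e [0, 0] \<in> q D \<or> map ?e [0, 0, 0] \<in> q D"
      unfolding ans[symmetric] by (meson imageI)
    moreover have "q D \<subseteq> tuples k (univ D)" using q D by (simp add: is_query_def)
    ultimately show ?thesis using z by (auto simp: tuples_def)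
  next
    case False
    then show ?thesis using ans by (simp add: arith_aux_def)
  qed
qed

lemma run_invariant:
  assumes init: "initial_database \<tau> D" and cs: "\<forall>ch \<in> set cs. is_change \<tau> (univ D) ch"
  shows "case fold tp.vstep cs (D, \<lambda>z. {}) of (D', A') \<Rightarrow> is_database \<tau> D' \<and> univ D' = univ D \<and>
    invariant D' A' \<and> {b \<in> tuples k (univ D). map emb b \<in> A' Ans} = q D'"
  using cs
proof (induction cs rule: rev_induct)
  case Nil
  then show ?case using init invariant_initial[OF init] q_initial[OF init]
    by (simp add: initial_database_def)
next
  case (snoc ch cs)
  obtain D1 A1 where s: "fold tp.vstep cs (D, \<lambda>z. {}) = (D1, A1)" by fastforce
  obtain \<delta> a where ch: "ch = (\<delta>, a)" by fastforce
  have D1: "is_database \<tau> D1" "univ D1 = univ D" "invariant D1 A1" using snoc s by auto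
  have c: "is_change \<tau> (univ D1) (\<delta>, a)" using snoc.prems D1(2) by (simp add: ch)
  have "fold tp.vstep (cs @ [ch]) (D, \<lambda>z. {}) =
      (apply_change (\<delta>, a) D1, snd (tp.vstep (\<delta>, a) (D1, A1)))"
    by (simp add: s ch)
  then show ?case
    using invariant_step[OF D1(1) c D1(3)] is_database_apply_change[OF D1(1) c] D1(2)
    by (simp del: tp.vstep.simps)
qed

lemma q_in_DynFO: "q \<in> DynFO \<tau> k"
proof -
  have "q \<in> DynFO \<tau> (sar Ans)"
  proof (rule tp.DynFO_tuple_program)
    show "is_query \<tau> (sar Ans) q" using q by simp
    show "case fold tp.vstep cs (D, \<lambda>z. {}) of (D', A') \<Rightarrow>
        {b \<in> tuples (sar Ans) (univ D). map emb b \<in> A' Ans} = q D'"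
      if "initial_database \<tau> D" "\<forall>ch \<in> set cs. is_change \<tau> (univ D) ch" for D cs
      using run_invariant[OF that] by (auto simp: split_beta)
  qed
  then show ?thesis by simp
qed

end

theorem theorem8:
  fixes \<tau> :: "('r, 'c) schema" and k :: nat and q :: "('a, 'r, 'c) query"
  assumes "infinite (UNIV :: 'a set)"
    and "finite_schema \<tau>"
    and "is_query \<tau> k q"
    and "domain_independent \<tau> q"
  shows "q \<in> DynFO_arith \<tau> k \<longleftrightarrow> q \<in> DynFO \<tau> k"
proof
  assume "q \<in> DynFO_arith \<tau> k"
  then have "\<exists>P L Pl Ti. is_program \<tau> k P \<and> {L, Pl, Ti} \<subseteq> aux_syms P \<and> distinct [L, Pl, Ti] \<and>
      aux_arity P L = 2 \<and> aux_arity P Pl = 3 \<and> aux_arity P Ti = 3 \<and>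
      (\<forall>D r. initial_database \<tau> D \<and> linear_order_on (univ D) r \<longrightarrow>
        maintains_from \<tau> P q (D, (\<lambda>S. {})(L := order_rel (univ D) r, Pl := plus_rel (univ D) r,
          Ti := times_rel (univ D) r)))"
    unfolding DynFO_arith_def by (elim CollectE conjE)
  then obtain P L Pl Ti where P: "is_program \<tau> k P" "{L, Pl, Ti} \<subseteq> aux_syms P" "distinct [L, Pl, Ti]"
    "aux_arity P L = 2" "aux_arity P Pl = 3" "aux_arity P Ti = 3"
    and main: "\<forall>D r. initial_database \<tau> D \<and> linear_order_on (univ D) r \<longrightarrow>
      maintains_from \<tau> P q (D, (\<lambda>S. {})(L := order_rel (univ D) r, Pl := plus_rel (univ D) r,
        Ti := times_rel (univ D) r))"
    by (elim exE conjE)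
  obtain Rl cl where l: "set Rl = rel_syms \<tau>" "set cl = con_syms \<tau>"
    using assms(2) finite_list unfolding finite_schema_def by metis
  \<comment> \<open>A sum bounds each of its summands, and the successor keeps \<open>mx\<close>
    positive when all arities are 0 or there is no input relation.\<close>
  define mx where "mx = Suc (\<Sum>R \<in> rel_syms \<tau>. arity \<tau> R)"
  have mx: "arity \<tau> R \<le> mx" if "R \<in> rel_syms \<tau>" for R
    using member_le_sum[of R "rel_syms \<tau>" "arity \<tau>"] that assms(2) by (simp add: mx_def finite_schema_def)
  interpret simulation \<tau> P L Pl Ti "mx + mx * card (rel_syms \<tau>) + 1"
    "length cl + 3 * mx + mx * card (rel_syms \<tau>)" k cl Rl q mx
  proof unfold_locales
    show "maintains_from \<tau> P q (D, (\<lambda>S. {})(L := order_rel (univ D) r, Pl := plus_rel (univ D) r,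
        Ti := times_rel (univ D) r))" if "initial_database \<tau> D" "linear_order_on (univ D) r" for D r
      using main that by blast
  qed (use assms P l mx in \<open>simp_all add: mx_def\<close>)
  show "q \<in> DynFO \<tau> k" by (rule q_in_DynFO)
qed (rule DynFO_imp_DynFO_arith)

end
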